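(* Assume that $\kappa,\lambda$ are infinite cardinals with $\kappa^{+++}\le\lambda$ and $\kappa^{<\kappa}=\kappa$, and $\eta$ is an ordinal with $\kappa^+\le\eta<\kappa^{++}$ and $\operatorname{cf}(\eta)=\kappa^+$. Assume that there is a $\kappa^+$-strongly unbounded function on $\lambda$. Then there is a cardinal-preserving partial order that forces the existence of a $(\kappa,\eta,\lambda)$-Boolean algebra.
   Context: For infinite cardinals $\kappa<\lambda$ with $\kappa$ regular, a function $F:[\lambda]^2\to\kappa^+$ is a $\kappa^+$-strongly unbounded function on $\lambda$ if for every ordinal $\delta<\kappa^+$, every cardinal $\nu<\kappa$ and every family $A\subseteq[\lambda]^\nu$ of pairwise disjoint sets with $|A|=\kappa^+$, there are distinct $a,b\in A$ with $F\{\alpha,\beta\}>\delta$ for all $\alpha\in a,\beta\in b$. A Boolean algebra is superatomic if every homomorphic image is atomic; with Cantor–Bendixson ideals $\mathcal J_0=\{0\}$, $\mathcal J_{\alpha+1}$ = preimage of the ideal generated by atoms of $\mathbb B/\mathcal J_\alpha$, unions at limits, the cardinal sequence of superatomic $\mathbb B$ is $\langle|\mathcal J_{\alpha+1}(\mathbb B)\setminus\mathcal J_\alpha(\mathbb B)|:\alpha<ht^-(\mathbb B)\rangle$, where $ht^-(\mathbb B)$ is the least $\delta$ with $\mathbb B=\mathcal J_{\delta+1}(\mathbb B)$. A $(\kappa,\eta,\lambda)$-Boolean algebra is a superatomic Boolean algebra with cardinal sequence $\langle\kappa\rangle_\eta{}^\frown\langle\lambda\rangle$.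
   Formalization: Cardinal sequence entries count atoms of B/J_α, not the set difference J_{α+1}∖J_α, whose size is at least |α| (claim false for η>κ⁺). Forcing uses names of hereditary size ≤θ, with θ≥|P|; preservation is stated for cardinals ≤θ, larger ones being automatic. *)

theory Defs
  imports Main
begin

unbundle cardinal_syntax

section \<open>Combinatorial hypotheses on the ground model\<close>

text \<open>The ground model is HOL itself. Infinite cardinals are cardinal orders on subsets of a type
  (\<open>Cinfinite\<close>), ordinals are well-orders, and \<open>cardSuc r\<close> is the successor cardinal.\<close>

definition less_power :: "'a rel \<Rightarrow> ('a \<times> ('a \<Rightarrow> 'a)) rel" where
  "less_power k = |SIGMA x : Field k. Func (underS k x) (Field k)|"
  \<comment> \<open>the cardinal of the set of functions into \<open>k\<close> whose domain is an ordinal below \<open>k\<close>;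
    the domain is recorded explicitly because elements of \<open>Func\<close> are total functions\<close>

definition has_cofinality :: "'a rel \<Rightarrow> 'b rel \<Rightarrow> bool" where
  "has_cofinality r c \<longleftrightarrow>
     (\<exists>A \<subseteq> Field r. cofinal A r \<and> |A| =o c) \<and>
     (\<forall>A \<subseteq> Field r. cofinal A r \<longrightarrow> c \<le>o |A| )"

text \<open>A function on pairs is represented by its values on two-element subsets of \<open>Field l\<close>;
  its values are elements of \<open>Field (cardSuc k)\<close>, i.e. ordinals below the successor of \<open>k\<close>.\<close>

definition strongly_unbounded :: "'a rel \<Rightarrow> 'a rel \<Rightarrow> ('a set \<Rightarrow> 'a set) \<Rightarrow> bool" where
  "strongly_unbounded k l F \<longleftrightarrow>
     (\<forall>e. e \<subseteq> Field l \<and> card e = 2 \<longrightarrow> F e \<in> Field (cardSuc k)) \<and>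
     (\<forall>d \<in> Field (cardSuc k). \<forall>n :: 'a rel. \<forall>A :: 'a set set.
        Card_order n \<and> n <o k \<and>
        (\<forall>a \<in> A. a \<subseteq> Field l \<and> |a| =o n) \<and> pairwise disjnt A \<and> |A| =o cardSuc k \<longrightarrow>
        (\<exists>a \<in> A. \<exists>b \<in> A. a \<noteq> b \<and>
           (\<forall>x \<in> a. \<forall>y \<in> b. (d, F {x, y}) \<in> cardSuc k - Id)))"


section \<open>The language of set theory\<close>

text \<open>Formulas in higher-order abstract syntax: \<open>'n\<close> is the type of the objects the variables
  range over. All formulas below are uniform in \<open>'n\<close>, hence are ordinary first-order formulas.\<close>

datatype 'n fm =
    Member 'n 'n (infix "\<^bold>\<in>" 50)
  | Equal 'n 'n (infix "\<^bold>=" 50)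
  | Neg "'n fm" ("\<^bold>\<not> _" [40] 40)
  | Conj "'n fm" "'n fm" (infixr "\<^bold>\<and>" 35)
  | Univ "'n \<Rightarrow> 'n fm" (binder "\<^bold>\<forall>" 10)

definition Disj :: "'n fm \<Rightarrow> 'n fm \<Rightarrow> 'n fm" (infixr "\<^bold>\<or>" 30) where
  "(\<phi> \<^bold>\<or> \<psi>) = (\<^bold>\<not> (\<^bold>\<not> \<phi> \<^bold>\<and> \<^bold>\<not> \<psi>))"

definition Imp :: "'n fm \<Rightarrow> 'n fm \<Rightarrow> 'n fm" (infixr "\<^bold>\<longrightarrow>" 25) where
  "(\<phi> \<^bold>\<longrightarrow> \<psi>) = (\<^bold>\<not> (\<phi> \<^bold>\<and> \<^bold>\<not> \<psi>))"

definition Iff :: "'n fm \<Rightarrow> 'n fm \<Rightarrow> 'n fm" (infixr "\<^bold>\<longleftrightarrow>" 25) where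
  "(\<phi> \<^bold>\<longleftrightarrow> \<psi>) = ((\<phi> \<^bold>\<longrightarrow> \<psi>) \<^bold>\<and> (\<psi> \<^bold>\<longrightarrow> \<phi>))"

definition Exis :: "('n \<Rightarrow> 'n fm) \<Rightarrow> 'n fm" (binder "\<^bold>\<exists>" 10) where
  "(\<^bold>\<exists>x. \<phi> x) = (\<^bold>\<not> (\<^bold>\<forall>x. \<^bold>\<not> \<phi> x))"

definition BUniv :: "'n \<Rightarrow> ('n \<Rightarrow> 'n fm) \<Rightarrow> 'n fm" where
  "BUniv A \<phi> = (\<^bold>\<forall>x. x \<^bold>\<in> A \<^bold>\<longrightarrow> \<phi> x)"

definition BExis :: "'n \<Rightarrow> ('n \<Rightarrow> 'n fm) \<Rightarrow> 'n fm" where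
  "BExis A \<phi> = (\<^bold>\<exists>x. x \<^bold>\<in> A \<^bold>\<and> \<phi> x)"

syntax
  "_BUniv" :: "pttrn \<Rightarrow> 'n \<Rightarrow> 'n fm \<Rightarrow> 'n fm" ("(3\<^bold>\<forall>_\<^bold>\<in>_./ _)" [0, 51, 10] 10)
  "_BExis" :: "pttrn \<Rightarrow> 'n \<Rightarrow> 'n fm \<Rightarrow> 'n fm" ("(3\<^bold>\<exists>_\<^bold>\<in>_./ _)" [0, 51, 10] 10)
translations
  "\<^bold>\<forall>x\<^bold>\<in>A. \<phi>" \<rightleftharpoons> "CONST BUniv A (\<lambda>x. \<phi>)"
  "\<^bold>\<exists>x\<^bold>\<in>A. \<phi>" \<rightleftharpoons> "CONST BExis A (\<lambda>x. \<phi>)"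


subsection \<open>Functions, ordinals, cardinals\<close>

definition is_upair :: "'n \<Rightarrow> 'n \<Rightarrow> 'n \<Rightarrow> 'n fm" where
  "is_upair a b z = (\<^bold>\<forall>w. w \<^bold>\<in> z \<^bold>\<longleftrightarrow> w \<^bold>= a \<^bold>\<or> w \<^bold>= b)"

definition is_pair :: "'n \<Rightarrow> 'n \<Rightarrow> 'n \<Rightarrow> 'n fm" where
  "is_pair a b z = (\<^bold>\<exists>u. \<^bold>\<exists>v. is_upair a a u \<^bold>\<and> is_upair a b v \<^bold>\<and> is_upair u v z)"

definition related :: "'n \<Rightarrow> 'n \<Rightarrow> 'n \<Rightarrow> 'n fm" where
  "related r a b = (\<^bold>\<exists>z\<^bold>\<in>r. is_pair a b z)"

definition is_function_on :: "'n \<Rightarrow> 'n \<Rightarrow> 'n fm" where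
  "is_function_on f A =
     ((\<^bold>\<forall>z\<^bold>\<in>f. \<^bold>\<exists>a\<^bold>\<in>A. \<^bold>\<exists>b. is_pair a b z) \<^bold>\<and>
      (\<^bold>\<forall>a\<^bold>\<in>A. \<^bold>\<exists>b. related f a b \<^bold>\<and> (\<^bold>\<forall>c. related f a c \<^bold>\<longrightarrow> c \<^bold>= b)))"

definition is_surjection :: "'n \<Rightarrow> 'n \<Rightarrow> 'n \<Rightarrow> 'n fm" where
  "is_surjection f A B =
     (is_function_on f A \<^bold>\<and>
      (\<^bold>\<forall>a\<^bold>\<in>A. \<^bold>\<forall>b. related f a b \<^bold>\<longrightarrow> b \<^bold>\<in> B) \<^bold>\<and>
      (\<^bold>\<forall>b\<^bold>\<in>B. \<^bold>\<exists>a\<^bold>\<in>A. related f a b))"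

definition is_bijection :: "'n \<Rightarrow> 'n \<Rightarrow> 'n \<Rightarrow> 'n fm" where
  "is_bijection f A B =
     (is_surjection f A B \<^bold>\<and>
      (\<^bold>\<forall>a\<^bold>\<in>A. \<^bold>\<forall>c\<^bold>\<in>A. \<^bold>\<forall>b\<^bold>\<in>B. related f a b \<^bold>\<and> related f c b \<^bold>\<longrightarrow> a \<^bold>= c))"

definition equipotent :: "'n \<Rightarrow> 'n \<Rightarrow> 'n fm" where
  "equipotent A B = (\<^bold>\<exists>f. is_bijection f A B)"

definition is_transitive :: "'n \<Rightarrow> 'n fm" where
  "is_transitive x = (\<^bold>\<forall>y\<^bold>\<in>x. \<^bold>\<forall>z\<^bold>\<in>y. z \<^bold>\<in> x)"

definition is_ordinal :: "'n \<Rightarrow> 'n fm" where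
  "is_ordinal x = (is_transitive x \<^bold>\<and> (\<^bold>\<forall>y\<^bold>\<in>x. is_transitive y))"

definition is_cardinal :: "'n \<Rightarrow> 'n fm" where
  "is_cardinal x = (is_ordinal x \<^bold>\<and> (\<^bold>\<forall>y\<^bold>\<in>x. \<^bold>\<not> equipotent y x))"

definition has_cardinality :: "'n \<Rightarrow> 'n \<Rightarrow> 'n fm" where
  "has_cardinality A m = (is_cardinal m \<^bold>\<and> equipotent A m)"

definition is_empty :: "'n \<Rightarrow> 'n fm" where
  "is_empty x = (\<^bold>\<forall>y. \<^bold>\<not> y \<^bold>\<in> x)"

definition is_succ :: "'n \<Rightarrow> 'n \<Rightarrow> 'n fm" where
  "is_succ x s = (\<^bold>\<forall>y. y \<^bold>\<in> s \<^bold>\<longleftrightarrow> y \<^bold>\<in> x \<^bold>\<or> y \<^bold>= x)"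

definition is_limit :: "'n \<Rightarrow> 'n fm" where
  "is_limit x = (is_ordinal x \<^bold>\<and> \<^bold>\<not> is_empty x \<^bold>\<and> \<^bold>\<not> (\<^bold>\<exists>y. is_succ y x))"


subsection \<open>Boolean algebras\<close>

text \<open>A Boolean algebra is a complemented distributive lattice, given by a set \<open>B\<close> and an order
  relation \<open>L\<close> (a set of ordered pairs). The last argument of the operation formulas is the value.\<close>

definition is_meet :: "'n \<Rightarrow> 'n \<Rightarrow> 'n \<Rightarrow> 'n \<Rightarrow> 'n \<Rightarrow> 'n fm" where
  "is_meet B L a b c =
     (c \<^bold>\<in> B \<^bold>\<and> related L c a \<^bold>\<and> related L c b \<^bold>\<and>
      (\<^bold>\<forall>d\<^bold>\<in>B. related L d a \<^bold>\<and> related L d b \<^bold>\<longrightarrow> related L d c))"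

definition is_join :: "'n \<Rightarrow> 'n \<Rightarrow> 'n \<Rightarrow> 'n \<Rightarrow> 'n \<Rightarrow> 'n fm" where
  "is_join B L a b c =
     (c \<^bold>\<in> B \<^bold>\<and> related L a c \<^bold>\<and> related L b c \<^bold>\<and>
      (\<^bold>\<forall>d\<^bold>\<in>B. related L a d \<^bold>\<and> related L b d \<^bold>\<longrightarrow> related L c d))"

definition is_bot :: "'n \<Rightarrow> 'n \<Rightarrow> 'n \<Rightarrow> 'n fm" where
  "is_bot B L z = (z \<^bold>\<in> B \<^bold>\<and> (\<^bold>\<forall>b\<^bold>\<in>B. related L z b))"

definition is_top :: "'n \<Rightarrow> 'n \<Rightarrow> 'n \<Rightarrow> 'n fm" where
  "is_top B L z = (z \<^bold>\<in> B \<^bold>\<and> (\<^bold>\<forall>b\<^bold>\<in>B. related L b z))"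

definition is_compl :: "'n \<Rightarrow> 'n \<Rightarrow> 'n \<Rightarrow> 'n \<Rightarrow> 'n fm" where
  "is_compl B L a b =
     (a \<^bold>\<in> B \<^bold>\<and> b \<^bold>\<in> B \<^bold>\<and>
      (\<^bold>\<exists>z. is_meet B L a b z \<^bold>\<and> is_bot B L z) \<^bold>\<and> (\<^bold>\<exists>u. is_join B L a b u \<^bold>\<and> is_top B L u))"

definition is_poset :: "'n \<Rightarrow> 'n \<Rightarrow> 'n fm" where
  "is_poset B L =
     ((\<^bold>\<forall>a\<^bold>\<in>B. related L a a) \<^bold>\<and>
      (\<^bold>\<forall>a\<^bold>\<in>B. \<^bold>\<forall>b\<^bold>\<in>B. related L a b \<^bold>\<and> related L b a \<^bold>\<longrightarrow> a \<^bold>= b) \<^bold>\<and>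
      (\<^bold>\<forall>a\<^bold>\<in>B. \<^bold>\<forall>b\<^bold>\<in>B. \<^bold>\<forall>c\<^bold>\<in>B. related L a b \<^bold>\<and> related L b c \<^bold>\<longrightarrow> related L a c))"

definition is_boolean_algebra :: "'n \<Rightarrow> 'n \<Rightarrow> 'n fm" where
  "is_boolean_algebra B L =
     (is_poset B L \<^bold>\<and>
      (\<^bold>\<forall>a\<^bold>\<in>B. \<^bold>\<forall>b\<^bold>\<in>B. (\<^bold>\<exists>c. is_meet B L a b c) \<^bold>\<and> (\<^bold>\<exists>c. is_join B L a b c)) \<^bold>\<and>
      (\<^bold>\<exists>z. is_bot B L z) \<^bold>\<and> (\<^bold>\<exists>u. is_top B L u) \<^bold>\<and>
      (\<^bold>\<forall>a\<^bold>\<in>B. \<^bold>\<forall>b\<^bold>\<in>B. \<^bold>\<forall>c\<^bold>\<in>B. \<^bold>\<forall>d\<^bold>\<in>B. \<^bold>\<forall>e\<^bold>\<in>B. \<^bold>\<forall>f\<^bold>\<in>B. \<^bold>\<forall>g\<^bold>\<in>B.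
         is_join B L b c d \<^bold>\<and> is_meet B L a d e \<^bold>\<and> is_meet B L a b f \<^bold>\<and> is_meet B L a c g
         \<^bold>\<longrightarrow> is_join B L f g e) \<^bold>\<and>
      (\<^bold>\<forall>a\<^bold>\<in>B. \<^bold>\<exists>b. is_compl B L a b))"

text \<open>\<open>(C, K)\<close> is a homomorphic image of \<open>(B, L)\<close> under \<open>h\<close>.\<close>

definition is_epimorphism :: "'n \<Rightarrow> 'n \<Rightarrow> 'n \<Rightarrow> 'n \<Rightarrow> 'n \<Rightarrow> 'n fm" where
  "is_epimorphism B L C K h =
     (is_boolean_algebra C K \<^bold>\<and> is_surjection h B C \<^bold>\<and>
      (\<^bold>\<forall>a\<^bold>\<in>B. \<^bold>\<forall>b\<^bold>\<in>B. \<^bold>\<forall>c\<^bold>\<in>B. \<^bold>\<forall>a'\<^bold>\<in>C. \<^bold>\<forall>b'\<^bold>\<in>C. \<^bold>\<forall>c'\<^bold>\<in>C.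
         related h a a' \<^bold>\<and> related h b b' \<^bold>\<and> related h c c' \<^bold>\<longrightarrow>
         (is_meet B L a b c \<^bold>\<longrightarrow> is_meet C K a' b' c') \<^bold>\<and>
         (is_join B L a b c \<^bold>\<longrightarrow> is_join C K a' b' c') \<^bold>\<and>
         (is_compl B L a b \<^bold>\<longrightarrow> is_compl C K a' b')))"

definition is_atom :: "'n \<Rightarrow> 'n \<Rightarrow> 'n \<Rightarrow> 'n fm" where
  "is_atom B L a =
     (a \<^bold>\<in> B \<^bold>\<and> \<^bold>\<not> is_bot B L a \<^bold>\<and> (\<^bold>\<forall>b\<^bold>\<in>B. related L b a \<^bold>\<longrightarrow> b \<^bold>= a \<^bold>\<or> is_bot B L b))"

definition is_atomic :: "'n \<Rightarrow> 'n \<Rightarrow> 'n fm" where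
  "is_atomic B L =
     (\<^bold>\<forall>b\<^bold>\<in>B. \<^bold>\<not> is_bot B L b \<^bold>\<longrightarrow> (\<^bold>\<exists>a. is_atom B L a \<^bold>\<and> related L a b))"

definition is_superatomic :: "'n \<Rightarrow> 'n \<Rightarrow> 'n fm" where
  "is_superatomic B L =
     (is_boolean_algebra B L \<^bold>\<and>
      (\<^bold>\<forall>C. \<^bold>\<forall>K. \<^bold>\<forall>h. is_epimorphism B L C K h \<^bold>\<longrightarrow> is_atomic C K))"

definition is_ideal :: "'n \<Rightarrow> 'n \<Rightarrow> 'n \<Rightarrow> 'n fm" where
  "is_ideal B L I =
     ((\<^bold>\<forall>x\<^bold>\<in>I. x \<^bold>\<in> B) \<^bold>\<and> (\<^bold>\<exists>z\<^bold>\<in>I. is_bot B L z) \<^bold>\<and>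
      (\<^bold>\<forall>x\<^bold>\<in>I. \<^bold>\<forall>y\<^bold>\<in>B. related L y x \<^bold>\<longrightarrow> y \<^bold>\<in> I) \<^bold>\<and>
      (\<^bold>\<forall>x\<^bold>\<in>I. \<^bold>\<forall>y\<^bold>\<in>I. \<^bold>\<forall>z. is_join B L x y z \<^bold>\<longrightarrow> z \<^bold>\<in> I))"

definition in_atom_ideal :: "'n \<Rightarrow> 'n \<Rightarrow> 'n \<Rightarrow> 'n fm" where
  "in_atom_ideal B L x =
     (x \<^bold>\<in> B \<^bold>\<and>
      (\<^bold>\<forall>I. is_ideal B L I \<^bold>\<and> (\<^bold>\<forall>a. is_atom B L a \<^bold>\<longrightarrow> a \<^bold>\<in> I) \<^bold>\<longrightarrow> x \<^bold>\<in> I))"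

text \<open>\<open>(C, K)\<close> with the projection \<open>h\<close> is (a copy of) the quotient of \<open>(B, L)\<close> by the ideal \<open>I\<close>.\<close>

definition is_quotient :: "'n \<Rightarrow> 'n \<Rightarrow> 'n \<Rightarrow> 'n \<Rightarrow> 'n \<Rightarrow> 'n \<Rightarrow> 'n fm" where
  "is_quotient B L I C K h =
     (is_ideal B L I \<^bold>\<and> is_epimorphism B L C K h \<^bold>\<and>
      (\<^bold>\<forall>b\<^bold>\<in>B. b \<^bold>\<in> I \<^bold>\<longleftrightarrow> (\<^bold>\<exists>z. is_bot C K z \<^bold>\<and> related h b z)))"


subsection \<open>Cantor--Bendixson ideals and the cardinal sequence\<close>

definition is_CB_derivative :: "'n \<Rightarrow> 'n \<Rightarrow> 'n \<Rightarrow> 'n \<Rightarrow> 'n fm" where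
  "is_CB_derivative B L I I' =
     (\<^bold>\<exists>C. \<^bold>\<exists>K. \<^bold>\<exists>h. is_quotient B L I C K h \<^bold>\<and>
        (\<^bold>\<forall>b. b \<^bold>\<in> I' \<^bold>\<longleftrightarrow> b \<^bold>\<in> B \<^bold>\<and> (\<^bold>\<exists>c. related h b c \<^bold>\<and> in_atom_ideal C K c)))"

text \<open>\<open>J\<close> is the sequence of the Cantor--Bendixson ideals indexed by the ordinals below \<open>r\<close>.\<close>

definition is_CB_sequence :: "'n \<Rightarrow> 'n \<Rightarrow> 'n \<Rightarrow> 'n \<Rightarrow> 'n fm" where
  "is_CB_sequence B L r J =
     (is_ordinal r \<^bold>\<and> is_function_on J r \<^bold>\<and>
      (\<^bold>\<forall>i\<^bold>\<in>r. \<^bold>\<forall>I. related J i I \<^bold>\<longrightarrow>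
         (is_empty i \<^bold>\<longrightarrow> (\<^bold>\<forall>x. x \<^bold>\<in> I \<^bold>\<longleftrightarrow> is_bot B L x)) \<^bold>\<and>
         (\<^bold>\<forall>j\<^bold>\<in>r. \<^bold>\<forall>I'. is_succ j i \<^bold>\<and> related J j I' \<^bold>\<longrightarrow> is_CB_derivative B L I' I) \<^bold>\<and>
         (is_limit i \<^bold>\<longrightarrow> (\<^bold>\<forall>x. x \<^bold>\<in> I \<^bold>\<longleftrightarrow> (\<^bold>\<exists>j\<^bold>\<in>i. \<^bold>\<exists>I'. related J j I' \<^bold>\<and> x \<^bold>\<in> I')))))"

definition is_CB_ideal :: "'n \<Rightarrow> 'n \<Rightarrow> 'n \<Rightarrow> 'n \<Rightarrow> 'n fm" where
  "is_CB_ideal B L i I = (\<^bold>\<exists>r. \<^bold>\<exists>J. is_CB_sequence B L r J \<^bold>\<and> i \<^bold>\<in> r \<^bold>\<and> related J i I)"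

text \<open>The least ordinal \<open>d\<close> such that \<open>B\<close> is the ideal with index \<open>d + 1\<close>.\<close>

definition is_ht_minus :: "'n \<Rightarrow> 'n \<Rightarrow> 'n \<Rightarrow> 'n fm" where
  "is_ht_minus B L d =
     (is_ordinal d \<^bold>\<and> (\<^bold>\<exists>s. is_succ d s \<^bold>\<and> is_CB_ideal B L s B) \<^bold>\<and>
      (\<^bold>\<forall>c\<^bold>\<in>d. \<^bold>\<not> (\<^bold>\<exists>s. is_succ c s \<^bold>\<and> is_CB_ideal B L s B)))"

text \<open>The number of elements of the \<open>i\<close>-th level of \<open>B\<close> is computed modulo the ideal with index
  \<open>i\<close>: it is the number of atoms of the quotient algebra. (The plain set difference of two
  consecutive ideals is at least as large as the smaller ideal, so with it no sequence that is
  constantly \<open>k\<close> could be longer than the successor cardinal of \<open>k\<close>.)\<close>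

definition has_width :: "'n \<Rightarrow> 'n \<Rightarrow> 'n \<Rightarrow> 'n \<Rightarrow> 'n fm" where
  "has_width B L i m =
     (\<^bold>\<exists>I. \<^bold>\<exists>C. \<^bold>\<exists>K. \<^bold>\<exists>h. \<^bold>\<exists>A. is_CB_ideal B L i I \<^bold>\<and> is_quotient B L I C K h \<^bold>\<and>
        (\<^bold>\<forall>a. a \<^bold>\<in> A \<^bold>\<longleftrightarrow> is_atom C K a) \<^bold>\<and> has_cardinality A m)"

text \<open>\<open>s\<close> is the cardinal sequence of \<open>B\<close>, a function on \<open>ht\<^sup>-(B)\<close>.\<close>

definition is_cardinal_sequence :: "'n \<Rightarrow> 'n \<Rightarrow> 'n \<Rightarrow> 'n fm" where
  "is_cardinal_sequence B L s =
     (\<^bold>\<exists>d. is_ht_minus B L d \<^bold>\<and> is_function_on s d \<^bold>\<and>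
        (\<^bold>\<forall>i\<^bold>\<in>d. \<^bold>\<forall>m. related s i m \<^bold>\<longrightarrow> has_width B L i m))"

text \<open>\<open>s\<close> is the sequence of length \<open>e + 1\<close> with the value \<open>k\<close> below \<open>e\<close> and \<open>l\<close> at \<open>e\<close>.\<close>

definition is_constant_then :: "'n \<Rightarrow> 'n \<Rightarrow> 'n \<Rightarrow> 'n \<Rightarrow> 'n fm" where
  "is_constant_then k e l s =
     ((\<^bold>\<exists>d. is_succ e d \<^bold>\<and> is_function_on s d) \<^bold>\<and> (\<^bold>\<forall>i\<^bold>\<in>e. related s i k) \<^bold>\<and> related s e l)"

definition is_kel_boolean_algebra :: "'n \<Rightarrow> 'n \<Rightarrow> 'n \<Rightarrow> 'n \<Rightarrow> 'n \<Rightarrow> 'n fm" where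
  "is_kel_boolean_algebra k e l B L =
     (is_superatomic B L \<^bold>\<and>
      (\<^bold>\<exists>s. is_cardinal_sequence B L s \<^bold>\<and> is_constant_then k e l s))"


section \<open>Forcing\<close>

text \<open>A notion of forcing is a nonempty partial order \<open>R\<close> with set of conditions \<open>Field R\<close>;
  \<open>(q, p) \<in> R\<close> means that \<open>q\<close> extends \<open>p\<close>. A name is (a code for) a set of pairs of a name and a
  condition, with at most \<open>|UNIV :: 'p set|\<close> many constituent names. Since there are at most that
  many conditions, these names describe the sets of hereditary cardinality at most
  \<open>|UNIV :: 'p set|\<close> in the generic extension.\<close>

datatype 'p name = EmptyName | Name "'p \<Rightarrow> 'p name" "'p \<Rightarrow> 'p set"

primrec name_pairs :: "'p name \<Rightarrow> ('p name \<times> 'p) set" where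
  "name_pairs EmptyName = {}"
| "name_pairs (Name f A) = {(f i, s) | i s. s \<in> A i}"

text \<open>The forcing relation for atomic formulas, by recursion on the first name in an equality;
  \<open>forces_eq_iff\<close> below gives the recursion in its usual symmetric form.\<close>

primrec forces_eq :: "'p rel \<Rightarrow> 'p name \<Rightarrow> 'p name \<Rightarrow> 'p \<Rightarrow> bool" where
  "forces_eq R EmptyName = (\<lambda>\<tau> p.
     \<forall>(\<tau>', t) \<in> name_pairs \<tau>. \<not> (\<exists>q. (q, p) \<in> R \<and> (q, t) \<in> R))"
| "forces_eq R (Name f A) = (\<lambda>\<tau> p.
     (\<forall>i. \<forall>s \<in> A i. \<forall>q. (q, p) \<in> R \<and> (q, s) \<in> R \<longrightarrow>
        (\<exists>r. (r, q) \<in> R \<and> (\<exists>(\<tau>', t) \<in> name_pairs \<tau>. (r, t) \<in> R \<and> forces_eq R (f i) \<tau>' r))) \<and>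
     (\<forall>(\<tau>', t) \<in> name_pairs \<tau>. \<forall>q. (q, p) \<in> R \<and> (q, t) \<in> R \<longrightarrow>
        (\<exists>r. (r, q) \<in> R \<and> (\<exists>i. \<exists>s \<in> A i. (r, s) \<in> R \<and> forces_eq R (f i) \<tau>' r))))"

definition forces_mem :: "'p rel \<Rightarrow> 'p name \<Rightarrow> 'p name \<Rightarrow> 'p \<Rightarrow> bool" where
  "forces_mem R \<sigma> \<tau> p \<longleftrightarrow>
     (\<forall>q. (q, p) \<in> R \<longrightarrow>
        (\<exists>r. (r, q) \<in> R \<and> (\<exists>(\<tau>', t) \<in> name_pairs \<tau>. (r, t) \<in> R \<and> forces_eq R \<sigma> \<tau>' r)))"

primrec forces :: "'p rel \<Rightarrow> 'p name fm \<Rightarrow> 'p \<Rightarrow> bool" where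
  "forces R (\<sigma> \<^bold>\<in> \<tau>) = forces_mem R \<sigma> \<tau>"
| "forces R (\<sigma> \<^bold>= \<tau>) = forces_eq R \<sigma> \<tau>"
| "forces R (\<^bold>\<not> \<phi>) = (\<lambda>p. \<forall>q. (q, p) \<in> R \<longrightarrow> \<not> forces R \<phi> q)"
| "forces R (\<phi> \<^bold>\<and> \<psi>) = (\<lambda>p. forces R \<phi> p \<and> forces R \<psi> p)"
| "forces R (Univ \<Phi>) = (\<lambda>p. \<forall>\<sigma>. forces R (\<Phi> \<sigma>) p)"

definition forced :: "'p rel \<Rightarrow> 'p name fm \<Rightarrow> bool" where
  "forced R \<phi> \<longleftrightarrow> (\<forall>p \<in> Field R. forces R \<phi> p)"

text \<open>Canonical names of ordinals: \<open>ordinal_name R r\<close> is the check name of the order type of the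
  well-order \<open>r\<close>, and \<open>segment_name R r x\<close> that of its initial segment below \<open>x\<close>.\<close>

definition segment_name :: "'p rel \<Rightarrow> 'p rel \<Rightarrow> 'p \<Rightarrow> 'p name" where
  "segment_name R r =
     wfrec (r - Id) (\<lambda>g x. Name g (\<lambda>y. if y \<in> underS r x then Field R else {}))"

definition ordinal_name :: "'p rel \<Rightarrow> 'p rel \<Rightarrow> 'p name" where
  "ordinal_name R r = Name (segment_name R r) (\<lambda>x. if x \<in> Field r then Field R else {})"

text \<open>Every cardinal (of a well-order on the type of conditions) remains a cardinal. Larger
  cardinals exceed the number of conditions.\<close>

definition cardinal_preserving :: "'p rel \<Rightarrow> bool" where
  "cardinal_preserving R \<longleftrightarrow>
     (\<forall>r :: 'p rel. Card_order r \<longrightarrow> forced R (is_cardinal (ordinal_name R r)))"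

text \<open>For conditions of type \<open>'a set\<close>, a well-order on \<open>'a\<close> is first copied to singletons.\<close>

definition check_ordinal :: "'a set rel \<Rightarrow> 'a rel \<Rightarrow> 'a set name" where
  "check_ordinal R r = ordinal_name R (dir_image r (\<lambda>x. {x}))"

lemma name_pairs_segment_name:
  assumes "Well_order r"
  shows "name_pairs (segment_name R r x) = (segment_name R r ` underS r x) \<times> Field R"
proof -
  have wf: "wf (r - Id)"
    using assms by (simp add: well_order_on_def)
  have "segment_name R r x =
      Name (cut (segment_name R r) (r - Id) x) (\<lambda>y. if y \<in> underS r x then Field R else {})"
    unfolding segment_name_def by (subst wfrec[OF wf]) simp
  then have "name_pairs (segment_name R r x) =
      {(cut (segment_name R r) (r - Id) x y, s) | y s. y \<in> underS r x \<and> s \<in> Field R}"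
    by (auto split: if_splits)
  moreover have "cut (segment_name R r) (r - Id) x y = segment_name R r y" if "y \<in> underS r x" for y
    using that by (auto simp: cut_def underS_def)
  ultimately show ?thesis
    by (auto, metis)
qed

lemma forces_eq_sym: "forces_eq R \<sigma> \<tau> p \<longleftrightarrow> forces_eq R \<tau> \<sigma> p"
proof (induction \<sigma> arbitrary: \<tau> p)
  case EmptyName
  then show ?case by (cases \<tau>) auto
next
  case (Name f A)
  show ?case
  proof (cases \<tau>)
    case EmptyName
    then show ?thesis by auto
  next
    case (Name g D)
    have *: "forces_eq R (g j) (f i) r \<longleftrightarrow> forces_eq R (f i) (g j) r" for i j r
      using Name.IH by blast
    have pairs: "(\<forall>(\<sigma>', s) \<in> name_pairs (Name f' A'). P \<sigma>' s) \<longleftrightarrow> (\<forall>i. \<forall>s \<in> A' i. P (f' i) s)"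
      "(\<exists>(\<sigma>', s) \<in> name_pairs (Name f' A'). P \<sigma>' s) \<longleftrightarrow> (\<exists>i. \<exists>s \<in> A' i. P (f' i) s)"
      for P :: "'a name \<Rightarrow> 'a \<Rightarrow> bool" and f' A'
      by fastforce+
    show ?thesis
      unfolding Name forces_eq.simps pairs * by (rule conj_commute)
  qed
qed

lemma forces_eq_iff:
  assumes "Partial_order R"
  shows "forces_eq R \<sigma> \<tau> p \<longleftrightarrow>
    (\<forall>(\<sigma>', s) \<in> name_pairs \<sigma>. \<forall>q. (q, p) \<in> R \<and> (q, s) \<in> R \<longrightarrow> forces_mem R \<sigma>' \<tau> q) \<and>
    (\<forall>(\<tau>', t) \<in> name_pairs \<tau>. \<forall>q. (q, p) \<in> R \<and> (q, t) \<in> R \<longrightarrow> forces_mem R \<tau>' \<sigma> q)"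
proof -
  have trans: "(r, q) \<in> R \<Longrightarrow> (q, p) \<in> R \<Longrightarrow> (r, p) \<in> R" for p q r
    using assms unfolding partial_order_on_def preorder_on_def trans_def by blast
  have refl: "(q, p) \<in> R \<Longrightarrow> (q, q) \<in> R" for p q
    using assms unfolding partial_order_on_def preorder_on_def refl_on_def by (auto intro: FieldI1)
  define D where "D \<rho> \<tau> q \<longleftrightarrow>
    (\<exists>r. (r, q) \<in> R \<and> (\<exists>(\<tau>', t) \<in> name_pairs \<tau>. (r, t) \<in> R \<and> forces_eq R \<rho> \<tau>' r))" for \<rho> \<tau> q
  have mem: "forces_mem R \<rho> \<tau> q \<longleftrightarrow> (\<forall>q'. (q', q) \<in> R \<longrightarrow> D \<rho> \<tau> q')" for \<rho> \<tau> q
    by (simp add: forces_mem_def D_def)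
  have half: "(\<forall>q. (q, p) \<in> R \<and> (q, s) \<in> R \<longrightarrow> D \<rho> \<tau> q) \<longleftrightarrow>
    (\<forall>q. (q, p) \<in> R \<and> (q, s) \<in> R \<longrightarrow> forces_mem R \<rho> \<tau> q)" for \<rho> \<tau> p s
  proof
    assume "\<forall>q. (q, p) \<in> R \<and> (q, s) \<in> R \<longrightarrow> D \<rho> \<tau> q"
    then show "\<forall>q. (q, p) \<in> R \<and> (q, s) \<in> R \<longrightarrow> forces_mem R \<rho> \<tau> q"
      unfolding mem using trans by blast
  next
    assume "\<forall>q. (q, p) \<in> R \<and> (q, s) \<in> R \<longrightarrow> forces_mem R \<rho> \<tau> q"
    then show "\<forall>q. (q, p) \<in> R \<and> (q, s) \<in> R \<longrightarrow> D \<rho> \<tau> q"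
      unfolding mem using refl by blast
  qed
  have "forces_eq R \<sigma> \<tau> p \<longleftrightarrow>
    (\<forall>(\<sigma>', s) \<in> name_pairs \<sigma>. \<forall>q. (q, p) \<in> R \<and> (q, s) \<in> R \<longrightarrow> D \<sigma>' \<tau> q) \<and>
    (\<forall>(\<tau>', t) \<in> name_pairs \<tau>. \<forall>q. (q, p) \<in> R \<and> (q, t) \<in> R \<longrightarrow> D \<tau>' \<sigma> q)"
  proof (cases \<sigma>)
    case EmptyName
    then show ?thesis by (auto simp: D_def)
  next
    case (Name f A)
    have "D \<tau>' (Name f A) q \<longleftrightarrow>
      (\<exists>r. (r, q) \<in> R \<and> (\<exists>i. \<exists>s \<in> A i. (r, s) \<in> R \<and> forces_eq R (f i) \<tau>' r))" for \<tau>' q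
      unfolding D_def forces_eq_sym[of R \<tau>'] by fastforce
    moreover have "(\<forall>(\<sigma>', s) \<in> name_pairs (Name f A). P \<sigma>' s) \<longleftrightarrow> (\<forall>i. \<forall>s \<in> A i. P (f i) s)"
      for P :: "'a name \<Rightarrow> 'a \<Rightarrow> bool"
      by fastforce
    ultimately show ?thesis
      unfolding Name by (simp only: forces_eq.simps D_def)
  qed
  then show ?thesis
    unfolding half .
qed

end

theory Submission imports Defs
begin

text \<open>The forcing conditions are partial orders of size less than \<open>\<kappa>\<close> on points \<open>Low x i\<close> of level \<open>x\<close> and
 points \<open>Top l\<close> of level \<open>\<eta>\<close>, in which two incomparable points have finitely many maximal common lower
 bounds; an extension adds no common lower bounds of old incomparable points beyond those below old ones. The
 levels of the maximal common lower bounds are restricted by \<open>F\<close> (for two top points) and by a bijection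
 \<open>\<rho>\<close> of \<open>\<eta>\<close> with \<open>\<kappa>\<^sup>+\<close>. Unions of chains show that the order is closed under descending sequences of length
 less than \<open>\<kappa>\<close>. Among more than \<open>\<kappa>\<close> conditions one finds isomorphic ones forming a \<open>\<Delta>\<close>-system; the strong
 unboundedness of \<open>F\<close> provides two of them that can be amalgamated over a set \<open>W\<close> of \<open>\<kappa>\<close> many levels, by
 adding a common lower bound with level in \<open>W\<close> below each pair of corresponding new points. Hence cardinals
 are preserved. In the extension, the sets of points above a given point generate a superatomic algebra: it is
 presented as the algebra of clopen codes modulo the ideal of those codes that are forced to avoid all
 these sets, and its Cantor--Bendixson ideals are generated by the points of lower level.\<close>

section \<open>The forcing relation\<close>

text \<open>The forcing relation alone is used: statements about the extension become statements
  about what holds densely below a condition. The chain condition is the obstacle. Two points taken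
  from two conditions need a common lower bound, whose level is restricted by \<open>ok\<close>. For
  each pair \<open>ok\<close> must leave only \<kappa> many levels, because the set \<open>W\<close>
  has to be closed under such levels and still have size \<kappa>. The order of \<eta> cannot do
  this counting, as its proper initial segments may have size \<open>\<kappa>\<^sup>+\<close>;
  measured through \<rho> they have size at most \<kappa>. For two top points \<rho> says nothing
  and F takes its place: amalgamation succeeds once F exceeds a single bound for \<rho> on
  \<open>W\<close> at all pairs of new top points, which is what strong unboundedness provides for
  \<open>\<kappa>\<^sup>+\<close> many disjoint sets of top points. The cofinality of \<eta> yields
  levels in \<open>W\<close> below the top points; a level of \<open>W\<close> with smaller
  cofinality is handled by putting a cofinal subset of it into \<open>W\<close>.\<close>

locale forcing =
 fixes R :: "'p rel"
 assumes po: "Partial_order R" and inf_p: "infinite (UNIV :: 'p set)"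
begin

abbreviation ext_le (infix "\<lhd>" 50) where "q \<lhd> p \<equiv> (q, p) \<in> R"
abbreviation frc (infix "||-" 45) where "p ||- \<phi> \<equiv> forces R \<phi> p"

section \<open>Properties that hold densely below a condition\<close>

definition densely :: "'p => ('p => bool) => bool" where
 "densely p \<Phi> \<longleftrightarrow> (\<forall>q. q \<lhd> p --> (\<exists>r. r \<lhd> q \<and> \<Phi> r))"

lemma le_trans: "r \<lhd> q ==> q \<lhd> p ==> r \<lhd> p"
 using po unfolding partial_order_on_def preorder_on_def trans_def by blast

lemma le_refl: "p \<in> Field R ==> p \<lhd> p"
 using po unfolding partial_order_on_def preorder_on_def refl_on_def by blast

lemma le_Field: "q \<lhd> p ==> q \<in> Field R" "q \<lhd> p ==> p \<in> Field R"
 by (auto intro: FieldI1 FieldI2)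

lemma le_refl1: "q \<lhd> p ==> q \<lhd> q" "q \<lhd> p ==> p \<lhd> p"
 by (auto intro: le_refl le_Field)

lemma denselyI: "(\<And>q. q \<lhd> p ==> \<exists>r. r \<lhd> q \<and> \<Phi> r) ==> densely p \<Phi>"
 by (simp add: densely_def)

lemma denselyD: "densely p \<Phi> ==> q \<lhd> p ==> \<exists>r. r \<lhd> q \<and> \<Phi> r"
 by (simp add: densely_def)

lemma densely_mono: "densely p \<Phi> ==> (\<And>r. r \<lhd> p ==> \<Phi> r ==> \<Psi> r) ==> densely p \<Psi>"
 unfolding densely_def by (meson le_trans)

lemma densely_le: "densely p \<Phi> ==> q \<lhd> p ==> densely q \<Phi>"
 unfolding densely_def by (meson le_trans)

lemma densely_densely: "densely p (\<lambda>q. densely q \<Phi>) ==> densely p \<Phi>"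
 unfolding densely_def by (meson le_trans le_refl1)

text \<open>Only \<open>\<Phi>\<close> has to persist: it is secured first and must survive the
  further extension that secures \<open>\<Psi>\<close>.\<close>

lemma densely_conj:
 assumes "densely p \<Phi>" "densely p \<Psi>" "\<And>q r. r \<lhd> q ==> \<Phi> q ==> \<Phi> r"
 shows "densely p (\<lambda>r. \<Phi> r \<and> \<Psi> r)"
 using assms unfolding densely_def by (meson le_trans)

lemma densely_const: "(\<And>q r. r \<lhd> q ==> \<Phi> q ==> \<Phi> r) ==> \<Phi> p ==> densely p \<Phi>"
 unfolding densely_def by (meson le_refl1)

section \<open>Persistence and density of the forcing relation\<close>

lemma forces_mem_mono: "q \<lhd> p ==> forces_mem R \<sigma> \<tau> p ==> forces_mem R \<sigma> \<tau> q"
 unfolding forces_mem_def by (meson le_trans)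

lemma forces_mono: "q \<lhd> p ==> p ||- \<phi> ==> q ||- \<phi>"
proof (induction \<phi> arbitrary: p q)
 case (Member \<sigma> \<tau>)
 then show ?case by (simp add: forces_mem_mono)
next
 case (Equal \<sigma> \<tau>)
 then show ?case
  unfolding forces.simps forces_eq_iff[OF po] using le_trans by fast
next
 case (Neg \<phi>)
 then show ?case unfolding forces.simps by (meson le_trans)
qed auto

lemma forces_mem_dense: "densely p (forces_mem R \<sigma> \<tau>) ==> forces_mem R \<sigma> \<tau> p"
 unfolding densely_def forces_mem_def by (meson le_trans le_refl1)

text \<open>This property makes forced truth classical. Every later argument that passes to an
  extension, chooses a witness there and returns to \<open>p\<close> ends with it. Negation needs
  persistence alone; equality reduces through \<open>forces_eq_iff\<close> to membership, whose
  definition already asks for density.\<close>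

lemma forces_dense: "densely p (\<lambda>r. r ||- \<phi>) ==> p ||- \<phi>"
proof (induction \<phi> arbitrary: p)
 case (Member \<sigma> \<tau>)
 then show ?case by (simp add: forces_mem_dense)
next
 case (Equal \<sigma> \<tau>)
 \<comment> \<open>Serves both halves of the symmetric recursion: below \<open>q\<close> some
   \<open>r\<close> already forces the equality and hence the membership, and membership needs to
   hold only densely.\<close>
 have *: "forces_mem R \<rho> \<upsilon> q" if asm: "q \<lhd> p" "q \<lhd> s"
  and asm3: "\<And>r r'. r \<lhd> p ==> forces_eq R \<sigma> \<tau> r ==> r' \<lhd> r ==> r' \<lhd> s ==> forces_mem R \<rho> \<upsilon> r'" for \<rho> \<upsilon> q s
 proof (rule forces_mem_dense, rule denselyI)
  fix q' assume "q' \<lhd> q"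
  then obtain r where r: "r \<lhd> q'" "forces_eq R \<sigma> \<tau> r"
   using Equal asm(1) \<open>q' \<lhd> q\<close> le_trans unfolding densely_def forces.simps by meson
  then have "r \<lhd> p" "r \<lhd> s" "r \<lhd> r"
   using \<open>q' \<lhd> q\<close> asm(1,2) by (meson le_trans le_refl1)+
  then show "\<exists>r. r \<lhd> q' \<and> forces_mem R \<rho> \<upsilon> r"
   using asm3 r by blast
 qed
 show ?case
  unfolding forces.simps forces_eq_iff[OF po]
  by (intro conjI ballI allI impI; clarify) (rule *, assumption, assumption, force simp: forces_eq_iff[OF po])+
next
 case (Neg \<phi>)
 then show ?case unfolding forces.simps densely_def by (meson le_trans forces_mono le_refl1)
next
 case (Conj \<phi> \<psi>)
 then show ?case unfolding forces.simps densely_def by meson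
next
 case (Univ \<Phi>)
 then show ?case unfolding forces.simps densely_def by (metis rangeI)
qed

lemma denseE: "(\<And>q. q \<lhd> p ==> \<exists>r. r \<lhd> q \<and> r ||- \<phi>) ==> p ||- \<phi>"
 by (rule forces_dense) (simp add: densely_def)

lemma forces_Neg: "p ||- (\<^bold>\<not> \<phi>) \<longleftrightarrow> (\<forall>q. q \<lhd> p --> \<not> q ||- \<phi>)"
 by simp

text \<open>Implication abbreviates a negated conjunction with a negation, so getting the conclusion
  back is double negation elimination and rests on \<open>forces_dense\<close>.\<close>

lemma forces_Imp: "p ||- (\<phi> \<^bold>\<longrightarrow> \<psi>) \<longleftrightarrow> (\<forall>q. q \<lhd> p --> q ||- \<phi> --> q ||- \<psi>)"
proof
 assume L: "p ||- (\<phi> \<^bold>\<longrightarrow> \<psi>)"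
 show "\<forall>q. q \<lhd> p --> q ||- \<phi> --> q ||- \<psi>"
 proof (intro allI impI)
  fix q assume "q \<lhd> p" "q ||- \<phi>"
  then show "q ||- \<psi>"
   using L unfolding Imp_def by simp (meson denseE forces_mono le_trans le_refl1)
 qed
next
 assume "\<forall>q. q \<lhd> p --> q ||- \<phi> --> q ||- \<psi>"
 then show "p ||- (\<phi> \<^bold>\<longrightarrow> \<psi>)"
  unfolding Imp_def by simp (meson le_refl1)
qed

lemma forces_Disj: "p ||- (\<phi> \<^bold>\<or> \<psi>) \<longleftrightarrow> densely p (\<lambda>r. r ||- \<phi> \<or> r ||- \<psi>)"
 unfolding Disj_def densely_def by simp (meson forces_mono le_trans le_refl1)

lemma forces_Iff: "p ||- (\<phi> \<^bold>\<longleftrightarrow> \<psi>) \<longleftrightarrow> (\<forall>q. q \<lhd> p --> (q ||- \<phi> \<longleftrightarrow> q ||- \<psi>))"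
 unfolding Iff_def using forces_Imp by auto

lemma forces_Exis: "p ||- (Exis \<Phi>) \<longleftrightarrow> densely p (\<lambda>r. \<exists>\<sigma>. r ||- \<Phi> \<sigma>)"
 unfolding Exis_def densely_def by simp (meson forces_mono le_trans le_refl1)

lemma forces_BUniv:
 "p ||- (BUniv A \<Phi>) \<longleftrightarrow> (\<forall>q \<sigma>. q \<lhd> p --> q ||- (\<sigma> \<^bold>\<in> A) --> q ||- \<Phi> \<sigma>)"
 unfolding BUniv_def using forces_Imp by auto

lemma forces_BExis:
 "p ||- (BExis A \<Phi>) \<longleftrightarrow> densely p (\<lambda>r. \<exists>\<sigma>. r ||- (\<sigma> \<^bold>\<in> A) \<and> r ||- \<Phi> \<sigma>)"
 unfolding BExis_def forces_Exis by simp

lemmas forces_Conj = forces.simps(4)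

lemma forces_ExisI: "p ||- \<Phi> \<sigma> ==> p ||- (Exis \<Phi>)"
 unfolding forces_Exis by (rule densely_const) (use forces_mono in blast)+

lemma forces_BExisI: "p ||- (\<sigma> \<^bold>\<in> A) ==> p ||- \<Phi> \<sigma> ==> p ||- (BExis A \<Phi>)"
 unfolding BExis_def by (rule forces_ExisI) simp

section \<open>Equality axioms\<close>

lemma eq_refl: "p ||- (\<sigma> \<^bold>= \<sigma>)"
proof (induction \<sigma> arbitrary: p)
 case EmptyName
 then show ?case by simp
next
 case (Name f A)
 have "forces_mem R \<sigma>' (Name f A) q" if "(\<sigma>', s) \<in> name_pairs (Name f A)" "q \<lhd> s" for \<sigma>' s q
  unfolding forces_mem_def
 proof (intro allI impI)
  fix r assume "r \<lhd> q"
  then have "r \<lhd> r" "r \<lhd> s" using that by (meson le_refl1 le_trans)+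
  moreover have "forces_eq R \<sigma>' \<sigma>' r" using that Name by auto
  ultimately show "\<exists>r'. r' \<lhd> r \<and> (\<exists>(\<tau>', t) \<in> name_pairs (Name f A). r' \<lhd> t \<and> forces_eq R \<sigma>' \<tau>' r')"
   by (intro exI[of _ r] conjI bexI[OF _ that(1)]) simp_all
 qed
 then show ?case unfolding forces.simps forces_eq_iff[OF po] by blast
qed

lemma eq_sym: "p ||- (\<sigma> \<^bold>= \<tau>) ==> p ||- (\<tau> \<^bold>= \<sigma>)"
 using forces_eq_sym[of R \<sigma> \<tau> p] by simp

lemma forces_eqD:
 assumes "p ||- (\<sigma> \<^bold>= \<tau>)" "(\<sigma>', s) \<in> name_pairs \<sigma>" "q \<lhd> p" "q \<lhd> s"
 shows "\<exists>r \<tau>' t. r \<lhd> q \<and> (\<tau>', t) \<in> name_pairs \<tau> \<and> r \<lhd> t \<and> r ||- (\<sigma>' \<^bold>= \<tau>')"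
proof -
 have "forces_mem R \<sigma>' \<tau> q"
  using assms unfolding forces.simps forces_eq_iff[OF po] by blast
 then show ?thesis
  unfolding forces_mem_def forces.simps using le_refl1(1)[OF assms(3)] by fast
qed

text \<open>The induction is on the first name only. Members of \<open>\<sigma>\<close> are followed
  forwards through \<open>\<tau>\<close>; a member of \<open>\<rho>\<close> is followed backwards
  until some \<open>\<sigma>'\<close> in \<open>\<sigma>\<close> is reached, so that both halves use
  the hypothesis for \<open>\<sigma>'\<close>.\<close>

lemma eq_trans: "p ||- (\<sigma> \<^bold>= \<tau>) ==> p ||- (\<tau> \<^bold>= \<rho>) ==> p ||- (\<sigma> \<^bold>= \<rho>)"
proof (induction \<sigma> arbitrary: \<tau> \<rho> p)
 have step: "forces_mem R \<sigma>' \<rho> q"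
  if asm: "p ||- (\<sigma> \<^bold>= \<tau>)" "p ||- (\<tau> \<^bold>= \<rho>)" "(\<sigma>', s) \<in> name_pairs \<sigma>" "q \<lhd> p" "q \<lhd> s"
  "\<And>\<tau> \<rho> p. p ||- (\<sigma>' \<^bold>= \<tau>) ==> p ||- (\<tau> \<^bold>= \<rho>) ==> p ||- (\<sigma>' \<^bold>= \<rho>)" for \<sigma> \<tau> \<rho> \<sigma>' s p q
  unfolding forces_mem_def
 proof (intro allI impI)
  fix q' assume q': "q' \<lhd> q"
  then have "q' \<lhd> p" "q' \<lhd> s" using asm by (meson le_trans)+
  then obtain r \<tau>' t where r: "r \<lhd> q'" "(\<tau>', t) \<in> name_pairs \<tau>" "r \<lhd> t" "r ||- (\<sigma>' \<^bold>= \<tau>')"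
   using forces_eqD[OF asm(1,3)] by meson
  then have "r \<lhd> p" using \<open>q' \<lhd> p\<close> by (meson le_trans)
  then obtain r' \<rho>' u where r': "r' \<lhd> r" "(\<rho>', u) \<in> name_pairs \<rho>" "r' \<lhd> u" "r' ||- (\<tau>' \<^bold>= \<rho>')"
   using forces_eqD[OF asm(2) r(2)] r(3) by meson
  have "r' ||- (\<sigma>' \<^bold>= \<rho>')" using asm(6) r r' forces_mono by meson
  then show "\<exists>r. r \<lhd> q' \<and> (\<exists>(\<rho>', t) \<in> name_pairs \<rho>. r \<lhd> t \<and> forces_eq R \<sigma>' \<rho>' r)"
   using r' le_trans[OF r'(1) r(1)] by auto
 qed
 have step': "forces_mem R \<rho>' \<sigma> q"
  if asm: "p ||- (\<sigma> \<^bold>= \<tau>)" "p ||- (\<tau> \<^bold>= \<rho>)" "(\<rho>', s) \<in> name_pairs \<rho>" "q \<lhd> p" "q \<lhd> s"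
  "\<And>\<sigma>' s \<tau> \<rho> p. (\<sigma>', s) \<in> name_pairs \<sigma> ==> p ||- (\<sigma>' \<^bold>= \<tau>) ==> p ||- (\<tau> \<^bold>= \<rho>) ==> p ||- (\<sigma>' \<^bold>= \<rho>)" for \<sigma> \<tau> \<rho> \<rho>' s p q
  unfolding forces_mem_def
 proof (intro allI impI)
  fix q' assume q': "q' \<lhd> q"
  then have "q' \<lhd> p" "q' \<lhd> s" using asm by (meson le_trans)+
  then obtain r \<tau>' t where r: "r \<lhd> q'" "(\<tau>', t) \<in> name_pairs \<tau>" "r \<lhd> t" "r ||- (\<rho>' \<^bold>= \<tau>')"
   using forces_eqD[OF eq_sym[OF asm(2)] asm(3)] by meson
  then have "r \<lhd> p" using \<open>q' \<lhd> p\<close> by (meson le_trans)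
  then obtain r' \<sigma>' u where r': "r' \<lhd> r" "(\<sigma>', u) \<in> name_pairs \<sigma>" "r' \<lhd> u" "r' ||- (\<tau>' \<^bold>= \<sigma>')"
   using forces_eqD[OF eq_sym[OF asm(1)] r(2)] r(3) by meson
  have "r' ||- (\<sigma>' \<^bold>= \<rho>')" using asm(6)[OF r'(2)] r r' forces_mono eq_sym by meson
  then show "\<exists>r. r \<lhd> q' \<and> (\<exists>(\<sigma>', t) \<in> name_pairs \<sigma>. r \<lhd> t \<and> forces_eq R \<rho>' \<sigma>' r)"
   using r' le_trans[OF r'(1) r(1)] eq_sym[where p = r' and \<sigma> = \<sigma>' and \<tau> = \<rho>'] by auto
 qed
 have comb: "p ||- (\<sigma> \<^bold>= \<rho>)"
  if prems: "p ||- (\<sigma> \<^bold>= \<tau>)" "p ||- (\<tau> \<^bold>= \<rho>)"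
   and IH: "\<And>\<sigma>' s \<tau> \<rho> p. (\<sigma>', s) \<in> name_pairs \<sigma> ==> p ||- (\<sigma>' \<^bold>= \<tau>) ==> p ||- (\<tau> \<^bold>= \<rho>) ==> p ||- (\<sigma>' \<^bold>= \<rho>)"
  for \<sigma> \<tau> \<rho> p
  unfolding forces.simps forces_eq_iff[OF po, of _ \<rho>]
 proof (intro conjI ballI allI impI; clarify)
  show "forces_mem R \<sigma>' \<rho> q" if "(\<sigma>', s) \<in> name_pairs \<sigma>" "q \<lhd> p" "q \<lhd> s" for \<sigma>' s q
   by (rule step[OF prems that IH[OF that(1)]])
  show "forces_mem R \<rho>' \<sigma> q" if "(\<rho>', s) \<in> name_pairs \<rho>" "q \<lhd> p" "q \<lhd> s" for \<rho>' s q
   by (rule step'[OF prems that IH])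
 qed
 {
  case EmptyName
  then show ?case by (rule comb) simp
 next
  case (Name f A)
  show ?case by (rule comb[OF Name.prems]) (use Name.IH in auto)
 }
qed

lemma mem_cong:
 assumes "p ||- (\<sigma> \<^bold>= \<sigma>')" "p ||- (\<tau> \<^bold>= \<tau>')" "p ||- (\<sigma> \<^bold>\<in> \<tau>)"
 shows "p ||- (\<sigma>' \<^bold>\<in> \<tau>')"
 unfolding forces.simps forces_mem_def
proof (intro allI impI)
 fix q assume q: "q \<lhd> p"
 then obtain r \<tau>1 t where r: "r \<lhd> q" "(\<tau>1, t) \<in> name_pairs \<tau>" "r \<lhd> t" "r ||- (\<sigma> \<^bold>= \<tau>1)"
  using assms(3) unfolding forces.simps forces_mem_def by fastforce
 then have "r \<lhd> p" using q by (meson le_trans)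
 then obtain r' \<tau>2 u where r': "r' \<lhd> r" "(\<tau>2, u) \<in> name_pairs \<tau>'" "r' \<lhd> u" "r' ||- (\<tau>1 \<^bold>= \<tau>2)"
  using forces_eqD[OF assms(2) r(2)] r(3) by meson
 have "r' ||- (\<sigma>' \<^bold>= \<tau>2)"
  using eq_sym[OF assms(1)] r r' forces_mono eq_trans q by meson
 then show "\<exists>r. r \<lhd> q \<and> (\<exists>(\<tau>'', t) \<in> name_pairs \<tau>'. r \<lhd> t \<and> forces_eq R \<sigma>' \<tau>'' r)"
  using r' le_trans[OF r'(1) r(1)] by auto
qed

text \<open>Extensionality. It allows names to be compared through the membership lemmas of their
  constructors, without unfolding the recursion for equality.\<close>

lemma eq_iff_mem: "p ||- (\<sigma> \<^bold>= \<tau>) \<longleftrightarrow> (\<forall>q \<rho>. q \<lhd> p --> (q ||- (\<rho> \<^bold>\<in> \<sigma>) \<longleftrightarrow> q ||- (\<rho> \<^bold>\<in> \<tau>)))"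
proof
 assume L: "p ||- (\<sigma> \<^bold>= \<tau>)"
 then show "\<forall>q \<rho>. q \<lhd> p --> (q ||- (\<rho> \<^bold>\<in> \<sigma>) \<longleftrightarrow> q ||- (\<rho> \<^bold>\<in> \<tau>))"
  by (meson forces_mono mem_cong eq_refl eq_sym)
next
 assume R: "\<forall>q \<rho>. q \<lhd> p --> (q ||- (\<rho> \<^bold>\<in> \<sigma>) \<longleftrightarrow> q ||- (\<rho> \<^bold>\<in> \<tau>))"
 have *: "q ||- (\<sigma>' \<^bold>\<in> \<sigma>)" if "(\<sigma>', s) \<in> name_pairs \<sigma>" "q \<lhd> s" for q s \<sigma>' \<sigma>
  unfolding forces.simps forces_mem_def
 proof (intro allI impI)
  fix r assume "r \<lhd> q"
  then have "r \<lhd> r" "r \<lhd> s" using that by (meson le_refl1 le_trans)+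
  then show "\<exists>r'. r' \<lhd> r \<and> (\<exists>(\<tau>', t) \<in> name_pairs \<sigma>. r' \<lhd> t \<and> forces_eq R \<sigma>' \<tau>' r')"
   using eq_refl by (intro exI[of _ r] conjI bexI[OF _ that(1)]) simp_all
 qed
 then show "p ||- (\<sigma> \<^bold>= \<tau>)"
  unfolding forces.simps forces_eq_iff[OF po] using R unfolding forces.simps by blast
qed

text \<open>\<open>Univ\<close> accepts an arbitrary function on names, so equals cannot be
  substituted in all formulas at once, and a congruence is derived for each formula separately. It
  must speak of all extensions because negation and implication do.\<close>

definition fiff :: "'p => 'p name fm => 'p name fm => bool" where
 "fiff p \<phi> \<psi> \<longleftrightarrow> (\<forall>q. q \<lhd> p --> (q ||- \<phi> \<longleftrightarrow> q ||- \<psi>))"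

lemma fiffD: "fiff p \<phi> \<psi> ==> p ||- \<phi> \<longleftrightarrow> p ||- \<psi>"
 unfolding fiff_def by (meson denseE forces_mono le_refl1)

lemma fiff_Member: "p ||- (a \<^bold>= a') ==> p ||- (b \<^bold>= b') ==> fiff p (a \<^bold>\<in> b) (a' \<^bold>\<in> b')"
 unfolding fiff_def by (meson mem_cong forces_mono eq_sym)

lemma fiff_Equal: "p ||- (a \<^bold>= a') ==> p ||- (b \<^bold>= b') ==> fiff p (a \<^bold>= b) (a' \<^bold>= b')"
 unfolding fiff_def by (meson eq_trans forces_mono eq_sym)

lemma fiff_Neg: "fiff p \<phi> \<phi>' ==> fiff p (\<^bold>\<not> \<phi>) (\<^bold>\<not> \<phi>')"
 unfolding fiff_def by simp (meson le_trans)

lemma fiff_Conj: "fiff p \<phi> \<phi>' ==> fiff p \<psi> \<psi>' ==> fiff p (\<phi> \<^bold>\<and> \<psi>) (\<phi>' \<^bold>\<and> \<psi>')"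
 unfolding fiff_def by simp

lemma fiff_Univ: "(\<And>x. fiff p (\<Phi> x) (\<Phi>' x)) ==> fiff p (Univ \<Phi>) (Univ \<Phi>')"
 unfolding fiff_def by simp

lemmas fiff_basic = fiff_Member fiff_Equal fiff_Neg fiff_Conj fiff_Univ

lemma fiff_derived:
 "fiff p \<phi> \<phi>' ==> fiff p \<psi> \<psi>' ==> fiff p (\<phi> \<^bold>\<or> \<psi>) (\<phi>' \<^bold>\<or> \<psi>')"
 "fiff p \<phi> \<phi>' ==> fiff p \<psi> \<psi>' ==> fiff p (\<phi> \<^bold>\<longrightarrow> \<psi>) (\<phi>' \<^bold>\<longrightarrow> \<psi>')"
 "fiff p \<phi> \<phi>' ==> fiff p \<psi> \<psi>' ==> fiff p (\<phi> \<^bold>\<longleftrightarrow> \<psi>) (\<phi>' \<^bold>\<longleftrightarrow> \<psi>')"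
 "(\<And>x. fiff p (\<Phi> x) (\<Phi>' x)) ==> fiff p (Exis \<Phi>) (Exis \<Phi>')"
 "p ||- (a \<^bold>= a') ==> (\<And>x. fiff p (\<Phi> x) (\<Phi>' x)) ==> fiff p (BUniv a \<Phi>) (BUniv a' \<Phi>')"
 "p ||- (a \<^bold>= a') ==> (\<And>x. fiff p (\<Phi> x) (\<Phi>' x)) ==> fiff p (BExis a \<Phi>) (BExis a' \<Phi>')"
 unfolding Disj_def Imp_def Iff_def Exis_def BUniv_def BExis_def
 by ((intro fiff_basic eq_refl; assumption?))+

lemmas fiff_intros = fiff_basic fiff_derived eq_refl

lemma fiff_upair:
 "p ||- (a \<^bold>= a') ==> p ||- (b \<^bold>= b') ==> p ||- (z \<^bold>= z') ==> fiff p (is_upair a b z) (is_upair a' b' z')"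
 unfolding is_upair_def by (intro fiff_intros; assumption?)

lemma fiff_pair:
 "p ||- (a \<^bold>= a') ==> p ||- (b \<^bold>= b') ==> p ||- (z \<^bold>= z') ==> fiff p (is_pair a b z) (is_pair a' b' z')"
 unfolding is_pair_def by (intro fiff_intros fiff_upair; assumption?)

lemma fiff_related:
 "p ||- (r \<^bold>= r') ==> p ||- (a \<^bold>= a') ==> p ||- (b \<^bold>= b') ==> fiff p (related r a b) (related r' a' b')"
 unfolding related_def by (intro fiff_intros fiff_pair; assumption?)

lemma related_cong:
 "p ||- (related r a b) ==> p ||- (a \<^bold>= a') ==> p ||- (b \<^bold>= b') ==> p ||- (related r a' b')"
 using fiffD[OF fiff_related[OF eq_refl]] by blast

end

section \<open>Names\<close>

context forcing
begin

section \<open>Natural deduction for forced formulas\<close>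

lemma dense_elim: "densely p \<Psi> ==> (\<And>r. r \<lhd> p ==> \<Psi> r ==> r ||- \<phi>) ==> p ||- \<phi>"
 by (rule forces_dense) (rule densely_mono)

text \<open>The goal must be a forced formula: the witness exists only at an extension, and a forced
  formula can be brought back from there.\<close>

lemma forces_ExisE:
 "p ||- (Exis \<Phi>) ==> (\<And>r \<sigma>. r \<lhd> p ==> r ||- \<Phi> \<sigma> ==> r ||- \<phi>) ==> p ||- \<phi>"
 unfolding forces_Exis by (erule dense_elim) blast

lemma forces_BExisE:
 "p ||- (BExis A \<Phi>) ==> (\<And>r \<sigma>. r \<lhd> p ==> r ||- (\<sigma> \<^bold>\<in> A) ==> r ||- \<Phi> \<sigma> ==> r ||- \<phi>) ==> p ||- \<phi>"
 unfolding forces_BExis by (erule dense_elim) blast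

lemma forces_DisjE:
 "p ||- (\<psi> \<^bold>\<or> \<chi>) ==> (\<And>r. r \<lhd> p ==> r ||- \<psi> ==> r ||- \<phi>) ==> (\<And>r. r \<lhd> p ==> r ||- \<chi> ==> r ||- \<phi>) ==> p ||- \<phi>"
 unfolding forces_Disj by (erule dense_elim) blast

lemma forces_DisjI: "p ||- \<phi> \<or> p ||- \<psi> ==> p ||- (\<phi> \<^bold>\<or> \<psi>)"
 unfolding forces_Disj by (rule densely_const) (use forces_mono in blast)+

lemma forces_ImpI: "(\<And>q. q \<lhd> p ==> q ||- \<phi> ==> q ||- \<psi>) ==> p ||- (\<phi> \<^bold>\<longrightarrow> \<psi>)"
 by (simp add: forces_Imp)

lemma forces_ImpD: "p ||- (\<phi> \<^bold>\<longrightarrow> \<psi>) ==> p ||- \<phi> ==> p ||- \<psi>"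
 by (meson forces_Imp denseE forces_mono le_refl1)

lemma forces_IffI:
 "(\<And>q. q \<lhd> p ==> q ||- \<phi> ==> q ||- \<psi>) ==> (\<And>q. q \<lhd> p ==> q ||- \<psi> ==> q ||- \<phi>) ==> p ||- (\<phi> \<^bold>\<longleftrightarrow> \<psi>)"
 by (auto simp add: forces_Iff)

lemma forces_IffD: "p ||- (\<phi> \<^bold>\<longleftrightarrow> \<psi>) ==> p ||- \<phi> \<longleftrightarrow> p ||- \<psi>"
 unfolding Iff_def using forces_ImpD by auto

lemma forces_UnivD: "p ||- (Univ \<Phi>) ==> p ||- \<Phi> \<sigma>"
 by simp

lemma forces_BUnivI:
 "(\<And>q \<sigma>. q \<lhd> p ==> q ||- (\<sigma> \<^bold>\<in> A) ==> q ||- \<Phi> \<sigma>) ==> p ||- (BUniv A \<Phi>)"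
 by (simp add: forces_BUniv)

lemma forces_BUnivD: "p ||- (BUniv A \<Phi>) ==> p ||- (\<sigma> \<^bold>\<in> A) ==> p ||- \<Phi> \<sigma>"
 unfolding BUniv_def by (drule forces_UnivD, erule forces_ImpD)

lemma forces_UnivI: "(\<And>\<sigma>. p ||- \<Phi> \<sigma>) ==> p ||- (Univ \<Phi>)"
 by simp

lemma forces_ConjI: "p ||- \<phi> ==> p ||- \<psi> ==> p ||- (\<phi> \<^bold>\<and> \<psi>)"
 by simp

lemma forces_NegI: "(\<And>q. q \<lhd> p ==> q ||- \<phi> ==> False) ==> p ||- (\<^bold>\<not> \<phi>)"
 by auto

text \<open>A \<open>p\<close> outside the field has no extensions and forces every negation, so a
  contradiction refutes membership in the field instead of giving \<open>False\<close>.\<close>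

lemma forces_NegD: "p ||- (\<^bold>\<not> \<phi>) ==> p ||- \<phi> ==> p \<notin> Field R"
 using le_refl by auto

section \<open>Congruence of the defined formulas under forced equality\<close>

lemma fiff_is_function_on:
 "p ||- (a \<^bold>= a') ==> p ||- (b \<^bold>= b') ==>
  fiff p (is_function_on a b) (is_function_on a' b')"
 unfolding is_function_on_def by (intro fiff_intros fiff_pair fiff_related; assumption?)

lemma fiff_is_surjection:
 "p ||- (a \<^bold>= a') ==> p ||- (b \<^bold>= b') ==> p ||- (c \<^bold>= c') ==>
  fiff p (is_surjection a b c) (is_surjection a' b' c')"
 unfolding is_surjection_def by (intro fiff_intros fiff_related fiff_is_function_on; assumption?)

lemma fiff_is_bijection:
 "p ||- (a \<^bold>= a') ==> p ||- (b \<^bold>= b') ==> p ||- (c \<^bold>= c') ==>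
  fiff p (is_bijection a b c) (is_bijection a' b' c')"
 unfolding is_bijection_def by (intro fiff_intros fiff_related fiff_is_surjection; assumption?)

lemma fiff_equipotent:
 "p ||- (a \<^bold>= a') ==> p ||- (b \<^bold>= b') ==>
  fiff p (equipotent a b) (equipotent a' b')"
 unfolding equipotent_def by (intro fiff_intros fiff_is_bijection; assumption?)

lemma fiff_is_transitive:
 "p ||- (a \<^bold>= a') ==>
  fiff p (is_transitive a) (is_transitive a')"
 unfolding is_transitive_def by (intro fiff_intros; assumption?)

lemma fiff_is_ordinal:
 "p ||- (a \<^bold>= a') ==>
  fiff p (is_ordinal a) (is_ordinal a')"
 unfolding is_ordinal_def by (intro fiff_intros fiff_is_transitive; assumption?)

lemma fiff_is_cardinal:
 "p ||- (a \<^bold>= a') ==>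
  fiff p (is_cardinal a) (is_cardinal a')"
 unfolding is_cardinal_def by (intro fiff_intros fiff_equipotent fiff_is_ordinal; assumption?)

lemma fiff_has_cardinality:
 "p ||- (a \<^bold>= a') ==> p ||- (b \<^bold>= b') ==>
  fiff p (has_cardinality a b) (has_cardinality a' b')"
 unfolding has_cardinality_def by (intro fiff_intros fiff_equipotent fiff_is_cardinal; assumption?)

lemma fiff_is_empty:
 "p ||- (a \<^bold>= a') ==>
  fiff p (is_empty a) (is_empty a')"
 unfolding is_empty_def by (intro fiff_intros; assumption?)

lemma fiff_is_succ:
 "p ||- (a \<^bold>= a') ==> p ||- (b \<^bold>= b') ==>
  fiff p (is_succ a b) (is_succ a' b')"
 unfolding is_succ_def by (intro fiff_intros; assumption?)

lemma fiff_is_limit: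
 "p ||- (a \<^bold>= a') ==>
  fiff p (is_limit a) (is_limit a')"
 unfolding is_limit_def by (intro fiff_intros fiff_is_ordinal fiff_is_empty fiff_is_succ; assumption?)

lemma fiff_is_meet:
 "p ||- (a \<^bold>= a') ==> p ||- (b \<^bold>= b') ==> p ||- (c \<^bold>= c') ==> p ||- (d \<^bold>= d') ==> p ||- (e \<^bold>= e') ==>
  fiff p (is_meet a b c d e) (is_meet a' b' c' d' e')"
 unfolding is_meet_def by (intro fiff_intros fiff_related; assumption?)

lemma fiff_is_join:
 "p ||- (a \<^bold>= a') ==> p ||- (b \<^bold>= b') ==> p ||- (c \<^bold>= c') ==> p ||- (d \<^bold>= d') ==> p ||- (e \<^bold>= e') ==>
  fiff p (is_join a b c d e) (is_join a' b' c' d' e')"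
 unfolding is_join_def by (intro fiff_intros fiff_related; assumption?)

lemma fiff_is_bot:
 "p ||- (a \<^bold>= a') ==> p ||- (b \<^bold>= b') ==> p ||- (c \<^bold>= c') ==>
  fiff p (is_bot a b c) (is_bot a' b' c')"
 unfolding is_bot_def by (intro fiff_intros fiff_related; assumption?)

lemma fiff_is_top:
 "p ||- (a \<^bold>= a') ==> p ||- (b \<^bold>= b') ==> p ||- (c \<^bold>= c') ==>
  fiff p (is_top a b c) (is_top a' b' c')"
 unfolding is_top_def by (intro fiff_intros fiff_related; assumption?)

lemma fiff_is_compl:
 "p ||- (a \<^bold>= a') ==> p ||- (b \<^bold>= b') ==> p ||- (c \<^bold>= c') ==> p ||- (d \<^bold>= d') ==>
  fiff p (is_compl a b c d) (is_compl a' b' c' d')"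
 unfolding is_compl_def by (intro fiff_intros fiff_is_meet fiff_is_join fiff_is_bot fiff_is_top; assumption?)

lemma fiff_is_poset:
 "p ||- (a \<^bold>= a') ==> p ||- (b \<^bold>= b') ==>
  fiff p (is_poset a b) (is_poset a' b')"
 unfolding is_poset_def by (intro fiff_intros fiff_related; assumption?)

lemma fiff_is_boolean_algebra:
 "p ||- (a \<^bold>= a') ==> p ||- (b \<^bold>= b') ==>
  fiff p (is_boolean_algebra a b) (is_boolean_algebra a' b')"
 unfolding is_boolean_algebra_def by (intro fiff_intros fiff_is_meet fiff_is_join fiff_is_bot fiff_is_top fiff_is_compl fiff_is_poset; assumption?)

lemma fiff_is_epimorphism:
 "p ||- (a \<^bold>= a') ==> p ||- (b \<^bold>= b') ==> p ||- (c \<^bold>= c') ==> p ||- (d \<^bold>= d') ==> p ||- (e \<^bold>= e') ==>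
  fiff p (is_epimorphism a b c d e) (is_epimorphism a' b' c' d' e')"
 unfolding is_epimorphism_def by (intro fiff_intros fiff_related fiff_is_surjection fiff_is_meet fiff_is_join fiff_is_compl fiff_is_boolean_algebra; assumption?)

lemma fiff_is_atom:
 "p ||- (a \<^bold>= a') ==> p ||- (b \<^bold>= b') ==> p ||- (c \<^bold>= c') ==>
  fiff p (is_atom a b c) (is_atom a' b' c')"
 unfolding is_atom_def by (intro fiff_intros fiff_related fiff_is_bot; assumption?)

lemma fiff_is_ideal:
 "p ||- (a \<^bold>= a') ==> p ||- (b \<^bold>= b') ==> p ||- (c \<^bold>= c') ==>
  fiff p (is_ideal a b c) (is_ideal a' b' c')"
 unfolding is_ideal_def by (intro fiff_intros fiff_related fiff_is_join fiff_is_bot; assumption?)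

lemma fiff_in_atom_ideal:
 "p ||- (a \<^bold>= a') ==> p ||- (b \<^bold>= b') ==> p ||- (c \<^bold>= c') ==>
  fiff p (in_atom_ideal a b c) (in_atom_ideal a' b' c')"
 unfolding in_atom_ideal_def by (intro fiff_intros fiff_is_atom fiff_is_ideal; assumption?)

lemma fiff_is_quotient:
 "p ||- (a \<^bold>= a') ==> p ||- (b \<^bold>= b') ==> p ||- (c \<^bold>= c') ==> p ||- (d \<^bold>= d') ==> p ||- (e \<^bold>= e') ==> p ||- (f \<^bold>= f') ==>
  fiff p (is_quotient a b c d e f) (is_quotient a' b' c' d' e' f')"
 unfolding is_quotient_def by (intro fiff_intros fiff_related fiff_is_bot fiff_is_epimorphism fiff_is_ideal; assumption?)

lemma fiff_is_CB_derivative: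
 "p ||- (a \<^bold>= a') ==> p ||- (b \<^bold>= b') ==> p ||- (c \<^bold>= c') ==> p ||- (d \<^bold>= d') ==>
  fiff p (is_CB_derivative a b c d) (is_CB_derivative a' b' c' d')"
 unfolding is_CB_derivative_def by (intro fiff_intros fiff_related fiff_in_atom_ideal fiff_is_quotient; assumption?)

lemma fiff_is_CB_sequence:
 "p ||- (a \<^bold>= a') ==> p ||- (b \<^bold>= b') ==> p ||- (c \<^bold>= c') ==> p ||- (d \<^bold>= d') ==>
  fiff p (is_CB_sequence a b c d) (is_CB_sequence a' b' c' d')"
 unfolding is_CB_sequence_def by (intro fiff_intros fiff_related fiff_is_function_on fiff_is_ordinal fiff_is_empty fiff_is_succ fiff_is_limit fiff_is_bot fiff_is_CB_derivative; assumption?)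

lemma fiff_is_CB_ideal:
 "p ||- (a \<^bold>= a') ==> p ||- (b \<^bold>= b') ==> p ||- (c \<^bold>= c') ==> p ||- (d \<^bold>= d') ==>
  fiff p (is_CB_ideal a b c d) (is_CB_ideal a' b' c' d')"
 unfolding is_CB_ideal_def by (intro fiff_intros fiff_related fiff_is_CB_sequence; assumption?)

lemma fiff_has_width:
 "p ||- (a \<^bold>= a') ==> p ||- (b \<^bold>= b') ==> p ||- (c \<^bold>= c') ==> p ||- (d \<^bold>= d') ==>
  fiff p (has_width a b c d) (has_width a' b' c' d')"
 unfolding has_width_def by (intro fiff_intros fiff_has_cardinality fiff_is_atom fiff_is_quotient fiff_is_CB_ideal; assumption?)

section \<open>Names built from sets of pairs\<close>

definition mk :: "('p name \<times> 'p) set => 'p name" where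
 "mk S = (SOME \<sigma>. name_pairs \<sigma> = S)"

text \<open>\<open>Name\<close> enumerates its constituents along the type of conditions and
  attaches an arbitrary set of conditions to each, so only the number of first components is
  bounded.\<close>

lemma name_pairs_mk:
 assumes "|fst ` S| \<le>o |UNIV :: 'p set|"
 shows "name_pairs (mk S) = S"
proof -
 have "\<exists>\<sigma>. name_pairs \<sigma> = S"
 proof (cases "S = {}")
  case True
  then show ?thesis by (intro exI[of _ EmptyName]) simp
 next
  case False
  then obtain g :: "'p => 'p name" where "g ` UNIV = fst ` S"
   using assms card_of_ordLeq2[of "fst ` S" UNIV] by auto
  then have "(\<sigma>, s) \<in> S ==> \<exists>i. \<sigma> = g i" for \<sigma> s
   by (metis fst_conv image_eqI image_iff)
  then have "name_pairs (Name g (\<lambda>i. {t. (g i, t) \<in> S})) = S"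
   by (auto, metis)
  then show ?thesis ..
 qed
 then show ?thesis unfolding mk_def by (rule someI_ex)
qed

lemma name_pairs_small: "|fst ` name_pairs (\<sigma> :: 'p name)| \<le>o |UNIV :: 'p set|"
proof (cases \<sigma>)
 case EmptyName
 then show ?thesis by (simp add: card_of_empty)
next
 case (Name f A)
 then have "fst ` name_pairs \<sigma> \<subseteq> range f" by auto
 then have "|fst ` name_pairs \<sigma>| \<le>o |range f|" by (rule card_of_mono1)
 then show ?thesis using card_of_image by (rule ordLeq_transitive)
qed

text \<open>The index set \<open>J\<close> lies in the ground model, where its size can be bounded;
  \<open>\<Phi> q j\<close> expresses that \<open>q\<close> puts the element with index
  \<open>j\<close> into the set.\<close>

definition vset :: "'j set => ('j => 'p name) => ('p => 'j => bool) => 'p name" where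
 "vset J a \<Phi> = mk {(a j, q) | j q. j \<in> J \<and> q \<in> Field R \<and> \<Phi> q j}"

definition persistent :: "('p => 'j => bool) => bool" where
 "persistent \<Phi> \<longleftrightarrow> (\<forall>q r j. r \<lhd> q --> \<Phi> q j --> \<Phi> r j)"

lemma persistentD: "persistent \<Phi> ==> r \<lhd> q ==> \<Phi> q j ==> \<Phi> r j"
 by (simp add: persistent_def)

lemma persistent_True: "persistent (\<lambda>_ _. True)"
 by (simp add: persistent_def)

lemma mem_vset:
 assumes "|J| \<le>o |UNIV :: 'p set|" and mono: "persistent \<Phi>"
 shows "p ||- (\<sigma> \<^bold>\<in> vset J a \<Phi>) \<longleftrightarrow> densely p (\<lambda>r. \<exists>j\<in>J. \<Phi> r j \<and> r ||- (\<sigma> \<^bold>= a j))"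
proof -
 let ?S = "{(a j, q) | j q. j \<in> J \<and> q \<in> Field R \<and> \<Phi> q j}"
 have "fst ` ?S \<subseteq> a ` J" by auto
 then have "|fst ` ?S| \<le>o |UNIV :: 'p set|"
  using ordLeq_transitive[OF card_of_mono1 ordLeq_transitive[OF card_of_image assms(1)]] by blast
 then have *: "name_pairs (vset J a \<Phi>) = ?S"
  unfolding vset_def by (rule name_pairs_mk)
 have "(\<exists>(\<tau>, t)\<in>?S. r \<lhd> t \<and> forces_eq R \<sigma> \<tau> r) \<longleftrightarrow> (\<exists>j\<in>J. \<Phi> r j \<and> r ||- (\<sigma> \<^bold>= a j))"
  if "r \<lhd> r" for r
  using that by (fastforce dest: persistentD[OF mono] intro: le_Field)
 then show ?thesis
  unfolding forces.simps forces_mem_def * densely_def by (meson le_refl1(1))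
qed

lemma vsetE:
 assumes "p ||- (\<sigma> \<^bold>\<in> vset J a \<Phi>)" "|J| \<le>o |UNIV :: 'p set|" "persistent \<Phi>"
  and "\<And>r j. r \<lhd> p ==> j \<in> J ==> \<Phi> r j ==> r ||- (\<sigma> \<^bold>= a j) ==> r ||- \<phi>"
 shows "p ||- \<phi>"
 using assms(1)[unfolded mem_vset[OF assms(2,3)]] by (rule dense_elim) (use assms(4) in blast)

lemma vsetI:
 assumes "|J| \<le>o |UNIV :: 'p set|" "persistent \<Phi>"
  and "j \<in> J" "\<Phi> p j"
 shows "p ||- (a j \<^bold>\<in> vset J a \<Phi>)"
 unfolding mem_vset[OF assms(1,2)]
 by (rule densely_const) (use assms eq_refl persistentD[OF assms(2)] forces_mono in blast)+

definition sep :: "'p name => ('p => 'p name => bool) => 'p name" where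
 "sep C \<Phi> = mk {(\<sigma>, s). \<exists>t. (\<sigma>, t) \<in> name_pairs C \<and> s \<lhd> t \<and> \<Phi> s \<sigma>}"

text \<open>Separation by a HOL predicate instead of a formula. The three hypotheses are the
  properties that \<open>\<Phi>\<close> would have if it were the forcing of a first-order
  formula.\<close>

lemma mem_sep:
 assumes mono: "\<And>q r \<sigma>. r \<lhd> q ==> \<Phi> q \<sigma> ==> \<Phi> r \<sigma>"
  and cong: "\<And>q \<sigma> \<tau>. q ||- (\<sigma> \<^bold>= \<tau>) ==> \<Phi> q \<sigma> ==> \<Phi> q \<tau>"
  and dense: "\<And>q \<sigma>. densely q (\<lambda>r. \<Phi> r \<sigma>) ==> \<Phi> q \<sigma>"
 shows "p ||- (\<sigma> \<^bold>\<in> sep C \<Phi>) \<longleftrightarrow> p ||- (\<sigma> \<^bold>\<in> C) \<and> \<Phi> p \<sigma>"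
proof -
 let ?S = "{(\<sigma>, s). \<exists>t. (\<sigma>, t) \<in> name_pairs C \<and> s \<lhd> t \<and> \<Phi> s \<sigma>}"
 have "fst ` ?S \<subseteq> fst ` name_pairs C" by force
 then have "|fst ` ?S| \<le>o |UNIV :: 'p set|"
  using ordLeq_transitive[OF card_of_mono1 name_pairs_small] by blast
 then have *: "name_pairs (sep C \<Phi>) = ?S"
  unfolding sep_def by (rule name_pairs_mk)
 have mem: "p ||- (\<sigma> \<^bold>\<in> sep C \<Phi>) \<longleftrightarrow>
  densely p (\<lambda>r. \<exists>\<tau> t. (\<tau>, t) \<in> name_pairs C \<and> r \<lhd> t \<and> \<Phi> r \<tau> \<and> r ||- (\<sigma> \<^bold>= \<tau>))" for p
 proof -
  have "(\<exists>(\<tau>, t)\<in>?S. r \<lhd> t \<and> forces_eq R \<sigma> \<tau> r) \<longleftrightarrow>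
   (\<exists>\<tau> t. (\<tau>, t) \<in> name_pairs C \<and> r \<lhd> t \<and> \<Phi> r \<tau> \<and> r ||- (\<sigma> \<^bold>= \<tau>))" if "r \<lhd> r" for r
   using that by simp (meson mono le_trans)
  then show ?thesis
   unfolding forces.simps forces_mem_def * densely_def by (meson le_refl1(1))
 qed
 have memC: "p ||- (\<sigma> \<^bold>\<in> C) \<longleftrightarrow>
  densely p (\<lambda>r. \<exists>\<tau> t. (\<tau>, t) \<in> name_pairs C \<and> r \<lhd> t \<and> r ||- (\<sigma> \<^bold>= \<tau>))" for p
  unfolding forces.simps forces_mem_def densely_def by fastforce
 show ?thesis
  unfolding mem memC
 proof (intro iffI conjI)
  assume L: "densely p (\<lambda>r. \<exists>\<tau> t. (\<tau>, t) \<in> name_pairs C \<and> r \<lhd> t \<and> \<Phi> r \<tau> \<and> r ||- (\<sigma> \<^bold>= \<tau>))"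
  then show "densely p (\<lambda>r. \<exists>\<tau> t. (\<tau>, t) \<in> name_pairs C \<and> r \<lhd> t \<and> r ||- (\<sigma> \<^bold>= \<tau>))"
   by (rule densely_mono) blast
  have "densely p (\<lambda>r. \<Phi> r \<sigma>)"
   using L by (rule densely_mono) (use cong eq_sym in blast)
  then show "\<Phi> p \<sigma>" by (rule dense)
 next
  assume R: "densely p (\<lambda>r. \<exists>\<tau> t. (\<tau>, t) \<in> name_pairs C \<and> r \<lhd> t \<and> r ||- (\<sigma> \<^bold>= \<tau>)) \<and> \<Phi> p \<sigma>"
  then show "densely p (\<lambda>r. \<exists>\<tau> t. (\<tau>, t) \<in> name_pairs C \<and> r \<lhd> t \<and> \<Phi> r \<tau> \<and> r ||- (\<sigma> \<^bold>= \<tau>))"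
   by (elim conjE, elim densely_mono) (use mono cong in blast)
 qed
qed

lemma finite_small: "finite A ==> |A| \<le>o |UNIV :: 'p set|"
 using inf_p by (intro ordLess_imp_ordLeq finite_ordLess_infinite) (simp_all add: card_of_well_order_on Field_card_of)

definition upair :: "'p name => 'p name => 'p name" where
 "upair a b = vset {a, b} id (\<lambda>_ _. True)"

lemma mem_upair: "p ||- (\<sigma> \<^bold>\<in> upair a b) \<longleftrightarrow> p ||- (\<sigma> \<^bold>= a \<^bold>\<or> \<sigma> \<^bold>= b)"
 unfolding upair_def by (subst mem_vset) (simp_all add: finite_small forces_Disj persistent_True)

definition op :: "'p name => 'p name => 'p name" where
 "op a b = upair (upair a a) (upair a b)"

lemma forces_Disj_same: "p ||- (\<phi> \<^bold>\<or> \<phi>) \<longleftrightarrow> p ||- \<phi>"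
 by (metis forces_DisjE forces_DisjI forces_mono)

lemma is_upair_iff: "p ||- (is_upair a b z) \<longleftrightarrow> p ||- (z \<^bold>= upair a b)"
 unfolding is_upair_def eq_iff_mem mem_upair by (auto simp: forces_Iff)

lemma upair_mem: "p ||- (a \<^bold>\<in> upair a b)" "p ||- (b \<^bold>\<in> upair a b)"
 unfolding mem_upair by (rule forces_DisjI, blast intro: eq_refl)+

lemma upair_cong: "p ||- (a \<^bold>= a') ==> p ||- (b \<^bold>= b') ==> p ||- (upair a b \<^bold>= upair a' b')"
 using fiffD[OF fiff_upair[OF _ _ eq_refl]] is_upair_iff eq_refl by blast

lemma op_cong: "p ||- (a \<^bold>= a') ==> p ||- (b \<^bold>= b') ==> p ||- (op a b \<^bold>= op a' b')"
 unfolding op_def by (intro upair_cong)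

lemma is_pair_iff: "p ||- (is_pair a b z) \<longleftrightarrow> p ||- (z \<^bold>= op a b)"
proof
 assume "p ||- (is_pair a b z)"
 then show "p ||- (z \<^bold>= op a b)"
  unfolding is_pair_def
  by (elim forces_ExisE)
   (simp only: forces_Conj is_upair_iff op_def, meson upair_cong eq_trans)
next
 assume "p ||- (z \<^bold>= op a b)"
 then show "p ||- (is_pair a b z)"
  unfolding is_pair_def
  by (intro forces_ExisI[where \<sigma> = "upair a a"] forces_ExisI[where \<sigma> = "upair a b"])
   (simp only: forces_Conj is_upair_iff op_def eq_refl simp_thms)
qed

lemma related_iff: "p ||- (related r a b) \<longleftrightarrow> p ||- (op a b \<^bold>\<in> r)"
proof
 assume "p ||- (related r a b)"
 then show "p ||- (op a b \<^bold>\<in> r)"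
  unfolding related_def by (elim forces_BExisE) (simp only: is_pair_iff, meson mem_cong eq_refl)
next
 assume "p ||- (op a b \<^bold>\<in> r)"
 then show "p ||- (related r a b)"
  unfolding related_def by (rule forces_BExisI) (simp only: is_pair_iff eq_refl)
qed

lemma op_inject1: assumes "p ||- (op a b \<^bold>= op c d)" shows "p ||- (a \<^bold>= c)"
proof -
 have "p ||- (upair a a \<^bold>\<in> op c d)"
  by (rule mem_cong[OF eq_refl assms]) (simp only: op_def upair_mem)
 then show ?thesis
  unfolding op_def mem_upair
 proof (elim forces_DisjE)
  fix r assume "r ||- (upair a a \<^bold>= upair c c)"
  then have "r ||- (c \<^bold>\<in> upair a a)" using mem_cong[OF eq_refl eq_sym] upair_mem by blast
  then show "r ||- (a \<^bold>= c)" unfolding mem_upair forces_Disj_same by (rule eq_sym)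
 next
  fix r assume "r ||- (upair a a \<^bold>= upair c d)"
  then have "r ||- (c \<^bold>\<in> upair a a)" using mem_cong[OF eq_refl eq_sym] upair_mem by blast
  then show "r ||- (a \<^bold>= c)" unfolding mem_upair forces_Disj_same by (rule eq_sym)
 qed
qed

lemma upair_inject2:
 assumes "p ||- (upair a b \<^bold>= upair a d)" shows "p ||- (b \<^bold>= d)"
proof -
 have b: "p ||- (b \<^bold>\<in> upair a d)" and d: "p ||- (d \<^bold>\<in> upair a b)"
  using mem_cong[OF eq_refl assms] mem_cong[OF eq_refl eq_sym[OF assms]] upair_mem by blast+
 show ?thesis
  using b unfolding mem_upair
 proof (elim forces_DisjE)
  fix r assume r: "r \<lhd> p" "r ||- (b \<^bold>= a)"
  show "r ||- (b \<^bold>= d)"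
   using forces_mono[OF r(1) d] unfolding mem_upair
  proof (elim forces_DisjE)
   show "s ||- (b \<^bold>= d)" if "s \<lhd> r" "s ||- (d \<^bold>= a)" for s
    using that r forces_mono eq_trans eq_sym by meson
   show "s ||- (b \<^bold>= d)" if "s \<lhd> r" "s ||- (d \<^bold>= b)" for s
    using that eq_sym by meson
  qed
 qed
qed

lemma op_inject2: assumes "p ||- (op a b \<^bold>= op c d)" shows "p ||- (b \<^bold>= d)"
proof -
 have ac: "p ||- (a \<^bold>= c)" by (rule op_inject1[OF assms])
 have "p ||- (op a b \<^bold>= op a d)"
  using assms op_cong[OF eq_sym[OF ac] eq_refl] eq_trans by blast
 \<comment> \<open>Both pairs now begin with the same element on the outer and on the inner level,
   so the same lemma strips the two layers of the Kuratowski pair in turn.\<close>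
 then have "p ||- (upair a b \<^bold>= upair a d)" unfolding op_def by (rule upair_inject2)
 then show ?thesis by (rule upair_inject2)
qed

lemma op_eq_iff: "p ||- (op a b \<^bold>= op c d) \<longleftrightarrow> p ||- (a \<^bold>= c) \<and> p ||- (b \<^bold>= d)"
 using op_inject1 op_inject2 op_cong by blast

section \<open>Names for functions\<close>

definition graph :: "'j set => ('j => 'p name) => ('j => 'p name) => ('p => 'j => bool) => 'p name" where
 "graph J a b \<Phi> = vset J (\<lambda>j. op (a j) (b j)) \<Phi>"

lemma related_graph:
 assumes "|J| \<le>o |UNIV :: 'p set|" "persistent \<Phi>"
 shows "p ||- (related (graph J a b \<Phi>) x y) \<longleftrightarrow>
  densely p (\<lambda>r. \<exists>j\<in>J. \<Phi> r j \<and> r ||- (x \<^bold>= a j) \<and> r ||- (y \<^bold>= b j))"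
 unfolding related_iff graph_def mem_vset[OF assms] op_eq_iff ..

lemma related_graphE:
 assumes "p ||- (related (graph J a b \<Phi>) x y)"
  "|J| \<le>o |UNIV :: 'p set|" "persistent \<Phi>"
  "\<And>r j. r \<lhd> p ==> j \<in> J ==> \<Phi> r j ==> r ||- (x \<^bold>= a j) ==> r ||- (y \<^bold>= b j) ==> r ||- \<phi>"
 shows "p ||- \<phi>"
 using assms(1)[unfolded related_graph[OF assms(2,3)]] by (rule dense_elim) (use assms(4) in blast)

lemma related_graphI:
 assumes "|J| \<le>o |UNIV :: 'p set|" "persistent \<Phi>"
  and "j \<in> J" "\<Phi> p j"
 shows "p ||- (related (graph J a b \<Phi>) (a j) (b j))"
 unfolding related_iff graph_def using assms by (rule vsetI)

abbreviation fgraph :: "'j set => ('j => 'p name) => ('j => 'p name) => 'p name" where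
 "fgraph J a b \<equiv> graph J a b (\<lambda>_ _. True)"

text \<open>Different indices may name the same argument at some condition, so \<open>fn\<close>
  demands equal values wherever the arguments are forced to be equal.\<close>

lemma fgraph_function:
 assumes J: "|J| \<le>o |UNIV :: 'p set|"
  and fn: "\<And>i j q. q \<lhd> p ==> i \<in> J ==> j \<in> J ==> q ||- (a i \<^bold>= a j) ==> q ||- (b i \<^bold>= b j)"
  and dom: "\<And>j. j \<in> J ==> p ||- (a j \<^bold>\<in> D)"
  and D: "\<And>q x. q \<lhd> p ==> q ||- (x \<^bold>\<in> D) ==> densely q (\<lambda>r. \<exists>j\<in>J. r ||- (x \<^bold>= a j))"
 shows "p ||- (is_function_on (fgraph J a b) D)"
 unfolding is_function_on_def
proof (intro forces_ConjI forces_BUnivI)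
 fix q z assume q: "q \<lhd> p" and z: "q ||- (z \<^bold>\<in> fgraph J a b)"
 show "q ||- (BExis D (\<lambda>x. Exis (\<lambda>y. is_pair x y z)))"
  using z[unfolded graph_def] J
 proof (rule vsetE, goal_cases)
  case (2 r j)
  then have "r ||- (a j \<^bold>\<in> D)" using dom q forces_mono le_trans by meson
  moreover have "r ||- (is_pair (a j) (b j) z)" using 2 by (simp only: is_pair_iff)
  ultimately show ?case by (meson forces_BExisI forces_ExisI)
 qed (simp add: persistent_True)
next
 fix q x assume q: "q \<lhd> p" and x: "q ||- (x \<^bold>\<in> D)"
 show "q ||- (Exis (\<lambda>y. related (fgraph J a b) x y \<^bold>\<and> Univ (\<lambda>c. related (fgraph J a b) x c \<^bold>\<longrightarrow> c \<^bold>= y)))"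
  using D[OF q x]
 proof (rule dense_elim)
  fix r assume r: "r \<lhd> q" "\<exists>j\<in>J. r ||- (x \<^bold>= a j)"
  then obtain j where j: "j \<in> J" "r ||- (x \<^bold>= a j)" by blast
  have "r ||- (related (fgraph J a b) (a j) (b j))"
   using J j(1) by (intro related_graphI persistent_True) simp_all
  then have 1: "r ||- (related (fgraph J a b) x (b j))"
   using related_cong eq_sym[OF j(2)] eq_refl by blast
  have 2: "s ||- (c \<^bold>= b j)" if s: "s \<lhd> r" "s ||- (related (fgraph J a b) x c)" for s c
   using s(2) J
  proof (rule related_graphE, goal_cases)
   case (2 t i)
   have "t \<lhd> p" "t \<lhd> r" using 2 s r q by (meson le_trans)+
   then have "t ||- (a i \<^bold>= a j)"
    using forces_mono[OF _ j(2)] 2(4) eq_trans eq_sym by meson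
   then have "t ||- (b i \<^bold>= b j)" using fn \<open>t \<lhd> p\<close> 2 j by blast
   then show ?case using 2(5) eq_trans by meson
  qed (simp add: persistent_True)
  show "r ||- (Exis (\<lambda>y. related (fgraph J a b) x y \<^bold>\<and> Univ (\<lambda>c. related (fgraph J a b) x c \<^bold>\<longrightarrow> c \<^bold>= y)))"
   by (rule forces_ExisI, rule forces_ConjI[OF 1], rule forces_UnivI, rule forces_ImpI, rule 2)
 qed
qed

lemma fgraph_surjection:
 assumes "p ||- (is_function_on (fgraph J a b) D)" and J: "|J| \<le>o |UNIV :: 'p set|"
  and dom: "\<And>j. j \<in> J ==> p ||- (a j \<^bold>\<in> D)"
  and ran: "\<And>j. j \<in> J ==> p ||- (b j \<^bold>\<in> E)"
  and E: "\<And>q x. q \<lhd> p ==> q ||- (x \<^bold>\<in> E) ==> densely q (\<lambda>r. \<exists>j\<in>J. r ||- (x \<^bold>= b j))"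
 shows "p ||- (is_surjection (fgraph J a b) D E)"
 unfolding is_surjection_def
proof (intro forces_ConjI forces_BUnivI forces_UnivI forces_ImpI assms(1))
 fix q x r y assume q: "q \<lhd> p" "r \<lhd> q" and rel: "r ||- (related (fgraph J a b) x y)"
 show "r ||- (y \<^bold>\<in> E)"
  using rel J
 proof (rule related_graphE, goal_cases)
  case (2 t j)
  then have "t ||- (b j \<^bold>\<in> E)" using ran q forces_mono le_trans by meson
  then show ?case using mem_cong eq_sym[OF 2(5)] eq_refl by blast
 qed (simp add: persistent_True)
next
 fix q y assume q: "q \<lhd> p" and y: "q ||- (y \<^bold>\<in> E)"
 show "q ||- (BExis D (\<lambda>x. related (fgraph J a b) x y))"
  using E[OF q y]
 proof (rule dense_elim)
  fix r assume r: "r \<lhd> q" "\<exists>j\<in>J. r ||- (y \<^bold>= b j)"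
  then obtain j where j: "j \<in> J" "r ||- (y \<^bold>= b j)" by blast
  have "r ||- (related (fgraph J a b) (a j) (b j))"
   using J j(1) by (intro related_graphI persistent_True) simp_all
  then have "r ||- (related (fgraph J a b) (a j) y)"
   using related_cong eq_sym[OF j(2)] eq_refl by blast
  moreover have "r ||- (a j \<^bold>\<in> D)" using dom j q r forces_mono le_trans by meson
  ultimately show "r ||- (BExis D (\<lambda>x. related (fgraph J a b) x y))" by (rule forces_BExisI[rotated])
 qed
qed

lemma fgraph_bijection:
 assumes "p ||- (is_surjection (fgraph J a b) D E)" and J: "|J| \<le>o |UNIV :: 'p set|"
  and inj: "\<And>i j q. q \<lhd> p ==> i \<in> J ==> j \<in> J ==> q ||- (b i \<^bold>= b j) ==> q ||- (a i \<^bold>= a j)"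
 shows "p ||- (is_bijection (fgraph J a b) D E)"
 unfolding is_bijection_def
proof (intro forces_ConjI forces_BUnivI forces_ImpI assms(1))
 fix q1 q2 q3 q x x' y
 assume le: "q1 \<lhd> p" "q2 \<lhd> q1" "q3 \<lhd> q2" "q \<lhd> q3"
  and rel: "q ||- (related (fgraph J a b) x y \<^bold>\<and> related (fgraph J a b) x' y)"
 have q: "q \<lhd> p" using le by (meson le_trans)
 have 1: "q ||- (related (fgraph J a b) x y)" and 2: "q ||- (related (fgraph J a b) x' y)" using rel by auto
 show "q ||- (x \<^bold>= x')"
  using 1 J
 proof (rule related_graphE, goal_cases)
  case (2 r i)
  show ?case
   using forces_mono[OF 2(1) \<open>q ||- (related (fgraph J a b) x' y)\<close>] J
  proof (rule related_graphE, goal_cases)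
   case (2 s j)
   have *: "s ||- (x \<^bold>= a i)" "s ||- (y \<^bold>= b i)" "s \<lhd> p"
    using forces_mono[OF 2(1)] \<open>r ||- (x \<^bold>= a i)\<close> \<open>r ||- (y \<^bold>= b i)\<close> 2(1) \<open>r \<lhd> q\<close> q by (blast, blast, meson le_trans)
   then have "s ||- (b i \<^bold>= b j)" using 2(5) eq_sym eq_trans by meson
   then have "s ||- (a i \<^bold>= a j)" using inj *(3) 2(2) \<open>i \<in> J\<close> by blast
   then show ?case using * 2(4) eq_sym eq_trans by meson
  qed (simp add: persistent_True)
 qed (simp add: persistent_True)
qed

end

section \<open>Ordinals in the extension\<close>

text \<open>The order type \<open>\<eta> + \<omega>\<close>; the points \<open>Hi n\<close> are \<open>\<eta> + n\<close>.\<close>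

datatype 'a lev = Lo 'a | Hi nat

fun lev_less :: "'a rel => 'a lev => 'a lev => bool" where
 "lev_less r (Lo x) (Lo y) \<longleftrightarrow> (x, y) \<in> r \<and> x \<noteq> y"
| "lev_less r (Lo x) (Hi n) \<longleftrightarrow> x \<in> Field r"
| "lev_less r (Hi m) (Hi n) \<longleftrightarrow> m < n"
| "lev_less r (Hi m) (Lo x) \<longleftrightarrow> False"

definition levs :: "'a rel => 'a lev set" where
 "levs r = Lo ` Field r \<union> range Hi"

lemma lev_less_levs: "lev_less r \<alpha> \<beta> ==> \<alpha> \<in> levs r" "lev_less r \<alpha> \<beta> ==> \<beta> \<in> levs r"
 by (cases \<alpha>; cases \<beta>; auto simp: levs_def intro: FieldI1 FieldI2)+

lemma lev_less_trans:
 assumes "Well_order r" "lev_less r \<alpha> \<beta>" "lev_less r \<beta> \<gamma>" shows "lev_less r \<alpha> \<gamma>"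
proof -
 have "trans r" "antisym r"
  using assms(1) by (auto simp: order_on_defs)
 then show ?thesis
  using assms(2,3)
  by (cases \<alpha>; cases \<beta>; cases \<gamma>) (auto dest: transD antisymD intro: FieldI1 FieldI2)
qed

lemma lev_less_irrefl: "\<not> lev_less r \<alpha> \<alpha>"
 by (cases \<alpha>) auto

lemma lev_less_total:
 assumes "Well_order r" "\<alpha> \<in> levs r" "\<beta> \<in> levs r" "\<alpha> \<noteq> \<beta>"
 shows "lev_less r \<alpha> \<beta> \<or> lev_less r \<beta> \<alpha>"
proof -
 have "total_on (Field r) r" using assms(1) by (auto simp: order_on_defs)
 then show ?thesis
  using assms(2-4) by (cases \<alpha>; cases \<beta>) (auto simp: levs_def total_on_def)
qed

lemma wf_lev_less:
 assumes "Well_order r" shows "wf {(\<alpha>, \<beta>). lev_less r \<alpha> \<beta>}"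
proof -
 have wf: "wf (r - Id)" using assms by (simp add: well_order_on_def)
 have Lo: "\<alpha> = Lo x ==> \<alpha> \<in> Q ==> \<exists>z\<in>Q. \<forall>y. lev_less r y z --> y \<notin> Q" for \<alpha> x Q
 proof -
  assume "\<alpha> = Lo x" "\<alpha> \<in> Q"
  then have "x \<in> {x. Lo x \<in> Q}" by simp
  then obtain z where z: "z \<in> {x. Lo x \<in> Q}" "\<And>y. (y, z) \<in> r - Id ==> y \<notin> {x. Lo x \<in> Q}"
   using wfE_min[OF wf] by metis
  then show ?thesis
   by (intro bexI[of _ "Lo z"] allI impI) (auto elim!: lev_less.elims)
 qed
 show ?thesis
  unfolding wf_eq_minimal
 proof (intro allI impI)
  fix Q :: "'a lev set" and \<alpha> assume \<alpha>: "\<alpha> \<in> Q"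
  show "\<exists>z\<in>Q. \<forall>y. (y, z) \<in> {(\<alpha>, \<beta>). lev_less r \<alpha> \<beta>} --> y \<notin> Q"
  proof (cases "\<exists>x. Lo x \<in> Q")
   case True
   then show ?thesis using Lo by simp blast
  next
   case False
   then obtain n where n: "Hi n \<in> Q" using \<alpha> by (cases \<alpha>) auto
   define m where "m = (LEAST m. Hi m \<in> Q)"
   have m: "Hi m \<in> Q" "\<And>k. k < m ==> Hi k \<notin> Q"
    unfolding m_def using n LeastI not_less_Least by (metis, metis)
   show ?thesis
    by (rule bexI[OF _ m(1)]) (use False m(2) in \<open>auto elim!: lev_less.elims\<close>)
  qed
 qed
qed

lemma lev_min:
 assumes "Well_order r" "P \<alpha>"
 obtains \<beta> where "P \<beta>" "\<And>\<gamma>. lev_less r \<gamma> \<beta> ==> \<not> P \<gamma>"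
proof -
 obtain z where "z \<in> Collect P" "\<And>y. (y, z) \<in> {(\<alpha>, \<beta>). lev_less r \<alpha> \<beta>} ==> y \<notin> Collect P"
  using wfE_min[OF wf_lev_less[OF assms(1)], of \<alpha> "Collect P"] assms(2) by (metis mem_Collect_eq)
 then show ?thesis using that[of z] by auto
qed

context forcing
begin

definition suc :: "'p name => 'p name" where
 "suc \<sigma> = mk (name_pairs \<sigma> \<union> {\<sigma>} \<times> Field R)"

lemma mem_suc: "p ||- (\<tau> \<^bold>\<in> suc \<sigma>) \<longleftrightarrow> densely p (\<lambda>r. r ||- (\<tau> \<^bold>\<in> \<sigma>) \<or> r ||- (\<tau> \<^bold>= \<sigma>))"
proof -
 have "fst ` (name_pairs \<sigma> \<union> {\<sigma>} \<times> Field R) \<subseteq> fst ` name_pairs \<sigma> \<union> {\<sigma>}" by auto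
 moreover have "|fst ` name_pairs \<sigma> \<union> {\<sigma>}| \<le>o |UNIV :: 'p set|"
  using inf_p name_pairs_small finite_small[of "{\<sigma>}"]
  by (intro card_of_Un_ordLeq_infinite_Field) (simp_all add: Field_card_of card_of_card_order_on)
 ultimately have "|fst ` (name_pairs \<sigma> \<union> {\<sigma>} \<times> Field R)| \<le>o |UNIV :: 'p set|"
  using ordLeq_transitive[OF card_of_mono1] by blast
 then have *: "name_pairs (suc \<sigma>) = name_pairs \<sigma> \<union> {\<sigma>} \<times> Field R"
  unfolding suc_def by (rule name_pairs_mk)
 have mem: "p ||- (\<tau> \<^bold>\<in> suc \<sigma>) \<longleftrightarrow>
  densely p (\<lambda>r. (\<exists>(\<rho>, t) \<in> name_pairs \<sigma>. r \<lhd> t \<and> forces_eq R \<tau> \<rho> r) \<or> r ||- (\<tau> \<^bold>= \<sigma>))" for p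
 proof -
  have "(\<exists>(\<rho>, t) \<in> name_pairs (suc \<sigma>). r \<lhd> t \<and> forces_eq R \<tau> \<rho> r) \<longleftrightarrow>
   (\<exists>(\<rho>, t) \<in> name_pairs \<sigma>. r \<lhd> t \<and> forces_eq R \<tau> \<rho> r) \<or> r ||- (\<tau> \<^bold>= \<sigma>)" if "r \<lhd> r" for r
   using that le_Field unfolding * by auto
  then show ?thesis
   unfolding forces.simps forces_mem_def densely_def by (meson le_refl1(1))
 qed
 show ?thesis
 proof
  assume "p ||- (\<tau> \<^bold>\<in> suc \<sigma>)"
  then show "densely p (\<lambda>r. r ||- (\<tau> \<^bold>\<in> \<sigma>) \<or> r ||- (\<tau> \<^bold>= \<sigma>))"
   unfolding mem
  proof (rule densely_mono)
   fix r assume "(\<exists>(\<rho>, t) \<in> name_pairs \<sigma>. r \<lhd> t \<and> forces_eq R \<tau> \<rho> r) \<or> r ||- (\<tau> \<^bold>= \<sigma>)"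
   then show "r ||- (\<tau> \<^bold>\<in> \<sigma>) \<or> r ||- (\<tau> \<^bold>= \<sigma>)"
   proof
    assume "\<exists>(\<rho>, t) \<in> name_pairs \<sigma>. r \<lhd> t \<and> forces_eq R \<tau> \<rho> r"
    then obtain \<rho> t where \<rho>: "(\<rho>, t) \<in> name_pairs \<sigma>" "r \<lhd> t" "forces_eq R \<tau> \<rho> r" by auto
    have "forces_mem R \<tau> \<sigma> r"
     unfolding forces_mem_def
    proof (intro allI impI)
     fix q assume q: "q \<lhd> r"
     then have "q \<lhd> q" "q \<lhd> t" "forces_eq R \<tau> \<rho> q"
      using \<rho> le_trans le_refl1 forces_mono[of q r "\<tau> \<^bold>= \<rho>"] by (auto intro: le_trans)
     then show "\<exists>r. r \<lhd> q \<and> (\<exists>(\<tau>', t)\<in>name_pairs \<sigma>. r \<lhd> t \<and> forces_eq R \<tau> \<tau>' r)"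
      using \<rho>(1) by (intro exI[of _ q] conjI bexI[OF _ \<rho>(1)]) simp_all
    qed
    then show ?thesis by simp
   qed simp
  qed
 next
  assume "densely p (\<lambda>r. r ||- (\<tau> \<^bold>\<in> \<sigma>) \<or> r ||- (\<tau> \<^bold>= \<sigma>))"
  then show "p ||- (\<tau> \<^bold>\<in> suc \<sigma>)"
  proof (rule dense_elim)
   fix r assume "r ||- (\<tau> \<^bold>\<in> \<sigma>) \<or> r ||- (\<tau> \<^bold>= \<sigma>)"
   then show "r ||- (\<tau> \<^bold>\<in> suc \<sigma>)"
   proof
    assume "r ||- (\<tau> \<^bold>\<in> \<sigma>)"
    then show ?thesis
     unfolding mem unfolding forces.simps forces_mem_def densely_def by meson
   next
    assume "r ||- (\<tau> \<^bold>= \<sigma>)"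
    then show ?thesis
     unfolding mem using forces_mono le_refl1 unfolding densely_def by meson
   qed
  qed
 qed
qed

end

text \<open>Only the membership rules of the canonical names are assumed, because two codings have
  to be covered: \<open>ordinal_name\<close> for well-orders on the conditions, needed for the
  preservation of cardinals, and \<open>check_ordinal\<close> for well-orders on the elements of
  conditions.\<close>

locale level_names = forcing R for R :: "'p rel" +
 fixes \<eta> :: "'a rel" and sn :: "'a => 'p name" and on :: "'p name"
 assumes wo: "Well_order \<eta>"
  and mem_sn: "\<And>p \<sigma> x. p ||- (\<sigma> \<^bold>\<in> sn x) \<longleftrightarrow> densely p (\<lambda>r. \<exists>y\<in>underS \<eta> x. r ||- (\<sigma> \<^bold>= sn y))"
  and mem_on: "\<And>p \<sigma>. p ||- (\<sigma> \<^bold>\<in> on) \<longleftrightarrow> densely p (\<lambda>r. \<exists>y\<in>Field \<eta>. r ||- (\<sigma> \<^bold>= sn y))"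
begin

abbreviation lless (infix "\<sqsubset>" 50) where "\<alpha> \<sqsubset> \<beta> \<equiv> lev_less \<eta> \<alpha> \<beta>"

definition ln :: "'a lev => 'p name" where
 "ln \<alpha> = (case \<alpha> of Lo x => sn x | Hi n => (suc ^^ n) on)"

lemma ln_simps: "ln (Lo x) = sn x" "ln (Hi 0) = on" "ln (Hi (Suc n)) = suc (ln (Hi n))"
 by (simp_all add: ln_def)

lemma mem_ln_Hi: "p ||- (\<sigma> \<^bold>\<in> ln (Hi n)) \<longleftrightarrow> densely p (\<lambda>r. \<exists>\<beta>. \<beta> \<sqsubset> Hi n \<and> r ||- (\<sigma> \<^bold>= ln \<beta>))"
proof (induction n arbitrary: p)
 case 0
 have "(\<exists>\<beta>. \<beta> \<sqsubset> Hi 0 \<and> r ||- (\<sigma> \<^bold>= ln \<beta>)) \<longleftrightarrow> (\<exists>y\<in>Field \<eta>. r ||- (\<sigma> \<^bold>= sn y))" for r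
 proof
  assume "\<exists>\<beta>. \<beta> \<sqsubset> Hi 0 \<and> r ||- (\<sigma> \<^bold>= ln \<beta>)"
  then obtain \<beta> where \<beta>: "\<beta> \<sqsubset> Hi 0" "r ||- (\<sigma> \<^bold>= ln \<beta>)" by blast
  then show "\<exists>y\<in>Field \<eta>. r ||- (\<sigma> \<^bold>= sn y)" by (cases \<beta>) (auto simp: ln_simps)
 next
  assume "\<exists>y\<in>Field \<eta>. r ||- (\<sigma> \<^bold>= sn y)"
  then obtain y where "y \<in> Field \<eta>" "r ||- (\<sigma> \<^bold>= sn y)" ..
  then show "\<exists>\<beta>. \<beta> \<sqsubset> Hi 0 \<and> r ||- (\<sigma> \<^bold>= ln \<beta>)" by (intro exI[of _ "Lo y"]) (simp add: ln_simps)
 qed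
 then show ?case by (simp only: ln_simps mem_on)
next
 case (Suc n)
 have less: "\<beta> \<sqsubset> Hi (Suc n) \<longleftrightarrow> \<beta> \<sqsubset> Hi n \<or> \<beta> = Hi n" for \<beta>
  by (cases \<beta>) auto
 have "densely p (\<lambda>r. r ||- (\<sigma> \<^bold>\<in> ln (Hi n)) \<or> r ||- (\<sigma> \<^bold>= ln (Hi n))) \<longleftrightarrow>
  densely p (\<lambda>r. (\<exists>\<beta>. \<beta> \<sqsubset> Hi n \<and> r ||- (\<sigma> \<^bold>= ln \<beta>)) \<or> r ||- (\<sigma> \<^bold>= ln (Hi n)))"
  unfolding Suc densely_def by (meson le_trans le_refl1)
 then show ?case unfolding ln_simps mem_suc less by (simp only: conj_disj_distribR ex_disj_distrib) auto
qed

lemma mem_ln: "p ||- (\<sigma> \<^bold>\<in> ln \<alpha>) \<longleftrightarrow> densely p (\<lambda>r. \<exists>\<beta>. \<beta> \<sqsubset> \<alpha> \<and> r ||- (\<sigma> \<^bold>= ln \<beta>))"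
proof (cases \<alpha>)
 case (Lo x)
 have "(\<exists>\<beta>. \<beta> \<sqsubset> Lo x \<and> r ||- (\<sigma> \<^bold>= ln \<beta>)) \<longleftrightarrow> (\<exists>y\<in>underS \<eta> x. r ||- (\<sigma> \<^bold>= sn y))" for r
 proof
  assume "\<exists>\<beta>. \<beta> \<sqsubset> Lo x \<and> r ||- (\<sigma> \<^bold>= ln \<beta>)"
  then obtain \<beta> where \<beta>: "\<beta> \<sqsubset> Lo x" "r ||- (\<sigma> \<^bold>= ln \<beta>)" by blast
  then show "\<exists>y\<in>underS \<eta> x. r ||- (\<sigma> \<^bold>= sn y)" by (cases \<beta>) (auto simp: underS_def ln_simps)
 next
  assume "\<exists>y\<in>underS \<eta> x. r ||- (\<sigma> \<^bold>= sn y)"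
  then obtain y where "y \<in> underS \<eta> x" "r ||- (\<sigma> \<^bold>= sn y)" ..
  then show "\<exists>\<beta>. \<beta> \<sqsubset> Lo x \<and> r ||- (\<sigma> \<^bold>= ln \<beta>)" by (intro exI[of _ "Lo y"]) (simp add: underS_def ln_simps)
 qed
 then show ?thesis by (simp only: Lo ln_simps mem_sn)
next
 case (Hi n)
 then show ?thesis by (simp only: mem_ln_Hi)
qed

lemma ln_memE:
 assumes "p ||- (\<sigma> \<^bold>\<in> ln \<alpha>)"
  and "\<And>r \<beta>. r \<lhd> p ==> \<beta> \<sqsubset> \<alpha> ==> r ||- (\<sigma> \<^bold>= ln \<beta>) ==> r ||- \<phi>"
 shows "p ||- \<phi>"
 using assms(1)[unfolded mem_ln] by (rule dense_elim) (use assms(2) in blast)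

lemma ln_memI: "\<beta> \<sqsubset> \<alpha> ==> p ||- (ln \<beta> \<^bold>\<in> ln \<alpha>)"
 unfolding mem_ln by (rule densely_const) (use forces_mono eq_refl in blast)+

text \<open>Foundation, by induction on the level: a forced self-membership makes the name equal, at
  some extension, to that of a smaller level, which inherits the self-membership.\<close>

lemma ln_mem_self: "p \<in> Field R ==> \<not> p ||- (ln \<alpha> \<^bold>\<in> ln \<alpha>)"
proof (induction \<alpha> arbitrary: p rule: wf_induct[OF wf_lev_less[OF wo]])
 case (1 \<alpha>)
 show ?case
 proof
  assume L: "p ||- (ln \<alpha> \<^bold>\<in> ln \<alpha>)"
  then obtain r \<beta> where r: "r \<lhd> p" "\<beta> \<sqsubset> \<alpha>" "r ||- (ln \<alpha> \<^bold>= ln \<beta>)"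
   unfolding mem_ln using denselyD[OF _ le_refl] 1(2) by blast
  then have "r ||- (ln \<beta> \<^bold>\<in> ln \<beta>)"
   using mem_cong[OF eq_refl r(3) ln_memI] by blast
  then show False using 1(1) r le_Field by blast
 qed
qed

lemma ln_eq_iff:
 assumes "p \<in> Field R" "\<alpha> \<in> levs \<eta>" "\<beta> \<in> levs \<eta>"
 shows "p ||- (ln \<alpha> \<^bold>= ln \<beta>) \<longleftrightarrow> \<alpha> = \<beta>"
proof
 assume L: "p ||- (ln \<alpha> \<^bold>= ln \<beta>)"
 show "\<alpha> = \<beta>"
 proof (rule ccontr)
  assume "\<alpha> \<noteq> \<beta>"
  then consider "\<alpha> \<sqsubset> \<beta>" | "\<beta> \<sqsubset> \<alpha>" using lev_less_total[OF wo assms(2,3)] by blast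
  then show False
  proof cases
   case 1
   then show False using mem_cong[OF L eq_refl ln_memI] ln_mem_self assms(1) by blast
  next
   case 2
   then show False using mem_cong[OF eq_sym[OF L] eq_refl ln_memI] ln_mem_self assms(1) by blast
  qed
 qed
qed (simp only: eq_refl)

lemma ln_mem_iff:
 assumes "p \<in> Field R" "\<alpha> \<in> levs \<eta>"
 shows "p ||- (ln \<alpha> \<^bold>\<in> ln \<beta>) \<longleftrightarrow> \<alpha> \<sqsubset> \<beta>"
proof
 assume "p ||- (ln \<alpha> \<^bold>\<in> ln \<beta>)"
 then obtain r \<gamma> where r: "r \<lhd> p" "\<gamma> \<sqsubset> \<beta>" "r ||- (ln \<alpha> \<^bold>= ln \<gamma>)"
  unfolding mem_ln using denselyD[OF _ le_refl] assms(1) by blast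
 then show "\<alpha> \<sqsubset> \<beta>" using ln_eq_iff le_Field lev_less_levs assms(2) by blast
qed (rule ln_memI)

lemma ordinal_ln: "p ||- (is_ordinal (ln \<alpha>))"
proof -
 have tr: "p ||- (is_transitive (ln \<alpha>))" for p \<alpha>
  unfolding is_transitive_def
 proof (intro forces_BUnivI)
  fix q y r z assume q: "q \<lhd> p" "q ||- (y \<^bold>\<in> ln \<alpha>)" and r: "r \<lhd> q" "r ||- (z \<^bold>\<in> y)"
  show "r ||- (z \<^bold>\<in> ln \<alpha>)"
   using forces_mono[OF r(1) q(2)]
  proof (rule ln_memE)
   fix s \<beta> assume s: "s \<lhd> r" "\<beta> \<sqsubset> \<alpha>" "s ||- (y \<^bold>= ln \<beta>)"
   have "s ||- (z \<^bold>\<in> ln \<beta>)" using mem_cong[OF eq_refl s(3)] forces_mono[OF s(1) r(2)] by blast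
   then show "s ||- (z \<^bold>\<in> ln \<alpha>)"
   proof (rule ln_memE)
    fix t \<gamma> assume "t \<lhd> s" "\<gamma> \<sqsubset> \<beta>" "t ||- (z \<^bold>= ln \<gamma>)"
    then show "t ||- (z \<^bold>\<in> ln \<alpha>)"
     using mem_cong[OF eq_sym eq_refl ln_memI] lev_less_trans[OF wo _ s(2)] by blast
   qed
  qed
 qed
 show ?thesis
  unfolding is_ordinal_def
 proof (intro forces_ConjI forces_BUnivI tr)
  fix q y assume "q ||- (y \<^bold>\<in> ln \<alpha>)"
  then show "q ||- (is_transitive y)"
   by (rule ln_memE) (use tr fiffD[OF fiff_is_transitive] in blast)
 qed
qed

text \<open>With \<open>is_succ_ln\<close> and \<open>is_limit_ln\<close> it decides in the ground
  model which levels are successors or limits in the extension.\<close>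

definition covers :: "'a lev => 'a lev => bool" where
 "covers \<beta> \<alpha> \<longleftrightarrow> \<beta> \<sqsubset> \<alpha> \<and> (\<forall>\<gamma>. \<gamma> \<sqsubset> \<alpha> --> \<gamma> \<sqsubset> \<beta> \<or> \<gamma> = \<beta>)"

lemma covers_Hi: "covers (Hi n) (Hi (Suc n))"
proof -
 have "\<gamma> \<sqsubset> Hi (Suc n) ==> \<gamma> \<sqsubset> Hi n \<or> \<gamma> = Hi n" for \<gamma> by (cases \<gamma>) auto
 then show ?thesis unfolding covers_def by simp
qed

lemma is_succ_ln:
 assumes "p \<in> Field R" "\<alpha> \<in> levs \<eta>" "\<beta> \<in> levs \<eta>"
 shows "p ||- (is_succ (ln \<beta>) (ln \<alpha>)) \<longleftrightarrow> covers \<beta> \<alpha>"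
proof
 assume "p ||- (is_succ (ln \<beta>) (ln \<alpha>))"
 then have *: "p ||- (y \<^bold>\<in> ln \<alpha>) \<longleftrightarrow> p ||- (y \<^bold>\<in> ln \<beta> \<^bold>\<or> y \<^bold>= ln \<beta>)" for y
  unfolding is_succ_def using forces_IffD forces_UnivD by blast
 have "p ||- (ln \<beta> \<^bold>\<in> ln \<alpha>)"
  unfolding * by (rule forces_DisjI) (use eq_refl in blast)
 moreover have "\<gamma> \<sqsubset> \<beta> \<or> \<gamma> = \<beta>" if "\<gamma> \<sqsubset> \<alpha>" for \<gamma>
 proof -
  have "p ||- (ln \<gamma> \<^bold>\<in> ln \<beta> \<^bold>\<or> ln \<gamma> \<^bold>= ln \<beta>)" using that * ln_memI by blast
  then obtain r where "r \<lhd> p" "r ||- (ln \<gamma> \<^bold>\<in> ln \<beta>) \<or> r ||- (ln \<gamma> \<^bold>= ln \<beta>)"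
   unfolding forces_Disj using denselyD[OF _ le_refl] assms(1) by blast
  then show ?thesis
   using ln_mem_iff ln_eq_iff le_Field lev_less_levs that assms by metis
 qed
 ultimately show "covers \<beta> \<alpha>" using assms ln_mem_iff by (simp only: covers_def) blast
next
 assume c: "covers \<beta> \<alpha>"
 show "p ||- (is_succ (ln \<beta>) (ln \<alpha>))"
  unfolding is_succ_def
 proof (intro forces_UnivI forces_IffI)
  fix q y assume "q ||- (y \<^bold>\<in> ln \<alpha>)"
  then show "q ||- (y \<^bold>\<in> ln \<beta> \<^bold>\<or> y \<^bold>= ln \<beta>)"
  proof (rule ln_memE)
   fix r \<gamma> assume r: "\<gamma> \<sqsubset> \<alpha>" "r ||- (y \<^bold>= ln \<gamma>)"
   then have "r ||- (y \<^bold>\<in> ln \<beta>) \<or> r ||- (y \<^bold>= ln \<beta>)"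
    using c mem_cong[OF eq_sym[OF r(2)] eq_refl ln_memI] unfolding covers_def by blast
   then show "r ||- (y \<^bold>\<in> ln \<beta> \<^bold>\<or> y \<^bold>= ln \<beta>)" by (rule forces_DisjI)
  qed
 next
  fix q y assume "q ||- (y \<^bold>\<in> ln \<beta> \<^bold>\<or> y \<^bold>= ln \<beta>)"
  then show "q ||- (y \<^bold>\<in> ln \<alpha>)"
  proof (rule forces_DisjE)
   fix r assume "r ||- (y \<^bold>\<in> ln \<beta>)"
   then show "r ||- (y \<^bold>\<in> ln \<alpha>)"
   proof (rule ln_memE)
    fix s \<gamma> assume s: "\<gamma> \<sqsubset> \<beta>" "s ||- (y \<^bold>= ln \<gamma>)"
    then have "\<gamma> \<sqsubset> \<alpha>" using c lev_less_trans[OF wo] unfolding covers_def by blast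
    then show "s ||- (y \<^bold>\<in> ln \<alpha>)" using mem_cong[OF eq_sym[OF s(2)] eq_refl ln_memI] by blast
   qed
  next
   fix r assume "r ||- (y \<^bold>= ln \<beta>)"
   then show "r ||- (y \<^bold>\<in> ln \<alpha>)"
    using mem_cong[OF eq_sym eq_refl ln_memI] c unfolding covers_def by blast
  qed
 qed
qed

lemma is_empty_ln:
 assumes "p \<in> Field R" "p ||- (is_empty (ln \<alpha>))"
 shows "\<not> \<beta> \<sqsubset> \<alpha>"
 using assms ln_memI[of \<beta> \<alpha> p] forces_NegD forces_UnivD unfolding is_empty_def by blast

lemma is_limit_ln:
 assumes "p \<in> Field R" "p ||- (is_limit (ln \<alpha>))" "\<alpha> \<in> levs \<eta>"
 shows "\<exists>\<beta>. \<beta> \<sqsubset> \<alpha>" "\<not> covers \<beta> \<alpha>"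
proof -
 have 1: "p ||- (\<^bold>\<not> is_empty (ln \<alpha>))" and 2: "p ||- (\<^bold>\<not> (\<^bold>\<exists>y. is_succ y (ln \<alpha>)))"
  using assms(2) unfolding is_limit_def forces_Conj by blast+
 show "\<exists>\<beta>. \<beta> \<sqsubset> \<alpha>"
 proof (rule ccontr)
  assume no: "\<not> (\<exists>\<beta>. \<beta> \<sqsubset> \<alpha>)"
  have "p ||- (is_empty (ln \<alpha>))"
   unfolding is_empty_def
  proof (intro forces_UnivI forces_NegI)
   fix y q assume q: "q \<lhd> p" "q ||- (y \<^bold>\<in> ln \<alpha>)"
   then show False unfolding mem_ln using denselyD[OF _ le_refl1(1)] no by blast
  qed
  then show False using 1 assms(1) forces_NegD by blast
 qed
 show "\<not> covers \<beta> \<alpha>"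
 proof
  assume "covers \<beta> \<alpha>"
  then have "p ||- (is_succ (ln \<beta>) (ln \<alpha>))"
   using is_succ_ln assms lev_less_levs unfolding covers_def by blast
  then have "p ||- (\<^bold>\<exists>y. is_succ y (ln \<alpha>))" by (rule forces_ExisI)
  then show False using 2 assms(1) forces_NegD by blast
 qed
qed

end

section \<open>The two codings of canonical names\<close>

context forcing
begin

lemma mem_segment_name:
 assumes "Well_order r"
 shows "p ||- (\<sigma> \<^bold>\<in> segment_name R r x) \<longleftrightarrow> densely p (\<lambda>q. \<exists>y\<in>underS r x. q ||- (\<sigma> \<^bold>= segment_name R r y))"
proof -
 have "(\<exists>(\<tau>, t) \<in> name_pairs (segment_name R r x). q \<lhd> t \<and> forces_eq R \<sigma> \<tau> q) \<longleftrightarrow>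
  (\<exists>y\<in>underS r x. q ||- (\<sigma> \<^bold>= segment_name R r y))" if "q \<lhd> q" for q
  using that le_Field unfolding name_pairs_segment_name[OF assms] by auto
 then show ?thesis
  unfolding forces.simps forces_mem_def densely_def by (meson le_refl1(1))
qed

lemma mem_ordinal_name:
 "p ||- (\<sigma> \<^bold>\<in> ordinal_name R r) \<longleftrightarrow> densely p (\<lambda>q. \<exists>y\<in>Field r. q ||- (\<sigma> \<^bold>= segment_name R r y))"
proof -
 have *: "name_pairs (ordinal_name R r) = (segment_name R r ` Field r) \<times> Field R"
  by (auto simp: ordinal_name_def split: if_splits)
 have "(\<exists>(\<tau>, t) \<in> name_pairs (ordinal_name R r). q \<lhd> t \<and> forces_eq R \<sigma> \<tau> q) \<longleftrightarrow>
  (\<exists>y\<in>Field r. q ||- (\<sigma> \<^bold>= segment_name R r y))" if "q \<lhd> q" for q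
  using that le_Field unfolding * by auto
 then show ?thesis
  unfolding forces.simps forces_mem_def densely_def by (meson le_refl1(1))
qed

lemma level_names_segment: "Well_order r ==> level_names R r (segment_name R r) (ordinal_name R r)"
 using mem_segment_name mem_ordinal_name po inf_p by unfold_locales auto

end

lemma level_names_check:
 fixes R :: "'a set rel" and r :: "'a rel"
 assumes "Partial_order R" "infinite (UNIV :: 'a set set)" "Well_order r"
 shows "level_names R r (\<lambda>x. segment_name R (dir_image r (\<lambda>x. {x})) {x}) (check_ordinal R r)"
proof -
 interpret forcing R using assms by unfold_locales
 let ?d = "dir_image r (\<lambda>x. {x})"
 have inj: "inj (\<lambda>x :: 'a. {x})" by simp
 have "Well_order ?d"
  by (rule Well_order_dir_image[OF assms(3)]) (simp add: inj_on_def)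
 moreover have "underS ?d {x} = (\<lambda>x. {x}) ` underS r x" for x
  by (auto simp: underS_def dir_image_def)
 moreover have "Field ?d = (\<lambda>x. {x}) ` Field r"
  by (rule dir_image_Field)
 ultimately show ?thesis
  using mem_segment_name[where r = ?d] mem_ordinal_name[where r = ?d] assms
  unfolding check_ordinal_def by unfold_locales simp_all
qed

section \<open>Preservation of cardinals\<close>

context forcing
begin

lemma densely_ex: "densely p \<Phi> ==> p \<in> Field R ==> \<exists>r. r \<lhd> p \<and> \<Phi> r"
 using denselyD le_refl by blast

lemma forces_Exis_ex: "p ||- (Exis \<Phi>) ==> p \<in> Field R ==> \<exists>r \<sigma>. r \<lhd> p \<and> r ||- \<Phi> \<sigma>"
 unfolding forces_Exis by (drule densely_ex) blast+

lemma forces_BExis_ex: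
 "p ||- (BExis A \<Phi>) ==> p \<in> Field R ==> \<exists>r \<sigma>. r \<lhd> p \<and> r ||- (\<sigma> \<^bold>\<in> A) \<and> r ||- \<Phi> \<sigma>"
 unfolding forces_BExis by (drule densely_ex) blast+

lemma forces_Disj_ex: "p ||- (\<phi> \<^bold>\<or> \<psi>) ==> p \<in> Field R ==> \<exists>r. r \<lhd> p \<and> (r ||- \<phi> \<or> r ||- \<psi>)"
 unfolding forces_Disj by (rule densely_ex)

text \<open>A bijection that collapses \<open>r\<close> would have a name \<open>f\<close>, defined
  on a proper segment. If \<open>r\<close> is at most \<kappa>, distributivity decides all values of
  \<open>f\<close> below one condition, and the collapse would happen in the ground model. If
  \<open>r\<close> exceeds \<kappa>, the chain condition leaves at most \<kappa> possible values for
  each argument, too few to exhaust \<open>r\<close>.\<close>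

lemma cardinal_preservingI:
 fixes \<kappa> :: "'a rel"
 assumes inf: "Cinfinite \<kappa>"
  and distr: "\<And>(A :: 'p set) \<Phi> p. |A| <o \<kappa> ==> p \<in> Field R ==> persistent \<Phi> ==>
   (\<And>a q. a \<in> A ==> q \<lhd> p ==> \<exists>r. r \<lhd> q \<and> \<Phi> r a) ==> \<exists>q. q \<lhd> p \<and> (\<forall>a\<in>A. \<Phi> q a)"
  and cc: "\<And>A. A \<subseteq> Field R ==> (\<And>x y r. x \<in> A ==> y \<in> A ==> r \<lhd> x ==> r \<lhd> y ==> x = y) ==> |A| \<le>o \<kappa>"
 shows "cardinal_preserving R"
 unfolding cardinal_preserving_def forced_def
proof (intro allI impI ballI)
 fix r :: "'p rel" and p assume r: "Card_order r"
 then have wo: "Well_order r" by (simp add: card_order_on_def)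
 let ?sn = "segment_name R r" and ?on = "ordinal_name R r"
 interpret level_names R r ?sn ?on by (rule level_names_segment[OF wo])
 have no_bij: False
  if u: "u \<in> Field R" "u ||- (is_bijection f (?sn z) ?on)" and z: "z \<in> Field r" for u f z
 proof -
  have surj: "u ||- (is_surjection f (?sn z) ?on)" using u(2) by (simp only: is_bijection_def forces_Conj)
  then have fn: "u ||- (is_function_on f (?sn z))" by (simp only: is_surjection_def forces_Conj)
  have val: "v ||- (y \<^bold>\<in> ?on)"
   if "v \<lhd> u" "v ||- (x \<^bold>\<in> ?sn z)" "v ||- (related f x y)" for v x y
   using forces_mono[OF that(1) surj] that(2,3) unfolding is_surjection_def forces_Conj
   by (meson forces_BUnivD forces_UnivD forces_ImpD)
  \<comment> \<open>\<open>F1\<close>, \<open>F2\<close> and \<open>F3\<close> are totality,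
    uniqueness and surjectivity of \<open>f\<close>, brought from arbitrary names to the canonical
    names of elements.\<close>
  have F1: "\<exists>w y. w \<lhd> v \<and> y \<in> Field r \<and> w ||- (related f (?sn x) (?sn y))"
   if v: "v \<lhd> u" and x: "x \<in> underS r z" for v x
  proof -
   have "\<And>q. q ||- (ln (Lo x) \<^bold>\<in> ln (Lo z))" using x by (intro ln_memI) (simp add: underS_def)
   then have xm: "\<And>q. q ||- (?sn x \<^bold>\<in> ?sn z)" by (simp only: ln_simps)
   have ex: "v ||- (\<^bold>\<exists>b. related f (?sn x) b \<^bold>\<and> (\<^bold>\<forall>c. related f (?sn x) c \<^bold>\<longrightarrow> c \<^bold>= b))"
    using forces_mono[OF v fn] xm unfolding is_function_on_def forces_Conj by (meson forces_BUnivD)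
   obtain v1 b where v1: "v1 \<lhd> v" "v1 ||- (related f (?sn x) b)"
    using forces_Exis_ex[OF ex le_Field(1)[OF v]] unfolding forces_Conj by blast
   have b: "v1 ||- (b \<^bold>\<in> ?on)" using val[OF le_trans[OF v1(1) v] xm v1(2)] .
   obtain w y where w: "w \<lhd> v1" "y \<in> Field r" "w ||- (b \<^bold>= ?sn y)"
    using densely_ex[OF b[unfolded mem_ordinal_name] le_Field(1)[OF v1(1)]] by blast
   have "w ||- (related f (?sn x) (?sn y))"
    using related_cong[OF forces_mono[OF w(1) v1(2)] eq_refl w(3)] .
   then show ?thesis using w le_trans[OF w(1) v1(1)] by blast
  qed
  have F2: "y = y'"
   if v: "v \<lhd> u" and x: "x \<in> underS r z" and y: "y \<in> Field r" "y' \<in> Field r"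
    and rel: "v ||- (related f (?sn x) (?sn y))" "v ||- (related f (?sn x) (?sn y'))" for v x y y'
  proof -
   have "v ||- (ln (Lo x) \<^bold>\<in> ln (Lo z))" using x by (intro ln_memI) (simp add: underS_def)
   then have "v ||- (\<^bold>\<exists>b. related f (?sn x) b \<^bold>\<and> (\<^bold>\<forall>c. related f (?sn x) c \<^bold>\<longrightarrow> c \<^bold>= b))"
    using forces_mono[OF v fn] unfolding is_function_on_def forces_Conj ln_simps by (meson forces_BUnivD)
   then have "v ||- (?sn y \<^bold>= ?sn y')"
   proof (rule forces_ExisE)
    fix w b assume w: "w \<lhd> v" "w ||- (related f (?sn x) b \<^bold>\<and> (\<^bold>\<forall>c. related f (?sn x) c \<^bold>\<longrightarrow> c \<^bold>= b))"
    then have "w ||- (?sn y \<^bold>= b)" "w ||- (?sn y' \<^bold>= b)"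
     using forces_mono[OF w(1)] rel unfolding forces_Conj by (meson forces_UnivD forces_ImpD)+
    then show "w ||- (?sn y \<^bold>= ?sn y')" using eq_trans eq_sym by blast
   qed
   then have "v ||- (ln (Lo y) \<^bold>= ln (Lo y'))" by (simp only: ln_simps)
   then have "Lo y = Lo y'"
    using ln_eq_iff le_Field(1)[OF v] y unfolding levs_def by blast
   then show ?thesis by simp
  qed
  have F3: "\<exists>w x. w \<lhd> v \<and> x \<in> underS r z \<and> w ||- (related f (?sn x) (?sn y))"
   if v: "v \<lhd> u" and y: "y \<in> Field r" for v y
  proof -
   have "v ||- (ln (Lo y) \<^bold>\<in> ln (Hi 0))" using y by (intro ln_memI) simp
   then have ex: "v ||- (\<^bold>\<exists>a\<^bold>\<in>?sn z. related f a (?sn y))"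
    using forces_mono[OF v surj] unfolding is_surjection_def forces_Conj ln_simps by (meson forces_BUnivD)
   obtain v1 a where v1: "v1 \<lhd> v" "v1 ||- (a \<^bold>\<in> ?sn z)" "v1 ||- (related f a (?sn y))"
    using forces_BExis_ex[OF ex le_Field(1)[OF v]] by blast
   then obtain w x where w: "w \<lhd> v1" "x \<in> underS r z" "w ||- (a \<^bold>= ?sn x)"
    using densely_ex[OF v1(2)[unfolded mem_segment_name[OF wo]] le_Field(1)[OF v1(1)]] by blast
   have "w ||- (related f (?sn x) (?sn y))"
    using related_cong[OF forces_mono[OF w(1) v1(3)] w(3) eq_refl] .
   then show ?thesis using w le_trans[OF w(1) v1(1)] by blast
  qed
  let ?S = "underS r z"
  have S: "|?S| <o r" by (rule card_of_underS[OF r z])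
  have Fr: "|Field r| =o r" by (rule card_of_Field_ordIso[OF r])
  have W\<kappa>: "Well_order \<kappa>" using inf by (simp add: card_order_on_def)
  show False
  proof (cases "r \<le>o \<kappa>")
   case True
   have "\<exists>q. q \<lhd> u \<and> (\<forall>x\<in>?S. \<exists>y\<in>Field r. q ||- (related f (?sn x) (?sn y)))"
   proof (rule distr)
    show "|?S| <o \<kappa>" using S True by (rule ordLess_ordLeq_trans)
    show "persistent (\<lambda>q x. \<exists>y\<in>Field r. q ||- (related f (?sn x) (?sn y)))"
     unfolding persistent_def using forces_mono by blast
   qed (use u F1 in blast)+
   then obtain q g where q: "q \<lhd> u" and g: "\<And>x. x \<in> ?S ==> g x \<in> Field r \<and> q ||- (related f (?sn x) (?sn (g x)))"
    by metis
   have "Field r \<subseteq> g ` ?S"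
   proof
    fix y assume y: "y \<in> Field r"
    obtain w x where w: "w \<lhd> q" "x \<in> ?S" "w ||- (related f (?sn x) (?sn y))"
     using F3[OF q y] by blast
    have "y = g x"
     using F2[OF le_trans[OF w(1) q] w(2) y _ w(3)] g[OF w(2)] forces_mono[OF w(1)] by blast
    then show "y \<in> g ` ?S" using w(2) by blast
   qed
   then have "|Field r| \<le>o |?S|" using card_of_mono1 card_of_image ordLeq_transitive by metis
   then have "r \<le>o |?S|" using Fr ordIso_ordLeq_trans ordIso_symmetric by metis
   then show False using S not_ordLess_ordLeq by metis
  next
   case False
   then have \<kappa>r: "\<kappa> <o r" using not_ordLeq_iff_ordLess[OF W\<kappa> wo] by blast
   \<comment> \<open>The possible values of \<open>f\<close> at \<open>x\<close>. Conditions that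
     witness different values are incompatible by \<open>F2\<close>, so choosing a witness for each
     value gives an antichain of the size of \<open>V x\<close>.\<close>
   define V where "V x = {y \<in> Field r. \<exists>v. v \<lhd> u \<and> v ||- (related f (?sn x) (?sn y))}" for x
   have V: "|V x| \<le>o \<kappa>" if x: "x \<in> ?S" for x
   proof -
    have "\<forall>y\<in>V x. \<exists>v. v \<lhd> u \<and> v ||- (related f (?sn x) (?sn y))"
     unfolding V_def by blast
    from bchoice[OF this] obtain h
     where h: "\<And>y. y \<in> V x ==> h y \<lhd> u \<and> h y ||- (related f (?sn x) (?sn y))"
     by blast
    have eq: "y = y'" if "y \<in> V x" "y' \<in> V x" "s \<lhd> h y" "s \<lhd> h y'" for y y' s
    proof (rule F2[of s])
     show "s \<lhd> u" using le_trans[OF that(3)] h[OF that(1)] by blast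
     show "y \<in> Field r" "y' \<in> Field r" using that unfolding V_def by auto
    qed (use that h x forces_mono in blast)+
    have "|h ` V x| \<le>o \<kappa>"
    proof (rule cc)
     show "h ` V x \<subseteq> Field R" using h le_Field by blast
     show "a = b" if "a \<in> h ` V x" "b \<in> h ` V x" "s \<lhd> a" "s \<lhd> b" for a b s
      using that eq by blast
    qed
    moreover have "inj_on h (V x)"
     using eq h le_refl1(1) by (intro inj_onI) metis
    then have "|V x| \<le>o |h ` V x|" using card_of_ordLeq by blast
    ultimately show ?thesis using ordLeq_transitive by blast
   qed
   have "Field r \<subseteq> (\<Union>x\<in>?S. V x)"
   proof
    fix y assume y: "y \<in> Field r"
    then show "y \<in> (\<Union>x\<in>?S. V x)" unfolding V_def using F3[OF le_refl[OF u(1)] y] by auto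
   qed
   then have 1: "|Field r| \<le>o |\<Union>x\<in>?S. V x|" by (rule card_of_mono1)
   have "|\<Union>x\<in>?S. V x| <o r"
   \<comment> \<open>The product of \<kappa> and the size of the segment is the larger of the two,
     and both are below \<open>r\<close>.\<close>
   proof (cases "|?S| \<le>o \<kappa>")
    case True
    then have "|\<Union>x\<in>?S. V x| \<le>o \<kappa>" using V inf by (intro UNION_Cinfinite_bound) auto
    then show ?thesis using \<kappa>r by (rule ordLeq_ordLess_trans)
   next
    case False
    then have \<kappa>S: "\<kappa> \<le>o |?S|" using ordLeq_total[OF W\<kappa> card_of_Well_order] by blast
    have "Cinfinite |?S|"
     using cinfinite_mono[OF \<kappa>S] inf by (simp add: card_of_Card_order card_of_card_order_on Field_card_of)
    then have "|\<Union>x\<in>?S. V x| \<le>o |?S|"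
     using V \<kappa>S by (intro UNION_Cinfinite_bound) (auto intro: ordLeq_refl card_of_mono1 ordLeq_transitive)
    then show ?thesis using S by (rule ordLeq_ordLess_trans)
   qed
   then have "|Field r| <o r" using 1 ordLeq_ordLess_trans by blast
   then show False using Fr not_ordLess_ordIso by blast
  qed
 qed
 show "p ||- (is_cardinal ?on)"
  unfolding is_cardinal_def
 proof (intro forces_ConjI forces_BUnivI)
  show "p ||- (is_ordinal ?on)" using ordinal_ln[where p = p and \<alpha> = "Hi 0"] by (simp only: ln_simps)
  fix q y assume "q ||- (y \<^bold>\<in> ?on)"
  then show "q ||- (\<^bold>\<not> equipotent y ?on)"
   unfolding mem_ordinal_name
  proof (rule dense_elim)
   fix s assume "\<exists>z\<in>Field r. s ||- (y \<^bold>= ?sn z)"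
   then obtain z where z: "z \<in> Field r" "s ||- (y \<^bold>= ?sn z)" ..
   show "s ||- (\<^bold>\<not> equipotent y ?on)"
   proof (rule forces_NegI)
    fix t assume t: "t \<lhd> s" "t ||- (equipotent y ?on)"
    then have ex: "t ||- (equipotent (?sn z) ?on)"
     using fiffD[OF fiff_equipotent[OF forces_mono[OF t(1) z(2)] eq_refl]] by blast
    obtain u f where "u \<lhd> t" "u ||- (is_bijection f (?sn z) ?on)"
     using forces_Exis_ex[OF ex[unfolded equipotent_def] le_Field(1)[OF t(1)]] by blast
    then show False using no_bij z le_Field by blast
   qed
  qed
 qed
qed

end

section \<open>Algebras of the extension as quotients of a ground-model field of sets\<close>

text \<open>Every algebra considered later, an arbitrary homomorphic image included, is a quotient
  of the single field of sets \<open>Cod\<close> of the ground model. Only the ideal is generic, so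
  statements about the extension become statements about functions from conditions to sets of
  codes.\<close>

locale codes = forcing R for R :: "'p rel" +
 fixes Cod :: "'v set set"
 assumes Cod_UNIV: "UNIV \<in> Cod" and Cod_compl: "\<And>a. a \<in> Cod ==> - a \<in> Cod"
  and Cod_Int: "\<And>a b. a \<in> Cod ==> b \<in> Cod ==> a \<inter> b \<in> Cod"
begin

lemma Cod_empty: "{} \<in> Cod"
 using Cod_compl[OF Cod_UNIV] by simp

lemma Cod_Diff: "a \<in> Cod ==> b \<in> Cod ==> a - b \<in> Cod"
 using Cod_Int[OF _ Cod_compl, of a b] by (simp add: Diff_eq)

lemma Cod_Un: "a \<in> Cod ==> b \<in> Cod ==> a \<union> b \<in> Cod"
 using Cod_compl[OF Cod_Int[OF Cod_compl Cod_compl, of a b]] by simp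

lemma Cod_UN: "finite F ==> (\<And>x. x \<in> F ==> U x \<in> Cod) ==> \<Union> (U ` F) \<in> Cod"
 by (induction F rule: finite_induct) (auto intro: Cod_empty Cod_Un)

lemmas Cod_intros = Cod_UNIV Cod_compl Cod_Int Cod_empty Cod_Diff Cod_Un

text \<open>The ideals of \<open>Cod\<close> in the generic extension, by their values at the conditions below \<open>p0\<close>.\<close>

definition videal :: "'p => ('p => 'v set set) => bool" where
 "videal p0 I \<longleftrightarrow> (\<forall>q. q \<lhd> p0 --> I q \<subseteq> Cod \<and> {} \<in> I q \<and> (\<forall>a\<in>I q. \<forall>b\<in>I q. a \<union> b \<in> I q) \<and>
  (\<forall>a\<in>I q. \<forall>b\<in>Cod. b \<subseteq> a --> b \<in> I q) \<and> (\<forall>r. r \<lhd> q --> I q \<subseteq> I r) \<and>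
  (\<forall>a\<in>Cod. densely q (\<lambda>r. a \<in> I r) --> a \<in> I q))"

lemma
 assumes "videal p0 I" "q \<lhd> p0"
 shows videal_Cod: "a \<in> I q ==> a \<in> Cod"
  and videal_empty: "{} \<in> I q"
  and videal_Un: "a \<in> I q ==> b \<in> I q ==> a \<union> b \<in> I q"
  and videal_down: "a \<in> I q ==> b \<in> Cod ==> b \<subseteq> a ==> b \<in> I q"
  and videal_mono: "r \<lhd> q ==> a \<in> I q ==> a \<in> I r"
  and videal_dense: "a \<in> Cod ==> densely q (\<lambda>r. a \<in> I r) ==> a \<in> I q"
proof -
 note * = assms(1)[unfolded videal_def, THEN spec, THEN mp, OF assms(2)]
 show "a \<in> I q ==> a \<in> Cod" "{} \<in> I q"
  using *[THEN conjunct1] *[THEN conjunct2, THEN conjunct1] by auto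
 show "a \<in> I q ==> b \<in> I q ==> a \<union> b \<in> I q"
  using *[THEN conjunct2, THEN conjunct2, THEN conjunct1] by blast
 show "a \<in> I q ==> b \<in> Cod ==> b \<subseteq> a ==> b \<in> I q"
  using *[THEN conjunct2, THEN conjunct2, THEN conjunct2, THEN conjunct1] by blast
 show "r \<lhd> q ==> a \<in> I q ==> a \<in> I r"
  using *[THEN conjunct2, THEN conjunct2, THEN conjunct2, THEN conjunct2, THEN conjunct1] by blast
 show "a \<in> Cod ==> densely q (\<lambda>r. a \<in> I r) ==> a \<in> I q"
  using *[THEN conjunct2, THEN conjunct2, THEN conjunct2, THEN conjunct2, THEN conjunct2] by blast
qed

lemma videal_UN:
 assumes "videal p0 I" "q \<lhd> p0" "finite F" "\<And>x. x \<in> F ==> U x \<in> I q"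
 shows "\<Union> (U ` F) \<in> I q"
 using assms(3,4) by (induction F rule: finite_induct) (auto intro: videal_empty[OF assms(1,2)] videal_Un[OF assms(1,2)])

text \<open>\<open>q\<close> forces the class of \<open>a\<close> to be an atom of the quotient by
  \<open>I\<close>. Cutting \<open>a\<close> by every code replaces the quantification over the
  elements below it.\<close>

definition vatom :: "('p => 'v set set) => 'p => 'v set => bool" where
 "vatom I q a \<longleftrightarrow> a \<in> Cod \<and> (\<forall>r. r \<lhd> q --> a \<notin> I r) \<and>
  (\<forall>e\<in>Cod. \<forall>r. r \<lhd> q --> densely r (\<lambda>s. a \<inter> e \<in> I s \<or> a - e \<in> I s))"

lemma vatom_le: "vatom I q a ==> r \<lhd> q ==> vatom I r a"
 unfolding vatom_def by (meson le_trans)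

end

text \<open>\<open>pres q c y\<close> says that \<open>q\<close> forces \<open>y\<close> to be the element of \<open>(C, K)\<close> with code \<open>c\<close>;
 two codes denote the same element if their difference lies in the ideal \<open>I\<close>.\<close>

locale presentation = codes R Cod for R :: "'p rel" and Cod :: "'v set set" +
 fixes p0 :: 'p and C K :: "'p name" and I :: "'p => 'v set set" and pres :: "'p => 'v set => 'p name => bool"
 assumes vid: "videal p0 I"
  and pres_Cod: "\<And>q c y. pres q c y ==> c \<in> Cod"
  and pres_ex: "\<And>q c. q \<lhd> p0 ==> c \<in> Cod ==> \<exists>r y. r \<lhd> q \<and> pres r c y"
  and pres_mem: "\<And>q c y. q \<lhd> p0 ==> pres q c y ==> q ||- (y \<^bold>\<in> C)"
  and pres_mono: "\<And>q r c y. r \<lhd> q ==> pres q c y ==> pres r c y"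
  and pres_cong: "\<And>q c y y'. pres q c y ==> q ||- (y \<^bold>= y') ==> pres q c y'"
  and pres_surj: "\<And>q y. q \<lhd> p0 ==> q ||- (y \<^bold>\<in> C) ==> \<exists>r c. r \<lhd> q \<and> pres r c y"
  and rel_iff: "\<And>q c d y z. q \<lhd> p0 ==> pres q c y ==> pres q d z ==> q ||- (related K y z) \<longleftrightarrow> c - d \<in> I q"
  and eqI: "\<And>q c d y z. q \<lhd> p0 ==> pres q c y ==> pres q d z ==> c - d \<in> I q ==> d - c \<in> I q ==> q ||- (y \<^bold>= z)"
begin

lemmas I_Cod = videal_Cod[OF vid] and I_empty = videal_empty[OF vid] and I_Un = videal_Un[OF vid]
 and I_down = videal_down[OF vid] and I_mono = videal_mono[OF vid] and I_dense = videal_dense[OF vid]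

lemma I_down2: "q \<lhd> p0 ==> a \<in> I q ==> b \<in> I q ==> c \<in> Cod ==> c \<subseteq> a \<union> b ==> c \<in> I q"
 using I_down I_Un by blast

lemma presE:
 assumes "q \<lhd> p0" "c \<in> Cod" "\<And>r y. r \<lhd> q ==> pres r c y ==> r ||- \<phi>"
 shows "q ||- \<phi>"
proof (rule denseE)
 fix s assume s: "s \<lhd> q"
 then obtain r y where "r \<lhd> s" "pres r c y" using pres_ex assms le_trans by meson
 then show "\<exists>r. r \<lhd> s \<and> r ||- \<phi>" using assms(3) le_trans[OF _ s] by meson
qed

lemma elemE:
 assumes "q \<lhd> p0" "q ||- (y \<^bold>\<in> C)" "\<And>r c. r \<lhd> q ==> pres r c y ==> r ||- \<phi>"
 shows "q ||- \<phi>"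
proof (rule denseE)
 fix s assume s: "s \<lhd> q"
 then obtain r c where "r \<lhd> s" "pres r c y" using pres_surj assms forces_mono le_trans by meson
 then show "\<exists>r. r \<lhd> s \<and> r ||- \<phi>" using assms(3) le_trans[OF _ s] by meson
qed

lemma BUnivC:
 assumes "q \<lhd> p0" "\<And>r c y. r \<lhd> q ==> r \<lhd> p0 ==> pres r c y ==> r ||- \<Phi> y"
 shows "q ||- (BUniv C \<Phi>)"
proof (rule forces_BUnivI)
 fix r y assume r: "r \<lhd> q" "r ||- (y \<^bold>\<in> C)"
 show "r ||- \<Phi> y"
  by (rule elemE[OF le_trans[OF r(1) assms(1)] r(2)], rule assms(2)) (use r assms(1) le_trans in meson)+
qed

lemma rel_refl: "q \<lhd> p0 ==> pres q c y ==> q ||- (related K y y)"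
 using rel_iff[of q c y c y] I_empty by auto

lemma eq_iff:
 assumes "q \<lhd> p0" "pres q c y" "pres q d z"
 shows "q ||- (y \<^bold>= z) \<longleftrightarrow> c - d \<in> I q \<and> d - c \<in> I q"
proof
 assume yz: "q ||- (y \<^bold>= z)"
 then have "q ||- (related K y z)" "q ||- (related K z y)"
  using rel_refl assms related_cong eq_refl eq_sym by blast+
 then show "c - d \<in> I q \<and> d - c \<in> I q" using rel_iff assms by blast
qed (use eqI assms in blast)

text \<open>An element with a prescribed code is available only at an extension. The forward
  direction here and in \<open>top_iff\<close>, \<open>meet_iff\<close> and \<open>join_iff\<close>
  therefore compares with such an element at an extension and returns by
  \<open>I_dense\<close>.\<close>

lemma bot_iff:
 assumes "q \<lhd> p0" "pres q c y"
 shows "q ||- (is_bot C K y) \<longleftrightarrow> c \<in> I q"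
proof
 assume bot: "q ||- (is_bot C K y)"
 show "c \<in> I q"
 proof (rule I_dense[OF assms(1) pres_Cod[OF assms(2)]], rule denselyI)
  fix s assume s: "s \<lhd> q"
  then have "s \<lhd> p0" using assms(1) by (meson le_trans)
  then obtain r z where r: "r \<lhd> s" "pres r {} z" using pres_ex Cod_empty by blast
  have rp: "r \<lhd> p0" "r \<lhd> q" using r s \<open>s \<lhd> p0\<close> by (meson le_trans)+
  have "r ||- (related K y z)"
   using forces_mono[OF rp(2) bot] pres_mem[OF rp(1) r(2)] unfolding is_bot_def forces_Conj
   by (meson forces_BUnivD)
  then have "c \<in> I r" using rel_iff[OF rp(1) pres_mono[OF rp(2) assms(2)] r(2)] by simp
  then show "\<exists>r. r \<lhd> s \<and> c \<in> I r" using r by blast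
 qed
next
 assume c: "c \<in> I q"
 show "q ||- (is_bot C K y)"
  unfolding is_bot_def
 proof (intro forces_ConjI BUnivC assms)
  show "q ||- (y \<^bold>\<in> C)" using pres_mem assms by blast
  fix r d z assume r: "r \<lhd> q" "r \<lhd> p0" "pres r d z"
  have "c - d \<in> I r"
   by (rule I_down[OF r(2) I_mono[OF assms(1) r(1) c]]) (use pres_Cod assms r Cod_Diff in blast)+
  then show "r ||- (related K y z)" using rel_iff[OF r(2) pres_mono[OF r(1) assms(2)] r(3)] by blast
 qed
qed

lemma top_iff:
 assumes "q \<lhd> p0" "pres q c y"
 shows "q ||- (is_top C K y) \<longleftrightarrow> - c \<in> I q"
proof
 assume top: "q ||- (is_top C K y)"
 show "- c \<in> I q"
 proof (rule I_dense[OF assms(1) Cod_compl[OF pres_Cod[OF assms(2)]]], rule denselyI)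
  fix s assume s: "s \<lhd> q"
  then have "s \<lhd> p0" using assms(1) by (meson le_trans)
  then obtain r z where r: "r \<lhd> s" "pres r UNIV z" using pres_ex Cod_UNIV by blast
  have rp: "r \<lhd> p0" "r \<lhd> q" using r s \<open>s \<lhd> p0\<close> by (meson le_trans)+
  have "r ||- (related K z y)"
   using forces_mono[OF rp(2) top] pres_mem[OF rp(1) r(2)] unfolding is_top_def forces_Conj
   by (meson forces_BUnivD)
  then have "- c \<in> I r"
   using rel_iff[OF rp(1) r(2) pres_mono[OF rp(2) assms(2)]] by (simp add: Compl_eq_Diff_UNIV)
  then show "\<exists>r. r \<lhd> s \<and> - c \<in> I r" using r by blast
 qed
next
 assume c: "- c \<in> I q"
 show "q ||- (is_top C K y)"
  unfolding is_top_def
 proof (intro forces_ConjI BUnivC assms)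
  show "q ||- (y \<^bold>\<in> C)" using pres_mem assms by blast
  fix r d z assume r: "r \<lhd> q" "r \<lhd> p0" "pres r d z"
  have "d - c \<in> I r"
   by (rule I_down[OF r(2) I_mono[OF assms(1) r(1) c]]) (use pres_Cod assms r Cod_Diff in blast)+
  then show "r ||- (related K z y)" using rel_iff[OF r(2) r(3) pres_mono[OF r(1) assms(2)]] by blast
 qed
qed

lemma meet_iff:
 assumes "q \<lhd> p0" "pres q a x" "pres q b y" "pres q c z"
 shows "q ||- (is_meet C K x y z) \<longleftrightarrow> a \<inter> b - c \<in> I q \<and> c - a \<inter> b \<in> I q"
proof
 assume m: "q ||- (is_meet C K x y z)"
 have Cod: "a \<in> Cod" "b \<in> Cod" "c \<in> Cod" using pres_Cod assms by blast+
 have "c - a \<in> I q" "c - b \<in> I q"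
  using m rel_iff assms unfolding is_meet_def forces_Conj by blast+
 then have 1: "c - a \<inter> b \<in> I q" by (rule I_down2[OF assms(1)]) (use Cod in \<open>auto intro: Cod_intros\<close>)
 have "a \<inter> b - c \<in> I q"
 proof (rule I_dense[OF assms(1)], use Cod in \<open>blast intro: Cod_intros\<close>, rule denselyI)
  fix s assume s: "s \<lhd> q"
  then have "s \<lhd> p0" using assms(1) by (meson le_trans)
  then obtain r w where r: "r \<lhd> s" "pres r (a \<inter> b) w" using pres_ex Cod_Int Cod by blast
  have rp: "r \<lhd> p0" "r \<lhd> q" using r s \<open>s \<lhd> p0\<close> by (meson le_trans)+
  have "a \<inter> b - a \<in> I r" "a \<inter> b - b \<in> I r"
   by (rule I_down[OF rp(1) I_empty[OF rp(1)]]; use Cod in \<open>auto intro: Cod_intros\<close>)+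
  then have "r ||- (related K w x)" "r ||- (related K w y)"
   using rel_iff[OF rp(1) r(2) pres_mono[OF rp(2) assms(2)]] rel_iff[OF rp(1) r(2) pres_mono[OF rp(2) assms(3)]] by blast+
  then have "r ||- (related K w z)"
   using forces_mono[OF rp(2) m] pres_mem[OF rp(1) r(2)] unfolding is_meet_def forces_Conj
   by (meson forces_BUnivD forces_ImpD forces_ConjI)
  then show "\<exists>r. r \<lhd> s \<and> a \<inter> b - c \<in> I r"
   using rel_iff[OF rp(1) r(2) pres_mono[OF rp(2) assms(4)]] r by blast
 qed
 with 1 show "a \<inter> b - c \<in> I q \<and> c - a \<inter> b \<in> I q" by blast
next
 assume c: "a \<inter> b - c \<in> I q \<and> c - a \<inter> b \<in> I q"
 have Cod: "a \<in> Cod" "b \<in> Cod" "c \<in> Cod" using pres_Cod assms by blast+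
 have "c - a \<in> I q" "c - b \<in> I q"
  by (rule I_down[OF assms(1) conjunct2[OF c]]; use Cod in \<open>auto intro: Cod_intros\<close>)+
 then show "q ||- (is_meet C K x y z)"
  unfolding is_meet_def
 proof (intro forces_ConjI BUnivC forces_ImpI assms)
  show "q ||- (z \<^bold>\<in> C)" using pres_mem assms by blast
  fix r d w s assume r: "r \<lhd> q" "r \<lhd> p0" "pres r d w" and s: "s \<lhd> r" "s ||- (related K w x \<^bold>\<and> related K w y)"
  have sp: "s \<lhd> p0" "s \<lhd> q" using r s by (meson le_trans)+
  have pr: "pres s a x" "pres s b y" "pres s c z" "pres s d w"
   using pres_mono[OF sp(2)] pres_mono[OF s(1)] assms r by blast+
  have "d - a \<in> I s" "d - b \<in> I s" using s(2) rel_iff sp pr unfolding forces_Conj by blast+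
  then have "(d - a) \<union> (d - b) \<in> I s" using I_Un sp by blast
  moreover have "a \<inter> b - c \<in> I s" using I_mono[OF assms(1) sp(2)] c by blast
  ultimately have "d - c \<in> I s"
   by (rule I_down2[OF sp(1)]) (use Cod pres_Cod[OF r(3)] in \<open>auto intro: Cod_intros\<close>)
  then show "s ||- (related K w z)" using rel_iff sp pr by blast
 qed (use rel_iff assms in blast)+
qed

lemma join_iff:
 assumes "q \<lhd> p0" "pres q a x" "pres q b y" "pres q c z"
 shows "q ||- (is_join C K x y z) \<longleftrightarrow> a \<union> b - c \<in> I q \<and> c - (a \<union> b) \<in> I q"
proof
 assume m: "q ||- (is_join C K x y z)"
 have Cod: "a \<in> Cod" "b \<in> Cod" "c \<in> Cod" using pres_Cod assms by blast+
 have "a - c \<in> I q" "b - c \<in> I q"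
  using m rel_iff assms unfolding is_join_def forces_Conj by blast+
 then have 1: "a \<union> b - c \<in> I q" by (rule I_down2[OF assms(1)]) (use Cod in \<open>auto intro: Cod_intros\<close>)
 have "c - (a \<union> b) \<in> I q"
 proof (rule I_dense[OF assms(1)], use Cod in \<open>blast intro: Cod_intros\<close>, rule denselyI)
  fix s assume s: "s \<lhd> q"
  then have "s \<lhd> p0" using assms(1) by (meson le_trans)
  then obtain r w where r: "r \<lhd> s" "pres r (a \<union> b) w" using pres_ex Cod_Un Cod by blast
  have rp: "r \<lhd> p0" "r \<lhd> q" using r s \<open>s \<lhd> p0\<close> by (meson le_trans)+
  have "a - (a \<union> b) \<in> I r" "b - (a \<union> b) \<in> I r"
   by (rule I_down[OF rp(1) I_empty[OF rp(1)]]; use Cod in \<open>auto intro: Cod_intros\<close>)+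
  then have "r ||- (related K x w)" "r ||- (related K y w)"
   using rel_iff[OF rp(1) pres_mono[OF rp(2) assms(2)] r(2)] rel_iff[OF rp(1) pres_mono[OF rp(2) assms(3)] r(2)] by blast+
  then have "r ||- (related K z w)"
   using forces_mono[OF rp(2) m] pres_mem[OF rp(1) r(2)] unfolding is_join_def forces_Conj
   by (meson forces_BUnivD forces_ImpD forces_ConjI)
  then show "\<exists>r. r \<lhd> s \<and> c - (a \<union> b) \<in> I r"
   using rel_iff[OF rp(1) pres_mono[OF rp(2) assms(4)] r(2)] r by blast
 qed
 with 1 show "a \<union> b - c \<in> I q \<and> c - (a \<union> b) \<in> I q" by blast
next
 assume c: "a \<union> b - c \<in> I q \<and> c - (a \<union> b) \<in> I q"
 have Cod: "a \<in> Cod" "b \<in> Cod" "c \<in> Cod" using pres_Cod assms by blast+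
 have "a - c \<in> I q" "b - c \<in> I q"
  by (rule I_down[OF assms(1) conjunct1[OF c]]; use Cod in \<open>auto intro: Cod_intros\<close>)+
 then show "q ||- (is_join C K x y z)"
  unfolding is_join_def
 proof (intro forces_ConjI BUnivC forces_ImpI assms)
  show "q ||- (z \<^bold>\<in> C)" using pres_mem assms by blast
  fix r d w s assume r: "r \<lhd> q" "r \<lhd> p0" "pres r d w" and s: "s \<lhd> r" "s ||- (related K x w \<^bold>\<and> related K y w)"
  have sp: "s \<lhd> p0" "s \<lhd> q" using r s by (meson le_trans)+
  have pr: "pres s a x" "pres s b y" "pres s c z" "pres s d w"
   using pres_mono[OF sp(2)] pres_mono[OF s(1)] assms r by blast+
  have "a - d \<in> I s" "b - d \<in> I s" using s(2) rel_iff sp pr unfolding forces_Conj by blast+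
  then have "(a - d) \<union> (b - d) \<in> I s" using I_Un sp by blast
  moreover have "c - (a \<union> b) \<in> I s" using I_mono[OF assms(1) sp(2)] c by blast
  ultimately have "c - d \<in> I s"
   by (rule I_down2[OF sp(1)]) (use Cod pres_Cod[OF r(3)] in \<open>auto intro: Cod_intros\<close>)
  then show "s ||- (related K z w)" using rel_iff sp pr by blast
 qed (use rel_iff assms in blast)+
qed

lemma meet_ex: "q \<lhd> p0 ==> pres q a x ==> pres q b y ==> pres q (a \<inter> b) z ==> q ||- (is_meet C K x y z)"
 by (subst meet_iff) (auto intro: I_empty)

lemma join_ex: "q \<lhd> p0 ==> pres q a x ==> pres q b y ==> pres q (a \<union> b) z ==> q ||- (is_join C K x y z)"
 by (subst join_iff) (auto intro: I_empty)

lemma compl_iff: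
 assumes "q \<lhd> p0" "pres q a x" "pres q b y"
 shows "q ||- (is_compl C K x y) \<longleftrightarrow> a \<inter> b \<in> I q \<and> - (a \<union> b) \<in> I q"
proof
 have Cod: "a \<in> Cod" "b \<in> Cod" using pres_Cod assms by blast+
 assume c: "q ||- (is_compl C K x y)"
 then have 1: "q ||- (\<^bold>\<exists>z. is_meet C K x y z \<^bold>\<and> is_bot C K z)"
  and 2: "q ||- (\<^bold>\<exists>u. is_join C K x y u \<^bold>\<and> is_top C K u)"
  unfolding is_compl_def forces_Conj by blast+
 have "densely q (\<lambda>r. a \<inter> b \<in> I r)"
 proof (rule denselyI)
  fix s assume s: "s \<lhd> q"
  then obtain r z where r: "r \<lhd> s" "r ||- (is_meet C K x y z)" "r ||- (is_bot C K z)"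
   using denselyD[OF 1[unfolded forces_Exis forces_Conj]] by blast
  have rq: "r \<lhd> q" "r \<lhd> p0" using r s assms(1) by (meson le_trans)+
  obtain t d where t: "t \<lhd> r" "pres t d z"
   using pres_surj[OF rq(2)] r(3) unfolding is_bot_def forces_Conj by blast
  have tq: "t \<lhd> q" "t \<lhd> p0" "t \<lhd> s" using t rq r by (meson le_trans)+
  have "a \<inter> b - d \<in> I t" "d \<in> I t"
   using meet_iff[OF tq(2) pres_mono[OF tq(1) assms(2)] pres_mono[OF tq(1) assms(3)] t(2)]
    bot_iff[OF tq(2) t(2)] forces_mono[OF t(1)] r by blast+
  then have "a \<inter> b \<in> I t" by (rule I_down2[OF tq(2)]) (use Cod in \<open>auto intro: Cod_intros\<close>)
  then show "\<exists>r. r \<lhd> s \<and> a \<inter> b \<in> I r" using tq by blast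
 qed
 moreover have "densely q (\<lambda>r. - (a \<union> b) \<in> I r)"
 proof (rule denselyI)
  fix s assume s: "s \<lhd> q"
  then obtain r z where r: "r \<lhd> s" "r ||- (is_join C K x y z)" "r ||- (is_top C K z)"
   using denselyD[OF 2[unfolded forces_Exis forces_Conj]] by blast
  have rq: "r \<lhd> q" "r \<lhd> p0" using r s assms(1) by (meson le_trans)+
  obtain t d where t: "t \<lhd> r" "pres t d z"
   using pres_surj[OF rq(2)] r(3) unfolding is_top_def forces_Conj by blast
  have tq: "t \<lhd> q" "t \<lhd> p0" "t \<lhd> s" using t rq r by (meson le_trans)+
  have "d - (a \<union> b) \<in> I t" "- d \<in> I t"
   using join_iff[OF tq(2) pres_mono[OF tq(1) assms(2)] pres_mono[OF tq(1) assms(3)] t(2)]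
    top_iff[OF tq(2) t(2)] forces_mono[OF t(1)] r by blast+
  then have "- (a \<union> b) \<in> I t"
   by (rule I_down2[OF tq(2)]) (use Cod Cod_compl[OF Cod_Un] in \<open>blast+\<close>)
  then show "\<exists>r. r \<lhd> s \<and> - (a \<union> b) \<in> I r" using tq by blast
 qed
 ultimately show "a \<inter> b \<in> I q \<and> - (a \<union> b) \<in> I q"
  using I_dense[OF assms(1)] Cod Cod_Int Cod_compl[OF Cod_Un] by blast
next
 have Cod: "a \<in> Cod" "b \<in> Cod" using pres_Cod assms by blast+
 assume c: "a \<inter> b \<in> I q \<and> - (a \<union> b) \<in> I q"
 show "q ||- (is_compl C K x y)"
  unfolding is_compl_def
 proof (intro forces_ConjI)
  show "q ||- (x \<^bold>\<in> C)" "q ||- (y \<^bold>\<in> C)" using pres_mem assms by blast+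
  show "q ||- (\<^bold>\<exists>z. is_meet C K x y z \<^bold>\<and> is_bot C K z)"
  proof (rule presE[OF assms(1) Cod_Int[OF Cod]])
   fix r z assume r: "r \<lhd> q" "pres r (a \<inter> b) z"
   have rp: "r \<lhd> p0" using r assms by (meson le_trans)
   have "r ||- (is_meet C K x y z)" "r ||- (is_bot C K z)"
    using meet_ex[OF rp pres_mono[OF r(1) assms(2)] pres_mono[OF r(1) assms(3)] r(2)]
     bot_iff[OF rp r(2)] I_mono[OF assms(1) r(1)] c by blast+
   then show "r ||- (\<^bold>\<exists>z. is_meet C K x y z \<^bold>\<and> is_bot C K z)" by (meson forces_ExisI forces_ConjI)
  qed
  show "q ||- (\<^bold>\<exists>u. is_join C K x y u \<^bold>\<and> is_top C K u)"
  proof (rule presE[OF assms(1) Cod_Un[OF Cod]])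
   fix r z assume r: "r \<lhd> q" "pres r (a \<union> b) z"
   have rp: "r \<lhd> p0" using r assms by (meson le_trans)
   have "r ||- (is_join C K x y z)" "r ||- (is_top C K z)"
    using join_ex[OF rp pres_mono[OF r(1) assms(2)] pres_mono[OF r(1) assms(3)] r(2)]
     top_iff[OF rp r(2)] I_mono[OF assms(1) r(1)] c by blast+
   then show "r ||- (\<^bold>\<exists>u. is_join C K x y u \<^bold>\<and> is_top C K u)" by (meson forces_ExisI forces_ConjI)
  qed
 qed
qed

lemma poset: "p0 \<lhd> p0 ==> p0 ||- (is_poset C K)"
 unfolding is_poset_def
proof (intro forces_ConjI BUnivC forces_ImpI)
 fix q c y assume "q \<lhd> p0" "pres q c y"
 then show "q ||- (related K y y)" by (rule rel_refl)
next
 fix q a x r b y s assume *: "q \<lhd> p0" "pres q a x" "r \<lhd> q" "r \<lhd> p0" "pres r b y" "s \<lhd> r"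
  "s ||- (related K x y \<^bold>\<and> related K y x)"
 have s: "s \<lhd> p0" "pres s a x" "pres s b y" using * by (meson le_trans pres_mono)+
 then show "s ||- (x \<^bold>= y)" using eq_iff[OF s] rel_iff * unfolding forces_Conj by blast
next
 fix q a x r b y s c z t assume *: "q \<lhd> p0" "pres q a x" "r \<lhd> q" "r \<lhd> p0" "pres r b y" "s \<lhd> r" "s \<lhd> p0" "pres s c z" "t \<lhd> s"
  "t ||- (related K x y \<^bold>\<and> related K y z)"
 have "t \<lhd> r" "t \<lhd> q" using * by (meson le_trans)+
 then have t: "t \<lhd> p0" "pres t a x" "pres t b y" "pres t c z" using * by (meson le_trans pres_mono)+
 then have "a - b \<in> I t" "b - c \<in> I t" using rel_iff * unfolding forces_Conj by blast+
 then have "a - c \<in> I t" by (rule I_down2[OF t(1)]) (use t pres_Cod in \<open>auto intro: Cod_intros\<close>)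
 then show "t ||- (related K x z)" using rel_iff t by blast
qed

lemma boolean_algebra: assumes "p0 \<lhd> p0" shows "p0 ||- (is_boolean_algebra C K)"
 unfolding is_boolean_algebra_def
proof (intro forces_ConjI BUnivC forces_ImpI poset assms)
 fix q a x r b y assume *: "q \<lhd> p0" "pres q a x" "r \<lhd> q" "r \<lhd> p0" "pres r b y"
 have Cod: "a \<in> Cod" "b \<in> Cod" using * pres_Cod by blast+
 show "r ||- (\<^bold>\<exists>c. is_meet C K x y c)"
 proof (rule presE[OF *(4) Cod_Int[OF Cod]], rule forces_ExisI)
  fix s z assume s: "s \<lhd> r" "pres s (a \<inter> b) z"
  have "s \<lhd> q" "s \<lhd> p0" using s(1) *(3,4) by (meson le_trans)+
  then show "s ||- (is_meet C K x y z)"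
   using meet_ex[OF _ pres_mono[OF _ *(2)] pres_mono[OF s(1) *(5)] s(2)] by blast
 qed
 show "r ||- (\<^bold>\<exists>c. is_join C K x y c)"
 proof (rule presE[OF *(4) Cod_Un[OF Cod]], rule forces_ExisI)
  fix s z assume s: "s \<lhd> r" "pres s (a \<union> b) z"
  have "s \<lhd> q" "s \<lhd> p0" using s(1) *(3,4) by (meson le_trans)+
  then show "s ||- (is_join C K x y z)"
   using join_ex[OF _ pres_mono[OF _ *(2)] pres_mono[OF s(1) *(5)] s(2)] by blast
 qed
next
 show "p0 ||- (\<^bold>\<exists>z. is_bot C K z)"
  by (rule presE[OF assms Cod_empty], rule forces_ExisI) (use bot_iff I_empty in blast)
 show "p0 ||- (\<^bold>\<exists>z. is_top C K z)"
  by (rule presE[OF assms Cod_UNIV], rule forces_ExisI) (use top_iff I_empty in force)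
next
 fix q1 a x1 q2 b x2 q3 c x3 q4 d x4 q5 e x5 q6 f x6 q7 g x7 q
 assume le: "q1 \<lhd> p0" "q2 \<lhd> q1" "q3 \<lhd> q2" "q4 \<lhd> q3" "q5 \<lhd> q4" "q6 \<lhd> q5" "q7 \<lhd> q6" "q \<lhd> q7" and "q7 \<lhd> p0"
  and pr: "pres q1 a x1" "pres q2 b x2" "pres q3 c x3" "pres q4 d x4" "pres q5 e x5" "pres q6 f x6" "pres q7 g x7"
  and F: "q ||- (is_join C K x2 x3 x4 \<^bold>\<and> is_meet C K x1 x4 x5 \<^bold>\<and> is_meet C K x1 x2 x6 \<^bold>\<and> is_meet C K x1 x3 x7)"
 have 6: "q \<lhd> q6" using le(7,8) by (meson le_trans)
 then have 5: "q \<lhd> q5" using le(6) by (meson le_trans)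
 then have 4: "q \<lhd> q4" using le(5) by (meson le_trans)
 then have 3: "q \<lhd> q3" using le(4) by (meson le_trans)
 then have 2: "q \<lhd> q2" using le(3) by (meson le_trans)
 then have 1: "q \<lhd> q1" using le(2) by (meson le_trans)
 then have 0: "q \<lhd> p0" using le(1) by (meson le_trans)
 note p = pres_mono[OF 1 pr(1)] pres_mono[OF 2 pr(2)] pres_mono[OF 3 pr(3)] pres_mono[OF 4 pr(4)]
  pres_mono[OF 5 pr(5)] pres_mono[OF 6 pr(6)] pres_mono[OF le(8) pr(7)]
 note Cod = p[THEN pres_Cod]
 have *: "b \<union> c - d \<in> I q" "d - (b \<union> c) \<in> I q" "a \<inter> d - e \<in> I q" "e - a \<inter> d \<in> I q"
  "a \<inter> b - f \<in> I q" "f - a \<inter> b \<in> I q" "a \<inter> c - g \<in> I q" "g - a \<inter> c \<in> I q"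
  using F join_iff[OF 0 p(2,3,4)] meet_iff[OF 0 p(1,4,5)] meet_iff[OF 0 p(1,2,6)] meet_iff[OF 0 p(1,3,7)]
  unfolding forces_Conj by blast+
 note un = I_Un[OF 0]
 \<comment> \<open>The distributive law of sets puts each of the two differences into the union of
   four of the eight error sets collected above.\<close>
 have "f \<union> g - e \<in> I q"
  by (rule I_down[OF 0 un[OF un[OF *(6,8)] un[OF *(1,3)]]]) (use Cod in \<open>auto intro: Cod_intros\<close>)
 moreover have "e - (f \<union> g) \<in> I q"
  by (rule I_down[OF 0 un[OF un[OF *(2,4)] un[OF *(5,7)]]]) (use Cod in \<open>auto intro: Cod_intros\<close>)
 ultimately show "q ||- (is_join C K x6 x7 x5)"
  using join_iff[OF 0 p(6,7,5)] by blast
next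
 fix q a x assume *: "q \<lhd> p0" "pres q a x"
 show "q ||- (\<^bold>\<exists>b. is_compl C K x b)"
 proof (rule presE[OF *(1) Cod_compl[OF pres_Cod[OF *(2)]]], rule forces_ExisI)
  fix r y assume r: "r \<lhd> q" "pres r (- a) y"
  have "r \<lhd> p0" using r * by (meson le_trans)
  then show "r ||- (is_compl C K x y)"
   using compl_iff[OF _ pres_mono[OF r(1) *(2)] r(2)] I_empty by simp
 qed
qed

text \<open>Up to the ideal, the elements below \<open>y\<close> are the intersections of
  \<open>a\<close> with codes, so the forward direction only tests the elements coded by
  \<open>a \<inter> e\<close>.\<close>

lemma atom_iff:
 assumes "q \<lhd> p0" "pres q a y"
 shows "q ||- (is_atom C K y) \<longleftrightarrow> vatom I q a"
proof
 have Cod: "a \<in> Cod" using pres_Cod assms by blast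
 assume at: "q ||- (is_atom C K y)"
 have "a \<notin> I r" if r: "r \<lhd> q" for r
  using at bot_iff[OF le_trans[OF r assms(1)] pres_mono[OF r assms(2)]] r unfolding is_atom_def forces_Conj forces_Neg
  by blast
 moreover have "densely r (\<lambda>s. a \<inter> e \<in> I s \<or> a - e \<in> I s)" if e: "e \<in> Cod" and r: "r \<lhd> q" for e r
 proof (rule denselyI)
  fix r' assume r': "r' \<lhd> r"
  then have "r' \<lhd> p0" using r assms by (meson le_trans)
  then obtain s z where s: "s \<lhd> r'" "pres s (a \<inter> e) z" using pres_ex Cod_Int[OF Cod e] by blast
  have sq: "s \<lhd> q" "s \<lhd> p0" using s r' r assms by (meson le_trans)+
  have "a \<inter> e - a \<in> I s" using I_empty[OF sq(2)] by (simp add: Int_Diff)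
  then have "s ||- (related K z y)"
   using rel_iff[OF sq(2) s(2) pres_mono[OF sq(1) assms(2)]] by blast
  then have dj: "s ||- (z \<^bold>= y \<^bold>\<or> is_bot C K z)"
   using forces_mono[OF sq(1) at] pres_mem[OF sq(2) s(2)] unfolding is_atom_def forces_Conj
   by (meson forces_BUnivD forces_ImpD)
  obtain t where t: "t \<lhd> s" "t ||- (z \<^bold>= y) \<or> t ||- (is_bot C K z)"
   using forces_Disj_ex[OF dj le_Field(1)[OF s(1)]] by blast
  have tq: "t \<lhd> p0" "t \<lhd> q" "t \<lhd> r'" using t s sq by (meson le_trans)+
  have "a \<inter> e \<in> I t \<or> a - e \<in> I t"
   using t(2) eq_iff[OF tq(1) pres_mono[OF t(1) s(2)] pres_mono[OF tq(2) assms(2)]]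
    bot_iff[OF tq(1) pres_mono[OF t(1) s(2)]] by (auto simp: Diff_Int)
  then show "\<exists>s. s \<lhd> r' \<and> (a \<inter> e \<in> I s \<or> a - e \<in> I s)" using tq by blast
 qed
 ultimately show "vatom I q a" unfolding vatom_def using Cod by blast
next
 have Cod: "a \<in> Cod" using pres_Cod assms by blast
 assume at: "vatom I q a"
 show "q ||- (is_atom C K y)"
  unfolding is_atom_def
 proof (intro forces_ConjI BUnivC forces_NegI forces_ImpI assms(1))
  show "q ||- (y \<^bold>\<in> C)" using pres_mem assms by blast
  fix r assume r: "r \<lhd> q" "r ||- (is_bot C K y)"
  then show False
   using bot_iff[OF le_trans[OF r(1) assms(1)] pres_mono[OF r(1) assms(2)]] at unfolding vatom_def by blast
 next
  fix r e z s assume r: "r \<lhd> q" "r \<lhd> p0" "pres r e z" and s: "s \<lhd> r" "s ||- (related K z y)"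
  have sq: "s \<lhd> q" "s \<lhd> p0" using r s by (meson le_trans)+
  have ea: "e - a \<in> I s" using s(2) rel_iff[OF sq(2) pres_mono[OF s(1) r(3)] pres_mono[OF sq(1) assms(2)]] by blast
  have "densely s (\<lambda>t. a \<inter> e \<in> I t \<or> a - e \<in> I t)"
   using at pres_Cod[OF r(3)] sq unfolding vatom_def by blast
  then show "s ||- (z \<^bold>= y \<^bold>\<or> is_bot C K z)"
  proof (rule dense_elim)
   fix t assume t: "t \<lhd> s" "a \<inter> e \<in> I t \<or> a - e \<in> I t"
   have tq: "t \<lhd> q" "t \<lhd> p0" "t \<lhd> r" using t sq s by (meson le_trans)+
   note p = pres_mono[OF tq(3) r(3)] pres_mono[OF tq(1) assms(2)]
   have ea': "e - a \<in> I t" using I_mono[OF sq(2) t(1) ea] .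
   have "t ||- (z \<^bold>= y) \<or> t ||- (is_bot C K z)"
   proof (cases "a - e \<in> I t")
    case True
    then show ?thesis using eq_iff[OF tq(2) p] ea' by blast
   next
    case False
    then have "a \<inter> e \<in> I t" using t by blast
    then have "e \<in> I t" using ea' by (rule I_down2[OF tq(2)]) (use pres_Cod r in auto)
    then show ?thesis using bot_iff[OF tq(2) p(1)] by blast
   qed
   then show "t ||- (z \<^bold>= y \<^bold>\<or> is_bot C K z)" by (rule forces_DisjI)
  qed
 qed
qed

text \<open>\<open>va\<close> concerns codes and conditions only: here the atomicity of a generic
  algebra is handed over to the ground model, where \<open>exists_vatom\<close> supplies it.\<close>

lemma atomicI:
 assumes "p0 \<lhd> p0"
  and va: "\<And>q c. q \<lhd> p0 ==> c \<in> Cod ==> (\<And>r. r \<lhd> q ==> c \<notin> I r) ==> \<exists>r a. r \<lhd> q \<and> a \<subseteq> c \<and> vatom I r a"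
 shows "p0 ||- (is_atomic C K)"
 unfolding is_atomic_def
proof (intro BUnivC forces_ImpI assms(1))
 fix q c y q' assume q: "q \<lhd> p0" "pres q c y" and q': "q' \<lhd> q" "q' ||- (\<^bold>\<not> is_bot C K y)"
 show "q' ||- (\<^bold>\<exists>a. is_atom C K a \<^bold>\<and> related K a y)"
 proof (rule denseE)
  fix s assume s: "s \<lhd> q'"
  have sq: "s \<lhd> q" "s \<lhd> p0" using s q q' by (meson le_trans)+
  have "c \<notin> I r" if "r \<lhd> s" for r
   using bot_iff[OF le_trans[OF that sq(2)] pres_mono[OF le_trans[OF that sq(1)] q(2)]] q'(2) le_trans[OF that s]
   unfolding forces_Neg by blast
  then obtain r a where r: "r \<lhd> s" "a \<subseteq> c" "vatom I r a"
   using va[OF sq(2) pres_Cod[OF q(2)]] by blast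
  have "a \<in> Cod" using r unfolding vatom_def by blast
  then obtain t z where t: "t \<lhd> r" "pres t a z" using pres_ex r sq le_trans by meson
  have tq: "t \<lhd> q" "t \<lhd> p0" "t \<lhd> s" using t r sq by (meson le_trans)+
  have "t ||- (is_atom C K z)" using atom_iff[OF tq(2) t(2)] vatom_le r t by blast
  moreover have "t ||- (related K z y)"
   using rel_iff[OF tq(2) t(2) pres_mono[OF tq(1) q(2)]] r(2) I_empty[OF tq(2)] by (simp add: Diff_eq_empty_iff[THEN iffD2])
  ultimately have "t ||- (\<^bold>\<exists>a. is_atom C K a \<^bold>\<and> related K a y)" by (meson forces_ExisI forces_ConjI)
  then show "\<exists>r. r \<lhd> s \<and> r ||- (\<^bold>\<exists>a. is_atom C K a \<^bold>\<and> related K a y)" using tq by blast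
 qed
qed

text \<open>Quantifying over all codes of \<open>y\<close> at all extensions makes membership
  independent of the chosen code; a single code suffices as soon as \<open>J\<close> contains
  \<open>I\<close>.\<close>

definition ideal_name :: "('p => 'v set set) => 'p name" where
 "ideal_name J = sep C (\<lambda>q y. \<forall>r c. r \<lhd> q --> r \<lhd> p0 --> pres r c y --> c \<in> J r)"

context
 fixes J assumes J: "videal p0 J" and IJ_all: "\<forall>q. q \<lhd> p0 --> I q \<subseteq> J q"
begin

lemma IJ: "q \<lhd> p0 ==> I q \<subseteq> J q"
 using IJ_all by blast

lemma mem_ideal_name:
 "q ||- (y \<^bold>\<in> ideal_name J) \<longleftrightarrow> q ||- (y \<^bold>\<in> C) \<and> (\<forall>r c. r \<lhd> q --> r \<lhd> p0 --> pres r c y --> c \<in> J r)"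
 unfolding ideal_name_def
proof (rule mem_sep)
 fix q \<sigma> assume d: "densely q (\<lambda>r. \<forall>s c. s \<lhd> r --> s \<lhd> p0 --> pres s c \<sigma> --> c \<in> J s)"
 show "\<forall>r c. r \<lhd> q --> r \<lhd> p0 --> pres r c \<sigma> --> c \<in> J r"
 proof (intro allI impI)
  fix r c assume r: "r \<lhd> q" "r \<lhd> p0" "pres r c \<sigma>"
  show "c \<in> J r"
  proof (rule videal_dense[OF J r(2) pres_Cod[OF r(3)]], rule denselyI)
   fix s assume s: "s \<lhd> r"
   then obtain t where t: "t \<lhd> s" "\<forall>u c. u \<lhd> t --> u \<lhd> p0 --> pres u c \<sigma> --> c \<in> J u"
    using denselyD[OF d] r le_trans by meson
   then show "\<exists>t. t \<lhd> s \<and> c \<in> J t"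
    using s r pres_mono le_trans le_refl1(1)[OF t(1)] by meson
  qed
 qed
qed (use le_trans pres_cong eq_sym forces_mono in meson)+

lemma mem_ideal_name_iff:
 assumes "q \<lhd> p0" "pres q c y"
 shows "q ||- (y \<^bold>\<in> ideal_name J) \<longleftrightarrow> c \<in> J q"
proof
 assume "q ||- (y \<^bold>\<in> ideal_name J)"
 then show "c \<in> J q" using assms le_refl1(1) unfolding mem_ideal_name by blast
next
 assume c: "c \<in> J q"
 show "q ||- (y \<^bold>\<in> ideal_name J)"
  unfolding mem_ideal_name
 proof (intro conjI allI impI)
  show "q ||- (y \<^bold>\<in> C)" using pres_mem assms by blast
  fix r d assume r: "r \<lhd> q" "r \<lhd> p0" "pres r d y"
  have "d - c \<in> I r" using eq_iff[OF r(2,3) pres_mono[OF r(1) assms(2)]] eq_refl by blast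
  then have "d - c \<in> J r" using IJ[OF r(2)] by blast
  moreover have "c \<in> J r" using videal_mono[OF J assms(1) r(1) c] .
  ultimately have "(d - c) \<union> c \<in> J r" using videal_Un[OF J r(2)] by blast
  then show "d \<in> J r" by (rule videal_down[OF J r(2)]) (use pres_Cod r in auto)
 qed
qed

lemma ideal_nameE:
 assumes "q \<lhd> p0" "q ||- (y \<^bold>\<in> ideal_name J)" "\<And>r c. r \<lhd> q ==> pres r c y ==> c \<in> J r ==> r ||- \<phi>"
 shows "q ||- \<phi>"
proof (rule elemE[OF assms(1)])
 show "q ||- (y \<^bold>\<in> C)" using assms(2) unfolding mem_ideal_name by blast
 fix r c assume "r \<lhd> q" "pres r c y"
 then show "r ||- \<phi>" using assms mem_ideal_name_iff forces_mono le_trans by metis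
qed

lemma ideal_name_ideal:
 assumes "p0 \<lhd> p0" shows "p0 ||- (is_ideal C K (ideal_name J))"
 unfolding is_ideal_def
proof (intro forces_ConjI forces_BUnivI forces_UnivI forces_ImpI)
 show "q ||- (x \<^bold>\<in> C)" if "q ||- (x \<^bold>\<in> ideal_name J)" for q x
  using that unfolding mem_ideal_name by blast
 show "p0 ||- (\<^bold>\<exists>z\<^bold>\<in>ideal_name J. is_bot C K z)"
  by (rule presE[OF assms Cod_empty], rule forces_BExisI)
   (use mem_ideal_name_iff videal_empty[OF J] bot_iff I_empty in blast)+
next
 fix q x r y s
 assume *: "q \<lhd> p0" "q ||- (x \<^bold>\<in> ideal_name J)" "r \<lhd> q" "r ||- (y \<^bold>\<in> C)" "s \<lhd> r" "s ||- (related K y x)"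
 have s: "s \<lhd> q" "s \<lhd> p0" using * by (meson le_trans)+
 show "s ||- (y \<^bold>\<in> ideal_name J)"
 proof (rule ideal_nameE[OF s(2) forces_mono[OF s(1) *(2)]])
  fix t c assume t: "t \<lhd> s" "pres t c x" "c \<in> J t"
  have tp: "t \<lhd> p0" "t \<lhd> r" using t s * by (meson le_trans)+
  show "t ||- (y \<^bold>\<in> ideal_name J)"
  proof (rule elemE[OF tp(1) forces_mono[OF tp(2) *(4)]])
   fix u d assume u: "u \<lhd> t" "pres u d y"
   have up: "u \<lhd> p0" "u \<lhd> s" using u t tp by (meson le_trans)+
   have "d - c \<in> I u" using rel_iff[OF up(1) u(2) pres_mono[OF u(1) t(2)]] forces_mono[OF up(2) *(6)] by blast
   then have "(d - c) \<union> c \<in> J u"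
    using IJ[OF up(1)] videal_mono[OF J tp(1) u(1) t(3)] videal_Un[OF J up(1)] by blast
   then have "d \<in> J u" by (rule videal_down[OF J up(1)]) (use pres_Cod u in auto)
   then show "u ||- (y \<^bold>\<in> ideal_name J)" using mem_ideal_name_iff[OF up(1) u(2)] by blast
  qed
 qed
next
 fix q x r y z s
 assume *: "q \<lhd> p0" "q ||- (x \<^bold>\<in> ideal_name J)" "r \<lhd> q" "r ||- (y \<^bold>\<in> ideal_name J)" "s \<lhd> r" "s ||- (is_join C K x y z)"
 have s: "s \<lhd> q" "s \<lhd> p0" using * by (meson le_trans)+
 show "s ||- (z \<^bold>\<in> ideal_name J)"
 proof (rule ideal_nameE[OF s(2) forces_mono[OF s(1) *(2)]])
  fix t c assume t: "t \<lhd> s" "pres t c x" "c \<in> J t"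
  have tp: "t \<lhd> p0" "t \<lhd> r" using t s * by (meson le_trans)+
  show "t ||- (z \<^bold>\<in> ideal_name J)"
  proof (rule ideal_nameE[OF tp(1) forces_mono[OF tp(2) *(4)]])
   fix u d assume u: "u \<lhd> t" "pres u d y" "d \<in> J u"
   have up: "u \<lhd> p0" "u \<lhd> s" using u t tp by (meson le_trans)+
   have "u ||- (z \<^bold>\<in> C)" using forces_mono[OF up(2) *(6)] unfolding is_join_def forces_Conj by blast
   then show "u ||- (z \<^bold>\<in> ideal_name J)"
   proof (rule elemE[OF up(1)])
    fix v e assume v: "v \<lhd> u" "pres v e z"
    have vp: "v \<lhd> p0" "v \<lhd> t" "v \<lhd> s" using v u up by (meson le_trans)+
    have "e - (c \<union> d) \<in> I v"
     using join_iff[OF vp(1) pres_mono[OF vp(2) t(2)] pres_mono[OF v(1) u(2)] v(2)] forces_mono[OF vp(3) *(6)] by blast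
    then have "(e - (c \<union> d)) \<union> (c \<union> d) \<in> J v"
     using IJ[OF vp(1)] videal_mono[OF J tp(1) vp(2) t(3)] videal_mono[OF J up(1) v(1) u(3)] videal_Un[OF J vp(1)]
     by blast
    then have "e \<in> J v" by (rule videal_down[OF J vp(1)]) (use pres_Cod v in auto)
    then show "v ||- (z \<^bold>\<in> ideal_name J)" using mem_ideal_name_iff[OF vp(1) v(2)] by blast
   qed
  qed
 qed
qed

end

text \<open>The ideal generated by the atoms is the intersection of all ideals containing them,
  hence bounded by any single one; \<open>ideal_name J\<close> is taken.\<close>

lemma in_atom_ideal_bound:
 assumes "p0 \<lhd> p0" and J: "videal p0 J" and IJ: "\<forall>q. q \<lhd> p0 --> I q \<subseteq> J q"
  and at: "\<And>q a. q \<lhd> p0 ==> vatom I q a ==> a \<in> J q"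
  and q: "q \<lhd> p0" "pres q c y" "q ||- (in_atom_ideal C K y)"
 shows "c \<in> J q"
proof -
 have "q ||- (\<^bold>\<forall>a. is_atom C K a \<^bold>\<longrightarrow> a \<^bold>\<in> ideal_name J)"
 proof (intro forces_UnivI forces_ImpI)
  fix a r assume r: "r \<lhd> q" "r ||- (is_atom C K a)"
  have rp: "r \<lhd> p0" using r q by (meson le_trans)
  show "r ||- (a \<^bold>\<in> ideal_name J)"
  proof (rule elemE[OF rp])
   show "r ||- (a \<^bold>\<in> C)" using r(2) unfolding is_atom_def forces_Conj by blast
   fix s d assume s: "s \<lhd> r" "pres s d a"
   then have sp: "s \<lhd> p0" using rp by (meson le_trans)
   then have "d \<in> J s" using at atom_iff[OF sp s(2)] forces_mono[OF s(1) r(2)] by blast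
   then show "s ||- (a \<^bold>\<in> ideal_name J)" using mem_ideal_name_iff[OF J IJ sp s(2)] by blast
  qed
 qed
 then have "q ||- (y \<^bold>\<in> ideal_name J)"
  using q(3) forces_mono[OF q(1) ideal_name_ideal[OF J IJ assms(1)]] unfolding in_atom_ideal_def forces_Conj
  by (meson forces_UnivD forces_ImpD forces_ConjI)
 then show ?thesis using mem_ideal_name_iff[OF J IJ q(1,2)] by blast
qed

text \<open>The complementary bound: an ideal \<open>W\<close> that contains the atoms contains the
  finite joins of atoms and null elements, hence everything below such a join modulo
  \<open>I\<close>.\<close>

lemma in_atom_idealI:
 assumes q: "q \<lhd> p0" "pres q c y"
  and gen: "\<And>r. r \<lhd> q ==> \<exists>s F. s \<lhd> r \<and> finite F \<and> (\<forall>f\<in>F. f \<in> I s \<or> vatom I s f) \<and> c - \<Union>F \<in> I s"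
 shows "q ||- (in_atom_ideal C K y)"
 unfolding in_atom_ideal_def
proof (intro forces_ConjI forces_UnivI forces_ImpI)
 show "q ||- (y \<^bold>\<in> C)" using pres_mem q by blast
 fix W r assume r: "r \<lhd> q" and "r ||- (is_ideal C K W \<^bold>\<and> (\<^bold>\<forall>a. is_atom C K a \<^bold>\<longrightarrow> a \<^bold>\<in> W))"
 then have W: "r ||- (is_ideal C K W)" and at: "r ||- (\<^bold>\<forall>a. is_atom C K a \<^bold>\<longrightarrow> a \<^bold>\<in> W)" by auto
 have bot: "t ||- (y \<^bold>\<in> W)" if t: "t \<lhd> r" "t ||- (is_bot C K y)" for t y
 proof -
  have "t ||- (\<^bold>\<exists>z\<^bold>\<in>W. is_bot C K z)" and dn: "t ||- (\<^bold>\<forall>x\<^bold>\<in>W. \<^bold>\<forall>y\<^bold>\<in>C. related K y x \<^bold>\<longrightarrow> y \<^bold>\<in> W)"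
   using forces_mono[OF t(1) W] unfolding is_ideal_def forces_Conj by blast+
  then show ?thesis
  proof (elim forces_BExisE)
   fix u z assume u: "u \<lhd> t" "u ||- (z \<^bold>\<in> W)" "u ||- (is_bot C K z)"
   have y: "u ||- (is_bot C K y)" using t u forces_mono by blast
   then have "u ||- (related K y z)" "u ||- (y \<^bold>\<in> C)"
    using u(3) unfolding is_bot_def forces_Conj by (meson forces_BUnivD)+
   then show "u ||- (y \<^bold>\<in> W)" using forces_mono[OF u(1) dn] u(2) by (meson forces_BUnivD forces_ImpD)
  qed
 qed
 have fin: "t ||- (y \<^bold>\<in> W)"
  if "finite F" "t \<lhd> r" "\<forall>f\<in>F. f \<in> I t \<or> vatom I t f" "pres t (\<Union>F) y" for F t y
  using that
 proof (induction F arbitrary: t y rule: finite_induct)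
  case empty
  have "t \<lhd> p0" using empty(1) r q le_trans by meson
  then show ?case using bot[OF empty(1)] bot_iff[OF _ empty(3)] I_empty by simp
 next
  case (insert f F)
  have tp: "t \<lhd> p0" using insert.prems(1) r q le_trans by meson
  have fC: "f \<in> Cod" "F \<subseteq> Cod" using insert.prems(2) I_Cod[OF tp] unfolding vatom_def by auto
  have "\<Union>F \<in> Cod" using Cod_UN[OF insert(1), of id] fC by auto
  then show ?case
  proof (rule presE[OF tp])
   fix u z assume u: "u \<lhd> t" "pres u (\<Union>F) z"
   have up: "u \<lhd> p0" "u \<lhd> r" using u tp insert.prems by (meson le_trans)+
   have "\<forall>f\<in>F. f \<in> I u \<or> vatom I u f"
    using insert.prems(2) I_mono[OF tp u(1)] vatom_le[OF _ u(1)] by blast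
   then have z: "u ||- (z \<^bold>\<in> W)" using insert.IH[OF up(2) _ u(2)] by blast
   show "u ||- (y \<^bold>\<in> W)"
   proof (rule presE[OF up(1) fC(1)])
    fix v x assume v: "v \<lhd> u" "pres v f x"
    have vp: "v \<lhd> p0" "v \<lhd> r" "v \<lhd> t" using v u up by (meson le_trans)+
    have "f \<in> I v \<or> vatom I v f" using insert.prems(2) I_mono[OF tp vp(3)] vatom_le[OF _ vp(3)] by blast
    then have x: "v ||- (x \<^bold>\<in> W)"
    proof
     assume "f \<in> I v"
     then show ?thesis using bot[OF vp(2)] bot_iff[OF vp(1) v(2)] by blast
    next
     assume "vatom I v f"
     then have "v ||- (is_atom C K x)" using atom_iff[OF vp(1) v(2)] by blast
     then show ?thesis using forces_mono[OF vp(2) at] by (meson forces_UnivD forces_ImpD)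
    qed
    have "pres v (f \<union> \<Union>F) y" using pres_mono[OF vp(3) insert.prems(3)] by simp
    then have "v ||- (is_join C K x z y)" using join_ex vp v pres_mono u by blast
    then show "v ||- (y \<^bold>\<in> W)"
     using forces_mono[OF vp(2) W] x forces_mono[OF v(1) z] unfolding is_ideal_def forces_Conj
     by (meson forces_BUnivD forces_UnivD forces_ImpD)
   qed
  qed
 qed
 show "r ||- (y \<^bold>\<in> W)"
 proof (rule denseE)
  fix r' assume r': "r' \<lhd> r"
  then obtain s F where s: "s \<lhd> r'" "finite F" "\<forall>f\<in>F. f \<in> I s \<or> vatom I s f" "c - \<Union>F \<in> I s"
   using gen r le_trans by meson
  have sp: "s \<lhd> p0" "s \<lhd> r" "s \<lhd> q" using s r' r q by (meson le_trans)+
  have "F \<subseteq> Cod" using s(3) I_Cod[OF sp(1)] unfolding vatom_def by auto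
  then have "\<Union>F \<in> Cod" using Cod_UN[OF s(2), of id] by auto
  then obtain t z where t: "t \<lhd> s" "pres t (\<Union>F) z" using pres_ex[OF sp(1)] by blast
  have tp: "t \<lhd> p0" "t \<lhd> r" "t \<lhd> q" "t \<lhd> r'" using t s(1) sp by (meson le_trans)+
  have "\<forall>f\<in>F. f \<in> I t \<or> vatom I t f" using s(3) I_mono[OF sp(1) t(1)] vatom_le[OF _ t(1)] by blast
  then have z: "t ||- (z \<^bold>\<in> W)" using fin s(2) tp t by blast
  have yC: "t ||- (related K y z)" "t ||- (y \<^bold>\<in> C)"
   using rel_iff[OF tp(1) pres_mono[OF tp(3) q(2)] t(2)] I_mono[OF sp(1) t(1) s(4)]
    pres_mem[OF tp(1) pres_mono[OF tp(3) q(2)]] by blast+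
  then have "t ||- (y \<^bold>\<in> W)"
   using forces_mono[OF tp(2) W] z unfolding is_ideal_def forces_Conj
   by (meson forces_BUnivD forces_ImpD)
  then show "\<exists>s. s \<lhd> r' \<and> s ||- (y \<^bold>\<in> W)" using tp by blast
 qed
qed

end

section \<open>Quotients of an algebra of codes\<close>

text \<open>The bound on the number of codes guarantees that sets of codes have names.\<close>

locale small_codes = codes R Cod for R :: "'p rel" and Cod :: "'v set set" +
 assumes small: "|Cod| \<le>o |UNIV :: 'p set|"
begin

definition idx :: "'v set => 'p" where
 "idx = (SOME f. inj_on f Cod)"

lemma inj_idx: "inj_on idx Cod"
proof -
 have "\<exists>f :: 'v set => 'p. inj_on f Cod" using small by (auto simp flip: card_of_ordLeq)
 then show ?thesis unfolding idx_def by (rule someI_ex)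
qed

text \<open>Pairwise distinct names for the codes: check names of ordinals.\<close>

definition kn :: "'v set => 'p name" where
 "kn c = segment_name R |UNIV :: 'p set| (idx c)"

lemma kn_eq:
 assumes "p \<in> Field R" "c \<in> Cod" "d \<in> Cod" "p ||- (kn c \<^bold>= kn d)"
 shows "c = d"
proof -
 interpret level_names R "|UNIV :: 'p set|" "segment_name R |UNIV :: 'p set|" "ordinal_name R |UNIV :: 'p set|"
  by (rule level_names_segment[OF card_of_Well_order])
 have "Lo (idx c) = Lo (idx d)"
  using assms(4) ln_eq_iff[OF assms(1), of "Lo (idx c)" "Lo (idx d)"]
  by (simp add: ln_simps kn_def levs_def Field_card_of)
 then show ?thesis using inj_idx assms(2,3) by (simp add: inj_on_def)
qed

text \<open>Ideals that are defined at all conditions; the kernel of a forced epimorphism is only a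
  \<open>videal\<close> below the condition that forces it to be one.\<close>

definition gideal :: "('p => 'v set set) => bool" where
 "gideal I \<longleftrightarrow> (\<forall>p. videal p I)"

lemma gidealD: "gideal I ==> videal p I"
 by (simp add: gideal_def)

lemma
 assumes "gideal I" "q \<in> Field R"
 shows gideal_Cod: "a \<in> I q ==> a \<in> Cod"
  and gideal_empty: "{} \<in> I q"
  and gideal_Un: "a \<in> I q ==> b \<in> I q ==> a \<union> b \<in> I q"
  and gideal_down: "a \<in> I q ==> b \<in> Cod ==> b \<subseteq> a ==> b \<in> I q"
  and gideal_dense: "a \<in> Cod ==> densely q (\<lambda>r. a \<in> I r) ==> a \<in> I q"
 using videal_Cod[OF gidealD[OF assms(1)] le_refl[OF assms(2)]]
  videal_empty[OF gidealD[OF assms(1)] le_refl[OF assms(2)]]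
  videal_Un[OF gidealD[OF assms(1)] le_refl[OF assms(2)]]
  videal_down[OF gidealD[OF assms(1)] le_refl[OF assms(2)]]
  videal_dense[OF gidealD[OF assms(1)] le_refl[OF assms(2)]]
 by blast+

lemma gideal_mono: "gideal I ==> r \<lhd> q ==> a \<in> I q ==> a \<in> I r"
 by (rule videal_mono[OF gidealD le_refl1(2)])

lemma gideal_down2:
 "gideal I ==> q \<in> Field R ==> a \<in> I q ==> b \<in> I q ==> c \<in> Cod ==> c \<subseteq> a \<union> b ==> c \<in> I q"
 using gideal_down gideal_Un by blast

definition cong_in :: "('p => 'v set set) => 'p => 'v set => 'v set => bool" where
 "cong_in I q c d \<longleftrightarrow> c - d \<in> I q \<and> d - c \<in> I q"

lemma cong_in_sym: "cong_in I q c d ==> cong_in I q d c"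
 by (simp add: cong_in_def)

lemma cong_in_trans:
 assumes "gideal I" "q \<in> Field R" "c \<in> Cod" "d \<in> Cod" "e \<in> Cod" "cong_in I q c d" "cong_in I q d e"
 shows "cong_in I q c e"
 unfolding cong_in_def
proof
 show "c - e \<in> I q"
  by (rule gideal_down2[OF assms(1,2), of "c - d" "d - e"]) (use assms Cod_Diff in \<open>auto simp: cong_in_def\<close>)
 show "e - c \<in> I q"
  by (rule gideal_down2[OF assms(1,2), of "d - c" "e - d"]) (use assms Cod_Diff in \<open>auto simp: cong_in_def\<close>)
qed

lemma cong_in_refl: "gideal I ==> q \<in> Field R ==> cong_in I q c c"
 by (simp add: cong_in_def gideal_empty)

lemma persistent_cong_in: "gideal I ==> persistent (\<lambda>q d. cong_in I q c d)"
 unfolding persistent_def cong_in_def using gideal_mono by blast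

text \<open>The class consists of the names \<open>kn d\<close> of the codes congruent to
  \<open>c\<close>. As these names are pairwise distinct, equality of classes in the extension is
  exactly congruence modulo \<open>I\<close>.\<close>

definition cls :: "('p => 'v set set) => 'v set => 'p name" where
 "cls I c = vset Cod kn (\<lambda>q d. cong_in I q c d)"

definition alg :: "('p => 'v set set) => 'p name" where
 "alg I = vset Cod (cls I) (\<lambda>_ _. True)"

definition leq :: "('p => 'v set set) => 'p name" where
 "leq I = graph (Cod \<times> Cod) (\<lambda>cd. cls I (fst cd)) (\<lambda>cd. cls I (snd cd)) (\<lambda>q cd. fst cd - snd cd \<in> I q)"

lemma cls_eq_iff:
 assumes I: "gideal I" and q: "q \<in> Field R" and c: "c \<in> Cod" "d \<in> Cod"
 shows "q ||- (cls I c \<^bold>= cls I d) \<longleftrightarrow> cong_in I q c d"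
proof
 assume eq: "q ||- (cls I c \<^bold>= cls I d)"
 have "q ||- (kn c \<^bold>\<in> cls I c)"
  unfolding cls_def by (rule vsetI[OF small persistent_cong_in[OF I] c(1) cong_in_refl[OF I q]])
 then have "q ||- (kn c \<^bold>\<in> cls I d)" using mem_cong[OF eq_refl eq] by blast
 then have d: "densely q (\<lambda>r. \<exists>e\<in>Cod. cong_in I r d e \<and> r ||- (kn c \<^bold>= kn e))"
  unfolding cls_def mem_vset[OF small persistent_cong_in[OF I]] .
 have "densely q (\<lambda>r. cong_in I r c d)"
  using d by (rule densely_mono) (use kn_eq c(1) le_Field cong_in_sym in metis)
 then have "densely q (\<lambda>r. c - d \<in> I r)" "densely q (\<lambda>r. d - c \<in> I r)"
  by (auto elim: densely_mono simp: cong_in_def)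
 then show "cong_in I q c d"
  unfolding cong_in_def using gideal_dense[OF I q] Cod_Diff c by blast
next
 have half: "r ||- (\<rho> \<^bold>\<in> cls I d)"
  if "cong_in I q c d" "c \<in> Cod" "d \<in> Cod" "r \<lhd> q" "r ||- (\<rho> \<^bold>\<in> cls I c)" for r \<rho> c d
  using that(5) unfolding cls_def
 proof (rule vsetE[OF _ small persistent_cong_in[OF I]])
  fix s e assume s: "s \<lhd> r" "e \<in> Cod" "cong_in I s c e" "s ||- (\<rho> \<^bold>= kn e)"
  have "s \<lhd> q" using s(1) that(4) by (rule le_trans)
  then have "cong_in I s d c" using that(1) gideal_mono[OF I] unfolding cong_in_def by blast
  then have "cong_in I s d e" using cong_in_trans[OF I le_Field(1)[OF s(1)]] that(2,3) s by blast
  then have "s ||- (kn e \<^bold>\<in> vset Cod kn (\<lambda>q e. cong_in I q d e))"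
   by (intro vsetI[OF small persistent_cong_in[OF I]] s)
  then show "s ||- (\<rho> \<^bold>\<in> vset Cod kn (\<lambda>q e. cong_in I q d e))"
   using mem_cong[OF eq_sym[OF s(4)] eq_refl] by blast
 qed
 assume "cong_in I q c d"
 then show "q ||- (cls I c \<^bold>= cls I d)"
  unfolding eq_iff_mem using half half[OF cong_in_sym] c by blast
qed

lemma cls_mem_alg: "c \<in> Cod ==> q ||- (cls I c \<^bold>\<in> alg I)"
 unfolding alg_def by (rule vsetI[OF small persistent_True]) simp_all

lemma mem_alg: "q ||- (x \<^bold>\<in> alg I) \<longleftrightarrow> densely q (\<lambda>r. \<exists>c\<in>Cod. r ||- (x \<^bold>= cls I c))"
 unfolding alg_def mem_vset[OF small persistent_True] by simp

definition qpres :: "('p => 'v set set) => 'p => 'v set => 'p name => bool" where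
 "qpres I q c y \<longleftrightarrow> c \<in> Cod \<and> q ||- (y \<^bold>= cls I c)"

lemma qpres_cls: "c \<in> Cod ==> qpres I q c (cls I c)"
 by (simp only: qpres_def eq_refl simp_thms)

lemma small2: "|Cod \<times> Cod| \<le>o |UNIV :: 'p set|"
 using small inf_p by (intro card_of_Times_ordLeq_infinite_Field) (simp_all add: Field_card_of card_of_card_order_on)

lemma related_leq:
 assumes I: "gideal I" and q: "q \<in> Field R" and y: "qpres I q c y" "qpres I q d z"
 shows "q ||- (related (leq I) y z) \<longleftrightarrow> c - d \<in> I q"
proof -
 have Cod: "c \<in> Cod" "d \<in> Cod" and eq: "q ||- (y \<^bold>= cls I c)" "q ||- (z \<^bold>= cls I d)"
  using y unfolding qpres_def by blast+
 have per: "persistent (\<lambda>q cd. fst cd - snd cd \<in> I q)"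
  unfolding persistent_def using gideal_mono[OF I] by blast
 show ?thesis
 proof
  assume "q ||- (related (leq I) y z)"
  then have d: "densely q (\<lambda>r. \<exists>cd\<in>Cod \<times> Cod. fst cd - snd cd \<in> I r \<and>
    r ||- (y \<^bold>= cls I (fst cd)) \<and> r ||- (z \<^bold>= cls I (snd cd)))"
   unfolding leq_def related_graph[OF small2 per] .
  have "densely q (\<lambda>r. c - d \<in> I r)"
   using d
  proof (rule densely_mono)
   fix r assume r: "r \<lhd> q" and "\<exists>cd\<in>Cod \<times> Cod. fst cd - snd cd \<in> I r \<and>
    r ||- (y \<^bold>= cls I (fst cd)) \<and> r ||- (z \<^bold>= cls I (snd cd))"
   then obtain c' d' where *: "c' \<in> Cod" "d' \<in> Cod" "c' - d' \<in> I r" "r ||- (y \<^bold>= cls I c')" "r ||- (z \<^bold>= cls I d')"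
    by auto
   note f = le_Field(1)[OF r]
   have "r ||- (cls I c \<^bold>= cls I c')" "r ||- (cls I d \<^bold>= cls I d')"
    using * eq forces_mono[OF r] eq_trans eq_sym by blast+
   then have "c - c' \<in> I r" "d' - d \<in> I r"
    using cls_eq_iff[OF I f] Cod * unfolding cong_in_def by blast+
   then have "((c - c') \<union> (d' - d)) \<union> (c' - d') \<in> I r" using gideal_Un[OF I f] *(3) by blast
   then show "c - d \<in> I r" by (rule gideal_down[OF I f]) (use Cod Cod_Diff in auto)
  qed
  then show "c - d \<in> I q" using gideal_dense[OF I q Cod_Diff[OF Cod]] by blast
 next
  assume "c - d \<in> I q"
  then have "q ||- (related (leq I) (cls I (fst (c, d))) (cls I (snd (c, d))))"
   unfolding leq_def by (intro related_graphI[OF small2 per]) (simp_all add: Cod)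
  then show "q ||- (related (leq I) y z)"
   unfolding fst_conv snd_conv using related_cong eq_sym eq by blast
 qed
qed

lemma presentation_alg:
 assumes I: "gideal I"
 shows "presentation R Cod p0 (alg I) (leq I) I (qpres I)"
proof (unfold_locales)
 show "videal p0 I" by (rule gidealD[OF I])
 show "c \<in> Cod" if "qpres I q c y" for q c y using that by (simp add: qpres_def)
 show "\<exists>r y. r \<lhd> q \<and> qpres I r c y" if "q \<lhd> p0" "c \<in> Cod" for q c
  using that qpres_cls le_refl1 by blast
 show "q ||- (y \<^bold>\<in> alg I)" if "qpres I q c y" for q c y
  using mem_cong[OF eq_sym eq_refl cls_mem_alg] that unfolding qpres_def by blast
 show "qpres I r c y" if "r \<lhd> q" "qpres I q c y" for q r c y
  using that forces_mono unfolding qpres_def by blast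
 show "qpres I q c y'" if "qpres I q c y" "q ||- (y \<^bold>= y')" for q c y y'
  using that eq_trans eq_sym unfolding qpres_def by blast
 show "\<exists>r c. r \<lhd> q \<and> qpres I r c y" if "q \<lhd> p0" "q ||- (y \<^bold>\<in> alg I)" for q y
  using densely_ex[OF that(2)[unfolded mem_alg] le_Field(1)[OF that(1)]] unfolding qpres_def by blast
 show "q ||- (related (leq I) y z) \<longleftrightarrow> c - d \<in> I q" if "q \<lhd> p0" "qpres I q c y" "qpres I q d z" for q c d y z
  using related_leq[OF I le_Field(1)] that by blast
 show "q ||- (y \<^bold>= z)" if "q \<lhd> p0" "qpres I q c y" "qpres I q d z" "c - d \<in> I q" "d - c \<in> I q" for q c d y z
  using cls_eq_iff[OF I le_Field(1)[OF that(1)], of c d] that eq_trans eq_sym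
  unfolding qpres_def cong_in_def by blast
qed

section \<open>Projections between the quotients by two ideals\<close>

definition hom :: "('p => 'v set set) => ('p => 'v set set) => 'p name" where
 "hom I J = fgraph Cod (cls I) (cls J)"

context
 fixes I J assumes I: "gideal I" and J: "gideal J" and IJ_all: "\<forall>q\<in>Field R. I q \<subseteq> J q"
begin

lemma IJ: "q \<in> Field R ==> I q \<subseteq> J q"
 using IJ_all by blast

lemma cong_in_mono: "q \<in> Field R ==> cong_in I q c d ==> cong_in J q c d"
 using IJ unfolding cong_in_def by blast

lemma related_hom:
 assumes "q \<in> Field R" "qpres I q c x"
 shows "q ||- (related (hom I J) x y) \<longleftrightarrow> qpres J q c y"
proof
 have c: "c \<in> Cod" "q ||- (x \<^bold>= cls I c)" using assms(2) unfolding qpres_def by blast+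
 assume "q ||- (related (hom I J) x y)"
 then have "q ||- (y \<^bold>= cls J c)"
  unfolding hom_def
 proof (rule related_graphE[OF _ small persistent_True])
  fix r d assume r: "r \<lhd> q" "d \<in> Cod" "r ||- (x \<^bold>= cls I d)" "r ||- (y \<^bold>= cls J d)"
  note f = le_Field(1)[OF r(1)]
  have "r ||- (cls I d \<^bold>= cls I c)" using r(3) forces_mono[OF r(1) c(2)] eq_trans eq_sym by blast
  then have "r ||- (cls J d \<^bold>= cls J c)"
   using cls_eq_iff[OF I f r(2) c(1)] cls_eq_iff[OF J f r(2) c(1)] cong_in_mono[OF f] by blast
  then show "r ||- (y \<^bold>= cls J c)" using r(4) eq_trans by blast
 qed
 then show "qpres J q c y" using c unfolding qpres_def by blast
next
 assume y: "qpres J q c y"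
 have c: "c \<in> Cod" "q ||- (x \<^bold>= cls I c)" using assms(2) unfolding qpres_def by blast+
 have "q ||- (related (hom I J) (cls I c) (cls J c))"
  unfolding hom_def by (rule related_graphI[OF small persistent_True c(1)]) simp
 then show "q ||- (related (hom I J) x y)"
  using related_cong eq_sym c y unfolding qpres_def by blast
qed

lemma epimorphism_hom:
 assumes p: "p \<in> Field R"
 shows "p ||- (is_epimorphism (alg I) (leq I) (alg J) (leq J) (hom I J))"
proof -
 interpret B: presentation R Cod p "alg I" "leq I" I "qpres I" by (rule presentation_alg[OF I])
 interpret C: presentation R Cod p "alg J" "leq J" J "qpres J" by (rule presentation_alg[OF J])
 have "p ||- (is_function_on (hom I J) (alg I))"
  unfolding hom_def
 proof (rule fgraph_function[OF small])
  show "q ||- (cls J i \<^bold>= cls J j)"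
   if "q \<lhd> p" "i \<in> Cod" "j \<in> Cod" "q ||- (cls I i \<^bold>= cls I j)" for i j q
   using that cls_eq_iff[OF I le_Field(1)[OF that(1)]] cls_eq_iff[OF J le_Field(1)[OF that(1)]]
    cong_in_mono[OF le_Field(1)[OF that(1)]] by blast
 qed (use cls_mem_alg mem_alg in blast)+
 then have "p ||- (is_surjection (hom I J) (alg I) (alg J))"
  unfolding hom_def by (rule fgraph_surjection[OF _ small]) (use cls_mem_alg mem_alg in blast)+
 then show ?thesis
  unfolding is_epimorphism_def
 proof (intro forces_ConjI B.BUnivC C.boolean_algebra le_refl p forces_BUnivI)
  fix q1 a x q2 b y q3 c z q4 x' q5 y' q6 z'
  assume le: "q1 \<lhd> p" "q2 \<lhd> q1" "q3 \<lhd> q2" "q4 \<lhd> q3" "q5 \<lhd> q4" "q6 \<lhd> q5"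
   and pr: "qpres I q1 a x" "qpres I q2 b y" "qpres I q3 c z"
  show "q6 ||- (related (hom I J) x x' \<^bold>\<and> related (hom I J) y y' \<^bold>\<and> related (hom I J) z z' \<^bold>\<longrightarrow>
    (is_meet (alg I) (leq I) x y z \<^bold>\<longrightarrow> is_meet (alg J) (leq J) x' y' z') \<^bold>\<and>
    (is_join (alg I) (leq I) x y z \<^bold>\<longrightarrow> is_join (alg J) (leq J) x' y' z') \<^bold>\<and>
    (is_compl (alg I) (leq I) x y \<^bold>\<longrightarrow> is_compl (alg J) (leq J) x' y'))"
  proof (rule forces_ImpI)
   fix q assume q: "q \<lhd> q6" and rel: "q ||- (related (hom I J) x x' \<^bold>\<and> related (hom I J) y y' \<^bold>\<and> related (hom I J) z z')"
   have "q \<lhd> q5" using q le(6) by (rule le_trans)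
   then have "q \<lhd> q4" using le(5) by (rule le_trans)
   then have 3: "q \<lhd> q3" using le(4) by (rule le_trans)
   then have 2: "q \<lhd> q2" using le(3) by (rule le_trans)
   then have 1: "q \<lhd> q1" using le(2) by (rule le_trans)
   then have 0: "q \<lhd> p" using le(1) by (rule le_trans)
   note b = B.pres_mono[OF 1 pr(1)] B.pres_mono[OF 2 pr(2)] B.pres_mono[OF 3 pr(3)]
   have c: "qpres J q a x'" "qpres J q b y'" "qpres J q c z'"
    using rel related_hom[OF le_Field(1)[OF q]] b unfolding forces_Conj by blast+
   have mono: "d \<in> I r ==> d \<in> J r" if "r \<lhd> q" for r d using IJ[OF le_Field(1)[OF that]] by blast
   show "q ||- ((is_meet (alg I) (leq I) x y z \<^bold>\<longrightarrow> is_meet (alg J) (leq J) x' y' z') \<^bold>\<and>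
    (is_join (alg I) (leq I) x y z \<^bold>\<longrightarrow> is_join (alg J) (leq J) x' y' z') \<^bold>\<and>
    (is_compl (alg I) (leq I) x y \<^bold>\<longrightarrow> is_compl (alg J) (leq J) x' y'))"
   proof (intro forces_ConjI forces_ImpI)
    fix r assume r: "r \<lhd> q"
    have r0: "r \<lhd> p" using r 0 by (rule le_trans)
    note br = b[THEN B.pres_mono[OF r]] and cr = c[THEN C.pres_mono[OF r]]
    show "r ||- (is_meet (alg J) (leq J) x' y' z')" if "r ||- (is_meet (alg I) (leq I) x y z)"
     using that B.meet_iff[OF r0 br] C.meet_iff[OF r0 cr] mono[OF r] by blast
    show "r ||- (is_join (alg J) (leq J) x' y' z')" if "r ||- (is_join (alg I) (leq I) x y z)"
     using that B.join_iff[OF r0 br] C.join_iff[OF r0 cr] mono[OF r] by blast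
    show "r ||- (is_compl (alg J) (leq J) x' y')" if "r ||- (is_compl (alg I) (leq I) x y)"
     using that B.compl_iff[OF r0 br(1,2)] C.compl_iff[OF r0 cr(1,2)] mono[OF r] by blast
   qed
  qed
 qed
qed

definition idl :: "'p name" where
 "idl = vset Cod (cls I) (\<lambda>q c. c \<in> J q)"

lemma mem_idl_iff:
 assumes "q \<in> Field R" "qpres I q c y"
 shows "q ||- (y \<^bold>\<in> idl) \<longleftrightarrow> c \<in> J q"
proof -
 have per: "persistent (\<lambda>q c. c \<in> J q)" unfolding persistent_def using gideal_mono[OF J] by blast
 have c: "c \<in> Cod" "q ||- (y \<^bold>= cls I c)" using assms(2) unfolding qpres_def by blast+
 show ?thesis
 proof
  assume "q ||- (y \<^bold>\<in> idl)"
  then have d: "densely q (\<lambda>r. \<exists>d\<in>Cod. d \<in> J r \<and> r ||- (y \<^bold>= cls I d))"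
   unfolding idl_def mem_vset[OF small per] .
  have "densely q (\<lambda>r. c \<in> J r)"
   using d
  proof (rule densely_mono)
   fix r assume r: "r \<lhd> q" "\<exists>d\<in>Cod. d \<in> J r \<and> r ||- (y \<^bold>= cls I d)"
   then obtain d where d: "d \<in> Cod" "d \<in> J r" "r ||- (y \<^bold>= cls I d)" by blast
   note f = le_Field(1)[OF r(1)]
   have "r ||- (cls I c \<^bold>= cls I d)" using d(3) forces_mono[OF r(1) c(2)] eq_trans eq_sym by blast
   then have "c - d \<in> J r" using cls_eq_iff[OF I f c(1) d(1)] cong_in_mono[OF f] unfolding cong_in_def by blast
   then show "c \<in> J r" using d(2) by (rule gideal_down2[OF J f]) (use c in auto)
  qed
  then show "c \<in> J q" using gideal_dense[OF J assms(1) c(1)] by blast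
 next
  assume "c \<in> J q"
  then have "q ||- (cls I c \<^bold>\<in> idl)" unfolding idl_def using c by (intro vsetI[OF small per])
  then show "q ||- (y \<^bold>\<in> idl)" using mem_cong[OF eq_sym eq_refl] c by blast
 qed
qed

lemma idl_sub_alg: "q ||- (y \<^bold>\<in> idl) ==> q ||- (y \<^bold>\<in> alg I)"
 unfolding idl_def
proof (erule vsetE[OF _ small])
 show "persistent (\<lambda>q c. c \<in> J q)" unfolding persistent_def using gideal_mono[OF J] by blast
qed (use mem_cong[OF eq_sym eq_refl cls_mem_alg] in blast)

text \<open>\<open>ideal_name\<close> mentions the condition below which the presentation lives,
  whereas \<open>idl\<close> is one name valid at all conditions; the equality transfers the ideal
  property to it.\<close>

lemma idl_eq_ideal_name:
 assumes "p \<in> Field R"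
 shows "p ||- (idl \<^bold>= presentation.ideal_name R p (alg I) (qpres I) J)"
proof -
 interpret B: presentation R Cod p "alg I" "leq I" I "qpres I" by (rule presentation_alg[OF I])
 have sub: "\<forall>q. q \<lhd> p --> I q \<subseteq> J q" using IJ le_Field by blast
 note mem = B.mem_ideal_name[OF gidealD[OF J] sub] B.mem_ideal_name_iff[OF gidealD[OF J] sub]
 show ?thesis
  unfolding eq_iff_mem
 proof (intro allI impI iffI)
  fix q y assume q: "q \<lhd> p" and y: "q ||- (y \<^bold>\<in> idl)"
  show "q ||- (y \<^bold>\<in> B.ideal_name J)"
  proof (rule B.elemE[OF q idl_sub_alg[OF y]])
   fix r c assume r: "r \<lhd> q" "qpres I r c y"
   then show "r ||- (y \<^bold>\<in> B.ideal_name J)"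
    using mem(2)[OF le_trans[OF r(1) q] r(2)] mem_idl_iff[OF le_Field(1)[OF r(1)] r(2)] forces_mono[OF r(1) y] by blast
  qed
 next
  fix q y assume q: "q \<lhd> p" and y: "q ||- (y \<^bold>\<in> B.ideal_name J)"
  show "q ||- (y \<^bold>\<in> idl)"
  proof (rule B.elemE[OF q])
   show "q ||- (y \<^bold>\<in> alg I)" using y unfolding mem(1) by blast
   fix r c assume r: "r \<lhd> q" "qpres I r c y"
   then show "r ||- (y \<^bold>\<in> idl)"
    using mem(2)[OF le_trans[OF r(1) q] r(2)] mem_idl_iff[OF le_Field(1)[OF r(1)] r(2)] forces_mono[OF r(1) y] by blast
  qed
 qed
qed

lemma quotient_hom:
 assumes p: "p \<in> Field R"
 shows "p ||- (is_quotient (alg I) (leq I) idl (alg J) (leq J) (hom I J))"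
proof -
 interpret B: presentation R Cod p "alg I" "leq I" I "qpres I" by (rule presentation_alg[OF I])
 interpret C: presentation R Cod p "alg J" "leq J" J "qpres J" by (rule presentation_alg[OF J])
 have sub: "\<forall>q. q \<lhd> p --> I q \<subseteq> J q" using IJ le_Field by blast
 show ?thesis
  unfolding is_quotient_def
 proof (intro forces_ConjI epimorphism_hom p B.BUnivC le_refl forces_IffI)
  show "p ||- (is_ideal (alg I) (leq I) idl)"
   using B.ideal_name_ideal[OF gidealD[OF J] sub le_refl[OF p]]
    fiffD[OF fiff_is_ideal[OF eq_refl eq_refl idl_eq_ideal_name[OF p]]] by blast
  fix q c y r assume q: "q \<lhd> p" "qpres I q c y" and r: "r \<lhd> q"
  have rp: "r \<lhd> p" using r q(1) by (rule le_trans)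
  note f = le_Field(1)[OF r]
  note y = B.pres_mono[OF r q(2)]
  show "r ||- (\<^bold>\<exists>z. is_bot (alg J) (leq J) z \<^bold>\<and> related (hom I J) y z)" if "r ||- (y \<^bold>\<in> idl)"
  proof (rule forces_ExisI, rule forces_ConjI)
   have c: "c \<in> J r" using that mem_idl_iff[OF f y] by blast
   have z: "qpres J r c (cls J c)" using y qpres_cls unfolding qpres_def by blast
   show "r ||- (is_bot (alg J) (leq J) (cls J c))" using C.bot_iff[OF rp z] c by blast
   show "r ||- (related (hom I J) y (cls J c))" using related_hom[OF f y] z by blast
  qed
  show "r ||- (y \<^bold>\<in> idl)" if "r ||- (\<^bold>\<exists>z. is_bot (alg J) (leq J) z \<^bold>\<and> related (hom I J) y z)"
   using that
  proof (rule forces_ExisE)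
   fix s z assume s: "s \<lhd> r" "s ||- (is_bot (alg J) (leq J) z \<^bold>\<and> related (hom I J) y z)"
   have sp: "s \<lhd> p" using s(1) rp by (rule le_trans)
   note fs = le_Field(1)[OF s(1)] and ys = B.pres_mono[OF s(1) y]
   have "qpres J s c z" using related_hom[OF fs ys] s(2) by auto
   then have "c \<in> J s" using C.bot_iff[OF sp] s(2) by auto
   then show "s ||- (y \<^bold>\<in> idl)" using mem_idl_iff[OF fs ys] by blast
  qed
 qed
qed

end

section \<open>Arbitrary homomorphic images presented by their kernels\<close>

context
 fixes I p0 C K h
 assumes I: "gideal I" and p0: "p0 \<in> Field R" and epi: "p0 ||- (is_epimorphism (alg I) (leq I) C K h)"
begin

text \<open>An element of the image \<open>C\<close> receives the codes of its preimages, and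
  \<open>ker\<close> is the ideal by which such codes are identified. This reduces every homomorphic
  image, and every quotient that a Cantor-Bendixson sequence may choose, to the same field of
  sets.\<close>

definition ker :: "'p => 'v set set" where
 "ker q = {c \<in> Cod. q ||- (\<^bold>\<exists>z. is_bot C K z \<^bold>\<and> related h (cls I c) z)}"

definition kpres :: "'p => 'v set => 'p name => bool" where
 "kpres q c y \<longleftrightarrow> c \<in> Cod \<and> q ||- (related h (cls I c) y)"

interpretation B: presentation R Cod p0 "alg I" "leq I" I "qpres I" by (rule presentation_alg[OF I])

lemma
 assumes q: "q \<lhd> p0"
 shows epi_BA: "q ||- (is_boolean_algebra C K)"
  and epi_surj: "q ||- (is_surjection h (alg I) C)"
  and epi_fun: "q ||- (is_function_on h (alg I))"
  and epi_meet: "q ||- (is_meet (alg I) (leq I) a b c) ==> q ||- (a \<^bold>\<in> alg I) ==> q ||- (b \<^bold>\<in> alg I) ==>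
   q ||- (c \<^bold>\<in> alg I) ==> q ||- (a' \<^bold>\<in> C) ==> q ||- (b' \<^bold>\<in> C) ==> q ||- (c' \<^bold>\<in> C) ==>
   q ||- (related h a a') ==> q ||- (related h b b') ==> q ||- (related h c c') ==> q ||- (is_meet C K a' b' c')"
  and epi_join: "q ||- (is_join (alg I) (leq I) a b c) ==> q ||- (a \<^bold>\<in> alg I) ==> q ||- (b \<^bold>\<in> alg I) ==>
   q ||- (c \<^bold>\<in> alg I) ==> q ||- (a' \<^bold>\<in> C) ==> q ||- (b' \<^bold>\<in> C) ==> q ||- (c' \<^bold>\<in> C) ==>
   q ||- (related h a a') ==> q ||- (related h b b') ==> q ||- (related h c c') ==> q ||- (is_join C K a' b' c')"
  and epi_compl: "q ||- (is_compl (alg I) (leq I) a b) ==> q ||- (a \<^bold>\<in> alg I) ==> q ||- (b \<^bold>\<in> alg I) ==>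
   q ||- (a' \<^bold>\<in> C) ==> q ||- (b' \<^bold>\<in> C) ==>
   q ||- (related h a a') ==> q ||- (related h b b') ==> q ||- (is_compl C K a' b')"
proof -
 note e = forces_mono[OF q epi, unfolded is_epimorphism_def forces_Conj]
 show "q ||- (is_boolean_algebra C K)" using e by blast
 show s: "q ||- (is_surjection h (alg I) C)" using e by blast
 show "q ||- (is_function_on h (alg I))" using s unfolding is_surjection_def forces_Conj by blast
 note p = e[THEN conjunct2, THEN conjunct2, THEN forces_BUnivD, THEN forces_BUnivD, THEN forces_BUnivD,
   THEN forces_BUnivD, THEN forces_BUnivD, THEN forces_BUnivD, THEN forces_ImpD, unfolded forces_Conj]
 show "q ||- (is_meet (alg I) (leq I) a b c) ==> q ||- (a \<^bold>\<in> alg I) ==> q ||- (b \<^bold>\<in> alg I) ==>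
   q ||- (c \<^bold>\<in> alg I) ==> q ||- (a' \<^bold>\<in> C) ==> q ||- (b' \<^bold>\<in> C) ==> q ||- (c' \<^bold>\<in> C) ==>
   q ||- (related h a a') ==> q ||- (related h b b') ==> q ||- (related h c c') ==> q ||- (is_meet C K a' b' c')"
  using p[of a b c a' b' c'] forces_ImpD by blast
 show "q ||- (is_join (alg I) (leq I) a b c) ==> q ||- (a \<^bold>\<in> alg I) ==> q ||- (b \<^bold>\<in> alg I) ==>
   q ||- (c \<^bold>\<in> alg I) ==> q ||- (a' \<^bold>\<in> C) ==> q ||- (b' \<^bold>\<in> C) ==> q ||- (c' \<^bold>\<in> C) ==>
   q ||- (related h a a') ==> q ||- (related h b b') ==> q ||- (related h c c') ==> q ||- (is_join C K a' b' c')"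
  using p[of a b c a' b' c'] forces_ImpD by blast
 show "q ||- (is_compl (alg I) (leq I) a b) ==> q ||- (a \<^bold>\<in> alg I) ==> q ||- (b \<^bold>\<in> alg I) ==>
   q ||- (a' \<^bold>\<in> C) ==> q ||- (b' \<^bold>\<in> C) ==>
   q ||- (related h a a') ==> q ||- (related h b b') ==> q ||- (is_compl C K a' b')"
  using p[of a b b a' b' b'] forces_ImpD by blast
qed

lemma poset_refl: "q ||- (is_poset C K) ==> q ||- (x \<^bold>\<in> C) ==> q ||- (related K x x)"
 unfolding is_poset_def forces_Conj by (meson forces_BUnivD)

lemma poset_antisym: "q ||- (is_poset C K) ==> q ||- (x \<^bold>\<in> C) ==> q ||- (y \<^bold>\<in> C) ==>
  q ||- (related K x y) ==> q ||- (related K y x) ==> q ||- (x \<^bold>= y)"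
 unfolding is_poset_def forces_Conj by (meson forces_BUnivD forces_ImpD forces_ConjI)

lemma poset_trans: "q ||- (is_poset C K) ==> q ||- (x \<^bold>\<in> C) ==> q ||- (y \<^bold>\<in> C) ==> q ||- (z \<^bold>\<in> C) ==>
  q ||- (related K x y) ==> q ||- (related K y z) ==> q ||- (related K x z)"
 unfolding is_poset_def forces_Conj by (meson forces_BUnivD forces_ImpD forces_ConjI)

lemma epi_poset: "q \<lhd> p0 ==> q ||- (is_poset C K)"
 using epi_BA unfolding is_boolean_algebra_def forces_Conj by blast

lemma kpres_Cod: "kpres q c y ==> c \<in> Cod"
 by (simp add: kpres_def)

lemma kpres_mono: "r \<lhd> q ==> kpres q c y ==> kpres r c y"
 using forces_mono unfolding kpres_def by blast

lemma kpres_mem: "q \<lhd> p0 ==> kpres q c y ==> q ||- (y \<^bold>\<in> C)"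
 using epi_surj cls_mem_alg unfolding kpres_def is_surjection_def forces_Conj
 by (meson forces_BUnivD forces_UnivD forces_ImpD)

lemma kpres_fun:
 assumes q: "q \<lhd> p0" and y: "kpres q c y" "kpres q c z" shows "q ||- (y \<^bold>= z)"
proof -
 have "q ||- (\<^bold>\<exists>b. related h (cls I c) b \<^bold>\<and> (\<^bold>\<forall>d. related h (cls I c) d \<^bold>\<longrightarrow> d \<^bold>= b))"
  using epi_fun[OF q] cls_mem_alg[where c = c and q = q] y unfolding is_function_on_def forces_Conj kpres_def
  by (meson forces_BUnivD)
 then show ?thesis
 proof (rule forces_ExisE)
  fix r b assume r: "r \<lhd> q" "r ||- (related h (cls I c) b \<^bold>\<and> (\<^bold>\<forall>d. related h (cls I c) d \<^bold>\<longrightarrow> d \<^bold>= b))"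
  then have "r ||- (y \<^bold>= b)" "r ||- (z \<^bold>= b)"
   using y forces_mono[OF r(1)] unfolding forces_Conj kpres_def by (meson forces_UnivD forces_ImpD)+
  then show "r ||- (y \<^bold>= z)" using eq_trans eq_sym by blast
 qed
qed

lemma kpres_ex:
 assumes q: "q \<lhd> p0" and c: "c \<in> Cod" shows "\<exists>r y. r \<lhd> q \<and> kpres r c y"
proof -
 have "q ||- (\<^bold>\<exists>b. related h (cls I c) b \<^bold>\<and> (\<^bold>\<forall>d. related h (cls I c) d \<^bold>\<longrightarrow> d \<^bold>= b))"
  using epi_fun[OF q] cls_mem_alg[OF c, where q = q] unfolding is_function_on_def forces_Conj
  by (meson forces_BUnivD)
 from forces_Exis_ex[OF this le_Field(1)[OF q]] show ?thesis
  using c unfolding kpres_def forces_Conj by blast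
qed

lemma kpres_surj:
 assumes q: "q \<lhd> p0" and y: "q ||- (y \<^bold>\<in> C)" shows "\<exists>r c. r \<lhd> q \<and> kpres r c y"
proof -
 have "q ||- (\<^bold>\<exists>a\<^bold>\<in>alg I. related h a y)"
  using epi_surj[OF q] y unfolding is_surjection_def forces_Conj by (meson forces_BUnivD)
 from forces_BExis_ex[OF this le_Field(1)[OF q]]
 obtain r a where r: "r \<lhd> q" "r ||- (a \<^bold>\<in> alg I)" "r ||- (related h a y)" by blast
 from densely_ex[OF r(2)[unfolded mem_alg] le_Field(1)[OF r(1)]]
 obtain s c where s: "s \<lhd> r" "c \<in> Cod" "s ||- (a \<^bold>= cls I c)" by blast
 have "s ||- (related h (cls I c) y)"
  using related_cong[OF forces_mono[OF s(1) r(3)] s(3) eq_refl] .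
 then show ?thesis using s le_trans[OF s(1) r(1)] unfolding kpres_def by blast
qed

lemma kpres_bot:
 assumes q: "q \<lhd> p0" and y: "kpres q c y"
 shows "c \<in> ker q \<longleftrightarrow> q ||- (is_bot C K y)"
proof
 assume "c \<in> ker q"
 then have "q ||- (\<^bold>\<exists>z. is_bot C K z \<^bold>\<and> related h (cls I c) z)" unfolding ker_def by blast
 then show "q ||- (is_bot C K y)"
 proof (rule forces_ExisE)
  fix r z assume r: "r \<lhd> q" "r ||- (is_bot C K z \<^bold>\<and> related h (cls I c) z)"
  have "kpres r c z" using r(2) kpres_Cod[OF y] unfolding kpres_def by auto
  then have "r ||- (z \<^bold>= y)" using kpres_fun[OF le_trans[OF r(1) q]] kpres_mono[OF r(1) y] by blast
  then show "r ||- (is_bot C K y)" using r(2) fiffD[OF fiff_is_bot[OF eq_refl eq_refl]] by auto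
 qed
next
 assume "q ||- (is_bot C K y)"
 then show "c \<in> ker q"
  using y unfolding ker_def kpres_def by (auto intro: forces_ExisI[where \<sigma> = y])
qed

lemma kpres_meet:
 "q \<lhd> p0 ==> kpres q a x ==> kpres q b y ==> kpres q (a \<inter> b) z ==> q ||- (is_meet C K x y z)"
 using epi_meet[OF _ B.meet_ex[OF _ qpres_cls qpres_cls qpres_cls] cls_mem_alg cls_mem_alg cls_mem_alg kpres_mem kpres_mem kpres_mem]
 unfolding kpres_def by blast

lemma kpres_join:
 "q \<lhd> p0 ==> kpres q a x ==> kpres q b y ==> kpres q (a \<union> b) z ==> q ||- (is_join C K x y z)"
 using epi_join[OF _ B.join_ex[OF _ qpres_cls qpres_cls qpres_cls] cls_mem_alg cls_mem_alg cls_mem_alg kpres_mem kpres_mem kpres_mem]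
 unfolding kpres_def by blast

lemma kpres_compl:
 assumes "q \<lhd> p0" "kpres q a x" "kpres q (- a) y" shows "q ||- (is_compl C K x y)"
proof -
 have Cod: "a \<in> Cod" "- a \<in> Cod" using assms kpres_Cod by blast+
 have "q ||- (is_compl (alg I) (leq I) (cls I a) (cls I (- a)))"
  using B.compl_iff[OF assms(1) qpres_cls[OF Cod(1)] qpres_cls[OF Cod(2)]] B.I_empty[OF assms(1)] by simp
 then show ?thesis
  using epi_compl[OF assms(1) _ cls_mem_alg[OF Cod(1)] cls_mem_alg[OF Cod(2)]] kpres_mem assms unfolding kpres_def by blast
qed

lemma bot_down:
 "q ||- (is_poset C K) ==> q ||- (is_bot C K z) ==> q ||- (x \<^bold>\<in> C) ==> q ||- (related K x z) ==> q ||- (is_bot C K x)"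
 unfolding is_bot_def forces_Conj
proof (intro conjI forces_BUnivI; (elim conjE)?)
 fix r w assume *: "q ||- (is_poset C K)" "q ||- (z \<^bold>\<in> C)" "q ||- (\<^bold>\<forall>b\<^bold>\<in>C. related K z b)" "q ||- (x \<^bold>\<in> C)"
  "q ||- (related K x z)" and r: "r \<lhd> q" "r ||- (w \<^bold>\<in> C)"
 note m = *[THEN forces_mono[OF r(1)]]
 show "r ||- (related K x w)" by (rule poset_trans[OF m(1,4,2) r(2) m(5) forces_BUnivD[OF m(3) r(2)]])
qed

text \<open>An epimorphism preserves meet, join and complement, and \<open>K\<close> has to be
  recovered from them. If \<open>y\<close> is below \<open>z\<close>, the image \<open>v\<close> of
  \<open>c - d\<close> is below both \<open>z\<close> and its complement \<open>w\<close>, hence is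
  bottom. Conversely \<open>y\<close> is the join of the images of \<open>c \<inter> d\<close> and
  \<open>c - d\<close>; the latter being bottom, \<open>y\<close> is below the former, which lies
  below \<open>z\<close>.\<close>

lemma kpres_rel:
 assumes q: "q \<lhd> p0" and y: "kpres q c y" "kpres q d z"
 shows "q ||- (related K y z) \<longleftrightarrow> c - d \<in> ker q"
proof -
 have Cod: "c \<in> Cod" "d \<in> Cod" using y kpres_Cod by blast+
 have all: "\<exists>r u v w. r \<lhd> s \<and> kpres r (c \<inter> d) u \<and> kpres r (c - d) v \<and> kpres r (- d) w" if s: "s \<lhd> q" for s
 proof -
  obtain r1 u where 1: "r1 \<lhd> s" "kpres r1 (c \<inter> d) u" using kpres_ex[OF le_trans[OF s q] Cod_Int[OF Cod]] by blast
  have p1: "r1 \<lhd> p0" using 1 s q by (meson le_trans)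
  obtain r2 v where 2: "r2 \<lhd> r1" "kpres r2 (c - d) v" using kpres_ex[OF p1 Cod_Diff[OF Cod]] by blast
  have p2: "r2 \<lhd> p0" using 2(1) p1 by (rule le_trans)
  obtain r3 w where 3: "r3 \<lhd> r2" "kpres r3 (- d) w" using kpres_ex[OF p2 Cod_compl[OF Cod(2)]] by blast
  have "r3 \<lhd> s" "r3 \<lhd> r1" using 1 2 3 by (meson le_trans)+
  then show ?thesis using 3 kpres_mono[OF 3(1) 2(2)] kpres_mono[OF _ 1(2)] by blast
 qed
 show ?thesis
 proof
  assume L: "q ||- (related K y z)"
  have "q ||- (\<^bold>\<exists>z. is_bot C K z \<^bold>\<and> related h (cls I (c - d)) z)"
  proof (rule denseE)
   fix s assume "s \<lhd> q"
   then obtain r u v w where r: "r \<lhd> s" "kpres r (c - d) v" "kpres r (- d) w" using all by blast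
   have rq: "r \<lhd> q" "r \<lhd> p0" using r \<open>s \<lhd> q\<close> q by (meson le_trans)+
   note yr = y[THEN kpres_mono[OF rq(1)]] and po = epi_poset[OF rq(2)]
   note mem = kpres_mem[OF rq(2) yr(1)] kpres_mem[OF rq(2) yr(2)] kpres_mem[OF rq(2) r(2)] kpres_mem[OF rq(2) r(3)]
   have "kpres r (c \<inter> - d) v" using r(2) by (simp add: Diff_eq)
   then have "r ||- (is_meet C K y w v)" using kpres_meet[OF rq(2) yr(1) r(3)] by blast
   then have v: "r ||- (related K v y)" "r ||- (related K v w)" unfolding is_meet_def forces_Conj by blast+
   have vz: "r ||- (related K v z)"
    by (rule poset_trans[OF po mem(3,1,2) v(1) forces_mono[OF rq(1) L]])
   have "r ||- (\<^bold>\<exists>b. is_meet C K z w b \<^bold>\<and> is_bot C K b)"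
    using kpres_compl[OF rq(2) yr(2) r(3)] unfolding is_compl_def forces_Conj by blast
   then have "r ||- (is_bot C K v)"
   proof (rule forces_ExisE)
    fix t b assume t: "t \<lhd> r" "t ||- (is_meet C K z w b \<^bold>\<and> is_bot C K b)"
    have "t ||- (related K v b)"
     using t(2) forces_mono[OF t(1)] mem(3) vz v(2) unfolding is_meet_def forces_Conj
     by (meson forces_BUnivD forces_ImpD forces_ConjI)
    then show "t ||- (is_bot C K v)"
     using bot_down[OF forces_mono[OF t(1) po] _ forces_mono[OF t(1) mem(3)]] t(2) by auto
   qed
   then have "r ||- (\<^bold>\<exists>z. is_bot C K z \<^bold>\<and> related h (cls I (c - d)) z)"
    using r(2) unfolding kpres_def by (auto intro: forces_ExisI[where \<sigma> = v])
   then show "\<exists>r. r \<lhd> s \<and> r ||- (\<^bold>\<exists>z. is_bot C K z \<^bold>\<and> related h (cls I (c - d)) z)" using r(1) by blast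
  qed
  then show "c - d \<in> ker q" unfolding ker_def using Cod_Diff[OF Cod] by blast
 next
  assume k: "c - d \<in> ker q"
  show "q ||- (related K y z)"
  proof (rule denseE)
   fix s assume "s \<lhd> q"
   then obtain r u v w where r: "r \<lhd> s" "kpres r (c \<inter> d) u" "kpres r (c - d) v" using all by blast
   have rq: "r \<lhd> q" "r \<lhd> p0" using r \<open>s \<lhd> q\<close> q by (meson le_trans)+
   note yr = y[THEN kpres_mono[OF rq(1)]] and po = epi_poset[OF rq(2)]
   note mem = kpres_mem[OF rq(2) yr(1)] kpres_mem[OF rq(2) yr(2)] kpres_mem[OF rq(2) r(2)] kpres_mem[OF rq(2) r(3)]
   have "c - d \<in> ker r" using k forces_mono[OF rq(1)] unfolding ker_def by blast
   then have "r ||- (is_bot C K v)" using kpres_bot[OF rq(2) r(3)] by blast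
   then have vu: "r ||- (related K v u)" using mem(3) unfolding is_bot_def forces_Conj by (meson forces_BUnivD)
   have "(c \<inter> d) \<union> (c - d) = c" by blast
   then have "r ||- (is_join C K u v y)" using kpres_join[OF rq(2) r(2,3), of y] yr(1) by simp
   then have yu: "r ||- (related K y u)"
    using poset_refl[OF po mem(3)] vu mem(3) unfolding is_join_def forces_Conj
    by (meson forces_BUnivD forces_ImpD forces_ConjI)
   have "r ||- (is_meet C K y z u)" using kpres_meet[OF rq(2) yr r(2)] .
   then have "r ||- (related K u z)" unfolding is_meet_def forces_Conj by blast
   then have "r ||- (related K y z)" by (rule poset_trans[OF po mem(1,3,2) yu])
   then show "\<exists>r. r \<lhd> s \<and> r ||- (related K y z)" using r(1) by blast
  qed
 qed
qed

text \<open>The definition of an epimorphism does not speak of the bottom element; that the empty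
  code goes there follows from its meets with all other codes.\<close>

lemma kpres_min:
 assumes q: "q \<lhd> p0" and y: "kpres q {} y" shows "q ||- (is_bot C K y)"
 unfolding is_bot_def
proof (intro forces_ConjI forces_BUnivI)
 show "q ||- (y \<^bold>\<in> C)" by (rule kpres_mem[OF q y])
 fix r b assume r: "r \<lhd> q" "r ||- (b \<^bold>\<in> C)"
 show "r ||- (related K y b)"
 proof (rule denseE)
  fix s assume s: "s \<lhd> r"
  have sp: "s \<lhd> p0" using s r q by (meson le_trans)
  obtain t d where t: "t \<lhd> s" "kpres t d b" using kpres_surj[OF sp forces_mono[OF s r(2)]] by blast
  have tp: "t \<lhd> p0" "t \<lhd> q" using t s r sp by (meson le_trans)+
  have "t ||- (is_meet C K y b y)" using kpres_meet[OF tp(1) kpres_mono[OF tp(2) y] t(2)] kpres_mono[OF tp(2) y] by simp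
  then have "t ||- (related K y b)" unfolding is_meet_def forces_Conj by blast
  then show "\<exists>t. t \<lhd> s \<and> t ||- (related K y b)" using t by blast
 qed
qed

lemma ker_I: assumes q: "q \<lhd> p0" shows "I q \<subseteq> ker q"
proof
 fix c assume c: "c \<in> I q"
 have Cod: "c \<in> Cod" by (rule B.I_Cod[OF q c])
 have eq: "q ||- (cls I c \<^bold>= cls I {})"
  using cls_eq_iff[OF I le_Field(1)[OF q] Cod Cod_empty] c B.I_empty[OF q] unfolding cong_in_def by simp
 have "q ||- (\<^bold>\<exists>z. is_bot C K z \<^bold>\<and> related h (cls I c) z)"
 proof (rule denseE)
  fix s assume s: "s \<lhd> q"
  then have "s \<lhd> p0" using q by (rule le_trans)
  then obtain r y where r: "r \<lhd> s" "kpres r {} y" using kpres_ex Cod_empty by blast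
  have rq: "r \<lhd> q" "r \<lhd> p0" using r s q by (meson le_trans)+
  have "r ||- (related h (cls I c) y)"
   using r(2) related_cong[OF _ eq_sym[OF forces_mono[OF rq(1) eq]] eq_refl] unfolding kpres_def by blast
  then have "r ||- (\<^bold>\<exists>z. is_bot C K z \<^bold>\<and> related h (cls I c) z)"
   using kpres_min[OF rq(2) r(2)] by (auto intro: forces_ExisI[where \<sigma> = y])
  then show "\<exists>r. r \<lhd> s \<and> r ||- (\<^bold>\<exists>z. is_bot C K z \<^bold>\<and> related h (cls I c) z)" using r by blast
 qed
 then show "c \<in> ker q" unfolding ker_def using Cod by blast
qed

lemma ker_dense: "c \<in> Cod ==> densely q (\<lambda>r. c \<in> ker r) ==> c \<in> ker q"
 unfolding ker_def by (simp only: mem_Collect_eq simp_thms) (rule forces_dense)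

lemma ker_videal: "videal p0 ker"
 unfolding videal_def
proof (intro allI impI conjI ballI)
 fix q assume q: "q \<lhd> p0"
 show "ker q \<subseteq> Cod" unfolding ker_def by blast
 show "{} \<in> ker q" using ker_I[OF q] B.I_empty[OF q] by blast
 show "ker q \<subseteq> ker r" if "r \<lhd> q" for r using forces_mono[OF that] unfolding ker_def by blast
 fix a assume a: "a \<in> ker q"
 have Ca: "a \<in> Cod" using a unfolding ker_def by blast
 have dn: "d \<in> ker q" if d: "d \<in> Cod" "d \<subseteq> a" "a \<in> ker q" for d a
 proof (rule ker_dense[OF d(1)], rule denselyI)
  fix s assume s: "s \<lhd> q"
  have Ca: "a \<in> Cod" using that unfolding ker_def by blast
  have "s \<lhd> p0" using s q by (rule le_trans)
  then obtain r1 x where 1: "r1 \<lhd> s" "kpres r1 a x" using kpres_ex Ca by blast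
  have "r1 \<lhd> p0" using 1(1) \<open>s \<lhd> p0\<close> by (rule le_trans)
  then obtain r y where r: "r \<lhd> r1" "kpres r d y" using kpres_ex d by blast
  have rp: "r \<lhd> p0" "r \<lhd> q" "r \<lhd> s" using r 1 s \<open>s \<lhd> p0\<close> by (meson le_trans)+
  have x: "kpres r a x" by (rule kpres_mono[OF r(1) 1(2)])
  have "a \<in> ker r" using that(3) forces_mono[OF rp(2)] unfolding ker_def by blast
  then have "r ||- (is_bot C K x)" using kpres_bot[OF rp(1) x] by blast
  moreover have "d - a \<in> ker r" using d ker_I[OF rp(1)] B.I_empty[OF rp(1)] by (simp add: Diff_eq_empty_iff[THEN iffD2] subset_iff)
  then have "r ||- (related K y x)" using kpres_rel[OF rp(1) r(2) x] by blast
  ultimately have "r ||- (is_bot C K y)" using bot_down[OF epi_poset[OF rp(1)] _ kpres_mem[OF rp(1) r(2)]] by blast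
  then show "\<exists>r. r \<lhd> s \<and> d \<in> ker r" using kpres_bot[OF rp(1) r(2)] rp by blast
 qed
 show "b \<in> ker q" if "b \<in> Cod" "b \<subseteq> a" for b using dn that a by blast
 fix b assume b: "b \<in> ker q"
 have Cb: "b \<in> Cod" using b unfolding ker_def by blast
 show "a \<union> b \<in> ker q"
 proof (rule ker_dense[OF Cod_Un[OF Ca Cb]], rule denselyI)
  fix s assume s: "s \<lhd> q"
  have "s \<lhd> p0" using s q by (rule le_trans)
  then obtain r1 x where 1: "r1 \<lhd> s" "kpres r1 a x" using kpres_ex Ca by blast
  have p1: "r1 \<lhd> p0" using 1(1) \<open>s \<lhd> p0\<close> by (rule le_trans)
  then obtain r2 y where 2: "r2 \<lhd> r1" "kpres r2 b y" using kpres_ex Cb by blast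
  have "r2 \<lhd> p0" using 2(1) p1 by (rule le_trans)
  then obtain r z where r: "r \<lhd> r2" "kpres r (a \<union> b) z" using kpres_ex Cod_Un Ca Cb by blast
  have rp: "r \<lhd> p0" "r \<lhd> q" "r \<lhd> s" "r \<lhd> r1" using r 1 2 s \<open>s \<lhd> p0\<close> by (meson le_trans)+
  note xy = kpres_mono[OF rp(4) 1(2)] kpres_mono[OF r(1) 2(2)]
  have "a \<in> ker r" "b \<in> ker r" using a b forces_mono[OF rp(2)] unfolding ker_def by blast+
  then have bots: "r ||- (is_bot C K x)" "r ||- (is_bot C K y)" using kpres_bot[OF rp(1)] xy by blast+
  have j: "r ||- (is_join C K x y z)" using kpres_join[OF rp(1) xy r(2)] .
  have "r ||- (related K z x)"
   using j bots kpres_mem[OF rp(1) xy(1)] poset_refl[OF epi_poset[OF rp(1)]] unfolding is_join_def is_bot_def forces_Conj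
   by (meson forces_BUnivD forces_ImpD forces_ConjI)
  then have "r ||- (is_bot C K z)"
   using bot_down[OF epi_poset[OF rp(1)] bots(1) kpres_mem[OF rp(1) r(2)]] by blast
  then show "\<exists>r. r \<lhd> s \<and> a \<union> b \<in> ker r" using kpres_bot[OF rp(1) r(2)] rp by blast
 qed
qed (use ker_dense in blast)

lemma presentation_epi: "presentation R Cod p0 C K ker kpres"
proof (unfold_locales)
 show "videal p0 ker" by (rule ker_videal)
 show "kpres q c y'" if "kpres q c y" "q ||- (y \<^bold>= y')" for q c y y'
  using that related_cong[OF _ eq_refl] unfolding kpres_def by blast
 show "q ||- (y \<^bold>= z)" if "q \<lhd> p0" "kpres q c y" "kpres q d z" "c - d \<in> ker q" "d - c \<in> ker q" for q c d y z
  using poset_antisym[OF epi_poset[OF that(1)]] kpres_mem[OF that(1)] kpres_rel[OF that(1)] that by blast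
qed (use kpres_Cod kpres_ex kpres_mem kpres_mono kpres_surj kpres_rel in blast)+

end

end

section \<open>The Cantor--Bendixson ideals of a generated algebra\<close>

context level_names
begin

lemma is_empty_lnI:
 assumes "\<And>\<beta>. \<not> \<beta> \<sqsubset> \<alpha>" shows "p ||- (is_empty (ln \<alpha>))"
 unfolding is_empty_def
proof (intro forces_UnivI forces_NegI)
 fix y q assume q: "q \<lhd> p" "q ||- (y \<^bold>\<in> ln \<alpha>)"
 then show False unfolding mem_ln using densely_ex[OF _ le_Field(1)] assms by blast
qed

lemma is_limit_lnI:
 assumes "\<beta> \<sqsubset> \<alpha>" "\<And>\<gamma>. \<not> covers \<gamma> \<alpha>" shows "p ||- (is_limit (ln \<alpha>))"
 unfolding is_limit_def
proof (intro forces_ConjI ordinal_ln forces_NegI)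
 show False if "q \<lhd> p" "q ||- (is_empty (ln \<alpha>))" for q
  using is_empty_ln[OF le_Field(1)[OF that(1)] that(2)] assms(1) by blast
 fix q assume q: "q \<lhd> p" and ex: "q ||- (\<^bold>\<exists>y. is_succ y (ln \<alpha>))"
 from forces_Exis_ex[OF ex le_Field(1)[OF q]]
 obtain r y where r: "r \<lhd> q" "r ||- (is_succ y (ln \<alpha>))" by blast
 \<comment> \<open>\<open>y\<close> is an arbitrary name. Being a member of its own successor it
   belongs to \<open>ln \<alpha>\<close>, so at some extension it equals a canonical name and
   \<open>is_succ_ln\<close> applies.\<close>
 have "r ||- (y \<^bold>\<in> ln \<alpha> \<^bold>\<longleftrightarrow> y \<^bold>\<in> y \<^bold>\<or> y \<^bold>= y)"
  using r(2) unfolding is_succ_def by (rule forces_UnivD)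
 moreover have "r ||- (y \<^bold>\<in> y \<^bold>\<or> y \<^bold>= y)" by (rule forces_DisjI) (use eq_refl in blast)
 ultimately have "r ||- (y \<^bold>\<in> ln \<alpha>)" using forces_IffD by blast
 from densely_ex[OF this[unfolded mem_ln] le_Field(1)[OF r(1)]]
 obtain s \<gamma> where s: "s \<lhd> r" "\<gamma> \<sqsubset> \<alpha>" "s ||- (y \<^bold>= ln \<gamma>)" by blast
 have "s ||- (is_succ (ln \<gamma>) (ln \<alpha>))"
  using forces_mono[OF s(1) r(2)] fiffD[OF fiff_is_succ[OF s(3) eq_refl]] by blast
 then show False using is_succ_ln[OF le_Field(1)[OF s(1)]] lev_less_levs[OF s(2)] assms(2) by blast
qed

lemma is_succ_unique:
 assumes "p ||- (is_succ x y)" "p ||- (is_succ x z)" shows "p ||- (y \<^bold>= z)"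
 unfolding eq_iff_mem
proof (intro allI impI)
 fix q w assume q: "q \<lhd> p"
 have "q ||- (w \<^bold>\<in> y \<^bold>\<longleftrightarrow> w \<^bold>\<in> x \<^bold>\<or> w \<^bold>= x)" "q ||- (w \<^bold>\<in> z \<^bold>\<longleftrightarrow> w \<^bold>\<in> x \<^bold>\<or> w \<^bold>= x)"
  using forces_mono[OF q assms(1)] forces_mono[OF q assms(2)] unfolding is_succ_def
  by (auto simp only: forces.simps(5) split: if_splits)
 then show "q ||- (w \<^bold>\<in> y) \<longleftrightarrow> q ||- (w \<^bold>\<in> z)" using forces_IffD by blast
qed

lemma covers_ex:
 assumes "\<beta> \<sqsubset> \<gamma>" obtains \<alpha> where "covers \<beta> \<alpha>" "\<alpha> \<sqsubset> \<gamma> \<or> \<alpha> = \<gamma>"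
proof -
 obtain \<alpha> where \<alpha>: "\<beta> \<sqsubset> \<alpha>" "\<And>\<delta>. \<delta> \<sqsubset> \<alpha> ==> \<not> \<beta> \<sqsubset> \<delta>"
  using lev_min[OF wo, of "\<lambda>\<alpha>. \<beta> \<sqsubset> \<alpha>", OF assms] by blast
 have "covers \<beta> \<alpha>"
  unfolding covers_def using \<alpha> lev_less_total[OF wo] lev_less_levs by metis
 moreover have "\<alpha> \<sqsubset> \<gamma> \<or> \<alpha> = \<gamma>"
  using lev_less_total[OF wo, of \<alpha> \<gamma>] lev_less_levs assms \<alpha> by metis
 ultimately show ?thesis using that by blast
qed

end

text \<open>\<open>U g\<close> is the code of the generator \<open>g\<close>. Below a generator, everything of smaller rank
 being disregarded, there is only the generator itself.\<close>

locale generators = small_codes R Cod + level_names R \<eta> sn on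
 for R :: "'p rel" and Cod :: "'v set set" and \<eta> :: "'a rel" and sn :: "'a => 'p name" and on +
 fixes G :: "'g set" and U :: "'g => 'v set" and rk :: "'g => 'a lev" and N :: "'p => 'v set set"
 assumes N: "gideal N"
  and U_Cod: "\<And>g. g \<in> G ==> U g \<in> Cod"
  and rk: "\<And>g. g \<in> G ==> rk g \<sqsubset> Hi 2"
  and generated: "\<And>P e. (\<And>g. g \<in> G ==> P (U g)) ==> (\<And>a. a \<in> Cod ==> P a ==> P (- a)) ==>
   (\<And>a b. a \<in> Cod ==> b \<in> Cod ==> P a ==> P b ==> P (a \<inter> b)) ==> e \<in> Cod ==> P e"
  and top: "\<exists>t\<in>G. U t = UNIV \<and> rk t = Hi 1"
  and split: "\<And>g g' p. g \<in> G ==> g' \<in> G ==> p \<in> Field R ==>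
   \<exists>q F. q \<lhd> p \<and> finite F \<and> F \<subseteq> G \<and> (\<forall>f\<in>F. rk f \<sqsubset> rk g) \<and>
    (U g \<inter> U g' - \<Union> (U ` F) \<in> N q \<or> U g - U g' \<in> N q \<and> (g = g' \<or> rk g \<sqsubset> rk g'))"
  and below: "\<And>g \<alpha> F p. g \<in> G ==> \<alpha> \<sqsubset> rk g ==> finite F ==> F \<subseteq> G ==> (\<And>f. f \<in> F ==> rk f \<sqsubset> rk g) ==>
   p \<in> Field R ==> \<exists>q g'. q \<lhd> p \<and> g' \<in> G \<and> rk g' = \<alpha> \<and> U g' - U g \<in> N q \<and> (\<forall>f\<in>F. U g' \<inter> U f \<in> N q)"
  and nz: "\<And>g F p. g \<in> G ==> finite F ==> F \<subseteq> G ==> (\<And>f. f \<in> F ==> rk f \<sqsubset> rk g) ==>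
   p \<in> Field R ==> U g - \<Union> (U ` F) \<notin> N p"
  and Field_small: "|Field \<eta>| \<le>o |UNIV :: 'p set|"
  and G_small: "|G| \<le>o |UNIV :: 'p set|"
begin

lemmas less_trans = lev_less_trans[OF wo]

section \<open>The ideals generated by the codes of smaller rank\<close>

definition fb :: "'a lev => 'g set => bool" where
 "fb \<alpha> F \<longleftrightarrow> finite F \<and> F \<subseteq> G \<and> (\<forall>f\<in>F. rk f \<sqsubset> \<alpha>)"

definition cov :: "'a lev => 'v set => 'p => bool" where
 "cov \<alpha> c r \<longleftrightarrow> (\<exists>F. fb \<alpha> F \<and> c - \<Union> (U ` F) \<in> N r)"

text \<open>Covering is required only densely: the finite set of generators may depend on the
  generic filter, and the ideal has to be closed under density to be a
  \<open>gideal\<close>.\<close>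

definition J :: "'a lev => 'p => 'v set set" where
 "J \<alpha> q = {c \<in> Cod. densely q (cov \<alpha> c)}"

lemma UF_Cod: "fb \<alpha> F ==> \<Union> (U ` F) \<in> Cod"
 unfolding fb_def by (intro Cod_UN U_Cod) auto

lemma cov_mono: "r \<lhd> q ==> cov \<alpha> c q ==> cov \<alpha> c r"
 using gideal_mono[OF N] unfolding cov_def by blast

lemma cov_N: "c \<in> N r ==> cov \<alpha> c r"
 unfolding cov_def by (rule exI[of _ "{}"]) (simp add: fb_def)

lemma cov_down: "r \<in> Field R ==> cov \<alpha> c r ==> d \<in> Cod ==> d \<subseteq> c ==> cov \<alpha> d r"
 unfolding cov_def
proof (elim exE conjE, intro exI conjI)
 fix F assume F: "r \<in> Field R" "d \<in> Cod" "d \<subseteq> c" "fb \<alpha> F" "c - \<Union> (U ` F) \<in> N r"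
 show "d - \<Union> (U ` F) \<in> N r"
  by (rule gideal_down[OF N F(1,5)]) (use F Cod_Diff UF_Cod in auto)
qed

lemma cov_Un:
 assumes r: "r \<in> Field R" and c: "cov \<alpha> c r" "cov \<alpha> d r" "c \<in> Cod" "d \<in> Cod"
 shows "cov \<alpha> (c \<union> d) r"
proof -
 obtain F F' where F: "fb \<alpha> F" "c - \<Union> (U ` F) \<in> N r" "fb \<alpha> F'" "d - \<Union> (U ` F') \<in> N r"
  using c unfolding cov_def by blast
 have fb: "fb \<alpha> (F \<union> F')" using F unfolding fb_def by auto
 have "(c \<union> d) - \<Union> (U ` (F \<union> F')) \<in> N r"
  by (rule gideal_down2[OF N r F(2,4)]) (use c UF_Cod[OF fb] Cod_Diff Cod_Un in auto)
 then show ?thesis using fb unfolding cov_def by blast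
qed

lemma cov_lift: "\<alpha> \<sqsubset> \<beta> ==> cov \<alpha> c r ==> cov \<beta> c r"
 unfolding cov_def fb_def using less_trans by meson

lemma J_covI: "r \<in> Field R ==> c \<in> Cod ==> cov \<alpha> c r ==> c \<in> J \<alpha> r"
 unfolding J_def using densely_const[of "cov \<alpha> c" r] cov_mono by blast

lemma N_J: "r \<in> Field R ==> N r \<subseteq> J \<alpha> r"
 using J_covI cov_N gideal_Cod[OF N] by blast

lemma J_gideal: "gideal (J \<alpha>)"
 unfolding gideal_def videal_def
proof (intro allI impI conjI ballI)
 fix p q assume "q \<lhd> p"
 then have q: "q \<in> Field R" by (rule le_Field)
 show "J \<alpha> q \<subseteq> Cod" unfolding J_def by blast
 show "{} \<in> J \<alpha> q" using N_J[OF q] gideal_empty[OF N q] by blast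
 show "J \<alpha> q \<subseteq> J \<alpha> r" if "r \<lhd> q" for r
  unfolding J_def using densely_le that by blast
 show "a \<in> J \<alpha> q" if "a \<in> Cod" "densely q (\<lambda>r. a \<in> J \<alpha> r)" for a
  using that densely_densely[of q "cov \<alpha> a"] unfolding J_def by (simp add: densely_def)
 fix a assume a: "a \<in> J \<alpha> q"
 show "b \<in> J \<alpha> q" if "b \<in> Cod" "b \<subseteq> a" for b
  using a that cov_down[OF le_Field(1)] unfolding J_def by (auto elim!: densely_mono[rotated] simp: densely_def, meson le_Field)
 show "a \<union> b \<in> J \<alpha> q" if b: "b \<in> J \<alpha> q" for b
 proof -
  have C: "a \<in> Cod" "b \<in> Cod" using a b unfolding J_def by auto
  have "densely q (\<lambda>r. cov \<alpha> a r \<and> cov \<alpha> b r)"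
   using a b cov_mono unfolding J_def by (intro densely_conj) auto
  then have "densely q (cov \<alpha> (a \<union> b))"
   by (rule densely_mono) (use cov_Un C le_Field in blast)
  then show ?thesis using C Cod_Un unfolding J_def by blast
 qed
qed

lemma J_mono: "\<alpha> \<sqsubset> \<beta> ==> J \<alpha> q \<subseteq> J \<beta> q"
 unfolding J_def using cov_lift by (auto elim: densely_mono)

lemma U_J: "q \<in> Field R ==> g \<in> G ==> rk g \<sqsubset> \<alpha> ==> U g \<in> J \<alpha> q"
 by (rule J_covI) (auto simp: U_Cod cov_def fb_def gideal_empty[OF N] intro!: exI[of _ "{g}"])

lemma UF_J: "q \<in> Field R ==> fb \<alpha> F ==> \<Union> (U ` F) \<in> J \<alpha> q"
 by (rule J_covI) (auto simp: UF_Cod cov_def gideal_empty[OF N])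

text \<open>Modulo codes of smaller rank, every code densely either contains \<open>U g\<close> or
  is disjoint from it. Generators do so by \<open>split\<close>, complements exchange the two cases,
  and for an intersection one small half or two small differences suffice. Hence \<open>U g\<close>
  becomes an atom at its own level.\<close>

lemma split_code:
 assumes g: "g \<in> G" and e: "e \<in> Cod"
 shows "densely p (\<lambda>r. cov (rk g) (U g \<inter> e) r \<or> cov (rk g) (U g - e) r)"
 using e
proof (induction arbitrary: p rule: generated[rotated -1, consumes 1])
 case (1 g')
 show ?case
 proof (rule denselyI)
  fix s assume "s \<lhd> p"
  then obtain q F where q: "q \<lhd> s" "finite F" "F \<subseteq> G" "\<forall>f\<in>F. rk f \<sqsubset> rk g"
   "U g \<inter> U g' - \<Union> (U ` F) \<in> N q \<or> U g - U g' \<in> N q"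
   using split[OF g 1 le_Field(1)] by metis
  have "cov (rk g) (U g \<inter> U g') q \<or> cov (rk g) (U g - U g') q"
   using q(5)
  proof
   assume "U g \<inter> U g' - \<Union> (U ` F) \<in> N q"
   then have "cov (rk g) (U g \<inter> U g') q" unfolding cov_def fb_def using q(2-4) by (intro exI[of _ F]) simp
   then show ?thesis ..
  next
   assume "U g - U g' \<in> N q"
   then show ?thesis by (intro disjI2 cov_N)
  qed
  then show "\<exists>r. r \<lhd> s \<and> (cov (rk g) (U g \<inter> U g') r \<or> cov (rk g) (U g - U g') r)"
   using q(1) by blast
 qed
next
 case (2 a)
 then show ?case by (simp add: Diff_eq Int_commute disj_commute)
next
 case (3 a b)
 show ?case
 proof (rule denselyI)
  fix s assume s: "s \<lhd> p"
  obtain q where q: "q \<lhd> s" "cov (rk g) (U g \<inter> a) q \<or> cov (rk g) (U g - a) q"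
   using denselyD[OF 3(3) s] by blast
  have "q \<lhd> p" using q(1) s by (rule le_trans)
  then obtain r where r: "r \<lhd> q" "cov (rk g) (U g \<inter> b) r \<or> cov (rk g) (U g - b) r"
   using denselyD[OF 3(4)] by blast
  have f: "r \<in> Field R" by (rule le_Field[OF r(1)])
  have "cov (rk g) (U g \<inter> (a \<inter> b)) r \<or> cov (rk g) (U g - a \<inter> b) r"
  proof (cases "cov (rk g) (U g \<inter> a) r \<or> cov (rk g) (U g \<inter> b) r")
   case True
   have "U g \<inter> (a \<inter> b) \<in> Cod" by (intro Cod_Int U_Cod g 3(1,2))
   then have "cov (rk g) (U g \<inter> (a \<inter> b)) r"
    using True cov_down[OF f, where d = "U g \<inter> (a \<inter> b)" and c = "U g \<inter> a"]
     cov_down[OF f, where d = "U g \<inter> (a \<inter> b)" and c = "U g \<inter> b"] by auto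
   then show ?thesis ..
  next
   case False
   then have "cov (rk g) (U g - a) r" "cov (rk g) (U g - b) r"
    using q(2) r(2) cov_mono[OF r(1)] by auto
   then have "cov (rk g) ((U g - a) \<union> (U g - b)) r"
    by (intro cov_Un f Cod_Diff U_Cod g 3(1,2))
   then show ?thesis by (simp add: Diff_Int)
  qed
  then show "\<exists>r. r \<lhd> s \<and> (cov (rk g) (U g \<inter> (a \<inter> b)) r \<or> cov (rk g) (U g - a \<inter> b) r)"
   using le_trans[OF r(1) q(1)] by blast
 qed
qed

text \<open>The heart of superatomicity; \<open>I\<close> will be the kernel of an arbitrary
  epimorphism. Take a generator \<open>g\<close> of least rank for which
  \<open>c \<inter> U g\<close> stays outside \<open>I\<close> below some \<open>r\<close>; the
  generator with code \<open>UNIV\<close> shows that one exists. The intersections of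
  \<open>c\<close> with generators of smaller rank lie in \<open>I\<close>, so
  \<open>split_code\<close> turns \<open>c \<inter> U g\<close> into an atom modulo
  \<open>I\<close>.\<close>

lemma exists_vatom:
 assumes I: "videal p0 I" and NI: "\<And>q. q \<lhd> p0 ==> N q \<subseteq> I q"
  and q: "q \<lhd> p0" "c \<in> Cod" and nz: "\<And>r. r \<lhd> q ==> c \<notin> I r"
 shows "\<exists>r a. r \<lhd> q \<and> a \<subseteq> c \<and> vatom I r a"
proof -
 obtain t where t: "t \<in> G" "U t = UNIV" "rk t = Hi 1" using top by blast
 let ?P = "\<lambda>\<alpha>. \<exists>g\<in>G. rk g = \<alpha> \<and> (\<exists>r. r \<lhd> q \<and> (\<forall>s. s \<lhd> r --> c \<inter> U g \<notin> I s))"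
 have "?P (Hi 1)" using t nz le_refl1(1)[OF q(1)] by (intro bexI[of _ t]) auto
 then obtain \<alpha> where \<alpha>: "?P \<alpha>" "\<And>\<beta>. \<beta> \<sqsubset> \<alpha> ==> \<not> ?P \<beta>" using lev_min[OF wo, of ?P] by blast
 then obtain g r where g: "g \<in> G" "rk g = \<alpha>" and r: "r \<lhd> q" "\<And>s. s \<lhd> r ==> c \<inter> U g \<notin> I s" by blast
 have low: "c \<inter> U f \<in> I s" if f: "f \<in> G" "rk f \<sqsubset> \<alpha>" and s: "s \<lhd> q" for f s
 proof -
  \<comment> \<open>Minimality of the rank denies that \<open>c \<inter> U f\<close> avoids
    \<open>I\<close> at all extensions of some condition below \<open>q\<close>, which means that it
    lies in \<open>I\<close> densely below \<open>q\<close>.\<close>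
  have "densely q (\<lambda>s. c \<inter> U f \<in> I s)" unfolding densely_def using \<alpha>(2)[OF f(2)] f(1) by blast
  then have "c \<inter> U f \<in> I q" by (rule videal_dense[OF I q(1) Cod_Int[OF q(2) U_Cod[OF f(1)]]])
  then show ?thesis by (rule videal_mono[OF I q(1) s])
 qed
 have aC: "c \<inter> U g \<in> Cod" by (rule Cod_Int[OF q(2) U_Cod[OF g(1)]])
 have "vatom I r (c \<inter> U g)"
  unfolding vatom_def
 proof (intro conjI ballI allI impI aC r(2))
  fix e s assume e: "e \<in> Cod" and s: "s \<lhd> r"
  have small: "c \<inter> U g \<inter> d \<in> I t" if d: "d \<in> Cod" "cov \<alpha> (U g \<inter> d) t" and t: "t \<lhd> s" for d t
  proof -
   obtain F where F: "fb \<alpha> F" "U g \<inter> d - \<Union> (U ` F) \<in> N t" using d(2) unfolding cov_def by blast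
   have tq: "t \<lhd> q" "t \<lhd> p0" using t s r(1) q(1) by (meson le_trans)+
   have 1: "\<Union> ((\<lambda>f. c \<inter> U f) ` F) \<in> I t"
    using F(1) low tq unfolding fb_def by (intro videal_UN[OF I tq(2)]) auto
   have 2: "U g \<inter> d - \<Union> (U ` F) \<in> I t" using NI[OF tq(2)] F(2) by blast
   show ?thesis
    by (rule videal_down[OF I tq(2) videal_Un[OF I tq(2) 1 2]]) (use Cod_Int aC d in auto)
  qed
  show "densely s (\<lambda>t. c \<inter> U g \<inter> e \<in> I t \<or> c \<inter> U g - e \<in> I t)"
   using split_code[OF g(1) e, unfolded g(2)]
  proof (rule densely_mono)
   fix t assume t: "t \<lhd> s" "cov \<alpha> (U g \<inter> e) t \<or> cov \<alpha> (U g - e) t"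
   then show "c \<inter> U g \<inter> e \<in> I t \<or> c \<inter> U g - e \<in> I t"
    using small[OF e _ t(1)] small[OF Cod_compl[OF e] _ t(1)] by (auto simp: Diff_eq)
  qed
 qed
 then show ?thesis using r(1) by blast
qed

lemma U_notin_J: "g \<in> G ==> q \<in> Field R ==> U g \<notin> J (rk g) q"
proof
 assume g: "g \<in> G" "q \<in> Field R" "U g \<in> J (rk g) q"
 then obtain r where r: "r \<lhd> q" "cov (rk g) (U g) r" unfolding J_def using densely_ex by blast
 then show False using nz[OF g(1)] le_Field(1)[OF r(1)] unfolding cov_def fb_def by blast
qed

lemma vatom_J:
 assumes g: "g \<in> G" shows "vatom (J (rk g)) q (U g)"
 unfolding vatom_def
proof (intro conjI ballI allI impI)
 show "U g \<notin> J (rk g) r" if "r \<lhd> q" for r using U_notin_J[OF g le_Field(1)[OF that]] .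
 fix e r assume e: "e \<in> Cod" "r \<lhd> q"
 show "densely r (\<lambda>s. U g \<inter> e \<in> J (rk g) s \<or> U g - e \<in> J (rk g) s)"
  using split_code[OF g e(1)]
 proof (rule densely_mono)
  fix s assume s: "s \<lhd> r" "cov (rk g) (U g \<inter> e) s \<or> cov (rk g) (U g - e) s"
  note J = J_covI[OF le_Field(1)[OF s(1)]]
  show "U g \<inter> e \<in> J (rk g) s \<or> U g - e \<in> J (rk g) s"
   using s(2) J[OF Cod_Int[OF U_Cod[OF g] e(1)]] J[OF Cod_Diff[OF U_Cod[OF g] e(1)]] by blast
 qed
qed (rule U_Cod[OF g])

text \<open>Needed to recognise all atoms of level \<open>\<alpha>\<close>. A generator
  \<open>g\<close> of least rank \<open>\<beta>\<close> that meets \<open>b\<close> outside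
  \<open>J \<alpha>\<close> lies inside \<open>b\<close> up to a finite set \<open>F\<close> of
  smaller ranks. Its rank is not below \<open>\<alpha>\<close>; if \<open>\<beta>\<close> exceeds
  \<open>\<alpha>\<close>, \<open>below\<close> supplies a generator of rank \<open>\<alpha>\<close>
  inside \<open>U g\<close> that avoids \<open>F\<close>.\<close>

lemma J_atom_below:
 assumes b: "b \<in> Cod" "q \<in> Field R" and \<alpha>: "\<alpha> \<sqsubset> Hi 2" and nzb: "\<And>r. r \<lhd> q ==> b \<notin> J \<alpha> r"
 shows "\<exists>r g. r \<lhd> q \<and> g \<in> G \<and> rk g = \<alpha> \<and> U g - b \<in> J \<alpha> r"
proof -
 note J = J_gideal[of \<alpha>]
 obtain t where t: "t \<in> G" "U t = UNIV" "rk t = Hi 1" using top by blast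
 let ?P = "\<lambda>\<beta>. \<exists>g\<in>G. rk g = \<beta> \<and> (\<exists>r. r \<lhd> q \<and> (\<forall>s. s \<lhd> r --> b \<inter> U g \<notin> J \<alpha> s))"
 have "?P (Hi 1)" using t nzb le_refl[OF b(2)] by (intro bexI[of _ t]) auto
 then obtain \<beta> where \<beta>: "?P \<beta>" "\<And>\<gamma>. \<gamma> \<sqsubset> \<beta> ==> \<not> ?P \<gamma>" using lev_min[OF wo, of ?P] by blast
 then obtain g r where g: "g \<in> G" "rk g = \<beta>" and r: "r \<lhd> q" "\<And>s. s \<lhd> r ==> b \<inter> U g \<notin> J \<alpha> s" by blast
 have low: "b \<inter> U f \<in> J \<alpha> s" if f: "f \<in> G" "rk f \<sqsubset> \<beta>" and s: "s \<lhd> q" for f s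
 proof -
  have "densely q (\<lambda>s. b \<inter> U f \<in> J \<alpha> s)" unfolding densely_def using \<beta>(2)[OF f(2)] f(1) by blast
  then have "b \<inter> U f \<in> J \<alpha> q" by (rule gideal_dense[OF J b(2) Cod_Int[OF b(1) U_Cod[OF f(1)]]])
  then show ?thesis by (rule gideal_mono[OF J s])
 qed
 obtain s where s: "s \<lhd> r" "cov \<beta> (U g \<inter> b) s \<or> cov \<beta> (U g - b) s"
  using densely_ex[OF split_code[OF g(1) b(1), of r] le_Field(1)[OF r(1)]] g(2) by blast
 have sq: "s \<lhd> q" using s(1) r(1) by (rule le_trans)
 note f = le_Field(1)[OF s(1)]
 have "\<not> cov \<beta> (U g \<inter> b) s"
 proof
  assume "cov \<beta> (U g \<inter> b) s"
  then obtain F where F: "fb \<beta> F" "U g \<inter> b - \<Union> (U ` F) \<in> N s" unfolding cov_def by blast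
  have 1: "\<Union> ((\<lambda>f. b \<inter> U f) ` F) \<in> J \<alpha> s"
   using F(1) low sq unfolding fb_def by (intro videal_UN[OF gidealD[OF J] le_refl[OF f]]) auto
  have 2: "U g \<inter> b - \<Union> (U ` F) \<in> J \<alpha> s" using N_J[OF f] F(2) by blast
  have "b \<inter> U g \<in> J \<alpha> s"
   by (rule gideal_down2[OF J f 1 2]) (use Cod_Int U_Cod b g in auto)
  then show False using r(2) s(1) by blast
 qed
 then obtain F where F: "fb \<beta> F" "U g - b - \<Union> (U ` F) \<in> N s" using s(2) unfolding cov_def by blast
 have "\<not> \<beta> \<sqsubset> \<alpha>"
 proof
  assume "\<beta> \<sqsubset> \<alpha>"
  then have "U g \<in> J \<alpha> s" using U_J[OF f g(1)] g(2) by blast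
  then have "b \<inter> U g \<in> J \<alpha> s" by (rule gideal_down[OF J f]) (use Cod_Int U_Cod b g in auto)
  then show False using r(2) s(1) by blast
 qed
 then consider "\<beta> = \<alpha>" | "\<alpha> \<sqsubset> \<beta>"
  using lev_less_total[OF wo, of \<beta> \<alpha>] lev_less_levs rk[OF g(1)] g(2) \<alpha> by blast
 then show ?thesis
 proof cases
  case 1
  have "U g - b \<in> J \<alpha> s"
   by (rule J_covI[OF f]) (use F 1 Cod_Diff U_Cod b g in \<open>auto simp: cov_def\<close>)
  then show ?thesis using sq g 1 by blast
 next
  case 2
  obtain u g' where u: "u \<lhd> s" "g' \<in> G" "rk g' = \<alpha>" "U g' - U g \<in> N u" "\<forall>f\<in>F. U g' \<inter> U f \<in> N u"
   using below[OF g(1), of \<alpha> F s] 2 g(2) F(1) f unfolding fb_def by blast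
  note fu = le_Field(1)[OF u(1)]
  have 1: "\<Union> ((\<lambda>f. U g' \<inter> U f) ` F) \<in> N u"
   using F(1) u(5) unfolding fb_def by (intro videal_UN[OF gidealD[OF N] le_refl[OF fu]]) auto
  have 2: "U g - b - \<Union> (U ` F) \<in> N u" by (rule gideal_mono[OF N u(1) F(2)])
  have "U g' - b \<in> N u"
   by (rule gideal_down[OF N fu gideal_Un[OF N fu u(4) gideal_Un[OF N fu 1 2]]])
    (use Cod_Diff U_Cod u b in auto)
  then have "U g' - b \<in> J \<alpha> u" using N_J[OF fu] by blast
  then show ?thesis using u le_trans[OF u(1) sq] by blast
 qed
qed

text \<open>Converse of \<open>vatom_J\<close>: a generator of rank \<open>\<alpha>\<close> can be
  placed below the atom \<open>b\<close>, and not being null it exhausts \<open>b\<close>.\<close>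

lemma vatom_J_cases:
 assumes at: "vatom (J \<alpha>) q b" and \<alpha>: "\<alpha> \<sqsubset> Hi 2"
 shows "densely q (\<lambda>r. \<exists>g\<in>G. rk g = \<alpha> \<and> cong_in (J \<alpha>) r b (U g))"
proof (rule denselyI)
 fix s assume s: "s \<lhd> q"
 note J = J_gideal[of \<alpha>]
 have b: "b \<in> Cod" using at unfolding vatom_def by blast
 have "b \<notin> J \<alpha> r" if "r \<lhd> s" for r using at le_trans[OF that s] unfolding vatom_def by blast
 then obtain r g where r: "r \<lhd> s" "g \<in> G" "rk g = \<alpha>" "U g - b \<in> J \<alpha> r"
  using J_atom_below[OF b le_Field(1)[OF s] \<alpha>] by blast
 have rq: "r \<lhd> q" using r(1) s by (rule le_trans)
 have "densely r (\<lambda>s. b \<inter> U g \<in> J \<alpha> s \<or> b - U g \<in> J \<alpha> s)"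
  using at U_Cod[OF r(2)] rq unfolding vatom_def by blast
 then obtain u where u: "u \<lhd> r" "b \<inter> U g \<in> J \<alpha> u \<or> b - U g \<in> J \<alpha> u"
  using densely_ex le_Field(1)[OF r(1)] by blast
 note f = le_Field(1)[OF u(1)]
 have *: "U g - b \<in> J \<alpha> u" by (rule gideal_mono[OF J u(1) r(4)])
 have "b \<inter> U g \<notin> J \<alpha> u"
 proof
  assume "b \<inter> U g \<in> J \<alpha> u"
  then have "U g \<in> J \<alpha> u" using * by (rule gideal_down2[OF J f]) (use U_Cod r in auto)
  then show False using U_notin_J[OF r(2) f] r(3) by blast
 qed
 then have "cong_in (J \<alpha>) u b (U g)" using u(2) * unfolding cong_in_def by blast
 then show "\<exists>r. r \<lhd> s \<and> (\<exists>g\<in>G. rk g = \<alpha> \<and> cong_in (J \<alpha>) r b (U g))"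
  using r le_trans[OF u(1) r(1)] by blast
qed

text \<open>The alternative of \<open>split\<close> in which one code contains the other requires a
  smaller rank or equal generators. So distinct generators of one rank give distinct atoms, and the
  width of a level can be counted on them.\<close>

lemma cong_in_J_eq:
 assumes g: "g \<in> G" "g' \<in> G" "rk g = rk g'" and q: "q \<in> Field R" and c: "cong_in (J (rk g)) q (U g) (U g')"
 shows "g = g'"
proof (rule ccontr)
 assume ne: "g \<noteq> g'"
 note J = J_gideal[of "rk g"]
 obtain r F where r: "r \<lhd> q" "fb (rk g) F" "U g \<inter> U g' - \<Union> (U ` F) \<in> N r"
  using split[OF g(1,2) q] g(3) ne lev_less_irrefl unfolding fb_def by metis
 note f = le_Field(1)[OF r(1)]
 have 1: "U g - U g' \<in> J (rk g) r" using c gideal_mono[OF J r(1)] unfolding cong_in_def by blast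
 have 2: "U g \<inter> U g' - \<Union> (U ` F) \<in> J (rk g) r" using N_J[OF f] r(3) by blast
 have "U g \<in> J (rk g) r"
  by (rule gideal_down[OF J f gideal_Un[OF J f 1 gideal_Un[OF J f 2 UF_J[OF f r(2)]]]]) (use U_Cod g in auto)
 then show False using U_notin_J[OF g(1) f] by blast
qed

lemma J_zero:
 assumes "\<And>\<beta>. \<not> \<beta> \<sqsubset> \<alpha>" "q \<in> Field R" shows "J \<alpha> q = N q"
proof
 show "J \<alpha> q \<subseteq> N q"
 proof
  fix c assume c: "c \<in> J \<alpha> q"
  have "densely q (\<lambda>r. c \<in> N r)"
   using c assms(1) unfolding J_def cov_def fb_def by (auto elim!: densely_mono)
  then show "c \<in> N q" using gideal_dense[OF N assms(2)] c unfolding J_def by blast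
 qed
qed (rule N_J[OF assms(2)])

text \<open>A finite set of ranks below a limit level is bounded by one smaller level; density
  enters because a finite cover is fixed only at extensions.\<close>

lemma J_limit:
 assumes lim: "\<beta> \<sqsubset> \<alpha>" "\<And>\<gamma>. \<not> covers \<gamma> \<alpha>" and c: "c \<in> J \<alpha> q"
 shows "densely q (\<lambda>r. \<exists>\<gamma>. \<gamma> \<sqsubset> \<alpha> \<and> c \<in> J \<gamma> r)"
proof -
 have C: "c \<in> Cod" and d: "densely q (cov \<alpha> c)" using c unfolding J_def by auto
 have bound: "\<exists>\<gamma>. \<gamma> \<sqsubset> \<alpha> \<and> (\<forall>f\<in>F. rk f \<sqsubset> \<gamma>)" if "finite F" "\<forall>f\<in>F. rk f \<sqsubset> \<alpha>" for F
  using that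
 proof (induction F rule: finite_induct)
  case (insert f F)
  then obtain \<gamma> where \<gamma>: "\<gamma> \<sqsubset> \<alpha>" "\<forall>f\<in>F. rk f \<sqsubset> \<gamma>" by auto
  have f: "rk f \<sqsubset> \<alpha>" using insert by auto
  show ?case
  proof (cases "rk f \<sqsubset> \<gamma>")
   case True
   then show ?thesis using \<gamma> by blast
  next
   case False
   obtain \<delta> where \<delta>: "\<delta> \<sqsubset> \<alpha>" "\<not> (\<delta> \<sqsubset> rk f \<or> \<delta> = rk f)" using lim(2)[of "rk f"] f unfolding covers_def by blast
   have "rk f \<sqsubset> \<delta>" using \<delta> lev_less_total[OF wo] lev_less_levs f by metis
   moreover have "\<gamma> \<sqsubset> rk f \<or> \<gamma> = rk f" using False lev_less_total[OF wo] lev_less_levs f \<gamma>(1) by metis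
   ultimately show ?thesis using \<delta>(1) \<gamma>(2) less_trans by (intro exI[of _ \<delta>]) (metis insert_iff)
  qed
 qed (use lim in auto)
 show ?thesis
  using d
 proof (rule densely_mono)
  fix r assume r: "r \<lhd> q" "cov \<alpha> c r"
  then obtain F where F: "fb \<alpha> F" "c - \<Union> (U ` F) \<in> N r" unfolding cov_def by blast
  obtain \<gamma> where "\<gamma> \<sqsubset> \<alpha>" "\<forall>f\<in>F. rk f \<sqsubset> \<gamma>" using bound F(1) unfolding fb_def by blast
  moreover from this have "cov \<gamma> c r" using F unfolding cov_def fb_def by blast
  ultimately show "\<exists>\<gamma>. \<gamma> \<sqsubset> \<alpha> \<and> c \<in> J \<gamma> r" using J_covI[OF le_Field(1)[OF r(1)] C] by blast
 qed
qed

lemma J_top: "q \<in> Field R ==> J (Hi 2) q = Cod"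
proof
 assume q: "q \<in> Field R"
 obtain t where t: "t \<in> G" "U t = UNIV" "rk t = Hi 1" using top by blast
 then have "UNIV \<in> J (Hi 2) q" using U_J[OF q t(1), of "Hi 2"] by simp
 then show "Cod \<subseteq> J (Hi 2) q" using gideal_down[OF J_gideal q] by blast
 show "J (Hi 2) q \<subseteq> Cod" unfolding J_def by blast
qed

lemma UNIV_notin_J: "q \<in> Field R ==> \<alpha> \<sqsubset> Hi 1 \<or> \<alpha> = Hi 1 ==> UNIV \<notin> J \<alpha> q"
 using top U_notin_J J_mono by (metis subsetD)

lemma atom_in_J_succ:
 assumes "vatom (J \<beta>) q a" "covers \<beta> \<alpha>" "\<beta> \<sqsubset> Hi 2" "q \<in> Field R"
 shows "a \<in> J \<alpha> q"
proof (rule gideal_dense[OF J_gideal assms(4)])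
 show C: "a \<in> Cod" using assms(1) unfolding vatom_def by blast
 have less: "\<beta> \<sqsubset> \<alpha>" using assms(2) unfolding covers_def by blast
 show "densely q (\<lambda>r. a \<in> J \<alpha> r)"
  using vatom_J_cases[OF assms(1,3)]
 proof (rule densely_mono)
  fix r assume r: "r \<lhd> q" "\<exists>g\<in>G. rk g = \<beta> \<and> cong_in (J \<beta>) r a (U g)"
  then obtain g where g: "g \<in> G" "rk g = \<beta>" "a - U g \<in> J \<beta> r" unfolding cong_in_def by blast
  note f = le_Field(1)[OF r(1)]
  have "a - U g \<in> J \<alpha> r" "U g \<in> J \<alpha> r" using g J_mono[OF less] U_J[OF f g(1)] less by auto
  then show "a \<in> J \<alpha> r" by (rule gideal_down2[OF J_gideal f]) (use C in auto)
 qed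
qed

lemma N_le_J: "\<forall>q\<in>Field R. N q \<subseteq> J \<alpha> q"
 using N_J by blast

section \<open>The algebra in the extension: superatomicity, ideals, height and widths\<close>

abbreviation B where "B \<equiv> alg N"
abbreviation L where "L \<equiv> leq N"
abbreviation Id_name where "Id_name \<alpha> \<equiv> idl N (J \<alpha>)"

text \<open>A homomorphic image is presented by its kernel, which contains \<open>N\<close>, so that
  \<open>exists_vatom\<close> applies to it.\<close>

lemma superatomic:
 assumes p: "p \<in> Field R" shows "p ||- (is_superatomic B L)"
 unfolding is_superatomic_def
proof (intro forces_ConjI forces_UnivI forces_ImpI)
 interpret B: presentation R Cod p B L N "qpres N" by (rule presentation_alg[OF N])
 show "p ||- (is_boolean_algebra B L)" by (rule B.boolean_algebra[OF le_refl[OF p]])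
 fix C K h q assume q: "q \<lhd> p" "q ||- (is_epimorphism B L C K h)"
 note f = le_Field(1)[OF q(1)]
 interpret C: presentation R Cod q C K "ker N C K h" "kpres N h"
  by (rule presentation_epi[OF N f q(2)])
 show "q ||- (is_atomic C K)"
  using exists_vatom[OF C.vid ker_I[OF N f q(2)]] by (intro C.atomicI le_refl f) blast
qed

text \<open>One direction of \<open>key\<close> is the bound by an ideal containing all atoms, the
  other is the finite cover: a generator of rank below \<open>\<alpha>\<close> either has rank
  \<open>\<beta>\<close> and is an atom modulo \<open>J \<beta>\<close>, or has smaller rank and is
  null.\<close>

lemma derivative:
 assumes c: "covers \<beta> \<alpha>" and \<alpha>: "\<alpha> \<sqsubset> Hi 3" and p: "p \<in> Field R"
 shows "p ||- (is_CB_derivative B L (Id_name \<beta>) (Id_name \<alpha>))"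
proof -
 interpret B: presentation R Cod p B L N "qpres N" by (rule presentation_alg[OF N])
 interpret C: presentation R Cod p "alg (J \<beta>)" "leq (J \<beta>)" "J \<beta>" "qpres (J \<beta>)" by (rule presentation_alg[OF J_gideal])
 have less: "\<beta> \<sqsubset> \<alpha>" and le: "\<And>\<gamma>. \<gamma> \<sqsubset> \<alpha> ==> \<gamma> \<sqsubset> \<beta> \<or> \<gamma> = \<beta>" using c unfolding covers_def by auto
 have \<beta>2: "\<beta> \<sqsubset> Hi 2" using less \<alpha> by (cases \<alpha>; cases \<beta>) (auto intro: FieldI1)
 have sub: "\<forall>q. q \<lhd> p --> J \<beta> q \<subseteq> J \<alpha> q" using J_mono[OF less] by blast
 have key: "q ||- (in_atom_ideal (alg (J \<beta>)) (leq (J \<beta>)) y) \<longleftrightarrow> c \<in> J \<alpha> q"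
  if q: "q \<lhd> p" and y: "qpres (J \<beta>) q c y" for q c y
 proof
  assume "q ||- (in_atom_ideal (alg (J \<beta>)) (leq (J \<beta>)) y)"
  then show "c \<in> J \<alpha> q"
   using atom_in_J_succ[OF _ c \<beta>2 le_Field(1)] by (intro C.in_atom_ideal_bound[OF le_refl[OF p] gidealD[OF J_gideal] sub _ q y])
 next
  assume "c \<in> J \<alpha> q"
  then have d: "densely q (cov \<alpha> c)" unfolding J_def by blast
  show "q ||- (in_atom_ideal (alg (J \<beta>)) (leq (J \<beta>)) y)"
  proof (rule C.in_atom_idealI[OF q y])
   fix r assume "r \<lhd> q"
   then obtain s F where s: "s \<lhd> r" "fb \<alpha> F" "c - \<Union> (U ` F) \<in> N s"
    using denselyD[OF d] unfolding cov_def by blast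
   note f = le_Field(1)[OF s(1)]
   have "\<forall>f\<in>U ` F. f \<in> J \<beta> s \<or> vatom (J \<beta>) s f"
    using s(2) le U_J[OF f] vatom_J unfolding fb_def by (metis imageE subsetD)
   then show "\<exists>s F. s \<lhd> r \<and> finite F \<and> (\<forall>f\<in>F. f \<in> J \<beta> s \<or> vatom (J \<beta>) s f) \<and> c - \<Union> F \<in> J \<beta> s"
    using s N_J[OF f] unfolding fb_def by (intro exI[of _ s] exI[of _ "U ` F"]) auto
  qed
 qed
 show ?thesis
  unfolding is_CB_derivative_def
 proof (rule forces_ExisI[where \<sigma> = "alg (J \<beta>)"], rule forces_ExisI[where \<sigma> = "leq (J \<beta>)"],
   rule forces_ExisI[where \<sigma> = "hom N (J \<beta>)"], intro forces_ConjI forces_UnivI forces_IffI)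
  show "p ||- (is_quotient B L (Id_name \<beta>) (alg (J \<beta>)) (leq (J \<beta>)) (hom N (J \<beta>)))"
   by (rule quotient_hom[OF N J_gideal N_le_J p])
 next
  fix b q assume q: "q \<lhd> p" "q ||- (b \<^bold>\<in> Id_name \<alpha>)"
  then show "q ||- (b \<^bold>\<in> B)" using idl_sub_alg[OF N J_gideal N_le_J] by blast
  then show "q ||- (\<^bold>\<exists>y. related (hom N (J \<beta>)) b y \<^bold>\<and> in_atom_ideal (alg (J \<beta>)) (leq (J \<beta>)) y)"
  proof (rule B.elemE[OF q(1)])
   fix r c assume r: "r \<lhd> q" "qpres N r c b"
   note f = le_Field(1)[OF r(1)]
   have rp: "r \<lhd> p" using r(1) q(1) by (rule le_trans)
   have "c \<in> J \<alpha> r" using mem_idl_iff[OF N J_gideal N_le_J f r(2)] forces_mono[OF r(1) q(2)] by blast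
   moreover have y: "qpres (J \<beta>) r c (cls (J \<beta>) c)" using r(2) qpres_cls unfolding qpres_def by blast
   ultimately have "r ||- (in_atom_ideal (alg (J \<beta>)) (leq (J \<beta>)) (cls (J \<beta>) c))" using key[OF rp y] by blast
   moreover have "r ||- (related (hom N (J \<beta>)) b (cls (J \<beta>) c))"
    using related_hom[OF N J_gideal N_le_J f r(2)] y by blast
   ultimately show "r ||- (\<^bold>\<exists>y. related (hom N (J \<beta>)) b y \<^bold>\<and> in_atom_ideal (alg (J \<beta>)) (leq (J \<beta>)) y)"
    by (meson forces_ExisI forces_ConjI)
  qed
 next
  fix b q assume q: "q \<lhd> p"
   "q ||- (b \<^bold>\<in> B \<^bold>\<and> (\<^bold>\<exists>y. related (hom N (J \<beta>)) b y \<^bold>\<and> in_atom_ideal (alg (J \<beta>)) (leq (J \<beta>)) y))"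
  then have b: "q ||- (b \<^bold>\<in> B)" and ex: "q ||- (\<^bold>\<exists>y. related (hom N (J \<beta>)) b y \<^bold>\<and> in_atom_ideal (alg (J \<beta>)) (leq (J \<beta>)) y)"
   by auto
  show "q ||- (b \<^bold>\<in> Id_name \<alpha>)"
   using ex
  proof (rule forces_ExisE)
   fix r y assume r: "r \<lhd> q" "r ||- (related (hom N (J \<beta>)) b y \<^bold>\<and> in_atom_ideal (alg (J \<beta>)) (leq (J \<beta>)) y)"
   have rp: "r \<lhd> p" using r(1) q(1) by (rule le_trans)
   show "r ||- (b \<^bold>\<in> Id_name \<alpha>)"
   proof (rule B.elemE[OF rp forces_mono[OF r(1) b]])
    fix s c assume s: "s \<lhd> r" "qpres N s c b"
    note f = le_Field(1)[OF s(1)]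
    have rel: "s ||- (related (hom N (J \<beta>)) b y)" "s ||- (in_atom_ideal (alg (J \<beta>)) (leq (J \<beta>)) y)"
     using forces_mono[OF s(1) r(2)] by auto
    have "qpres (J \<beta>) s c y" using related_hom[OF N J_gideal N_le_J f s(2)] rel(1) by blast
    then have "c \<in> J \<alpha> s" using key[OF le_trans[OF s(1) rp]] rel(2) by blast
    then show "s ||- (b \<^bold>\<in> Id_name \<alpha>)" using mem_idl_iff[OF N J_gideal N_le_J f s(2)] by blast
   qed
  qed
 qed
qed

text \<open>The length is \<eta> + 3, since the index \<eta> + 2 is the first one at which the ideal
  is the whole algebra.\<close>

definition J_name :: "'p name" where
 "J_name = fgraph {\<alpha>. \<alpha> \<sqsubset> Hi 3} ln Id_name"

lemma levels_small: "|{\<alpha>. \<alpha> \<sqsubset> Hi n}| \<le>o |UNIV :: 'p set|"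
proof -
 have eq: "{\<alpha>. \<alpha> \<sqsubset> Hi n} = Lo ` Field \<eta> \<union> Hi ` {..<n}"
  by (auto elim!: lev_less.elims)
 have "|Lo ` Field \<eta>| \<le>o |UNIV :: 'p set|" using ordLeq_transitive[OF card_of_image Field_small] .
 moreover have "|Hi ` {..<n} :: 'a lev set| \<le>o |UNIV :: 'p set|" by (rule finite_small) simp
 ultimately show ?thesis
  unfolding eq using inf_p by (intro card_of_Un_ordLeq_infinite_Field) (simp_all add: Field_card_of card_of_card_order_on)
qed

lemma level_function:
 assumes "\<And>\<alpha>. \<alpha> \<sqsubset> Hi n ==> True"
 shows "p ||- (is_function_on (fgraph {\<alpha>. \<alpha> \<sqsubset> Hi n} ln b) (ln (Hi n)))"
proof (rule fgraph_function[OF levels_small])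
 show "q ||- (b i \<^bold>= b j)"
  if "q \<lhd> p" "i \<in> {\<alpha>. \<alpha> \<sqsubset> Hi n}" "j \<in> {\<alpha>. \<alpha> \<sqsubset> Hi n}" "q ||- (ln i \<^bold>= ln j)" for i j q
  using that ln_eq_iff[OF le_Field(1)[OF that(1)]] lev_less_levs eq_refl by (metis mem_Collect_eq)
qed (use ln_memI mem_ln in auto)

lemma J_name_related: "\<alpha> \<sqsubset> Hi 3 ==> p ||- (related J_name (ln \<alpha>) (Id_name \<alpha>))"
 unfolding J_name_def by (rule related_graphI[OF levels_small persistent_True]) simp_all

lemma J_nameE:
 assumes "p ||- (related J_name x y)"
  "\<And>r \<alpha>. r \<lhd> p ==> \<alpha> \<sqsubset> Hi 3 ==> r ||- (x \<^bold>= ln \<alpha>) ==> r ||- (y \<^bold>= Id_name \<alpha>) ==> r ||- \<phi>"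
 shows "p ||- \<phi>"
 using assms(1) unfolding J_name_def
 by (rule related_graphE[OF _ levels_small persistent_True]) (use assms(2) in blast)

lemma CB_sequence:
 assumes p: "p \<in> Field R" shows "p ||- (is_CB_sequence B L (ln (Hi 3)) J_name)"
 unfolding is_CB_sequence_def
proof (intro forces_ConjI[OF ordinal_ln forces_ConjI] forces_BUnivI forces_UnivI forces_ImpI)
 show "p ||- (is_function_on J_name (ln (Hi 3)))"
  unfolding J_name_def by (rule level_function) simp
 let ?\<Psi> = "\<lambda>i I. (is_empty i \<^bold>\<longrightarrow> (\<^bold>\<forall>x. x \<^bold>\<in> I \<^bold>\<longleftrightarrow> is_bot B L x)) \<^bold>\<and>
    (\<^bold>\<forall>j\<^bold>\<in>ln (Hi 3). \<^bold>\<forall>I'. is_succ j i \<^bold>\<and> related J_name j I' \<^bold>\<longrightarrow> is_CB_derivative B L I' I) \<^bold>\<and>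
    (is_limit i \<^bold>\<longrightarrow> (\<^bold>\<forall>x. x \<^bold>\<in> I \<^bold>\<longleftrightarrow> (\<^bold>\<exists>j\<^bold>\<in>i. \<^bold>\<exists>I'. related J_name j I' \<^bold>\<and> x \<^bold>\<in> I')))"
 fix q1 i I q assume "q1 \<lhd> p" "q \<lhd> q1" and rel: "q ||- (related J_name i I)"
 show "q ||- ?\<Psi> i I"
  using rel
 proof (rule J_nameE)
  fix r \<alpha> assume r: "r \<lhd> q" "\<alpha> \<sqsubset> Hi 3" "r ||- (i \<^bold>= ln \<alpha>)" "r ||- (I \<^bold>= Id_name \<alpha>)"
  note fr = le_Field(1)[OF r(1)]
  interpret B: presentation R Cod r B L N "qpres N" by (rule presentation_alg[OF N])
  note mem = mem_idl_iff[OF N J_gideal N_le_J] and sub = idl_sub_alg[OF N J_gideal N_le_J]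
  have lev: "\<alpha> \<in> levs \<eta>" using lev_less_levs r(2) by blast
  \<comment> \<open>The clauses are checked for canonical names and carried over to \<open>i\<close>
    and \<open>I\<close> by the congruence lemmas.\<close>
  have "r ||- ?\<Psi> (ln \<alpha>) (Id_name \<alpha>)"
  proof (intro forces_ConjI forces_ImpI forces_UnivI forces_BUnivI forces_IffI)
   fix s x t assume s: "s \<lhd> r" "s ||- (is_empty (ln \<alpha>))" and t: "t \<lhd> s"
   have J: "J \<alpha> u = N u" if "u \<in> Field R" for u
    using J_zero[OF is_empty_ln[OF le_Field(1)[OF s(1)] s(2)] that] .
   have tr: "t \<lhd> r" using t s(1) by (rule le_trans)
   show "t ||- (is_bot B L x)" if x: "t ||- (x \<^bold>\<in> Id_name \<alpha>)"
   proof (rule B.elemE[OF tr sub[OF x]])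
    fix u c assume u: "u \<lhd> t" "qpres N u c x"
    then have "c \<in> N u" using mem[OF le_Field(1)[OF u(1)] u(2)] forces_mono[OF u(1) x] J le_Field by blast
    then show "u ||- (is_bot B L x)" using B.bot_iff[OF le_trans[OF u(1) tr] u(2)] by blast
   qed
   show "t ||- (x \<^bold>\<in> Id_name \<alpha>)" if x: "t ||- (is_bot B L x)"
   proof (rule B.elemE[OF tr])
    show "t ||- (x \<^bold>\<in> B)" using x unfolding is_bot_def forces_Conj by blast
    fix u c assume u: "u \<lhd> t" "qpres N u c x"
    then have "c \<in> N u" using B.bot_iff[OF le_trans[OF u(1) tr] u(2)] forces_mono[OF u(1) x] by blast
    then show "u ||- (x \<^bold>\<in> Id_name \<alpha>)" using mem[OF le_Field(1)[OF u(1)] u(2)] J le_Field[OF u(1)] by blast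
   qed
  next
   fix s j I' t assume s: "s \<lhd> r" and t: "t \<lhd> s" "t ||- (is_succ j (ln \<alpha>) \<^bold>\<and> related J_name j I')"
   then have succ: "t ||- (is_succ j (ln \<alpha>))" and rel: "t ||- (related J_name j I')" by auto
   show "t ||- (is_CB_derivative B L I' (Id_name \<alpha>))"
    using rel
   proof (rule J_nameE)
    fix u \<beta> assume u: "u \<lhd> t" "\<beta> \<sqsubset> Hi 3" "u ||- (j \<^bold>= ln \<beta>)" "u ||- (I' \<^bold>= Id_name \<beta>)"
    note f = le_Field(1)[OF u(1)]
    have "u ||- (is_succ (ln \<beta>) (ln \<alpha>))"
     using forces_mono[OF u(1) succ] fiffD[OF fiff_is_succ[OF u(3) eq_refl]] by blast
    then have "covers \<beta> \<alpha>" using is_succ_ln[OF f lev] lev_less_levs u(2) by blast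
    then show "u ||- (is_CB_derivative B L I' (Id_name \<alpha>))"
     using derivative[OF _ r(2) f] fiffD[OF fiff_is_CB_derivative[OF eq_refl eq_refl u(4) eq_refl]] by blast
   qed
  next
   fix s x t assume s: "s \<lhd> r" "s ||- (is_limit (ln \<alpha>))" and t: "t \<lhd> s"
   obtain \<beta> where lim: "\<beta> \<sqsubset> \<alpha>" "\<And>\<gamma>. \<not> covers \<gamma> \<alpha>"
    using is_limit_ln[OF le_Field(1)[OF s(1)] s(2) lev] by blast
   have tr: "t \<lhd> r" using t s(1) by (rule le_trans)
   show "t ||- (\<^bold>\<exists>j\<^bold>\<in>ln \<alpha>. \<^bold>\<exists>I'. related J_name j I' \<^bold>\<and> x \<^bold>\<in> I')" if x: "t ||- (x \<^bold>\<in> Id_name \<alpha>)"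
   proof (rule B.elemE[OF tr sub[OF x]])
    fix u c assume u: "u \<lhd> t" "qpres N u c x"
    then have "c \<in> J \<alpha> u" using mem[OF le_Field(1)[OF u(1)] u(2)] forces_mono[OF u(1) x] by blast
    then have d: "densely u (\<lambda>r. \<exists>\<gamma>. \<gamma> \<sqsubset> \<alpha> \<and> c \<in> J \<gamma> r)" using J_limit[OF lim] by blast
    show "u ||- (\<^bold>\<exists>j\<^bold>\<in>ln \<alpha>. \<^bold>\<exists>I'. related J_name j I' \<^bold>\<and> x \<^bold>\<in> I')"
     using d
    proof (rule dense_elim)
     fix v assume v: "v \<lhd> u" "\<exists>\<gamma>. \<gamma> \<sqsubset> \<alpha> \<and> c \<in> J \<gamma> v"
     then obtain \<gamma> where \<gamma>: "\<gamma> \<sqsubset> \<alpha>" "c \<in> J \<gamma> v" by blast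
     have "v ||- (x \<^bold>\<in> Id_name \<gamma>)" using mem[OF le_Field(1)[OF v(1)] B.pres_mono[OF v(1) u(2)]] \<gamma>(2) by blast
     moreover have "v ||- (related J_name (ln \<gamma>) (Id_name \<gamma>))" by (rule J_name_related[OF less_trans[OF \<gamma>(1) r(2)]])
     moreover have "v ||- (ln \<gamma> \<^bold>\<in> ln \<alpha>)" by (rule ln_memI[OF \<gamma>(1)])
     ultimately show "v ||- (\<^bold>\<exists>j\<^bold>\<in>ln \<alpha>. \<^bold>\<exists>I'. related J_name j I' \<^bold>\<and> x \<^bold>\<in> I')"
      by (meson forces_BExisI forces_ExisI forces_ConjI)
    qed
   qed
   show "t ||- (x \<^bold>\<in> Id_name \<alpha>)" if ex: "t ||- (\<^bold>\<exists>j\<^bold>\<in>ln \<alpha>. \<^bold>\<exists>I'. related J_name j I' \<^bold>\<and> x \<^bold>\<in> I')"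
    using ex
   proof (elim forces_BExisE forces_ExisE)
    fix u j v I' assume u: "u \<lhd> t" "u ||- (j \<^bold>\<in> ln \<alpha>)" and v: "v \<lhd> u" "v ||- (related J_name j I' \<^bold>\<and> x \<^bold>\<in> I')"
    then have rel: "v ||- (related J_name j I')" and x: "v ||- (x \<^bold>\<in> I')" by auto
    show "v ||- (x \<^bold>\<in> Id_name \<alpha>)"
     using rel
    proof (rule J_nameE)
     fix w \<gamma> assume w: "w \<lhd> v" "\<gamma> \<sqsubset> Hi 3" "w ||- (j \<^bold>= ln \<gamma>)" "w ||- (I' \<^bold>= Id_name \<gamma>)"
     note f = le_Field(1)[OF w(1)]
     have wr: "w \<lhd> r" "w \<lhd> u" using w(1) v(1) u(1) tr by (meson le_trans)+
     have "w ||- (ln \<gamma> \<^bold>\<in> ln \<alpha>)" using mem_cong[OF w(3) eq_refl forces_mono[OF wr(2) u(2)]] .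
     then have less: "\<gamma> \<sqsubset> \<alpha>" using ln_mem_iff[OF f] lev_less_levs w(2) by blast
     have x: "w ||- (x \<^bold>\<in> Id_name \<gamma>)" using mem_cong[OF eq_refl w(4) forces_mono[OF w(1) x]] .
     show "w ||- (x \<^bold>\<in> Id_name \<alpha>)"
     proof (rule B.elemE[OF wr(1) sub[OF x]])
      fix z c assume z: "z \<lhd> w" "qpres N z c x"
      then show "z ||- (x \<^bold>\<in> Id_name \<alpha>)"
       using mem[OF le_Field(1)[OF z(1)] z(2)] forces_mono[OF z(1) x] J_mono[OF less] by blast
     qed
    qed
   qed
  qed
  moreover have "fiff r (?\<Psi> i I) (?\<Psi> (ln \<alpha>) (Id_name \<alpha>))"
   by (intro fiff_intros fiff_is_empty fiff_is_bot fiff_is_succ fiff_related fiff_is_CB_derivative fiff_is_limit r(3,4))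
  ultimately show "r ||- ?\<Psi> i I" using fiffD by blast
 qed
qed

lemma CB_ideal:
 assumes "p \<in> Field R" "\<alpha> \<sqsubset> Hi 3" shows "p ||- (is_CB_ideal B L (ln \<alpha>) (Id_name \<alpha>))"
 unfolding is_CB_ideal_def
 by (rule forces_ExisI[where \<sigma> = "ln (Hi 3)"], rule forces_ExisI[where \<sigma> = J_name])
  (intro forces_ConjI CB_sequence ln_memI J_name_related assms)

text \<open>Minimality of the height refers to every Cantor-Bendixson sequence, whatever quotients
  it uses, so \<open>J'\<close> is arbitrary. An upper bound is enough: it keeps \<open>UNIV\<close>
  out of the ideals with index up to \<eta> + 1.\<close>

lemma CB_sequence_bound:
 assumes "q \<in> Field R" "q ||- (is_CB_sequence B L r' J')" "q ||- (ln \<alpha> \<^bold>\<in> r')" "q ||- (related J' (ln \<alpha>) I')"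
  "\<alpha> \<sqsubset> Hi 2" "c \<in> Cod" "q ||- (cls N c \<^bold>\<in> I')"
 shows "c \<in> J \<alpha> q"
 using assms
proof (induction \<alpha> arbitrary: q I' c rule: wf_induct[OF wf_lev_less[OF wo]])
 case (1 \<alpha>)
 note prems = 1(2-8)
 have IH: "c \<in> J \<beta> q" if "\<beta> \<sqsubset> \<alpha>" "q \<in> Field R" "q ||- (is_CB_sequence B L r' J')" "q ||- (ln \<beta> \<^bold>\<in> r')"
  "q ||- (related J' (ln \<beta>) I')" "c \<in> Cod" "q ||- (cls N c \<^bold>\<in> I')" for \<beta> q I' c
  using 1(1) that less_trans[OF that(1) prems(5)] by blast
 have ord: "q ||- (is_ordinal r')" and fn: "q ||- (is_function_on J' r')"
  using prems(2) unfolding is_CB_sequence_def forces_Conj by blast+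
 note cl = prems(2)[unfolded is_CB_sequence_def forces_Conj, THEN conjunct2, THEN conjunct2,
   THEN forces_BUnivD, OF prems(3), THEN forces_UnivD, THEN forces_ImpD, OF prems(4), unfolded forces_Conj]
 interpret B: presentation R Cod q B L N "qpres N" by (rule presentation_alg[OF N])
 have mem_r': "q ||- (ln \<beta> \<^bold>\<in> r')" if "\<beta> \<sqsubset> \<alpha>" for \<beta>
  using ord prems(3) ln_memI[OF that] unfolding is_ordinal_def is_transitive_def forces_Conj
  by (meson forces_BUnivD)
 consider "\<And>\<beta>. \<not> \<beta> \<sqsubset> \<alpha>" | \<beta> where "covers \<beta> \<alpha>" | \<beta> where "\<beta> \<sqsubset> \<alpha>" "\<And>\<gamma>. \<not> covers \<gamma> \<alpha>" by blast
 then show ?case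
 proof cases
  case 1
  have "q ||- (cls N c \<^bold>\<in> I' \<^bold>\<longleftrightarrow> is_bot B L (cls N c))"
   using forces_ImpD[OF conjunct1[OF cl] is_empty_lnI[OF 1]] by (rule forces_UnivD)
  then have "c \<in> N q"
   using forces_IffD prems(7) B.bot_iff[OF le_refl[OF prems(1)] qpres_cls[OF prems(6)]] by blast
  then show ?thesis using N_J[OF prems(1)] by blast
 next
  case (2 \<beta>)
  have less: "\<beta> \<sqsubset> \<alpha>" using 2 unfolding covers_def by blast
  have \<beta>2: "\<beta> \<sqsubset> Hi 2" by (rule less_trans[OF less prems(5)])
  have succ: "q ||- (is_succ (ln \<beta>) (ln \<alpha>))" using is_succ_ln[OF prems(1)] lev_less_levs less 2 by blast
  have exI: "q ||- (\<^bold>\<exists>b. related J' (ln \<beta>) b \<^bold>\<and> (\<^bold>\<forall>c. related J' (ln \<beta>) c \<^bold>\<longrightarrow> c \<^bold>= b))"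
   using fn mem_r'[OF less] unfolding is_function_on_def forces_Conj by (meson forces_BUnivD)
  show ?thesis
  proof (rule gideal_dense[OF J_gideal prems(1) prems(6)], rule denselyI)
   fix s assume s: "s \<lhd> q"
   obtain s1 I'' where s1: "s1 \<lhd> s" "s1 ||- (related J' (ln \<beta>) I'')"
    using forces_Exis_ex[OF forces_mono[OF s exI] le_Field(1)[OF s]] unfolding forces_Conj by blast
   have s1q: "s1 \<lhd> q" using s1(1) s by (rule le_trans)
   have all: "s1 ||- (\<^bold>\<forall>j\<^bold>\<in>r'. \<^bold>\<forall>I''. is_succ j (ln \<alpha>) \<^bold>\<and> related J' j I'' \<^bold>\<longrightarrow> is_CB_derivative B L I'' I')"
    using forces_mono[OF s1q] cl by blast
   have der: "s1 ||- (is_CB_derivative B L I'' I')"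
    by (rule forces_ImpD[OF forces_UnivD[OF forces_BUnivD[OF all forces_mono[OF s1q mem_r'[OF less]]]]
       forces_ConjI[OF forces_mono[OF s1q succ] s1(2)]])
   obtain s2 C where s2: "s2 \<lhd> s1" "s2 ||- (\<^bold>\<exists>K. \<^bold>\<exists>h. is_quotient B L I'' C K h \<^bold>\<and>
    (\<^bold>\<forall>b. b \<^bold>\<in> I' \<^bold>\<longleftrightarrow> b \<^bold>\<in> B \<^bold>\<and> (\<^bold>\<exists>c. related h b c \<^bold>\<and> in_atom_ideal C K c)))"
    using forces_Exis_ex[OF der[unfolded is_CB_derivative_def] le_Field(1)[OF s1(1)]] by blast
   obtain s3 K where s3: "s3 \<lhd> s2" "s3 ||- (\<^bold>\<exists>h. is_quotient B L I'' C K h \<^bold>\<and>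
    (\<^bold>\<forall>b. b \<^bold>\<in> I' \<^bold>\<longleftrightarrow> b \<^bold>\<in> B \<^bold>\<and> (\<^bold>\<exists>c. related h b c \<^bold>\<and> in_atom_ideal C K c)))"
    using forces_Exis_ex[OF s2(2) le_Field(1)[OF s2(1)]] by blast
   obtain u h where u: "u \<lhd> s3" and quo: "u ||- (is_quotient B L I'' C K h)"
    and iff: "u ||- (\<^bold>\<forall>b. b \<^bold>\<in> I' \<^bold>\<longleftrightarrow> b \<^bold>\<in> B \<^bold>\<and> (\<^bold>\<exists>c. related h b c \<^bold>\<and> in_atom_ideal C K c))"
    using forces_Exis_ex[OF s3(2) le_Field(1)[OF s3(1)]] unfolding forces_Conj by blast
   have us: "u \<lhd> s1" "u \<lhd> s" "u \<lhd> q" using u s3(1) s2(1) s1(1) s by (meson le_trans)+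
   note fu = le_Field(1)[OF u]
   have epi: "u ||- (is_epimorphism B L C K h)" using quo unfolding is_quotient_def forces_Conj by blast
   interpret C: presentation R Cod u C K "ker N C K h" "kpres N h"
    by (rule presentation_epi[OF N fu epi])
   \<comment> \<open>The kernel of the unknown quotient map is the preceding ideal
     \<open>I''\<close>, to which the induction hypothesis applies.\<close>
   have ker\<beta>: "ker N C K h w \<subseteq> J \<beta> w" if w: "w \<lhd> u" for w
   proof
    fix d assume d: "d \<in> ker N C K h w"
    have dC: "d \<in> Cod" using C.I_Cod[OF w d] .
    have "w ||- (\<^bold>\<exists>z. is_bot C K z \<^bold>\<and> related h (cls N d) z)" using d unfolding ker_def[OF N fu epi] by blast
    moreover have "w ||- (cls N d \<^bold>\<in> I'' \<^bold>\<longleftrightarrow> (\<^bold>\<exists>z. is_bot C K z \<^bold>\<and> related h (cls N d) z))"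
     using forces_mono[OF w quo] cls_mem_alg[OF dC] unfolding is_quotient_def forces_Conj by (meson forces_BUnivD)
    ultimately have "w ||- (cls N d \<^bold>\<in> I'')" using forces_IffD by blast
    moreover have "w \<lhd> q" "w \<lhd> s1" using w us by (meson le_trans)+
    ultimately show "d \<in> J \<beta> w"
     using IH[OF less le_Field(1)[OF w] _ _ _ dC] prems(2) mem_r'[OF less] s1(2) forces_mono by blast
   qed
   have "u ||- (cls N c \<^bold>\<in> I' \<^bold>\<longleftrightarrow> cls N c \<^bold>\<in> B \<^bold>\<and> (\<^bold>\<exists>y. related h (cls N c) y \<^bold>\<and> in_atom_ideal C K y))"
    using iff by (rule forces_UnivD)
   from forces_IffD[OF this] have "u ||- (\<^bold>\<exists>y. related h (cls N c) y \<^bold>\<and> in_atom_ideal C K y)"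
    using forces_mono[OF us(3) prems(7)] by (simp only: forces_Conj simp_thms)
   from forces_Exis_ex[OF this fu]
   obtain v y where v: "v \<lhd> u" "v ||- (related h (cls N c) y)" "v ||- (in_atom_ideal C K y)"
    unfolding forces_Conj by blast
   have "c \<in> J \<alpha> v"
   proof (rule C.in_atom_ideal_bound[OF le_refl[OF fu] gidealD[OF J_gideal] _ _ v(1) _ v(3)])
    show "\<forall>w. w \<lhd> u --> ker N C K h w \<subseteq> J \<alpha> w" using ker\<beta> J_mono[OF less] by blast
    show "kpres N h v c y" unfolding kpres_def[OF N fu epi] using prems(6) v(2) by blast
    fix w a assume w: "w \<lhd> u" and at: "vatom (ker N C K h) w a"
    have aC: "a \<in> Cod" using at unfolding vatom_def by blast
    show "a \<in> J \<alpha> w"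
    proof (rule gideal_dense[OF J_gideal le_Field(1)[OF w] aC], rule denselyI)
     fix x assume x: "x \<lhd> w"
     show "\<exists>y. y \<lhd> x \<and> a \<in> J \<alpha> y"
     \<comment> \<open>An atom modulo the kernel may be null modulo the larger ideal
       \<open>J \<beta>\<close>. If it is so at no extension of \<open>x\<close>, it is still an
       atom there, since the splitting property passes to larger ideals.\<close>
     proof (cases "\<exists>y. y \<lhd> x \<and> a \<in> J \<beta> y")
      case True
      then show ?thesis using J_mono[OF less] by blast
     next
      case False
      have "vatom (J \<beta>) x a"
       unfolding vatom_def
      proof (intro conjI aC ballI allI impI)
       show "a \<notin> J \<beta> y" if "y \<lhd> x" for y using False that by blast
       fix e y assume e: "e \<in> Cod" and y: "y \<lhd> x"
       have yw: "y \<lhd> w" using y x by (rule le_trans)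
       have "densely y (\<lambda>s. a \<inter> e \<in> ker N C K h s \<or> a - e \<in> ker N C K h s)"
        using at e yw unfolding vatom_def by blast
       then show "densely y (\<lambda>s. a \<inter> e \<in> J \<beta> s \<or> a - e \<in> J \<beta> s)"
       proof (rule densely_mono)
        fix s assume s: "s \<lhd> y" "a \<inter> e \<in> ker N C K h s \<or> a - e \<in> ker N C K h s"
        have "s \<lhd> u" using s(1) yw w by (meson le_trans)
        then show "a \<inter> e \<in> J \<beta> s \<or> a - e \<in> J \<beta> s" using s(2) ker\<beta> by blast
       qed
      qed
      then have "a \<in> J \<alpha> x" by (rule atom_in_J_succ[OF _ 2 \<beta>2 le_Field(1)[OF x]])
      then show ?thesis using le_refl1(1)[OF x] by blast
     qed
    qed
   qed
   then show "\<exists>v. v \<lhd> s \<and> c \<in> J \<alpha> v" using le_trans[OF v(1) us(2)] by blast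
  qed
 next
  case (3 \<beta>)
  have "q ||- (cls N c \<^bold>\<in> I' \<^bold>\<longleftrightarrow> (\<^bold>\<exists>j\<^bold>\<in>ln \<alpha>. \<^bold>\<exists>I''. related J' j I'' \<^bold>\<and> cls N c \<^bold>\<in> I''))"
   using forces_ImpD[OF cl[THEN conjunct2, THEN conjunct2] is_limit_lnI[OF 3]] by (rule forces_UnivD)
  then have ex: "q ||- (\<^bold>\<exists>j\<^bold>\<in>ln \<alpha>. \<^bold>\<exists>I''. related J' j I'' \<^bold>\<and> cls N c \<^bold>\<in> I'')" using forces_IffD prems(7) by blast
  show ?thesis
  proof (rule gideal_dense[OF J_gideal prems(1) prems(6)], rule denselyI)
   fix s assume s: "s \<lhd> q"
   obtain s1 j where s1: "s1 \<lhd> s" "s1 ||- (j \<^bold>\<in> ln \<alpha>)" "s1 ||- (\<^bold>\<exists>I''. related J' j I'' \<^bold>\<and> cls N c \<^bold>\<in> I'')"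
    using forces_BExis_ex[OF forces_mono[OF s ex] le_Field(1)[OF s]] by blast
   obtain s2 I'' where s2: "s2 \<lhd> s1" "s2 ||- (related J' j I'')" "s2 ||- (cls N c \<^bold>\<in> I'')"
    using forces_Exis_ex[OF s1(3) le_Field(1)[OF s1(1)]] unfolding forces_Conj by blast
   have "densely s2 (\<lambda>r. \<exists>\<beta>. \<beta> \<sqsubset> \<alpha> \<and> r ||- (j \<^bold>= ln \<beta>))" using forces_mono[OF s2(1) s1(2)] unfolding mem_ln .
   then obtain s3 \<gamma> where s3: "s3 \<lhd> s2" "\<gamma> \<sqsubset> \<alpha>" "s3 ||- (j \<^bold>= ln \<gamma>)" using densely_ex le_Field(1)[OF s2(1)] by blast
   have le: "s3 \<lhd> s" "s3 \<lhd> q" using s3(1) s2(1) s1(1) s by (meson le_trans)+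
   have "s3 ||- (related J' (ln \<gamma>) I'')" using related_cong[OF forces_mono[OF s3(1) s2(2)] s3(3) eq_refl] .
   then have "c \<in> J \<gamma> s3"
    using IH[OF s3(2) le_Field(1)[OF s3(1)] forces_mono[OF le(2) prems(2)] forces_mono[OF le(2) mem_r'[OF s3(2)]] _ prems(6)]
     forces_mono[OF s3(1) s2(3)] by blast
   then show "\<exists>r. r \<lhd> s \<and> c \<in> J \<alpha> r" using le J_mono[OF s3(2)] by blast
  qed
 qed
qed

lemma ht_minus:
 assumes p: "p \<in> Field R" shows "p ||- (is_ht_minus B L (ln (Hi 1)))"
 unfolding is_ht_minus_def
proof (intro forces_ConjI ordinal_ln forces_BUnivI forces_NegI)
 have levs: "Hi n \<in> levs \<eta>" for n by (simp add: levs_def)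
 have "p ||- (Id_name (Hi 2) \<^bold>= B)"
  unfolding eq_iff_mem
 proof (intro allI impI iffI)
  fix q x assume q: "q \<lhd> p"
  interpret B: presentation R Cod q B L N "qpres N" by (rule presentation_alg[OF N])
  show "q ||- (x \<^bold>\<in> B)" if "q ||- (x \<^bold>\<in> Id_name (Hi 2))"
   using idl_sub_alg[OF N J_gideal N_le_J] that by blast
  show "q ||- (x \<^bold>\<in> Id_name (Hi 2))" if "q ||- (x \<^bold>\<in> B)"
  proof (rule B.elemE[OF le_refl1(1)[OF q] that])
   fix r c assume r: "r \<lhd> q" "qpres N r c x"
   then show "r ||- (x \<^bold>\<in> Id_name (Hi 2))"
    using mem_idl_iff[OF N J_gideal N_le_J le_Field(1)[OF r(1)] r(2), of "Hi 2"] J_top[OF le_Field(1)[OF r(1)]] B.pres_Cod[OF r(2)] by blast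
  qed
 qed
 then have "p ||- (is_CB_ideal B L (ln (Hi 2)) B)"
  using CB_ideal[OF p, of "Hi 2"] fiffD[OF fiff_is_CB_ideal[OF eq_refl eq_refl eq_refl]] by simp
 moreover have "p ||- (is_succ (ln (Hi 1)) (ln (Hi 2)))"
  using is_succ_ln[OF p levs levs] covers_Hi[of 1] by (simp add: numeral_2_eq_2)
 ultimately show "p ||- (\<^bold>\<exists>s. is_succ (ln (Hi 1)) s \<^bold>\<and> is_CB_ideal B L s B)"
  by (intro forces_ExisI[where \<sigma> = "ln (Hi 2)"] forces_ConjI)
 fix q1 x q assume q1: "q1 \<lhd> p" "q1 ||- (x \<^bold>\<in> ln (Hi 1))" and q: "q \<lhd> q1" "q ||- (\<^bold>\<exists>s. is_succ x s \<^bold>\<and> is_CB_ideal B L s B)"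
 have "densely q (\<lambda>r. \<exists>\<beta>. \<beta> \<sqsubset> Hi 1 \<and> r ||- (x \<^bold>= ln \<beta>))" using forces_mono[OF q(1) q1(2)] unfolding mem_ln .
 then obtain r \<beta> where r: "r \<lhd> q" "\<beta> \<sqsubset> Hi 1" "r ||- (x \<^bold>= ln \<beta>)" using densely_ex le_Field(1)[OF q(1)] by blast
 obtain r1 s where r1: "r1 \<lhd> r" "r1 ||- (is_succ x s)" "r1 ||- (is_CB_ideal B L s B)"
  using forces_Exis_ex[OF forces_mono[OF r(1) q(2)] le_Field(1)[OF r(1)]] unfolding forces_Conj by blast
 \<comment> \<open>The successor of an index below \<eta> + 1 is at most \<eta> + 1, where
   \<open>UNIV\<close> is still missing from the ideal.\<close>
 obtain \<alpha> where \<alpha>: "covers \<beta> \<alpha>" "\<alpha> \<sqsubset> Hi 1 \<or> \<alpha> = Hi 1" using covers_ex[OF r(2)] by blast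
 note f1 = le_Field(1)[OF r1(1)]
 have lev: "\<alpha> \<in> levs \<eta>" "\<beta> \<in> levs \<eta>" using \<alpha>(1) lev_less_levs unfolding covers_def by blast+
 have 2: "\<alpha> \<sqsubset> Hi 2" using \<alpha>(2) less_trans[of \<alpha> "Hi 1" "Hi 2"] by auto
 have "r1 ||- (is_succ (ln \<beta>) s)"
  using r1(2) fiffD[OF fiff_is_succ[OF forces_mono[OF r1(1) r(3)] eq_refl]] by blast
 moreover have "r1 ||- (is_succ (ln \<beta>) (ln \<alpha>))" using is_succ_ln[OF f1 lev] \<alpha>(1) by blast
 ultimately have "r1 ||- (s \<^bold>= ln \<alpha>)" by (rule is_succ_unique)
 then have cb: "r1 ||- (is_CB_ideal B L (ln \<alpha>) B)"
  using r1(3) fiffD[OF fiff_is_CB_ideal[OF eq_refl eq_refl _ eq_refl]] by blast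
 obtain r2 r' where r2: "r2 \<lhd> r1" "r2 ||- (\<^bold>\<exists>J'. is_CB_sequence B L r' J' \<^bold>\<and> ln \<alpha> \<^bold>\<in> r' \<^bold>\<and> related J' (ln \<alpha>) B)"
  using forces_Exis_ex[OF cb[unfolded is_CB_ideal_def] f1] by blast
 obtain r3 J' where r3: "r3 \<lhd> r2" "r3 ||- (is_CB_sequence B L r' J')" "r3 ||- (ln \<alpha> \<^bold>\<in> r')" "r3 ||- (related J' (ln \<alpha>) B)"
  using forces_Exis_ex[OF r2(2) le_Field(1)[OF r2(1)]] unfolding forces_Conj by blast
 have "UNIV \<in> J \<alpha> r3"
  by (rule CB_sequence_bound[OF le_Field(1)[OF r3(1)] r3(2-4) 2 Cod_UNIV cls_mem_alg[OF Cod_UNIV]])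
 then show False using UNIV_notin_J[OF le_Field(1)[OF r3(1)] \<alpha>(2)] by blast
qed

text \<open>\<open>X\<close> and \<open>xn\<close> list the members of the cardinal
  \<open>m\<close>. A bijection of the ground model between the generators of rank
  \<open>\<alpha>\<close> and \<open>X\<close> induces a forced bijection between the atoms and
  \<open>m\<close>, because both families of names are pairwise distinct.\<close>

lemma width:
 fixes X :: "'x set" and xn :: "'x => 'p name"
 assumes p: "p \<in> Field R" and \<alpha>: "\<alpha> \<sqsubset> Hi 2"
  and m: "p ||- (is_cardinal m)" "\<And>q \<sigma>. q ||- (\<sigma> \<^bold>\<in> m) \<longleftrightarrow> densely q (\<lambda>r. \<exists>x\<in>X. r ||- (\<sigma> \<^bold>= xn x))"
  and xn: "\<And>q x y. q \<in> Field R ==> x \<in> X ==> y \<in> X ==> q ||- (xn x \<^bold>= xn y) ==> x = y"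
  and bij: "bij_betw \<phi> {g \<in> G. rk g = \<alpha>} X"
 shows "p ||- (has_width B L (ln \<alpha>) m)"
proof -
 let ?G = "{g \<in> G. rk g = \<alpha>}"
 let ?at = "\<lambda>g. cls (J \<alpha>) (U g)"
 define A where "A = vset ?G ?at (\<lambda>_ _. True)"
 interpret C: presentation R Cod p "alg (J \<alpha>)" "leq (J \<alpha>)" "J \<alpha>" "qpres (J \<alpha>)" by (rule presentation_alg[OF J_gideal])
 have small: "|?G| \<le>o |UNIV :: 'p set|"
  using ordLeq_transitive[OF card_of_mono1 G_small, of ?G] by blast
 have memA: "q ||- (\<sigma> \<^bold>\<in> A) \<longleftrightarrow> densely q (\<lambda>r. \<exists>g\<in>?G. r ||- (\<sigma> \<^bold>= ?at g))" for q \<sigma>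
  unfolding A_def mem_vset[OF small persistent_True] by simp
 have inA: "g \<in> ?G ==> q ||- (?at g \<^bold>\<in> A)" for g q
  unfolding A_def by (rule vsetI[OF small persistent_True]) simp_all
 have inm: "x \<in> X ==> q ||- (xn x \<^bold>\<in> m)" for x q
  unfolding m(2) by (rule densely_const) (use forces_mono eq_refl in blast)+
 have at_inj: "g = g'" if "q \<in> Field R" "g \<in> ?G" "g' \<in> ?G" "q ||- (?at g \<^bold>= ?at g')" for q g g'
  using that cls_eq_iff[OF J_gideal that(1), of "U g" "U g'" \<alpha>] cong_in_J_eq[of g g' q] U_Cod by auto
 have \<phi>X: "g \<in> ?G ==> \<phi> g \<in> X" for g using bij unfolding bij_betw_def by blast
 have atoms: "p ||- (\<^bold>\<forall>a. a \<^bold>\<in> A \<^bold>\<longleftrightarrow> is_atom (alg (J \<alpha>)) (leq (J \<alpha>)) a)"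
 proof (intro forces_UnivI forces_IffI)
  fix a q assume q: "q \<lhd> p" "q ||- (a \<^bold>\<in> A)"
  then show "q ||- (is_atom (alg (J \<alpha>)) (leq (J \<alpha>)) a)"
   unfolding memA
  proof (elim dense_elim)
   fix r assume r: "r \<lhd> q" "\<exists>g\<in>?G. r ||- (a \<^bold>= ?at g)"
   then obtain g where g: "g \<in> G" "rk g = \<alpha>" "r ||- (a \<^bold>= ?at g)" by blast
   have "qpres (J \<alpha>) r (U g) a" using g U_Cod unfolding qpres_def by blast
   then show "r ||- (is_atom (alg (J \<alpha>)) (leq (J \<alpha>)) a)"
    using C.atom_iff[OF le_trans[OF r(1) q(1)]] vatom_J[OF g(1)] g(2) by blast
  qed
 next
  fix a q assume q: "q \<lhd> p" "q ||- (is_atom (alg (J \<alpha>)) (leq (J \<alpha>)) a)"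
  then have "q ||- (a \<^bold>\<in> alg (J \<alpha>))" unfolding is_atom_def forces_Conj by blast
  then show "q ||- (a \<^bold>\<in> A)"
  proof (rule C.elemE[OF q(1)])
   fix r c assume r: "r \<lhd> q" "qpres (J \<alpha>) r c a"
   have rp: "r \<lhd> p" using r(1) q(1) by (rule le_trans)
   have "vatom (J \<alpha>) r c" using C.atom_iff[OF rp r(2)] forces_mono[OF r(1) q(2)] by blast
   from vatom_J_cases[OF this \<alpha>] show "r ||- (a \<^bold>\<in> A)"
   proof (rule dense_elim)
    fix s assume s: "s \<lhd> r" "\<exists>g\<in>G. rk g = \<alpha> \<and> cong_in (J \<alpha>) s c (U g)"
    then obtain g where g: "g \<in> G" "rk g = \<alpha>" "cong_in (J \<alpha>) s c (U g)" by blast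
    have c: "c \<in> Cod" "s ||- (a \<^bold>= cls (J \<alpha>) c)" using r(2) forces_mono[OF s(1)] unfolding qpres_def by blast+
    have "s ||- (cls (J \<alpha>) c \<^bold>= ?at g)"
     using cls_eq_iff[OF J_gideal le_Field(1)[OF s(1)] c(1) U_Cod[OF g(1)]] g(3) by blast
    then have "s ||- (?at g \<^bold>= a)" using c(2) eq_trans eq_sym by blast
    then show "s ||- (a \<^bold>\<in> A)" using mem_cong[OF _ eq_refl inA] g by blast
   qed
  qed
 qed
 let ?f = "fgraph ?G ?at (\<lambda>g. xn (\<phi> g))"
 have "p ||- (is_function_on ?f A)"
 proof (rule fgraph_function[OF small _ inA])
  show "q ||- (xn (\<phi> i) \<^bold>= xn (\<phi> j))" if "q \<lhd> p" "i \<in> ?G" "j \<in> ?G" "q ||- (?at i \<^bold>= ?at j)" for i j q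
   using at_inj[OF le_Field(1)[OF that(1)] that(2-4)] eq_refl by simp
 qed (use memA in auto)
 then have "p ||- (is_surjection ?f A m)"
 proof (rule fgraph_surjection[OF _ small inA])
  show "p ||- (xn (\<phi> j) \<^bold>\<in> m)" if "j \<in> ?G" for j by (rule inm[OF \<phi>X[OF that]])
  fix q x assume "q ||- (x \<^bold>\<in> m)"
  then have "densely q (\<lambda>r. \<exists>y\<in>X. r ||- (x \<^bold>= xn y))" unfolding m(2) .
  moreover have "X = \<phi> ` ?G" using bij unfolding bij_betw_def by blast
  ultimately show "densely q (\<lambda>r. \<exists>j\<in>?G. r ||- (x \<^bold>= xn (\<phi> j)))" by (simp only: bex_simps)
 qed
 then have "p ||- (is_bijection ?f A m)"
 proof (rule fgraph_bijection[OF _ small])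
  show "q ||- (?at i \<^bold>= ?at j)" if "q \<lhd> p" "i \<in> ?G" "j \<in> ?G" "q ||- (xn (\<phi> i) \<^bold>= xn (\<phi> j))" for i j q
  proof -
   have "\<phi> i = \<phi> j" using xn[OF le_Field(1)[OF that(1)] \<phi>X[OF that(2)] \<phi>X[OF that(3)] that(4)] .
   then have "i = j" using bij that(2,3) unfolding bij_betw_def by (meson inj_onD)
   then show ?thesis by (simp only: eq_refl)
  qed
 qed
 then have "p ||- (has_cardinality A m)"
  unfolding has_cardinality_def equipotent_def by (intro forces_ConjI m(1)) (rule forces_ExisI)
 moreover have "\<alpha> \<sqsubset> Hi 3" using less_trans[OF \<alpha>, of "Hi 3"] by simp
 ultimately show ?thesis
  unfolding has_width_def
  by (intro forces_ExisI[where \<sigma> = "Id_name \<alpha>"] forces_ExisI[where \<sigma> = "alg (J \<alpha>)"] forces_ExisI[where \<sigma> = "leq (J \<alpha>)"]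
    forces_ExisI[where \<sigma> = "hom N (J \<alpha>)"] forces_ExisI[where \<sigma> = A] forces_ConjI CB_ideal[OF p] quotient_hom[OF N J_gideal N_le_J p] atoms)
qed

theorem kel_boolean_algebra:
 assumes p: "p \<in> Field R"
  and W: "\<And>p \<alpha>. p \<in> Field R ==> \<alpha> \<sqsubset> Hi 1 ==> p ||- (has_width B L (ln \<alpha>) (if \<alpha> = Hi 0 then l else k))"
 shows "p ||- (is_kel_boolean_algebra k (ln (Hi 0)) l B L)"
proof -
 define s where "s = fgraph {\<alpha>. \<alpha> \<sqsubset> Hi 1} ln (\<lambda>\<alpha>. if \<alpha> = Hi 0 then l else k)"
 have fn: "p ||- (is_function_on s (ln (Hi 1)))" for p
  unfolding s_def by (rule level_function) simp
 have rel: "p ||- (related s (ln \<alpha>) (if \<alpha> = Hi 0 then l else k))" if "\<alpha> \<sqsubset> Hi 1" for p \<alpha>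
  unfolding s_def using that by (intro related_graphI[OF levels_small persistent_True]) simp_all
 have "p ||- (is_cardinal_sequence B L s)"
  unfolding is_cardinal_sequence_def
 proof (rule forces_ExisI[where \<sigma> = "ln (Hi 1)"], intro forces_ConjI ht_minus[OF p] fn forces_BUnivI forces_UnivI forces_ImpI)
  fix q1 i m q assume q: "q ||- (related s i m)"
  then show "q ||- (has_width B L i m)"
   unfolding s_def
  proof (rule related_graphE[OF _ levels_small persistent_True])
   fix r \<alpha> assume r: "r \<lhd> q" "\<alpha> \<in> {\<alpha>. \<alpha> \<sqsubset> Hi 1}" "r ||- (i \<^bold>= ln \<alpha>)" "r ||- (m \<^bold>= (if \<alpha> = Hi 0 then l else k))"
   then show "r ||- (has_width B L i m)"
    using W[OF le_Field(1)[OF r(1)]] fiffD[OF fiff_has_width[OF eq_refl eq_refl r(3,4)]] by blast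
  qed
 qed
 moreover have "p ||- (is_constant_then k (ln (Hi 0)) l s)"
  unfolding is_constant_then_def
 proof (intro forces_ConjI forces_BUnivI)
  have "p ||- (is_succ (ln (Hi 0)) (ln (Hi 1)))"
   using is_succ_ln[OF p, of "Hi 1" "Hi 0"] covers_Hi[of 0] by (simp add: levs_def)
  then show "p ||- (\<^bold>\<exists>d. is_succ (ln (Hi 0)) d \<^bold>\<and> is_function_on s d)"
   by (intro forces_ExisI[where \<sigma> = "ln (Hi 1)"] forces_ConjI fn)
  show "p ||- (related s (ln (Hi 0)) l)" using rel[of "Hi 0"] by simp
  fix q i assume q: "q \<lhd> p" "q ||- (i \<^bold>\<in> ln (Hi 0))"
  show "q ||- (related s i k)"
   using q(2)
  proof (rule ln_memE)
   fix r \<beta> assume r: "\<beta> \<sqsubset> Hi 0" "r ||- (i \<^bold>= ln \<beta>)"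
   have "\<beta> \<sqsubset> Hi 1" using less_trans[OF r(1), of "Hi 1"] by simp
   moreover have "\<beta> \<noteq> Hi 0" using r(1) by auto
   ultimately have "r ||- (related s (ln \<beta>) k)" using rel[of \<beta> r] by simp
   then show "r ||- (related s i k)" using related_cong eq_sym r(2) eq_refl by blast
  qed
 qed
 ultimately show ?thesis
  unfolding is_kel_boolean_algebra_def
  by (intro forces_ConjI superatomic p forces_ExisI[where \<sigma> = s])
qed

end

section \<open>Infinitary combinatorics\<close>

lemma ordLess_underS:
 assumes k: "Card_order k" and A: "|A| <o k"
 obtains x where "x \<in> Field k" "|A| =o |underS k x|"
proof -
 have wo: "Well_order k" using k by (simp add: card_order_on_def)
 obtain x where x: "x \<in> Field k" "|A| =o Restr k (underS k x)"
  using A ordLess_iff_ordIso_Restr[OF wo card_of_Well_order] by blast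
 have "Field (Restr k (underS k x)) = underS k x"
  using wo by (intro Field_Restr_ofilter) (simp_all add: wo_rel.underS_ofilter wo_rel_def)
 then have "|A| =o |underS k x|" using card_of_cong[OF x(2)] by (simp add: Field_card_of)
 then show ?thesis using x(1) that by blast
qed

locale reg_card =
 fixes \<kappa> :: "'a rel"
 assumes inf: "Cinfinite \<kappa>" and lp: "less_power \<kappa> =o \<kappa>"
begin

lemma Card: "Card_order \<kappa>"
 using inf by simp

lemma wo_k: "Well_order \<kappa>"
 using inf by (simp add: card_order_on_def)

lemma infinite_Field: "\<not> finite (Field \<kappa>)"
 using inf by (simp add: cinfinite_def)

lemma underS_less: "x \<in> Field \<kappa> ==> |underS \<kappa> x| <o \<kappa>"
 by (rule card_of_underS[OF Card])

lemma Field_k: "|Field \<kappa>| =o \<kappa>"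
 by (rule card_of_Field_ordIso[OF Card])

lemma above: "x \<in> Field \<kappa> ==> \<exists>y\<in>Field \<kappa>. x \<noteq> y \<and> (x, y) \<in> \<kappa>"
 using infinite_Card_order_limit[OF Card infinite_Field] by blast

lemma not_surj:
 assumes "|A| <o \<kappa>" shows "\<exists>y\<in>Field \<kappa>. y \<notin> f ` A"
proof (rule ccontr)
 assume "\<not> ?thesis"
 then have "Field \<kappa> \<subseteq> f ` A" by blast
 then have "|Field \<kappa>| \<le>o |A|" using card_of_mono1 card_of_image ordLeq_transitive by metis
 then have "\<kappa> \<le>o |A|" using Field_k ordIso_ordLeq_trans ordIso_symmetric by metis
 then show False using assms not_ordLess_ordLeq by metis
qed

text \<open>Koenig's diagonal argument: \<open>\<kappa>\<close> is regular since \<open>\<kappa>\<^sup>\<mu> > \<kappa>\<close> for the cofinality \<open>\<mu>\<close>.\<close>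

lemma regular: "regularCard \<kappa>"
 unfolding regularCard_def
proof (intro allI impI, elim conjE)
 fix K assume K: "K \<subseteq> Field \<kappa>" "cofinal K \<kappa>"
 show "|K| =o \<kappa>"
 proof (rule ccontr)
  assume ne: "\<not> |K| =o \<kappa>"
  have "|K| \<le>o \<kappa>" using card_of_mono1[OF K(1)] Field_k ordLeq_ordIso_trans by blast
  then have less: "|K| <o \<kappa>" using ne ordLeq_iff_ordLess_or_ordIso by blast
  then obtain x where x: "x \<in> Field \<kappa>" "|K| =o |underS \<kappa> x|" by (rule ordLess_underS[OF Card])
  obtain b where b: "bij_betw b K (underS \<kappa> x)" using x(2) card_of_ordIso by blast
  let ?S = "SIGMA x : Field \<kappa>. Func (underS \<kappa> x) (Field \<kappa>)"
  have "|?S| =o |Field \<kappa>|"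
   using lp Field_k ordIso_symmetric ordIso_transitive unfolding less_power_def by blast
  then obtain e where e: "bij_betw e (Field \<kappa>) ?S" using card_of_ordIso ordIso_symmetric by blast
  \<comment> \<open>\<open>e\<close> enumerates the functions on proper segments. \<open>d k\<close>
    differs from the value at coordinate \<open>b k\<close> of every function enumerated before
    \<open>k\<close>; there are fewer than \<kappa> of these. As \<open>K\<close> is cofinal, the
    diagonal function \<open>h\<close> built from \<open>d\<close> differs from every function
    enumerated with domain index \<open>x\<close>.\<close>
  have "\<forall>k\<in>K. \<exists>y\<in>Field \<kappa>. y \<notin> (\<lambda>z. snd (e z) (b k)) ` underS \<kappa> k"
   using not_surj underS_less K(1) by blast
  then obtain d where d: "\<And>k. k \<in> K ==> d k \<in> Field \<kappa>" "\<And>k z. k \<in> K ==> z \<in> underS \<kappa> k ==> d k \<noteq> snd (e z) (b k)"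
   by (metis imageI)
  define h where "h y = (if y \<in> underS \<kappa> x then d (inv_into K b y) else undefined)" for y
  have hb: "h (b k) = d k" if "k \<in> K" for k
   using b that unfolding h_def bij_betw_def by (auto simp: inv_into_f_f)
  have "h \<in> Func (underS \<kappa> x) (Field \<kappa>)"
   using b d(1) unfolding Func_def h_def bij_betw_def by (auto intro!: d(1) inv_into_into)
  then have "(x, h) \<in> ?S" using x by blast
  then obtain z where z: "z \<in> Field \<kappa>" "e z = (x, h)" using e unfolding bij_betw_def by (metis imageE)
  obtain k where k: "k \<in> K" "z \<noteq> k" "(z, k) \<in> \<kappa>" using K(2) z(1) unfolding cofinal_def by blast
  then have "d k \<noteq> snd (e z) (b k)" using d(2)[OF k(1)] unfolding underS_def by blast
  then show False using z(2) hb[OF k(1)] by simp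
 qed
qed

lemma UN_less: "|I| <o \<kappa> ==> (\<And>i. i \<in> I ==> |A i| <o \<kappa>) ==> |\<Union>i\<in>I. A i| <o \<kappa>"
 using card_of_UNION_ordLess_infinite_Field_regularCard[OF regular inf] by blast

lemma UN_le: "|I| \<le>o \<kappa> ==> (\<And>i. i \<in> I ==> |A i| \<le>o \<kappa>) ==> |\<Union>i\<in>I. A i| \<le>o \<kappa>"
 using UNION_Cinfinite_bound[OF _ _ inf] by blast

lemma Un_le: "|A| \<le>o \<kappa> ==> |B| \<le>o \<kappa> ==> |A \<union> B| \<le>o \<kappa>"
 using Un_Cinfinite_bound[OF _ _ inf] by blast

lemma Un_less: "|A| <o \<kappa> ==> |B| <o \<kappa> ==> |A \<union> B| <o \<kappa>"
 using Un_Cinfinite_bound_strict[OF _ _ inf] by blast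

lemma finite_less: "finite A ==> |A| <o \<kappa>"
 using finite_ordLess_infinite[OF card_of_Well_order wo_k] infinite_Field by (simp add: Field_card_of)

lemma subset_less: "A \<subseteq> B ==> |B| <o \<kappa> ==> |A| <o \<kappa>"
 using card_of_mono1 ordLeq_ordLess_trans by blast

lemma subset_le: "A \<subseteq> B ==> |B| \<le>o \<kappa> ==> |A| \<le>o \<kappa>"
 using card_of_mono1 ordLeq_transitive by blast

lemma image_less: "|A| <o \<kappa> ==> |f ` A| <o \<kappa>"
 using card_of_image ordLeq_ordLess_trans by blast

lemma image_le: "|A| \<le>o \<kappa> ==> |f ` A| \<le>o \<kappa>"
 using card_of_image ordLeq_transitive by blast

lemma less_le: "|A| <o \<kappa> ==> |A| \<le>o \<kappa>"
 by (rule ordLess_imp_ordLeq)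

lemma Times_le: "|A| \<le>o \<kappa> ==> |B| \<le>o \<kappa> ==> |A \<times> B| \<le>o \<kappa>"
 by (rule card_of_Times_ordLeq_infinite_Field[OF infinite_Field _ _ Card])

lemma bounded:
 assumes "A \<subseteq> Field \<kappa>" "|A| <o \<kappa>"
 shows "\<exists>x\<in>Field \<kappa>. \<forall>a\<in>A. a \<noteq> x \<and> (a, x) \<in> \<kappa>"
proof -
 have "\<not> cofinal A \<kappa>"
  using regular assms not_ordLess_ordIso unfolding regularCard_def by blast
 then obtain x where x: "x \<in> Field \<kappa>" "\<And>a. a \<in> A ==> \<not> (x \<noteq> a \<and> (x, a) \<in> \<kappa>)"
  unfolding cofinal_def by blast
 obtain y where y: "y \<in> Field \<kappa>" "x \<noteq> y" "(x, y) \<in> \<kappa>" using above[OF x(1)] by blast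
 have ord: "total_on (Field \<kappa>) \<kappa>" "trans \<kappa>" "antisym \<kappa>" "refl_on (Field \<kappa>) \<kappa>"
  using wo_k by (auto simp: order_on_defs)
 have "a \<noteq> y \<and> (a, y) \<in> \<kappa>" if a: "a \<in> A" for a
 proof -
  have "(a, x) \<in> \<kappa>" using x(2)[OF a] ord(1,4) x(1) assms(1) a unfolding total_on_def refl_on_def by (metis subsetD)
  then show ?thesis using y ord(2,3) unfolding trans_def antisym_def by metis
 qed
 then show ?thesis using y(1) by blast
qed

text \<open>A subset of size less than \<kappa> is the range of a function on a proper segment of
  \<kappa>, and \<open>less_power\<close> counts these functions.\<close>

lemma small_subsets:
 assumes Z: "|Z| \<le>o \<kappa>" shows "|{X. X \<subseteq> Z \<and> |X| <o \<kappa>}| \<le>o \<kappa>"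
proof -
 have "|Z| \<le>o |Field \<kappa>|" using ordLeq_ordIso_trans[OF Z ordIso_symmetric[OF Field_k]] .
 from iffD2[OF card_of_ordLeq this] obtain j where j: "inj_on j Z" "j ` Z \<subseteq> Field \<kappa>" by blast
 let ?S = "SIGMA x : Field \<kappa>. Func (underS \<kappa> x) (Field \<kappa>)"
 let ?f = "\<lambda>(x, h). {z \<in> Z. j z \<in> h ` underS \<kappa> x}"
 have "{X. X \<subseteq> Z \<and> |X| <o \<kappa>} \<subseteq> ?f ` ?S"
 proof
  fix X assume "X \<in> {X. X \<subseteq> Z \<and> |X| <o \<kappa>}"
  then have X: "X \<subseteq> Z" "|X| <o \<kappa>" by auto
  obtain x where x: "x \<in> Field \<kappa>" "|X| =o |underS \<kappa> x|" using ordLess_underS[OF Card X(2)] .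
  from iffD2[OF card_of_ordIso ordIso_symmetric[OF x(2)]] obtain b where b: "bij_betw b (underS \<kappa> x) X" by blast
  define h where "h y = (if y \<in> underS \<kappa> x then j (b y) else undefined)" for y
  have "h ` underS \<kappa> x = j ` b ` underS \<kappa> x" unfolding h_def by (auto simp: image_iff)
  then have im: "h ` underS \<kappa> x = j ` X" using b unfolding bij_betw_def by simp
  have "h \<in> Func (underS \<kappa> x) (Field \<kappa>)"
   using b j(2) X(1) unfolding Func_def h_def bij_betw_def by auto
  moreover have "{z \<in> Z. j z \<in> j ` X} = X" using j(1) X(1) by (auto dest: inj_onD)
  ultimately show "X \<in> ?f ` ?S" using x(1) im by (intro image_eqI[of _ _ "(x, h)"]) auto
 qed
 from ordLeq_transitive[OF card_of_mono1[OF this] card_of_image]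
 have "|{X. X \<subseteq> Z \<and> |X| <o \<kappa>}| \<le>o |?S|" .
 then show ?thesis using lp unfolding less_power_def by (rule ordLeq_ordIso_trans)
qed

text \<open>The closure takes \<kappa> rounds: by regularity a subset of the union of size less than
  \<kappa> is contained in one stage, and \<open>small_subsets\<close> keeps every stage at size at
  most \<kappa>.\<close>

lemma closure_exists:
 fixes \<Phi> :: "'b set => 'b set"
 assumes W0: "|W0| \<le>o \<kappa>" and \<Phi>: "\<And>E. |E| <o \<kappa> ==> |\<Phi> E| \<le>o \<kappa>"
 shows "\<exists>W. W0 \<subseteq> W \<and> |W| \<le>o \<kappa> \<and> (\<forall>E. E \<subseteq> W \<and> |E| <o \<kappa> --> \<Phi> E \<subseteq> W)"
proof -
 define step where "step S = S \<union> \<Union> (\<Phi> ` {E. E \<subseteq> S \<and> |E| <o \<kappa>})" for S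
 define V where "V = wfrec (\<kappa> - Id) (\<lambda>g x. W0 \<union> (\<Union>y\<in>underS \<kappa> x. step (g y)))"
 have wf: "wf (\<kappa> - Id)" using wo_k by (simp add: well_order_on_def)
 have V: "V x = W0 \<union> (\<Union>y\<in>underS \<kappa> x. step (V y))" for x
 proof -
  have "V x = W0 \<union> (\<Union>y\<in>underS \<kappa> x. step (cut V (\<kappa> - Id) x y))"
   unfolding V_def by (subst wfrec[OF wf]) simp
  also have "\<dots> = W0 \<union> (\<Union>y\<in>underS \<kappa> x. step (V y))"
   by (auto simp: cut_def underS_def)
  finally show ?thesis .
 qed
 have step_le: "|step S| \<le>o \<kappa>" if "|S| \<le>o \<kappa>" for S
  unfolding step_def using that \<Phi> small_subsets by (intro Un_le UN_le) auto
 have V_le: "|V x| \<le>o \<kappa>" for x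
 proof (induction x rule: wf_induct[OF wf])
  case (1 x)
  show ?case
  proof (cases "x \<in> Field \<kappa>")
   case True
   then show ?thesis
    unfolding V[of x] using 1 by (intro Un_le W0 UN_le[OF less_le[OF underS_less[OF True]] step_le]) (auto simp: underS_def)
  next
   case False
   then have "underS \<kappa> x = {}" by (auto simp: underS_def intro: FieldI2)
   then show ?thesis unfolding V[of x] using W0 by simp
  qed
 qed
 have V_step: "step (V y) \<subseteq> V x" if "y \<noteq> x" "(y, x) \<in> \<kappa>" for x y
  using that V[of x] by (auto simp: underS_def)
 let ?W = "\<Union>x\<in>Field \<kappa>. V x"
 have "|?W| \<le>o \<kappa>" using V_le ordIso_imp_ordLeq[OF Field_k] by (intro UN_le)
 moreover have "W0 \<subseteq> ?W" using V infinite_Field by (metis UN_upper Un_upper1 dual_order.trans equals0I finite.emptyI)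
 moreover have "\<Phi> E \<subseteq> ?W" if E: "E \<subseteq> ?W" "|E| <o \<kappa>" for E
 proof -
  obtain f where f: "\<And>e. e \<in> E ==> f e \<in> Field \<kappa> \<and> e \<in> V (f e)" using E(1) by (metis UN_E subsetD)
  obtain x where x: "x \<in> Field \<kappa>" "\<forall>a\<in>f ` E. a \<noteq> x \<and> (a, x) \<in> \<kappa>"
   using bounded[of "f ` E"] f image_less[OF E(2)] by blast
  obtain y where y: "y \<in> Field \<kappa>" "x \<noteq> y" "(x, y) \<in> \<kappa>" using above[OF x(1)] by blast
  have "E \<subseteq> V x"
  proof
   fix e assume e: "e \<in> E"
   have "e \<in> step (V (f e))" using f[OF e] unfolding step_def by blast
   then show "e \<in> V x" using V_step[of "f e" x] x(2) e by blast
  qed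
  then have "\<Phi> E \<subseteq> step (V x)" using E(2) unfolding step_def by blast
  then show ?thesis using V_step[OF y(2,3)] y(1) by blast
 qed
 ultimately show ?thesis by blast
qed

text \<open>For each root \<open>D\<close> fix a maximal system \<open>K D\<close>. If all of them
  had size at most \<kappa>, a set \<open>W\<close> of size at most \<kappa> could be closed under
  passing from a small \<open>D\<close> to the union of the sets indexed by \<open>K D\<close>. Some
  \<open>S i\<close> is not contained in \<open>W\<close>. For the root
  \<open>S i \<inter> W\<close> the sets of the maximal system lie inside \<open>W\<close>, so
  \<open>i\<close> could be added to it. \<open>fib\<close> allows for repetitions in the family
  \<open>S\<close>.\<close>

lemma delta_system:
 fixes S :: "'i => 'b set"
 assumes S: "\<And>i. i \<in> I ==> |S i| <o \<kappa>" and I: "\<not> |I| \<le>o \<kappa>"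
  and fib: "\<And>X. |{i \<in> I. S i = X}| \<le>o \<kappa>"
 shows "\<exists>D I'. I' \<subseteq> I \<and> \<not> |I'| \<le>o \<kappa> \<and> (\<forall>i\<in>I'. D \<subseteq> S i) \<and> (\<forall>i\<in>I'. \<forall>j\<in>I'. i \<noteq> j --> S i \<inter> S j = D)"
proof -
 define P where "P D = {K. K \<subseteq> I \<and> (\<forall>i\<in>K. D \<subseteq> S i) \<and> (\<forall>i\<in>K. \<forall>j\<in>K. i \<noteq> j --> S i \<inter> S j = D)}" for D
 have "\<exists>K\<in>P D. \<forall>K'\<in>P D. K \<subseteq> K' --> K' = K" for D
 proof (rule subset_Zorn_nonempty)
  show "P D \<noteq> {}" unfolding P_def by blast
  fix \<C> assume ne: "\<C> \<noteq> {}" and ch: "subset.chain (P D) \<C>"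
  have sub: "\<C> \<subseteq> P D" and tot: "\<And>X Y. X \<in> \<C> ==> Y \<in> \<C> ==> X \<subseteq> Y \<or> Y \<subseteq> X"
   using ch unfolding subset_chain_def by blast+
  show "\<Union> \<C> \<in> P D"
   unfolding P_def
  proof (intro CollectI conjI ballI impI)
   show "\<Union> \<C> \<subseteq> I" using sub unfolding P_def by blast
   show "D \<subseteq> S i" if "i \<in> \<Union> \<C>" for i using that sub unfolding P_def by blast
   fix i j assume ij: "i \<in> \<Union> \<C>" "j \<in> \<Union> \<C>" "i \<noteq> j"
   then obtain X where "X \<in> \<C>" "i \<in> X" "j \<in> X" using tot by (metis UnionE subsetD)
   then show "S i \<inter> S j = D" using sub ij(3) unfolding P_def by blast
  qed
 qed
 then obtain K where K: "\<And>D. K D \<in> P D" "\<And>D K'. K' \<in> P D ==> K D \<subseteq> K' ==> K' = K D" by metis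
 have "\<exists>D. \<not> |K D| \<le>o \<kappa>"
 proof (rule ccontr)
  assume "\<not> ?thesis"
  then have le: "|K D| \<le>o \<kappa>" for D by blast
  define \<Phi> where "\<Phi> D = (\<Union>i\<in>K D. S i)" for D
  have \<Phi>: "|\<Phi> D| \<le>o \<kappa>" for D
   unfolding \<Phi>_def using K(1)[of D] S by (intro UN_le[OF le less_le]) (auto simp: P_def)
  have e: "|{} :: 'b set| \<le>o \<kappa>" by (rule less_le[OF finite_less]) simp
  have "\<exists>W. {} \<subseteq> W \<and> |W| \<le>o \<kappa> \<and> (\<forall>E. E \<subseteq> W \<and> |E| <o \<kappa> --> \<Phi> E \<subseteq> W)"
   by (rule closure_exists[OF e \<Phi>])
  then obtain W where W: "|W| \<le>o \<kappa>" "\<And>E. E \<subseteq> W ==> |E| <o \<kappa> ==> \<Phi> E \<subseteq> W"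
   by auto
  have "\<exists>i\<in>I. \<not> S i \<subseteq> W"
  proof (rule ccontr)
   assume "\<not> ?thesis"
   then have "I \<subseteq> (\<Union>X\<in>{X. X \<subseteq> W \<and> |X| <o \<kappa>}. {i \<in> I. S i = X})" using S by blast
   moreover have "|\<Union>X\<in>{X. X \<subseteq> W \<and> |X| <o \<kappa>}. {i \<in> I. S i = X}| \<le>o \<kappa>"
    by (rule UN_le[OF small_subsets[OF W(1)] fib])
   ultimately show False using I subset_le by blast
  qed
  then obtain i where i: "i \<in> I" "\<not> S i \<subseteq> W" by blast
  let ?D = "S i \<inter> W"
  have "|?D| <o \<kappa>" using subset_less[OF _ S[OF i(1)]] by blast
  then have sub: "\<Phi> ?D \<subseteq> W" using W(2) by blast
  have Sj: "S j \<subseteq> W" if "j \<in> K ?D" for j using that sub unfolding \<Phi>_def by blast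
  have KD: "K ?D \<subseteq> I" "\<And>j. j \<in> K ?D ==> ?D \<subseteq> S j" "\<And>j l. j \<in> K ?D ==> l \<in> K ?D ==> j \<noteq> l ==> S j \<inter> S l = ?D"
   using K(1)[of ?D] unfolding P_def by auto
  have "S i \<inter> S j = ?D" if "j \<in> K ?D" for j using Sj[OF that] KD(2)[OF that] by blast
  then have "insert i (K ?D) \<in> P ?D" unfolding P_def using KD i(1) by (auto simp: Int_commute)
  then have "i \<in> K ?D" using K(2)[of "insert i (K ?D)" ?D] by blast
  then show False using Sj i(2) by blast
 qed
 then obtain D where "\<not> |K D| \<le>o \<kappa>" by blast
 then show ?thesis using K(1)[of D] unfolding P_def by blast
qed

lemma large_fibre:
 assumes I: "\<not> |I| \<le>o \<kappa>" and t: "t ` I \<subseteq> Z" "|Z| \<le>o \<kappa>"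
 shows "\<exists>z. \<not> |{i \<in> I. t i = z}| \<le>o \<kappa>"
proof (rule ccontr)
 assume "\<not> ?thesis"
 then have "|\<Union>z\<in>Z. {i \<in> I. t i = z}| \<le>o \<kappa>" using t(2) by (intro UN_le) auto
 moreover have "I \<subseteq> (\<Union>z\<in>Z. {i \<in> I. t i = z})" using t(1) by blast
 ultimately show False using I subset_le by blast
qed

end

section \<open>The conditions and their amalgamation\<close>

datatype 'a pt = Low 'a 'a | Top 'a

fun lv :: "'a pt => 'a lev" where
 "lv (Low x i) = Lo x"
| "lv (Top l) = Hi 0"

definition strict :: "'b rel => 'b => 'b => bool" where
 "strict r a b \<longleftrightarrow> (a, b) \<in> r \<and> a \<noteq> b"

lemma Partial_orderD:
 assumes "Partial_order r"
 shows "a \<in> Field r ==> (a, a) \<in> r" "(a, b) \<in> r ==> (b, c) \<in> r ==> (a, c) \<in> r"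
  "(a, b) \<in> r ==> (b, a) \<in> r ==> a = b"
 using assms unfolding order_on_defs refl_on_def trans_def antisym_def by blast+

lemma Partial_orderI:
 assumes "\<And>a b. (a, b) \<in> r ==> (a, a) \<in> r \<and> (b, b) \<in> r" "\<And>a b c. (a, b) \<in> r ==> (b, c) \<in> r ==> (a, c) \<in> r"
  "\<And>a b. (a, b) \<in> r ==> (b, a) \<in> r ==> a = b"
 shows "Partial_order r"
 unfolding order_on_defs refl_on_def trans_def antisym_def
 using assms by (auto simp: Field_def)

lemma Well_order_strict:
 assumes "Well_order r"
 shows strict_trans: "strict r a b ==> strict r b c ==> strict r a c"
  and strict_total: "a \<in> Field r ==> b \<in> Field r ==> a = b \<or> strict r a b \<or> strict r b a"
  and strict_asym: "strict r a b ==> \<not> strict r b a"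
proof -
 have *: "total_on (Field r) r" "trans r" "antisym r" using assms by (auto simp: order_on_defs)
 show "strict r a b ==> strict r b c ==> strict r a c"
  using *(2,3) unfolding strict_def trans_def antisym_def by metis
 show "a \<in> Field r ==> b \<in> Field r ==> a = b \<or> strict r a b \<or> strict r b a"
  using *(1) unfolding strict_def total_on_def by blast
 show "strict r a b ==> \<not> strict r b a" using *(3) unfolding strict_def antisym_def by blast
qed

locale cs_poset = reg_card \<kappa> for \<kappa> :: "'a rel" +
 fixes \<Lambda> \<eta> :: "'a rel" and F :: "'a set => 'a set" and \<rho> :: "'a => 'a set"
 assumes wo_eta: "Well_order \<eta>"
  and rho: "bij_betw \<rho> (Field \<eta>) (Field (cardSuc \<kappa>))"
  and F: "strongly_unbounded \<kappa> \<Lambda> F"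
  and cf: "\<And>A. A \<subseteq> Field \<eta> ==> |A| \<le>o \<kappa> ==> \<exists>z\<in>Field \<eta>. \<forall>a\<in>A. strict \<eta> a z"
begin

abbreviation cless where "cless \<equiv> strict (cardSuc \<kappa>)"
abbreviation lless (infix "\<sqsubset>" 50) where "\<alpha> \<sqsubset> \<beta> \<equiv> lev_less \<eta> \<alpha> \<beta>"

lemmas lt_trans = lev_less_trans[OF wo_eta]

lemma wo_C: "Well_order (cardSuc \<kappa>)"
 using cardSuc_Card_order[OF Card] by (simp add: card_order_on_def)

definition T :: "'a pt set" where
 "T = {Low x i | x i. x \<in> Field \<eta> \<and> i \<in> Field \<kappa>} \<union> Top ` Field \<Lambda>"

text \<open>\<open>ok s t v\<close> bounds the level of a common lower bound \<open>v\<close> of \<open>s\<close> and \<open>t\<close> that a condition may use: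
 it leaves only \<open>\<kappa>\<close> many points \<open>v\<close> for given \<open>s\<close> and \<open>t\<close>.\<close>

definition ok :: "'a pt => 'a pt => 'a pt => bool" where
 "ok s t v \<longleftrightarrow> (\<exists>y j. v = Low y j \<and> (\<forall>x i. s = Low x i --> cless (\<rho> y) (\<rho> x)) \<and>
  (\<forall>x i. t = Low x i --> cless (\<rho> y) (\<rho> x)) \<and> (\<forall>l m. s = Top l --> t = Top m --> cless (\<rho> y) (F {l, m})))"

lemma ok_sym: "ok s t v ==> ok t s v"
 unfolding ok_def by (auto simp: insert_commute)

text \<open>\<open>I\<close> is any finite cofinal set of common lower bounds; its elements need not
  be maximal, and it is empty exactly if there is no common lower bound.\<close>

definition covered :: "'a pt rel => 'a pt => 'a pt => bool" where
 "covered r s t \<longleftrightarrow> (\<exists>I. finite I \<and> (\<forall>v\<in>I. (v, s) \<in> r \<and> (v, t) \<in> r \<and> ok s t v) \<and>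
  (\<forall>u. (u, s) \<in> r --> (u, t) \<in> r --> (\<exists>v\<in>I. (u, v) \<in> r)))"

definition cnd :: "'a pt rel => bool" where
 "cnd r \<longleftrightarrow> |Field r| <o \<kappa> \<and> Partial_order r \<and> Field r \<subseteq> T \<and>
  (\<forall>s t. (s, t) \<in> r --> s \<noteq> t --> lv s \<sqsubset> lv t) \<and>
  (\<forall>s\<in>Field r. \<forall>t\<in>Field r. (s, t) \<notin> r --> (t, s) \<notin> r --> covered r s t)"

text \<open>The last clause keeps a finite set that witnesses \<open>covered\<close> in
  \<open>p\<close> valid in every extension.\<close>

definition ext :: "'a pt rel => 'a pt rel => bool" where
 "ext q p \<longleftrightarrow> p \<subseteq> q \<and> (\<forall>s\<in>Field p. \<forall>t\<in>Field p. (s, t) \<in> q --> (s, t) \<in> p) \<and>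
  (\<forall>s\<in>Field p. \<forall>t\<in>Field p. (s, t) \<notin> p --> (t, s) \<notin> p -->
   (\<forall>u. (u, s) \<in> q --> (u, t) \<in> q --> (\<exists>v. (v, s) \<in> p \<and> (v, t) \<in> p \<and> (u, v) \<in> q)))"

lemma
 assumes "cnd r"
 shows cnd_small: "|Field r| <o \<kappa>" and cnd_po: "Partial_order r" and cnd_T: "Field r \<subseteq> T"
  and cnd_lv: "(s, t) \<in> r ==> s \<noteq> t ==> lv s \<sqsubset> lv t"
  and cnd_cov: "s \<in> Field r ==> t \<in> Field r ==> (s, t) \<notin> r ==> (t, s) \<notin> r ==> covered r s t"
 using assms unfolding cnd_def by blast+

lemma cnd_refl: "cnd r ==> s \<in> Field r ==> (s, s) \<in> r"
 and cnd_trans: "cnd r ==> (s, t) \<in> r ==> (t, u) \<in> r ==> (s, u) \<in> r"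
 and cnd_antisym: "cnd r ==> (s, t) \<in> r ==> (t, s) \<in> r ==> s = t"
 using Partial_orderD[OF cnd_po] by blast+

lemma
 assumes "ext q p"
 shows ext_sub: "p \<subseteq> q"
  and ext_restr: "s \<in> Field p ==> t \<in> Field p ==> (s, t) \<in> q ==> (s, t) \<in> p"
  and ext_cov: "s \<in> Field p ==> t \<in> Field p ==> (s, t) \<notin> p ==> (t, s) \<notin> p ==> (u, s) \<in> q ==> (u, t) \<in> q ==>
   \<exists>v. (v, s) \<in> p \<and> (v, t) \<in> p \<and> (u, v) \<in> q"
 using assms unfolding ext_def by blast+

lemma ext_Field: "ext q p ==> Field p \<subseteq> Field q"
 by (rule mono_Field[OF ext_sub])

lemma ext_refl: "cnd p ==> ext p p"
 unfolding ext_def using cnd_refl[of p] FieldI1[of _ _ p] by (intro conjI ballI allI impI subset_refl; blast)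

lemma ext_trans:
 assumes r: "cnd r" and rq: "ext r q" and qp: "ext q p" shows "ext r p"
 unfolding ext_def
proof (intro conjI ballI impI allI)
 show "p \<subseteq> r" using ext_sub[OF rq] ext_sub[OF qp] by blast
 fix s t assume st: "s \<in> Field p" "t \<in> Field p"
 have st': "s \<in> Field q" "t \<in> Field q" using st ext_Field[OF qp] by blast+
 show "(s, t) \<in> p" if "(s, t) \<in> r" using that ext_restr[OF rq st'] ext_restr[OF qp st] by blast
 fix u assume n: "(s, t) \<notin> p" "(t, s) \<notin> p" and u: "(u, s) \<in> r" "(u, t) \<in> r"
 have "(s, t) \<notin> q" "(t, s) \<notin> q" using n st ext_restr[OF qp] by blast+
 then obtain v where v: "(v, s) \<in> q" "(v, t) \<in> q" "(u, v) \<in> r" using ext_cov[OF rq st' _ _ u] by blast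
 obtain w where w: "(w, s) \<in> p" "(w, t) \<in> p" "(v, w) \<in> q" using ext_cov[OF qp st n v(1,2)] by blast
 have "(u, w) \<in> r" using cnd_trans[OF r v(3)] ext_sub[OF rq] w(3) by blast
 then show "\<exists>v. (v, s) \<in> p \<and> (v, t) \<in> p \<and> (u, v) \<in> r" using w by blast
qed

lemma ext_antisym: "ext q p ==> ext p q ==> q = p"
 unfolding ext_def by blast

text \<open>Two points of the union occur in one member of the chain, whose finite witness serves
  for the union by the last clause of \<open>ext\<close>; regularity of \<kappa> keeps the field
  small.\<close>

lemma cnd_Union:
 assumes C: "\<And>p. p \<in> C ==> cnd p" and small: "|C| <o \<kappa>"
  and ch: "\<And>p q. p \<in> C ==> q \<in> C ==> ext p q \<or> ext q p"
 shows "cnd (\<Union>C) \<and> (\<forall>p\<in>C. ext (\<Union>C) p)"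
proof -
 have FU: "Field (\<Union>C) = (\<Union>p\<in>C. Field p)" by (auto simp: Field_def)
 have two: "\<exists>r\<in>C. ext r p \<and> ext r q" if "p \<in> C" "q \<in> C" for p q
  using ch[OF that] ext_refl[OF C[OF that(1)]] ext_refl[OF C[OF that(2)]] that by blast
 have mem: "\<exists>r\<in>C. ext r p \<and> (s, t) \<in> r" if asm: "(s, t) \<in> \<Union>C" "p \<in> C" for s t p
 proof -
  obtain p' where p': "p' \<in> C" "(s, t) \<in> p'" using asm(1) by blast
  obtain r where "r \<in> C" "ext r p'" "ext r p" using two[OF p'(1) asm(2)] by blast
  then show ?thesis using ext_sub[of r p'] p'(2) by blast
 qed
 have ext: "ext (\<Union>C) p" if p: "p \<in> C" for p
  unfolding ext_def
 proof (intro conjI ballI impI allI)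
  show "p \<subseteq> \<Union>C" using p by blast
  fix s t assume st: "s \<in> Field p" "t \<in> Field p"
  show "(s, t) \<in> p" if "(s, t) \<in> \<Union>C" using mem[OF that p] ext_restr st by blast
  fix u assume n: "(s, t) \<notin> p" "(t, s) \<notin> p" and u: "(u, s) \<in> \<Union>C" "(u, t) \<in> \<Union>C"
  obtain r1 where r1: "r1 \<in> C" "ext r1 p" "(u, s) \<in> r1" using mem[OF u(1) p] by blast
  obtain r where r: "r \<in> C" "ext r r1" "(u, t) \<in> r" using mem[OF u(2) r1(1)] by blast
  have "(u, s) \<in> r" using r1 ext_sub[OF r(2)] by blast
  moreover have "ext r p" using ext_trans[OF C[OF r(1)] r(2) r1(2)] .
  ultimately obtain v where "(v, s) \<in> p" "(v, t) \<in> p" "(u, v) \<in> r" using ext_cov[OF _ st n _ r(3)] by blast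
  then show "\<exists>v. (v, s) \<in> p \<and> (v, t) \<in> p \<and> (u, v) \<in> \<Union>C" using r(1) by blast
 qed
 have "cnd (\<Union>C)"
  unfolding cnd_def
 proof (intro conjI ballI impI allI)
  show "|Field (\<Union>C)| <o \<kappa>" unfolding FU by (rule UN_less[OF small]) (rule cnd_small[OF C])
  show "Partial_order (\<Union>C)"
  proof (rule Partial_orderI)
   show "(a, a) \<in> \<Union>C \<and> (b, b) \<in> \<Union>C" if asm: "(a, b) \<in> \<Union>C" for a b
   proof -
    obtain p where "p \<in> C" "(a, b) \<in> p" using asm by blast
    then show ?thesis using cnd_refl[OF C, of p] FieldI1[of a b p] FieldI2[of a b p] by blast
   qed
   show "(a, c) \<in> \<Union>C" if ab: "(a, b) \<in> \<Union>C" "(b, c) \<in> \<Union>C" for a b c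
   proof -
    obtain p where p: "p \<in> C" "(a, b) \<in> p" using ab by blast
    obtain r where r: "r \<in> C" "ext r p" "(b, c) \<in> r" using mem[OF ab(2) p(1)] by blast
    have "(a, c) \<in> r" using cnd_trans[OF C[OF r(1)] _ r(3)] ext_sub[OF r(2)] p(2) by blast
    then show ?thesis using r(1) by blast
   qed
   show "a = b" if ab: "(a, b) \<in> \<Union>C" "(b, a) \<in> \<Union>C" for a b
   proof -
    obtain p where p: "p \<in> C" "(a, b) \<in> p" using ab by blast
    obtain r where r: "r \<in> C" "ext r p" "(b, a) \<in> r" using mem[OF ab(2) p(1)] by blast
    show ?thesis using cnd_antisym[OF C[OF r(1)] _ r(3)] ext_sub[OF r(2)] p(2) by blast
   qed
  qed
  show "Field (\<Union>C) \<subseteq> T" unfolding FU using C cnd_T by blast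
  show "lv s \<sqsubset> lv t" if "(s, t) \<in> \<Union>C" "s \<noteq> t" for s t using that C cnd_lv by blast
  fix s t assume st: "s \<in> Field (\<Union>C)" "t \<in> Field (\<Union>C)" and n: "(s, t) \<notin> \<Union>C" "(t, s) \<notin> \<Union>C"
  obtain p1 p2 where "p1 \<in> C" "s \<in> Field p1" "p2 \<in> C" "t \<in> Field p2" using st unfolding FU by blast
  then obtain p where p: "p \<in> C" "s \<in> Field p" "t \<in> Field p" using two ext_Field by (metis subsetD)
  have np: "(s, t) \<notin> p" "(t, s) \<notin> p" using n p(1) by blast+
  obtain I where I: "finite I" "\<forall>v\<in>I. (v, s) \<in> p \<and> (v, t) \<in> p \<and> ok s t v"
   "\<And>u. (u, s) \<in> p ==> (u, t) \<in> p ==> \<exists>v\<in>I. (u, v) \<in> p"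
   using cnd_cov[OF C[OF p(1)] p(2,3) np] unfolding covered_def by blast
  have "\<exists>v\<in>I. (u, v) \<in> \<Union>C" if u: "(u, s) \<in> \<Union>C" "(u, t) \<in> \<Union>C" for u
  proof -
   obtain w where w: "(w, s) \<in> p" "(w, t) \<in> p" "(u, w) \<in> \<Union>C" using ext_cov[OF ext[OF p(1)] p(2,3) np u] by blast
   obtain v where v: "v \<in> I" "(w, v) \<in> p" using I(3)[OF w(1,2)] by blast
   obtain r where r: "r \<in> C" "ext r p" "(u, w) \<in> r" using mem[OF w(3) p(1)] by blast
   have "(u, v) \<in> r" using cnd_trans[OF C[OF r(1)] r(3)] ext_sub[OF r(2)] v(2) by blast
   then show ?thesis using v(1) r(1) by blast
  qed
  then show "covered (\<Union>C) s t" unfolding covered_def using I(1,2) p(1) by (intro exI[of _ I]) blast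
 qed
 then show ?thesis using ext by blast
qed

text \<open>\<open>t\<close> becomes minimal with exactly \<open>B\<close> above it.
  \<open>princ\<close> protects the last clause of \<open>ext\<close>: two points of
  \<open>B\<close> have the least element of \<open>B\<close> as an old common lower bound above
  \<open>t\<close>. The lemma is used with \<open>B\<close> empty and with \<open>B\<close> the set
  of points above some \<open>s\<close>.\<close>

lemma add_point:
 assumes p: "cnd p" and t: "t \<in> T" "t \<notin> Field p" and B: "B \<subseteq> Field p"
  and up: "\<And>u w. u \<in> B ==> (u, w) \<in> p ==> w \<in> B" and princ: "B = {} \<or> (\<exists>s\<in>B. \<forall>u\<in>B. (s, u) \<in> p)"
  and lev: "\<And>u. u \<in> B ==> lv t \<sqsubset> lv u"
 defines "q \<equiv> p \<union> {(t, t)} \<union> {t} \<times> B"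
 shows "cnd q" "ext q p" "Field q = insert t (Field p)" "(u, t) \<in> q ==> u = t" "(t, u) \<in> q \<longleftrightarrow> u = t \<or> u \<in> B"
proof -
 have Fq: "Field q = insert t (Field p)" unfolding q_def using B by (auto simp: Field_def)
 have tp: "(t, u) \<notin> p" "(u, t) \<notin> p" for u using t(2) by (auto intro: FieldI1 FieldI2)
 have tB: "t \<notin> B" using B t(2) by blast
 have low: "u = t" if "(u, t) \<in> q" for u using that tp tB unfolding q_def by blast
 have old: "(u, w) \<in> p" if "(u, w) \<in> q" "u \<noteq> t" for u w using that unfolding q_def by blast
 have tq: "(t, u) \<in> q \<longleftrightarrow> u = t \<or> u \<in> B" for u using tp unfolding q_def by blast
 have cov: "\<exists>v. (v, a) \<in> p \<and> (v, b) \<in> p \<and> (u, v) \<in> q"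
  if "a \<in> Field p" "b \<in> Field p" "(u, a) \<in> q" "(u, b) \<in> q" for a b u
 proof (cases "u = t")
  case True
  then have ab: "a \<in> B" "b \<in> B" using that t(2) tq[of a] tq[of b] by metis+
  then obtain s where "s \<in> B" "\<forall>u\<in>B. (s, u) \<in> p" using princ by blast
  then show ?thesis using ab True tq by blast
 next
  case False
  then have "(u, a) \<in> p" "(u, b) \<in> p" using old that by blast+
  moreover have "(u, u) \<in> q" using cnd_refl[OF p FieldI1[OF \<open>(u, a) \<in> p\<close>]] unfolding q_def by blast
  ultimately show ?thesis by blast
 qed
 show "ext q p"
  unfolding ext_def
 proof (intro conjI ballI impI allI)
  show "p \<subseteq> q" unfolding q_def by blast
  fix a b assume ab: "a \<in> Field p" "b \<in> Field p"
  show "(a, b) \<in> p" if "(a, b) \<in> q" using old[OF that] ab(1) t(2) by blast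
  fix u assume "(u, a) \<in> q" "(u, b) \<in> q"
  then show "\<exists>v. (v, a) \<in> p \<and> (v, b) \<in> p \<and> (u, v) \<in> q" using cov ab by blast
 qed
 have tr: "(a, c) \<in> q" if "(a, b) \<in> q" "(b, c) \<in> q" for a b c
 proof (cases "a = t")
  case True
  show ?thesis
  proof (cases "b = t")
   case False
   then have "b \<in> B" "(b, c) \<in> p" using that True tq old by blast+
   then show ?thesis using up True tq by blast
  qed (use that True in simp)
 next
  case False
  then have ab: "(a, b) \<in> p" using that old by blast
  then have "b \<noteq> t" using tp by blast
  then have "(b, c) \<in> p" using that old by blast
  then show ?thesis using cnd_trans[OF p ab] unfolding q_def by blast
 qed
 show "cnd q"
  unfolding cnd_def
 proof (intro conjI ballI impI allI)
  show "|Field q| <o \<kappa>"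
   unfolding Fq using Un_less[OF finite_less[of "{t}"] cnd_small[OF p]] by simp
  show "Partial_order q"
  proof (rule Partial_orderI)
   show "(a, a) \<in> q \<and> (b, b) \<in> q" if "(a, b) \<in> q" for a b
   proof -
    have "a \<in> insert t (Field p)" "b \<in> insert t (Field p)" using that FieldI1 FieldI2 unfolding Fq[symmetric] by fast+
    then show ?thesis using cnd_refl[OF p] unfolding q_def by blast
   qed
   show "a = b" if "(a, b) \<in> q" "(b, a) \<in> q" for a b
    using that low old cnd_antisym[OF p] by metis
  qed (rule tr)
  show "Field q \<subseteq> T" unfolding Fq using t(1) cnd_T[OF p] by blast
  show "lv a \<sqsubset> lv b" if "(a, b) \<in> q" "a \<noteq> b" for a b
   using that lev tq old cnd_lv[OF p] by metis
  fix a b assume ab: "a \<in> Field q" "b \<in> Field q" and n: "(a, b) \<notin> q" "(b, a) \<notin> q"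
  show "covered q a b"
  proof (cases "a = t \<or> b = t")
   case True
   then have "\<not> ((u, a) \<in> q \<and> (u, b) \<in> q)" for u using low n by metis
   then show ?thesis unfolding covered_def by (intro exI[of _ "{}"]) blast
  next
   case False
   then have ab': "a \<in> Field p" "b \<in> Field p" using ab Fq by blast+
   have "(a, b) \<notin> p" "(b, a) \<notin> p" using n unfolding q_def by blast+
   then obtain I where I: "finite I" "\<forall>v\<in>I. (v, a) \<in> p \<and> (v, b) \<in> p \<and> ok a b v"
    "\<And>u. (u, a) \<in> p ==> (u, b) \<in> p ==> \<exists>v\<in>I. (u, v) \<in> p"
    using cnd_cov[OF p ab'] unfolding covered_def by blast
   have pq: "p \<subseteq> q" unfolding q_def by blast
   have "\<exists>v\<in>I. (u, v) \<in> q" if u: "(u, a) \<in> q" "(u, b) \<in> q" for u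
   proof -
    obtain w where "(w, a) \<in> p" "(w, b) \<in> p" "(u, w) \<in> q" using cov[OF ab' u] by blast
    then show ?thesis using I(3) tr pq by blast
   qed
   then show ?thesis unfolding covered_def using I(1,2) pq by (intro exI[of _ I]) blast
  qed
 qed
 show "Field q = insert t (Field p)" by (rule Fq)
 show "(u, t) \<in> q ==> u = t" by (rule low)
 show "(t, u) \<in> q \<longleftrightarrow> u = t \<or> u \<in> B" by (rule tq)
qed

end

text \<open>Two isomorphic conditions are amalgamated over their common part \<open>D\<close> by adding, for each pair
 of corresponding points outside \<open>D\<close>, a new common lower bound \<open>Low (lo s) (k s)\<close> of the two.\<close>

locale amalgam = cs_poset +
 fixes p p' :: "'a pt rel" and D :: "'a pt set" and h :: "'a pt => 'a pt" and W :: "'a set"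
  and lo :: "'a pt => 'a" and k :: "'a pt => 'a"
 assumes p: "cnd p" and p': "cnd p'" and D: "D = Field p \<inter> Field p'"
  and h: "bij_betw h (Field p) (Field p')" and hD: "\<And>s. s \<in> D ==> h s = s"
  and h_iff: "\<And>s t. s \<in> Field p ==> t \<in> Field p ==> (h s, h t) \<in> p' \<longleftrightarrow> (s, t) \<in> p"
  and W: "W \<subseteq> Field \<eta>" and W_init: "\<And>x y. x \<in> W ==> y \<in> Field \<eta> ==> cless (\<rho> y) (\<rho> x) ==> y \<in> W"
  and new: "\<And>x i. Low x i \<in> Field p - D ==> x \<notin> W" "\<And>x i. Low x i \<in> Field p' - D ==> x \<notin> W"
  and root: "\<And>x i. Low x i \<in> D ==> x \<in> W"
  and root_top: "\<And>l m y. Top l \<in> D ==> Top m \<in> D ==> l \<noteq> m ==> y \<in> Field \<eta> ==> cless (\<rho> y) (F {l, m}) ==> y \<in> W"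
  and new_top: "\<And>l m y. Top l \<in> Field p - D ==> Top m \<in> Field p' - D ==> y \<in> W ==> cless (\<rho> y) (F {l, m})"
  and lW: "\<And>s. s \<in> Field p - D ==> lo s \<in> W"
  and l_below: "\<And>s. s \<in> Field p - D ==> Lo (lo s) \<sqsubset> lv s" "\<And>s. s \<in> Field p - D ==> Lo (lo s) \<sqsubset> lv (h s)"
  and l_root: "\<And>r s. s \<in> Field p - D ==> r \<in> D ==> (r, s) \<in> p ==>
   \<exists>x i. r = Low x i \<and> Lo x \<sqsubset> Lo (lo s) \<and> cless (\<rho> x) (\<rho> (lo s))"
  and l_mono: "\<And>t s. s \<in> Field p - D ==> t \<in> Field p - D ==> (t, s) \<in> p ==> t \<noteq> s ==>
   Lo (lo t) \<sqsubset> Lo (lo s) \<and> cless (\<rho> (lo t)) (\<rho> (lo s))"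
  and k_inj: "inj_on k (Field p - D)" and k_Field: "\<And>s. s \<in> Field p - D ==> k s \<in> Field \<kappa>"
  and k_new: "\<And>s. s \<in> Field p - D ==> Low (lo s) (k s) \<notin> Field p \<union> Field p'"
begin

text \<open>A point of the amalgam is coded by a point of \<open>p\<close> and its kind: \<open>0\<close> for \<open>p\<close>, \<open>1\<close> for \<open>p'\<close>,
 \<open>2\<close> for the new points and the points of \<open>D\<close>.\<close>

definition E :: "('a pt \<times> nat) set" where
 "E = {(s, i). s \<in> Field p \<and> i \<le> 2 \<and> (s \<in> D --> i = 2)}"

definition e :: "'a pt \<times> nat => 'a pt" where
 "e a = (if fst a \<in> D \<or> snd a = 0 then fst a else if snd a = 1 then h (fst a) else Low (lo (fst a)) (k (fst a)))"

text \<open>A point of kind 2 lies below its counterparts on both sides; otherwise two different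
  kinds are connected only through the root \<open>D\<close>.\<close>

definition le :: "'a pt \<times> nat => 'a pt \<times> nat => bool" where
 "le a b \<longleftrightarrow> (fst a, fst b) \<in> p \<and>
  (snd a = 2 \<or> snd a = snd b \<or> (\<exists>m\<in>D. (fst a, m) \<in> p \<and> (m, fst b) \<in> p))"

definition q :: "'a pt rel" where
 "q = {(e a, e b) | a b. a \<in> E \<and> b \<in> E \<and> le a b}"

lemma DF: "D \<subseteq> Field p" "D \<subseteq> Field p'"
 using D by blast+

lemma h_D_iff: "s \<in> Field p ==> h s \<in> D \<longleftrightarrow> s \<in> D"
 using hD h DF unfolding bij_betw_def inj_on_def by (metis subsetD)

lemma h_mem: "s \<in> Field p ==> h s \<in> Field p'"
 using h unfolding bij_betw_def by blast

lemma inj_e: "inj_on e E"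
proof (rule inj_onI)
 fix a b assume ab: "a \<in> E" "b \<in> E" "e a = e b"
 obtain s i t j where st: "a = (s, i)" "b = (t, j)" by (metis surj_pair)
 have S: "s \<in> Field p" "t \<in> Field p" "i \<le> 2" "j \<le> 2" "s \<in> D ==> i = 2" "t \<in> D ==> j = 2"
  using ab(1,2) unfolding st E_def by auto
 have hin: "s = t" if "h s = h t" using that S(1,2) h unfolding bij_betw_def inj_on_def by blast
 have kin: "s = t" if "s \<notin> D" "t \<notin> D" "k s = k t" using that S(1,2) k_inj unfolding inj_on_def by blast
 have hs: "h s \<in> Field p'" "h t \<in> Field p'" "s \<notin> D ==> h s \<notin> D" "t \<notin> D ==> h t \<notin> D" using h_mem h_D_iff S(1,2) by auto
 have ks: "s \<notin> D ==> Low (lo s) (k s) \<notin> Field p \<union> Field p'" "t \<notin> D ==> Low (lo t) (k t) \<notin> Field p \<union> Field p'"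
  using k_new S(1,2) by blast+
 have ij: "i = 0 \<or> i = 1 \<or> i = 2" "j = 0 \<or> j = 1 \<or> j = 2" using S(3,4) by auto
 have eq: "(if s \<in> D \<or> i = 0 then s else if i = 1 then h s else Low (lo s) (k s)) =
   (if t \<in> D \<or> j = 0 then t else if j = 1 then h t else Low (lo t) (k t))"
  using ab(3) unfolding st e_def fst_conv snd_conv .
 have "s = t \<and> i = j"
 proof (cases "s \<in> D"; cases "t \<in> D")
  assume "s \<in> D" "t \<in> D"
  then show ?thesis using eq S by simp
 next
  assume sD: "s \<in> D" "t \<notin> D"
  then have "s \<in> Field p'" using DF by blast
  then show ?thesis using eq sD S hs ks ij(2) D by auto
 next
  assume sD: "s \<notin> D" "t \<in> D"
  then have "t \<in> Field p'" using DF by blast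
  then show ?thesis using eq sD S hs ks ij(1) D by auto
 next
  assume sD: "s \<notin> D" "t \<notin> D"
  have hD': "h s \<notin> Field p" "h t \<notin> Field p" "s \<notin> Field p'" "t \<notin> Field p'" using hs sD S D by blast+
  have 1: ?thesis if "i = j" using that ij(1) eq sD hin kin by (elim disjE) auto
  have 2: False if "i \<noteq> j" using that ij eq sD S hD' hs(1,2) ks by (elim disjE) auto
  show ?thesis using 1 2 by blast
 qed
 then show "a = b" unfolding st by simp
qed

lemma le_refl: "a \<in> E ==> le a a"
 unfolding le_def E_def using cnd_refl[OF p] by auto

lemma le_trans: "le a b ==> le b c ==> le a c"
 unfolding le_def using cnd_trans[OF p] by metis

lemma le_antisym:
 assumes "a \<in> E" "b \<in> E" "le a b" "le b a" shows "a = b"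
proof -
 have eq: "fst a = fst b" using assms cnd_antisym[OF p] unfolding le_def by blast
 have "snd a = snd b"
 proof (rule ccontr)
  assume ne: "snd a \<noteq> snd b"
  have "\<exists>m\<in>D. (fst a, m) \<in> p \<and> (m, fst a) \<in> p" using assms(3,4) ne eq unfolding le_def by metis
  then have "fst a \<in> D" using cnd_antisym[OF p] by blast
  then show False using assms(1,2) ne eq unfolding E_def by auto
 qed
 then show ?thesis using eq by (simp add: prod_eq_iff)
qed

lemma q_iff: "a \<in> E ==> b \<in> E ==> (e a, e b) \<in> q \<longleftrightarrow> le a b"
 unfolding q_def mem_Collect_eq prod.inject using inj_onD[OF inj_e] by metis

lemma q_E: "(u, w) \<in> q ==> \<exists>a\<in>E. \<exists>b\<in>E. u = e a \<and> w = e b \<and> le a b"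
 unfolding q_def by blast

lemma Field_q: "Field q = e ` E"
proof
 show "Field q \<subseteq> e ` E" unfolding q_def Field_def by auto
 show "e ` E \<subseteq> Field q" using le_refl q_iff by (meson FieldI1 image_subsetI)
qed

lemma q_po: "Partial_order q"
proof (rule Partial_orderI)
 show "(a, a) \<in> q \<and> (b, b) \<in> q" if "(a, b) \<in> q" for a b
  using q_E[OF that] q_iff le_refl by blast
 show "(a, c) \<in> q" if "(a, b) \<in> q" "(b, c) \<in> q" for a b c
  using q_E[OF that(1)] q_E[OF that(2)] q_iff le_trans inj_e by (metis inj_onD)
 show "a = b" if "(a, b) \<in> q" "(b, a) \<in> q" for a b
  using q_E[OF that(1)] that q_iff le_antisym by blast
qed

text \<open>The code of the copy of \<open>s\<close> in \<open>P l\<close>; a root point is its own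
  copy and always has kind 2.\<close>

definition side :: "nat => 'a pt => 'a pt \<times> nat" where
 "side l s = (s, if s \<in> D then 2 else l)"

definition P :: "nat => 'a pt rel" where
 "P l = (if l = 0 then p else p')"

lemma side_E: "s \<in> Field p ==> l \<le> 2 ==> side l s \<in> E"
 unfolding side_def E_def by auto

lemma e_side: "e (side 0 s) = s" "s \<in> Field p ==> e (side (Suc 0) s) = h s"
 unfolding side_def e_def using hD by auto

lemma P_iff: "s \<in> Field p ==> t \<in> Field p ==> l < 2 ==> (e (side l s), e (side l t)) \<in> P l \<longleftrightarrow> (s, t) \<in> p"
 using h_iff by (cases "l = 0") (simp_all add: P_def e_side less_2_cases_iff)

lemma P_cnd: "cnd (P l)"
 using p p' by (simp add: P_def)

lemma P_Field: "l < 2 ==> Field (P l) = (\<lambda>s. e (side l s)) ` Field p"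
 using h by (cases "l = 0") (auto simp: P_def e_side less_2_cases_iff bij_betw_def cong: image_cong)

lemma le_side: "s \<in> Field p ==> t \<in> Field p ==> le (side l s) (side l t) \<longleftrightarrow> (s, t) \<in> p"
 unfolding le_def side_def using cnd_refl[OF p] by auto

text \<open>The witness is transported into \<open>p\<close> along the isomorphism, so that both
  sides are treated alike. \<open>ok\<close> stays with the copies, because \<open>h\<close>
  respects the order but need not respect the levels.\<close>

lemma side_cov:
 assumes "s \<in> Field p" "t \<in> Field p" "(s, t) \<notin> p" "(t, s) \<notin> p" "l < 2"
 obtains I where "finite I" "\<And>v. v \<in> I ==> (v, s) \<in> p \<and> (v, t) \<in> p \<and> ok (e (side l s)) (e (side l t)) (e (side l v))"
  "\<And>u. (u, s) \<in> p ==> (u, t) \<in> p ==> \<exists>v\<in>I. (u, v) \<in> p"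
proof -
 let ?f = "\<lambda>s. e (side l s)"
 have F: "?f s \<in> Field (P l)" "?f t \<in> Field (P l)" using assms P_Field by auto
 obtain I where I: "finite I" "\<forall>v\<in>I. (v, ?f s) \<in> P l \<and> (v, ?f t) \<in> P l \<and> ok (?f s) (?f t) v"
  "\<And>u. (u, ?f s) \<in> P l ==> (u, ?f t) \<in> P l ==> \<exists>v\<in>I. (u, v) \<in> P l"
  using cnd_cov[OF P_cnd F] P_iff assms unfolding covered_def by blast
 let ?I = "{v \<in> Field p. ?f v \<in> I}"
 have inj: "inj_on ?f (Field p)"
 proof (rule inj_onI)
  fix s t assume "s \<in> Field p" "t \<in> Field p" "?f s = ?f t"
  then have "side l s = side l t" using inj_e side_E assms(5) by (metis inj_onD less_imp_le_nat)
  then show "s = t" unfolding side_def by simp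
 qed
 have "finite (?f ` ?I)" by (rule finite_subset[OF _ I(1)]) blast
 then have "finite ?I" by (rule finite_imageD) (use inj in \<open>auto intro: inj_on_subset\<close>)
 moreover have "\<exists>v\<in>?I. (u, v) \<in> p" if u: "(u, s) \<in> p" "(u, t) \<in> p" for u
 proof -
  have uF: "u \<in> Field p" using u by (blast intro: FieldI1)
  then have "(?f u, ?f s) \<in> P l" "(?f u, ?f t) \<in> P l" using P_iff assms u by blast+
  then obtain v where v: "v \<in> I" "(?f u, v) \<in> P l" using I(3) by blast
  then have "v \<in> Field (P l)" by (blast intro: FieldI2)
  then obtain w where w: "w \<in> Field p" "v = ?f w" using P_Field assms(5) by blast
  then have "(u, w) \<in> p" using v(2) P_iff uF assms(5) by blast
  then show ?thesis using v w by blast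
 qed
 ultimately show ?thesis using that[of ?I] I(2) P_iff assms by blast
qed

lemma low_in_D: "v \<in> Field p ==> v = Low y j ==> y \<in> W ==> v \<in> D"
 using new by blast

lemma Low_Field: "Low y j \<in> Field p ==> y \<in> Field \<eta>"
 using cnd_T[OF p] unfolding T_def by auto

lemma top_max: "(Top l, t) \<in> p ==> t = Top l"
 using cnd_lv[OF p, of "Top l" t] by (cases t) auto

text \<open>The reason for closing \<open>W\<close> downwards under \<rho>: the cover of
  \<open>m\<close> and \<open>w\<close> contains a \<open>v\<close> whose level has smaller \<rho>
  than that of \<open>m\<close>. So this level is in \<open>W\<close>, and a point of
  \<open>p\<close> with level in \<open>W\<close> is a root point.\<close>

lemma root_cov2:
 assumes m: "m \<in> D" "m = Low x i" and w: "w \<in> Field p" "(w, m) \<notin> p" and u: "(u, m) \<in> p" "(u, w) \<in> p"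
 shows "\<exists>v\<in>D. (u, v) \<in> p \<and> (v, m) \<in> p \<and> (v, w) \<in> p"
proof (cases "(m, w) \<in> p")
 case True
 then show ?thesis using m u cnd_refl[OF p] DF by blast
next
 case False
 have mF: "m \<in> Field p" using m DF by blast
 obtain I where I: "\<And>v. v \<in> I ==> (v, m) \<in> p \<and> (v, w) \<in> p \<and> ok (e (side 0 m)) (e (side 0 w)) (e (side 0 v))"
  "\<And>u. (u, m) \<in> p ==> (u, w) \<in> p ==> \<exists>v\<in>I. (u, v) \<in> p"
  using side_cov[OF mF w(1) False w(2)] by (metis zero_less_numeral)
 then obtain v where v: "v \<in> I" "(u, v) \<in> p" using u by blast
 have vm: "(v, m) \<in> p" "(v, w) \<in> p" "ok m w v" using I(1)[OF v(1)] by (simp_all add: e_side)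
 obtain y j where y: "v = Low y j" "cless (\<rho> y) (\<rho> x)" using vm(3) m(2) unfolding ok_def by blast
 have vF: "v \<in> Field p" using vm by (blast intro: FieldI1)
 have "y \<in> W" using W_init[OF root _ y(2)] m Low_Field vF y(1) by blast
 then have "v \<in> D" using low_in_D vF y(1) by blast
 then show ?thesis using v vm by blast
qed

text \<open>For two top points of the root \<open>ok\<close> gives no bound by a \<rho> of theirs;
  instead \<open>root_top\<close> places the levels allowed by F in \<open>W\<close>.\<close>

lemma root_cov1:
 assumes m: "m \<in> D" "m' \<in> D" and u: "(u, m) \<in> p" "(u, m') \<in> p"
 shows "\<exists>v\<in>D. (u, v) \<in> p \<and> (v, m) \<in> p \<and> (v, m') \<in> p"
proof (cases "(m, m') \<in> p \<or> (m', m) \<in> p")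
 case True
 then show ?thesis using m u cnd_refl[OF p] DF by blast
next
 case False
 show ?thesis
 proof (cases "(\<exists>x i. m = Low x i) \<or> (\<exists>x i. m' = Low x i)")
  case True
  then show ?thesis using root_cov2[of m _ _ m' u] root_cov2[of m' _ _ m u] m u False DF by blast
 next
  case notlow: False
  then obtain l l' where l: "m = Top l" "m' = Top l'" by (metis pt.exhaust)
  have mF: "m \<in> Field p" "m' \<in> Field p" using m DF by blast+
  obtain I where I: "\<And>v. v \<in> I ==> (v, m) \<in> p \<and> (v, m') \<in> p \<and> ok (e (side 0 m)) (e (side 0 m')) (e (side 0 v))"
   "\<And>u. (u, m) \<in> p ==> (u, m') \<in> p ==> \<exists>v\<in>I. (u, v) \<in> p"
   using side_cov[OF mF] False by (metis zero_less_numeral)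
  then obtain v where v: "v \<in> I" "(u, v) \<in> p" using u by blast
  have vm: "(v, m) \<in> p" "(v, m') \<in> p" "ok m m' v" using I(1)[OF v(1)] by (simp_all add: e_side)
  obtain y j where y: "v = Low y j" "cless (\<rho> y) (F {l, l'})" using vm(3) l unfolding ok_def by blast
  have vF: "v \<in> Field p" using vm by (blast intro: FieldI1)
  have "l \<noteq> l'" using False l cnd_refl[OF p mF(1)] by blast
  then have "y \<in> W" using root_top[OF _ _ _ _ y(2)] m l Low_Field vF y(1) by blast
  then have "v \<in> D" using low_in_D vF y(1) by blast
  then show ?thesis using v vm by blast
 qed
qed

lemma level_2:
 assumes "s \<in> Field p" "t \<in> Field p" "(s, t) \<in> p" "s \<noteq> t"
 shows "lv (e (s, 2)) \<sqsubset> lv (e (t, 2))"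
proof (cases "s \<in> D"; cases "t \<in> D")
 assume "s \<in> D" "t \<in> D"
 then show ?thesis using cnd_lv[OF p assms(3,4)] by (simp add: e_def)
next
 assume "s \<in> D" "t \<notin> D"
 then show ?thesis using l_root[of t s] assms by (auto simp: e_def)
next
 assume "s \<notin> D" "t \<in> D"
 then show ?thesis using lt_trans[OF l_below(1) cnd_lv[OF p assms(3,4)]] assms by (simp add: e_def)
next
 assume "s \<notin> D" "t \<notin> D"
 then show ?thesis using l_mono[of t s] assms by (simp add: e_def)
qed

lemma level_2_le: "(s, i) \<in> E ==> i \<noteq> 2 ==> lv (e (s, 2)) \<sqsubset> lv (e (s, i))"
 using l_below unfolding E_def e_def by auto

lemma level_side:
 assumes "s \<in> Field p" "t \<in> Field p" "(s, t) \<in> p" "s \<noteq> t" "l < 2"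
 shows "lv (e (side l s)) \<sqsubset> lv (e (side l t))"
proof (rule cnd_lv[OF P_cnd[of l]])
 show "(e (side l s), e (side l t)) \<in> P l" using P_iff assms by blast
 have "side l s \<noteq> side l t" using assms(4) unfolding side_def by simp
 then show "e (side l s) \<noteq> e (side l t)" using inj_e side_E assms by (metis inj_onD less_imp_le_nat)
qed

text \<open>A step from kind 2 goes up inside kind 2 by \<open>level_2\<close> and then to the
  required side by \<open>level_2_le\<close>; a step from one side to another kind passes through a
  root point.\<close>

lemma level_mono:
 assumes a: "a \<in> E" and b: "b \<in> E" and ab: "le a b" and ne: "a \<noteq> b"
 shows "lv (e a) \<sqsubset> lv (e b)"
proof -
 obtain s i t j where st: "a = (s, i)" "b = (t, j)" by (metis surj_pair)
 have S: "s \<in> Field p" "t \<in> Field p" "(s, t) \<in> p" using a b ab unfolding st E_def le_def by auto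
 have from2: "lv (e (s, 2)) \<sqsubset> lv (e (t, j))" if "s \<in> Field p" "(s, t) \<in> p" "(s, 2) \<noteq> (t, j)" for s
 proof (cases "s = t")
  case True
  then show ?thesis using level_2_le[of t j] b that unfolding st by auto
 next
  case False
  then have *: "lv (e (s, 2)) \<sqsubset> lv (e (t, 2))" using level_2 that S by blast
  show ?thesis
  proof (cases "j = 2")
   case False
   then show ?thesis using lt_trans[OF * level_2_le] b unfolding st by blast
  qed (use * in simp)
 qed
 show ?thesis
 proof (cases "i = 2")
  case True
  then show ?thesis using from2[OF S(1,3)] ne unfolding st by blast
 next
  case i: False
  then have i2: "i < 2" and sD: "s \<notin> D" using a unfolding st E_def by auto
  then have as: "a = side i s" unfolding st side_def by simp
  show ?thesis
  proof (cases "i = j")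
   case True
   then have "b = side i t" using b i unfolding st side_def E_def by auto
   then show ?thesis using level_side[OF S _ i2] ne as unfolding st True by (auto simp: side_def)
  next
   case False
   then obtain m where m: "m \<in> D" "(s, m) \<in> p" "(m, t) \<in> p" using ab i unfolding st le_def by auto
   have mF: "m \<in> Field p" using m DF by blast
   have "side i m = (m, 2)" using m unfolding side_def by simp
   then have 1: "lv (e a) \<sqsubset> lv (e (m, 2))" using level_side[OF S(1) mF m(2) _ i2] m(1) sD as by auto
   show ?thesis
   proof (cases "(m, 2) = (t, j)")
    case False
    then show ?thesis using lt_trans[OF 1 from2[OF mF m(3)]] unfolding st by blast
   qed (use 1 in \<open>simp add: st\<close>)
  qed
 qed
qed

lemma via_root:
 assumes "le (u, i) (s, j)" "i \<noteq> 2" "i \<noteq> j"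
 shows "\<exists>m\<in>D. (u, m) \<in> p \<and> (m, s) \<in> p"
 using assms unfolding le_def by auto

lemma common_root:
 assumes "m \<in> D" "m' \<in> D" "(u, m) \<in> p" "(u, m') \<in> p" "(m, s) \<in> p" "(m', t) \<in> p"
 shows "\<exists>w\<in>D. (u, w) \<in> p \<and> (w, s) \<in> p \<and> (w, t) \<in> p"
 using root_cov1[OF assms(1-4)] cnd_trans[OF p] assms(5,6) by blast

text \<open>If \<open>c\<close> comes from the opposite side, it reaches \<open>s\<close> and
  \<open>t\<close> through root points, which \<open>common_root\<close> merges into one below both;
  the cover in \<open>p\<close> is then applied to that root point.\<close>

lemma side_cover:
 assumes st: "s \<in> Field p" "t \<in> Field p" and l: "l < 2" and n: "(s, t) \<notin> p" "(t, s) \<notin> p"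
  and I: "\<And>u. (u, s) \<in> p ==> (u, t) \<in> p ==> \<exists>v\<in>I. (u, v) \<in> p"
  and c: "c \<in> E" "le c (side l s)" "le c (side l t)"
 shows "\<exists>v\<in>I. le c (side l v)"
proof -
 obtain u i where ui: "c = (u, i)" by (metis surj_pair)
 have us: "(u, s) \<in> p" "(u, t) \<in> p" using c unfolding ui le_def side_def by auto
 show ?thesis
 proof (cases "i = 2 \<or> i = l")
  case True
  obtain v where v: "v \<in> I" "(u, v) \<in> p" using I us by blast
  have "v \<in> Field p" using v by (blast intro: FieldI2)
  then have "le c (side l v)" using True v(2) cnd_refl[OF p] unfolding ui le_def side_def by auto
  then show ?thesis using v by blast
 next
  case False
  obtain m where m: "m \<in> D" "(u, m) \<in> p" "(m, s) \<in> p"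
   using via_root[of u i s "snd (side l s)"] c(2) False unfolding ui side_def by (auto split: if_splits)
  obtain m' where m': "m' \<in> D" "(u, m') \<in> p" "(m', t) \<in> p"
   using via_root[of u i t "snd (side l t)"] c(3) False unfolding ui side_def by (auto split: if_splits)
  obtain w where w: "w \<in> D" "(u, w) \<in> p" "(w, s) \<in> p" "(w, t) \<in> p"
   using common_root[OF m(1) m'(1) m(2) m'(2) m(3) m'(3)] by blast
  obtain v where v: "v \<in> I" "(w, v) \<in> p" using I w by blast
  have "(u, v) \<in> p" using cnd_trans[OF p w(2) v(2)] .
  then have "le c (side l v)" using w v unfolding ui le_def side_def by auto
  then show ?thesis using v by blast
 qed
qed

lemma W_less: "z \<in> W ==> x \<in> Field \<eta> ==> x \<notin> W ==> cless (\<rho> z) (\<rho> x)"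
proof -
 assume z: "z \<in> W" "x \<in> Field \<eta>" "x \<notin> W"
 have zF: "z \<in> Field \<eta>" and ne: "z \<noteq> x" using z W by blast+
 have "\<rho> z \<in> Field (cardSuc \<kappa>)" "\<rho> x \<in> Field (cardSuc \<kappa>)" "\<rho> z \<noteq> \<rho> x"
  using bij_betwE[OF rho] zF z(2) ne inj_onD[OF bij_betw_imp_inj_on[OF rho]] by blast+
 then show ?thesis using strict_total[OF wo_C, of "\<rho> z" "\<rho> x"] W_init[OF z(1,2)] z(3) by blast
qed

text \<open>If the point over \<open>s\<close> is an old point outside \<open>D\<close>, its level
  is outside \<open>W\<close> and \<open>W_less\<close> applies. If it is a new lower bound,
  \<open>l_root\<close> or \<open>l_mono\<close> compares the levels. If it is in \<open>D\<close>,
  the other point must be a new lower bound, and the bound is inherited from \<open>ok\<close> in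
  \<open>p\<close>.\<close>

lemma cross_ok_low:
 assumes E: "(s, i) \<in> E" "(t, j) \<in> E" and n: "\<not> le (s, i) (t, j)" "\<not> le (t, j) (s, i)"
  and diff: "\<not> (\<exists>l<2. (s, i) = side l s \<and> (t, j) = side l t)"
  and v: "(v, s) \<in> p" "(v, t) \<in> p" "(s, t) \<notin> p ==> (t, s) \<notin> p ==> ok s t v"
  and z: "e (v, 2) = Low z z'" "z \<in> W" and x: "e (s, i) = Low x x'"
 shows "cless (\<rho> z) (\<rho> x)"
proof -
 have F: "s \<in> Field p" "t \<in> Field p" "i \<le> 2" "j \<le> 2" "s \<in> D ==> i = 2" "t \<in> D ==> j = 2" using E unfolding E_def by auto
 have vF: "v \<in> Field p" using v(1) by (blast intro: FieldI1)
 consider "s \<notin> D" "i < 2" | "s \<notin> D" "i = 2" | "s \<in> D" using F(3) by linarith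
 then show ?thesis
 proof cases
  case 1
  have "Low x x' \<in> Field p - D \<or> Low x x' \<in> Field p' - D"
   using 1 x F(1) h_mem[OF F(1)] h_D_iff[OF F(1)] by (cases "i = 0") (auto simp: e_def less_2_cases_iff)
  then have "x \<notin> W" "x \<in> Field \<eta>" using new cnd_T[OF p] cnd_T[OF p'] unfolding T_def by auto
  then show ?thesis using W_less z(2) by blast
 next
  case 2
  have x: "x = lo s" using 2 x unfolding e_def by simp
  have "v \<noteq> s" using n(1) v(2) 2 unfolding le_def by auto
  then show ?thesis
   using l_root[of s v] l_mono[of s v] v(1) vF F(1) 2(1) x z(1) unfolding e_def by (auto split: if_splits)
 next
  case 3
  have i: "i = 2" using 3 F by blast
  have "\<not> j < 2"
  proof
   assume "j < 2"
   then have "(s, i) = side j s \<and> (t, j) = side j t" using 3 i F(6) unfolding side_def by auto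
   then show False using diff \<open>j < 2\<close> by blast
  qed
  then have j: "j = 2" using F(4) by simp
  have "t \<notin> D" using diff 3 i j zero_less_numeral unfolding side_def by metis
  have ns: "(s, t) \<notin> p" "(t, s) \<notin> p" using n i j unfolding le_def by auto
  have xs: "s = Low x x'" using x 3 unfolding e_def by simp
  obtain y y' where y: "v = Low y y'" "cless (\<rho> y) (\<rho> x)" using v(3)[OF ns] xs unfolding ok_def by blast
  have "y \<in> W" using W_init[OF root _ y(2)] 3 xs Low_Field vF y(1) by blast
  then have "v \<in> D" using low_in_D[OF vF y(1)] by blast
  then show ?thesis using z(1) y unfolding e_def by simp
 qed
qed

text \<open>The cover consists of the kind 2 copies of a cover \<open>J\<close> in \<open>p\<close>
  of the underlying points, or of the smaller of these if they are comparable. Its points have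
  levels in \<open>W\<close>, which is what makes \<open>ok\<close> hold across the two
  sides.\<close>

lemma cross_covered:
 assumes E: "(s, i) \<in> E" "(t, j) \<in> E" and n: "\<not> le (s, i) (t, j)" "\<not> le (t, j) (s, i)"
  and diff: "\<not> (\<exists>l<2. (s, i) = side l s \<and> (t, j) = side l t)"
 shows "covered q (e (s, i)) (e (t, j))"
proof -
 have F: "s \<in> Field p" "t \<in> Field p" "i \<le> 2" "j \<le> 2" "s \<in> D ==> i = 2" "t \<in> D ==> j = 2" using E unfolding E_def by auto
 obtain J where J: "finite J" "\<And>v. v \<in> J ==> (v, s) \<in> p \<and> (v, t) \<in> p"
  "\<And>v. v \<in> J ==> (s, t) \<notin> p ==> (t, s) \<notin> p ==> ok s t v" "\<And>u. (u, s) \<in> p ==> (u, t) \<in> p ==> \<exists>v\<in>J. (u, v) \<in> p"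
 proof -
  consider "(s, t) \<in> p" | "(t, s) \<in> p" | "(s, t) \<notin> p" "(t, s) \<notin> p" by blast
  then show ?thesis
  proof cases
   case 1
   then show ?thesis using that[of "{s}"] cnd_refl[OF p F(1)] by blast
  next
   case 2
   then show ?thesis using that[of "{t}"] cnd_refl[OF p F(2)] by blast
  next
   case 3
   obtain I where I: "finite I" "\<And>v. v \<in> I ==> (v, s) \<in> p \<and> (v, t) \<in> p \<and> ok (e (side 0 s)) (e (side 0 t)) (e (side 0 v))"
    "\<And>u. (u, s) \<in> p ==> (u, t) \<in> p ==> \<exists>v\<in>I. (u, v) \<in> p"
    using side_cov[OF F(1,2) 3] by (metis zero_less_numeral)
   then show ?thesis using that[of I] by (simp add: e_side)
  qed
 qed
 have JF: "v \<in> Field p" if "v \<in> J" for v using J(2)[OF that] by (blast intro: FieldI1)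
 have J2: "(v, 2) \<in> E" if "v \<in> J" for v using JF[OF that] unfolding E_def by simp
 have zW: "\<exists>z z'. e (v, 2) = Low z z' \<and> z \<in> W" if v: "v \<in> J" for v
 proof (cases "v \<in> D")
  case True
  show ?thesis
  proof (cases v)
   case (Low z z')
   then show ?thesis using True root by (auto simp: e_def)
  next
   case (Top l)
   then have "s = v" "t = v" using J(2)[OF v] top_max by blast+
   then show ?thesis using n E True le_refl unfolding E_def by auto
  qed
 next
  case False
  then show ?thesis using lW JF[OF v] by (auto simp: e_def)
 qed
 have okJ: "ok (e (s, i)) (e (t, j)) (e (v, 2))" if v: "v \<in> J" for v
 proof -
  obtain z z' where z: "e (v, 2) = Low z z'" "z \<in> W" using zW[OF v] by blast
  have vst: "(v, s) \<in> p" "(v, t) \<in> p" using J(2)[OF v] by blast+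
  have diff': "\<not> (\<exists>l<2. (t, j) = side l t \<and> (s, i) = side l s)" using diff by blast
  have a: "cless (\<rho> z) (\<rho> x)" if "e (s, i) = Low x x'" for x x'
   using cross_ok_low[OF E n diff vst J(3)[OF v] z that] by blast
  have b: "cless (\<rho> z) (\<rho> x)" if "e (t, j) = Low x x'" for x x'
   using cross_ok_low[OF E(2,1) n(2,1) diff' vst(2,1) ok_sym[OF J(3)[OF v]] z that] by blast
  \<comment> \<open>Outside \<open>D\<close> a point of kind 2 is never a top point, so
    \<open>diff\<close> leaves only the case of one new top point on either side, and
    \<open>new_top\<close> gives the bound by F.\<close>
  have c: "cless (\<rho> z) (F {l, m})" if lm: "e (s, i) = Top l" "e (t, j) = Top m" for l m
  proof -
   have sD: "s \<notin> D"
   proof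
    assume "s \<in> D"
    then have "(s, i) = side l s" for l using F unfolding side_def by simp
    moreover have "t \<in> D \<or> j < 2" using lm(2) F(4) unfolding e_def by (auto split: if_splits)
    then have "\<exists>l<2. (t, j) = side l t" using F(6) unfolding side_def by (auto intro: exI[of _ "0 :: nat"])
    ultimately show False using diff by blast
   qed
   have tD: "t \<notin> D"
   proof
    assume "t \<in> D"
    then have "(t, j) = side l t" for l using F unfolding side_def by simp
    moreover have "i < 2" using lm(1) F(3) sD unfolding e_def by (auto split: if_splits)
    then have "\<exists>l<2. (s, i) = side l s" using sD unfolding side_def by auto
    ultimately show False using diff by blast
   qed
   have ij: "i < 2" "j < 2" using lm F(3,4) sD tD unfolding e_def by (auto split: if_splits)
   then have "i \<noteq> j" using diff sD tD unfolding side_def by auto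
   then consider "i = 0" "j = 1" | "i = 1" "j = 0" using ij by linarith
   then show ?thesis
   proof cases
    case 1
    then have "Top l \<in> Field p - D" "Top m \<in> Field p' - D"
     using lm sD tD F(1,2) h_mem[OF F(2)] h_D_iff[OF F(2)] unfolding e_def by auto
    then show ?thesis using new_top z(2) by blast
   next
    case 2
    then have "Top m \<in> Field p - D" "Top l \<in> Field p' - D"
     using lm sD tD F(1,2) h_mem[OF F(1)] h_D_iff[OF F(1)] unfolding e_def by auto
    then show ?thesis using new_top z(2) by (metis insert_commute)
   qed
  qed
  show ?thesis unfolding ok_def using z(1) a b c by blast
 qed
 have cov: "\<exists>v\<in>J. le c (v, 2)" if c: "c \<in> E" "le c (s, i)" "le c (t, j)" for c
 proof -
  obtain u l where ul: "c = (u, l)" by (metis surj_pair)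
  have us: "(u, s) \<in> p" "(u, t) \<in> p" using c unfolding ul le_def by auto
  show ?thesis
  proof (cases "l = 2")
   case True
   then show ?thesis using J(4)[OF us] unfolding ul le_def by auto
  next
   case l: False
   then have l2: "l < 2" using c(1) unfolding ul E_def by auto
   have "\<exists>w\<in>D. (u, w) \<in> p \<and> (w, s) \<in> p \<and> (w, t) \<in> p"
   proof -
    \<comment> \<open>Here \<open>c\<close> is on the side of \<open>s\<close> but not on that of
      \<open>t\<close>. It reaches \<open>t\<close> through a root point \<open>m\<close>, which is
      not a top point as it lies strictly below \<open>t\<close>; so \<open>root_cov2\<close> finds
      a root point below \<open>s\<close> and \<open>m\<close>.\<close>
    have one: "\<exists>w\<in>D. (u, w) \<in> p \<and> (w, s) \<in> p \<and> (w, t) \<in> p"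
     if asm: "(s, i) \<in> E" "(t, j) \<in> E" "\<not> le (s, i) (t, j)" "\<not> (\<exists>l<2. (s, i) = side l s \<and> (t, j) = side l t)"
      "l = i" "l \<noteq> j" "(u, s) \<in> p" "le (u, l) (t, j)" for s i t j
    proof -
     obtain m where m: "m \<in> D" "(u, m) \<in> p" "(m, t) \<in> p" using via_root[of u l t j] asm l by blast
     have sD: "s \<notin> D" and sF: "s \<in> Field p" using asm l unfolding E_def by auto
     then have si: "(s, i) = side l s" using asm unfolding side_def by simp
     have tD: "t \<notin> D" using asm(4) si l2 asm(2) unfolding side_def E_def by (cases "t \<in> D") auto
     obtain x x' where mx: "m = Low x x'" using m tD top_max by (cases m) auto
     have "(s, m) \<notin> p"
     proof
      assume "(s, m) \<in> p"
      then have "le (s, i) (t, j)" unfolding le_def using m cnd_trans[OF p] by auto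
      then show False using asm by blast
     qed
     then obtain w where "w \<in> D" "(u, w) \<in> p" "(w, m) \<in> p" "(w, s) \<in> p"
      using root_cov2[OF m(1) mx sF] m(2) asm(7) by blast
     then show ?thesis using cnd_trans[OF p _ m(3)] by blast
    qed
    consider "l = i" "l = j" | "l = i" "l \<noteq> j" | "l \<noteq> i" "l = j" | "l \<noteq> i" "l \<noteq> j" by blast
    then show ?thesis
    proof cases
     case 1
     then have "(s, i) = side l s \<and> (t, j) = side l t" using l F unfolding side_def by auto
     then show ?thesis using diff l2 by blast
    next
     case 2
     then show ?thesis using one[OF E n(1) diff] us c(3) ul by blast
    next
     case 3
     then show ?thesis using one[OF E(2,1) n(2)] diff us c(2) ul by blast
    next
     case 4
     obtain m where m: "m \<in> D" "(u, m) \<in> p" "(m, s) \<in> p" using via_root c(2) 4(1) l unfolding ul by blast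
     obtain m' where m': "m' \<in> D" "(u, m') \<in> p" "(m', t) \<in> p" using via_root c(3) 4(2) l unfolding ul by blast
     show ?thesis by (rule common_root[OF m(1) m'(1) m(2) m'(2) m(3) m'(3)])
    qed
   qed
   then obtain w where w: "w \<in> D" "(u, w) \<in> p" "(w, s) \<in> p" "(w, t) \<in> p" by blast
   obtain v where v: "v \<in> J" "(w, v) \<in> p" using J(4) w by blast
   then show ?thesis using w cnd_trans[OF p w(2) v(2)] unfolding ul le_def by auto
  qed
 qed
 have leJ: "le (v, 2) (s, i)" "le (v, 2) (t, j)" if "v \<in> J" for v using J(2)[OF that] unfolding le_def by auto
 show ?thesis
  unfolding covered_def
 proof (intro exI[of _ "(\<lambda>v. e (v, 2)) ` J"] conjI ballI allI impI)
  show "finite ((\<lambda>v. e (v, 2)) ` J)" using J(1) by blast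
  fix w assume "w \<in> (\<lambda>v. e (v, 2)) ` J"
  then obtain v where v: "v \<in> J" "w = e (v, 2)" by blast
  show "(w, e (s, i)) \<in> q" "(w, e (t, j)) \<in> q" "ok (e (s, i)) (e (t, j)) w"
   using v q_iff[OF J2 E(1)] q_iff[OF J2 E(2)] leJ okJ by auto
 next
  fix w assume w: "(w, e (s, i)) \<in> q" "(w, e (t, j)) \<in> q"
  obtain c where c: "c \<in> E" "w = e c" using q_E[OF w(1)] by blast
  have "le c (s, i)" "le c (t, j)" using w c q_iff E by blast+
  then obtain v where "v \<in> J" "le c (v, 2)" using cov c(1) by blast
  then show "\<exists>v\<in>(\<lambda>v. e (v, 2)) ` J. (w, v) \<in> q" using q_iff[OF c(1) J2] c(2) by blast
 qed
qed

lemma side_covered: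
 assumes st: "s \<in> Field p" "t \<in> Field p" and l: "l < 2" and n: "\<not> le (side l s) (side l t)" "\<not> le (side l t) (side l s)"
 shows "covered q (e (side l s)) (e (side l t))"
proof -
 have np: "(s, t) \<notin> p" "(t, s) \<notin> p" using n le_side st by blast+
 obtain I where I: "finite I" "\<And>v. v \<in> I ==> (v, s) \<in> p \<and> (v, t) \<in> p \<and> ok (e (side l s)) (e (side l t)) (e (side l v))"
  "\<And>u. (u, s) \<in> p ==> (u, t) \<in> p ==> \<exists>v\<in>I. (u, v) \<in> p"
  by (rule side_cov[OF st np l]) blast
 have l2: "l \<le> 2" using l by simp
 have IF: "v \<in> Field p" if "v \<in> I" for v using I(2)[OF that] by (blast intro: FieldI1)
 show ?thesis
  unfolding covered_def
 proof (intro exI[of _ "(\<lambda>v. e (side l v)) ` I"] conjI ballI allI impI)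
  show "finite ((\<lambda>v. e (side l v)) ` I)" using I(1) by blast
  fix w assume "w \<in> (\<lambda>v. e (side l v)) ` I"
  then obtain v where v: "v \<in> I" "w = e (side l v)" by blast
  show "(w, e (side l s)) \<in> q" "(w, e (side l t)) \<in> q" "ok (e (side l s)) (e (side l t)) w"
   using v I(2)[OF v(1)] q_iff[OF side_E side_E, OF IF[OF v(1)] l2 _ l2] le_side IF[OF v(1)] st by auto
 next
  fix w assume w: "(w, e (side l s)) \<in> q" "(w, e (side l t)) \<in> q"
  obtain c where c: "c \<in> E" "w = e c" using q_E[OF w(1)] by blast
  have "le c (side l s)" "le c (side l t)" using w c q_iff side_E st l2 by blast+
  then obtain v where v: "v \<in> I" "le c (side l v)" using side_cover[OF st l np I(3) c(1)] by blast
  then show "\<exists>v\<in>(\<lambda>v. e (side l v)) ` I. (w, v) \<in> q" using q_iff[OF c(1) side_E[OF IF l2]] c(2) by blast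
 qed
qed

lemma e_T: "a \<in> E ==> e a \<in> T"
proof -
 assume a: "a \<in> E"
 obtain s i where si: "a = (s, i)" by (metis surj_pair)
 have s: "s \<in> Field p" using a unfolding si E_def by auto
 have 1: "s \<in> T" "h s \<in> T" using s cnd_T[OF p] cnd_T[OF p'] h_mem by blast+
 have 2: "Low (lo s) (k s) \<in> T" if "s \<notin> D" using that s lW k_Field W unfolding T_def by blast
 show ?thesis using 1 2 unfolding si e_def by auto
qed

lemma q_cnd: "cnd q"
 unfolding cnd_def
proof (intro conjI ballI impI allI q_po)
 have "e ` E \<subseteq> Field p \<union> (Field p' \<union> (\<lambda>s. Low (lo s) (k s)) ` Field p)"
  unfolding e_def E_def using h_mem by auto
 moreover have "|Field p \<union> (Field p' \<union> (\<lambda>s. Low (lo s) (k s)) ` Field p)| <o \<kappa>"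
  by (intro Un_less image_less cnd_small p p')
 ultimately show "|Field q| <o \<kappa>" unfolding Field_q by (rule subset_less)
 show "Field q \<subseteq> T" unfolding Field_q using e_T by blast
 show "lv x \<sqsubset> lv y" if "(x, y) \<in> q" "x \<noteq> y" for x y
  using q_E[OF that(1)] that(2) level_mono by blast
 fix x y assume xy: "x \<in> Field q" "y \<in> Field q" and n: "(x, y) \<notin> q" "(y, x) \<notin> q"
 obtain a b where ab: "a \<in> E" "b \<in> E" "x = e a" "y = e b" using xy unfolding Field_q by blast
 obtain s i t j where st: "a = (s, i)" "b = (t, j)" by (metis surj_pair)
 have F: "s \<in> Field p" "t \<in> Field p" using ab(1,2) unfolding st E_def by auto
 have nl: "\<not> le a b" "\<not> le b a" using n ab q_iff by blast+
 show "covered q x y"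
 proof (cases "\<exists>l<2. (s, i) = side l s \<and> (t, j) = side l t")
  case True
  then show ?thesis using side_covered[OF F] nl unfolding ab(3,4) st by metis
 next
  case False
  then show ?thesis using cross_covered ab(1,2) nl unfolding ab(3,4) st by blast
 qed
qed

lemma q_ext: assumes l: "l < 2" shows "ext q (P l)"
 unfolding ext_def
proof (intro conjI ballI impI allI)
 have l2: "l \<le> 2" using l by simp
 have iff: "(e (side l s), e (side l t)) \<in> q \<longleftrightarrow> (e (side l s), e (side l t)) \<in> P l" if "s \<in> Field p" "t \<in> Field p" for s t
  using q_iff[OF side_E[OF that(1) l2] side_E[OF that(2) l2]] le_side[OF that] P_iff[OF that l] by blast
 show "P l \<subseteq> q"
 proof (rule subrelI)
  fix x y assume xy: "(x, y) \<in> P l"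
  then have "x \<in> Field (P l)" "y \<in> Field (P l)" by (blast intro: FieldI1 FieldI2)+
  then show "(x, y) \<in> q" using xy iff unfolding P_Field[OF l] by blast
 qed
 fix x y assume "x \<in> Field (P l)" "y \<in> Field (P l)"
 then obtain s t where st: "s \<in> Field p" "t \<in> Field p" "x = e (side l s)" "y = e (side l t)" unfolding P_Field[OF l] by blast
 show "(x, y) \<in> P l" if "(x, y) \<in> q" using that iff st by blast
 fix w assume n: "(x, y) \<notin> P l" "(y, x) \<notin> P l" and w: "(w, x) \<in> q" "(w, y) \<in> q"
 have np: "(s, t) \<notin> p" "(t, s) \<notin> p" using n P_iff st l by blast+
 obtain I where I: "\<And>v. v \<in> I ==> (v, s) \<in> p \<and> (v, t) \<in> p \<and> ok (e (side l s)) (e (side l t)) (e (side l v))"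
  "\<And>u. (u, s) \<in> p ==> (u, t) \<in> p ==> \<exists>v\<in>I. (u, v) \<in> p"
  by (rule side_cov[OF st(1,2) np l]) blast
 obtain c where c: "c \<in> E" "w = e c" using q_E[OF w(1)] by blast
 have cs: "le c (side l s)" "le c (side l t)"
  using w q_iff[OF c(1) side_E[OF st(1) l2]] q_iff[OF c(1) side_E[OF st(2) l2]] unfolding c(2) st(3,4) by blast+
 have "\<exists>v\<in>I. le c (side l v)" by (rule side_cover[OF st(1,2) l np _ c(1) cs]) (rule I(2))
 then obtain v where v: "v \<in> I" "le c (side l v)" by blast
 have vF: "v \<in> Field p" using I(1)[OF v(1)] by (blast intro: FieldI1)
 have "(w, e (side l v)) \<in> q" using q_iff[OF c(1) side_E[OF vF l2]] v(2) c(2) by blast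
 moreover have "(e (side l v), x) \<in> P l" "(e (side l v), y) \<in> P l" using P_iff[OF vF st(1) l] P_iff[OF vF st(2) l] I(1)[OF v(1)] unfolding st(3,4) by blast+
 ultimately show "\<exists>v. (v, x) \<in> P l \<and> (v, y) \<in> P l \<and> (w, v) \<in> q" by blast
qed

lemma compatible: "\<exists>r. cnd r \<and> ext r p \<and> ext r p'"
 using q_cnd q_ext[of 0] q_ext[of 1] unfolding P_def by auto

end

section \<open>The chain condition\<close>

context cs_poset
begin

section \<open>Sets of levels closed under the choices of the amalgamation\<close>

lemma cless_Field: "cless a b ==> a \<in> Field (cardSuc \<kappa>)" "cless a b ==> b \<in> Field (cardSuc \<kappa>)"
 unfolding strict_def by (auto intro: FieldI1 FieldI2)

lemma le_cardSuc: "|A| <o cardSuc \<kappa> ==> |A| \<le>o \<kappa>"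
 using cardSuc_ordLeq_ordLess[OF Card card_of_Card_order] by blast

text \<open>The counting for which \<rho> is introduced: proper initial segments of
  \<open>\<kappa>\<^sup>+\<close> have size at most \<kappa>.\<close>

lemma seg_le: "|{y \<in> Field \<eta>. cless (\<rho> y) c}| \<le>o \<kappa>"
proof (cases "c \<in> Field (cardSuc \<kappa>)")
 case True
 have 1: "|underS (cardSuc \<kappa>) c| \<le>o \<kappa>"
  using le_cardSuc[OF card_of_underS[OF cardSuc_Card_order[OF Card] True]] .
 have inj: "inj_on \<rho> {y \<in> Field \<eta>. cless (\<rho> y) c}"
  by (rule inj_on_subset[OF bij_betw_imp_inj_on[OF rho]]) blast
 have "\<rho> ` {y \<in> Field \<eta>. cless (\<rho> y) c} \<subseteq> underS (cardSuc \<kappa>) c"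
  unfolding strict_def underS_def by blast
 with inj have "|{y \<in> Field \<eta>. cless (\<rho> y) c}| \<le>o |underS (cardSuc \<kappa>) c|"
  by (intro iffD1[OF card_of_ordLeq] exI[of _ \<rho>] conjI)
 then show ?thesis using 1 by (rule ordLeq_transitive)
next
 case False
 then have "{y \<in> Field \<eta>. cless (\<rho> y) c} = {}" using cless_Field(2) by blast
 then show ?thesis using less_le[OF finite_less[OF finite.emptyI]] by (simp only:)
qed

lemma rho_total:
 assumes "x \<in> Field \<eta>" "y \<in> Field \<eta>" "x \<noteq> y" shows "cless (\<rho> x) (\<rho> y) \<or> cless (\<rho> y) (\<rho> x)"
proof -
 have "\<rho> x \<in> Field (cardSuc \<kappa>)" "\<rho> y \<in> Field (cardSuc \<kappa>)" "\<rho> x \<noteq> \<rho> y"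
  using bij_betwE[OF rho] assms inj_onD[OF bij_betw_imp_inj_on[OF rho]] by blast+
 then show ?thesis using strict_total[OF wo_C] by blast
qed

text \<open>\<open>big \<alpha>\<close>: the level \<open>\<alpha>\<close> has cofinality above \<open>\<kappa>\<close>.\<close>

definition big :: "'a lev => bool" where
 "big \<alpha> \<longleftrightarrow> (\<forall>A. A \<subseteq> {x. Lo x \<sqsubset> \<alpha>} --> |A| \<le>o \<kappa> --> (\<exists>z. Lo z \<sqsubset> \<alpha> \<and> (\<forall>a\<in>A. Lo a \<sqsubset> Lo z)))"

lemma below_Field: "Lo x \<sqsubset> \<alpha> ==> x \<in> Field \<eta>"
 using lev_less_levs(1)[of \<eta> "Lo x" \<alpha>] unfolding levs_def by auto

lemma big_top: "big (Hi 0)"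
 unfolding big_def
proof (intro allI impI)
 fix A assume A: "A \<subseteq> {x. Lo x \<sqsubset> Hi 0}" "|A| \<le>o \<kappa>"
 have "A \<subseteq> Field \<eta>" using A(1) by auto
 then obtain z where "z \<in> Field \<eta>" "\<forall>a\<in>A. strict \<eta> a z" using cf[OF _ A(2)] by blast
 then show "\<exists>z. Lo z \<sqsubset> Hi 0 \<and> (\<forall>a\<in>A. Lo a \<sqsubset> Lo z)" unfolding strict_def by auto
qed

text \<open>What a new level \<open>z\<close> under a point of level \<open>\<alpha>\<close> has to
  satisfy: it exceeds the relevant members of \<open>A\<close> in \<eta>, and all of
  \<open>A\<close> in the order given by \<rho>. This becomes \<open>l_root\<close> and
  \<open>l_mono\<close>.\<close>

definition dominates :: "'a lev => 'a set => 'a => bool" where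
 "dominates \<alpha> A z \<longleftrightarrow> Lo z \<sqsubset> \<alpha> \<and> (\<forall>a\<in>A. (Lo a \<sqsubset> \<alpha> --> Lo a \<sqsubset> Lo z) \<and> cless (\<rho> a) (\<rho> z))"

text \<open>From the bound \<open>b\<close> upwards there remain more than \<kappa> levels below
  \<open>\<alpha>\<close>, and at most \<kappa> of them fail to exceed \<open>A\<close> under
  \<rho>.\<close>

lemma big_dominates:
 assumes \<alpha>: "big \<alpha>" and A: "A \<subseteq> Field \<eta>" "|A| \<le>o \<kappa>" shows "\<exists>z. dominates \<alpha> A z"
proof -
 let ?A = "{a \<in> A. Lo a \<sqsubset> \<alpha>}"
 have "|?A| \<le>o \<kappa>" by (rule subset_le[OF _ A(2)]) blast
 then obtain b where b: "Lo b \<sqsubset> \<alpha>" "\<And>a. a \<in> ?A ==> Lo a \<sqsubset> Lo b"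
  using \<alpha>[unfolded big_def, rule_format, of ?A] by blast
 let ?Z = "{z. Lo z \<sqsubset> \<alpha> \<and> (z = b \<or> Lo b \<sqsubset> Lo z)}"
 \<comment> \<open>If there were at most \<kappa> of them, the hypothesis on \<open>\<alpha>\<close>
   would give one strictly above all of them, itself included.\<close>
 have big: "\<not> |?Z| \<le>o \<kappa>"
 proof
  assume "|?Z| \<le>o \<kappa>"
  then obtain z where z: "Lo z \<sqsubset> \<alpha>" "\<And>a. a \<in> ?Z ==> Lo a \<sqsubset> Lo z"
   using \<alpha>[unfolded big_def, rule_format, of ?Z] by blast
  have "Lo b \<sqsubset> Lo z" by (rule z(2)) (use b(1) in blast)
  then have "Lo z \<sqsubset> Lo z" by (intro z(2)) (use z(1) in blast)
  then show False using lev_less_irrefl by blast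
 qed
 let ?X = "\<Union>a\<in>A. insert a {y \<in> Field \<eta>. cless (\<rho> y) (\<rho> a)}"
 have "|?X| \<le>o \<kappa>"
 proof (rule UN_le[OF A(2)])
  fix a
  show "|insert a {y \<in> Field \<eta>. cless (\<rho> y) (\<rho> a)}| \<le>o \<kappa>"
   using Un_le[OF less_le[OF finite_less[of "{a}"]] seg_le[of "\<rho> a"]] by simp
 qed
 then have "\<not> ?Z \<subseteq> ?X" using big subset_le by blast
 then obtain z where z: "z \<in> ?Z" "z \<notin> ?X" by blast
 have zF: "z \<in> Field \<eta>" using z(1) below_Field by blast
 have "cless (\<rho> a) (\<rho> z)" if a: "a \<in> A" for a
  using rho_total[of a z] zF a A(1) z(2) by blast
 moreover have "Lo a \<sqsubset> Lo z" if "a \<in> A" "Lo a \<sqsubset> \<alpha>" for a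
  using b(2)[of a] that z(1) lt_trans by blast
 ultimately show ?thesis using z(1) unfolding dominates_def by blast
qed

text \<open>The least member of \<open>W\<close> above \<open>\<alpha>\<close>, with \<eta> added on
  top and standing for itself. Levels outside \<open>W\<close> with the same gap have the same
  members of \<open>W\<close> below them, so one choice in \<open>W\<close> serves two corresponding
  points of different levels.\<close>

definition gap :: "'a set => 'a lev => 'a lev" where
 "gap W \<alpha> = (SOME \<gamma>. \<gamma> \<in> insert (Hi 0) (Lo ` W) \<and> (\<alpha> \<sqsubset> \<gamma> \<or> \<alpha> = Hi 0 \<and> \<gamma> = Hi 0) \<and>
  (\<forall>w\<in>W. Lo w \<sqsubset> \<gamma> --> \<not> \<alpha> \<sqsubset> Lo w))"

lemma gap:
 assumes \<alpha>: "\<alpha> = Hi 0 \<or> (\<exists>x\<in>Field \<eta>. \<alpha> = Lo x)"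
 shows "gap W \<alpha> \<in> insert (Hi 0) (Lo ` W)" "\<alpha> \<sqsubset> gap W \<alpha> \<or> \<alpha> = Hi 0 \<and> gap W \<alpha> = Hi 0"
  "w \<in> W ==> Lo w \<sqsubset> gap W \<alpha> ==> \<not> \<alpha> \<sqsubset> Lo w"
proof -
 let ?P = "\<lambda>\<gamma>. \<gamma> \<in> insert (Hi 0) (Lo ` W) \<and> (\<alpha> \<sqsubset> \<gamma> \<or> \<alpha> = Hi 0 \<and> \<gamma> = Hi 0)"
 have "?P (Hi 0)" using \<alpha> by auto
 from lev_min[OF wo_eta, of ?P, OF this]
 obtain \<gamma> where \<gamma>: "?P \<gamma>" "\<And>\<beta>. \<beta> \<sqsubset> \<gamma> ==> \<not> ?P \<beta>" by metis
 then have "?P \<gamma> \<and> (\<forall>w\<in>W. Lo w \<sqsubset> \<gamma> --> \<not> \<alpha> \<sqsubset> Lo w)" by blast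
 then have "\<exists>\<gamma>. \<gamma> \<in> insert (Hi 0) (Lo ` W) \<and> (\<alpha> \<sqsubset> \<gamma> \<or> \<alpha> = Hi 0 \<and> \<gamma> = Hi 0) \<and>
  (\<forall>w\<in>W. Lo w \<sqsubset> \<gamma> --> \<not> \<alpha> \<sqsubset> Lo w)" by blast
 note * = someI_ex[OF this, folded gap_def]
 show "gap W \<alpha> \<in> insert (Hi 0) (Lo ` W)" "\<alpha> \<sqsubset> gap W \<alpha> \<or> \<alpha> = Hi 0 \<and> gap W \<alpha> = Hi 0" using * by blast+
 show "w \<in> W ==> Lo w \<sqsubset> gap W \<alpha> ==> \<not> \<alpha> \<sqsubset> Lo w" using * by blast
qed

definition free :: "'a set => 'a lev => bool" where
 "free W \<alpha> \<longleftrightarrow> \<alpha> = Hi 0 \<or> (\<exists>x\<in>Field \<eta>. x \<notin> W \<and> \<alpha> = Lo x)"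

text \<open>A choice in \<open>W\<close> below the gap of \<open>\<alpha>\<close> is a choice below
  \<open>\<alpha>\<close>, since \<open>W\<close> has no member in between. The gap is a big level:
  otherwise \<open>W\<close> would contain a cofinal subset of it, and some member of this subset
  would lie between \<open>\<alpha>\<close> and the gap.\<close>

lemma closed_set:
 assumes W0: "W0 \<subseteq> Field \<eta>" "|W0| \<le>o \<kappa>"
 shows "\<exists>W \<zeta>. W0 \<subseteq> W \<and> W \<subseteq> Field \<eta> \<and> |W| \<le>o \<kappa> \<and>
  (\<forall>x\<in>W. \<forall>y\<in>Field \<eta>. cless (\<rho> y) (\<rho> x) --> y \<in> W) \<and>
  (\<forall>\<alpha> A. free W \<alpha> \<and> A \<subseteq> W \<and> |A| <o \<kappa> --> \<zeta> (gap W \<alpha>) A \<in> W \<and> dominates \<alpha> A (\<zeta> (gap W \<alpha>) A))"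
proof -
 have "\<forall>\<alpha>. \<exists>A. \<not> big \<alpha> --> A \<subseteq> {x. Lo x \<sqsubset> \<alpha>} \<and> |A| \<le>o \<kappa> \<and> \<not> (\<exists>z. Lo z \<sqsubset> \<alpha> \<and> (\<forall>a\<in>A. Lo a \<sqsubset> Lo z))"
  unfolding big_def by blast
 then obtain B where B: "\<And>\<alpha>. \<not> big \<alpha> ==> B \<alpha> \<subseteq> {x. Lo x \<sqsubset> \<alpha>} \<and> |B \<alpha>| \<le>o \<kappa> \<and>
   \<not> (\<exists>z. Lo z \<sqsubset> \<alpha> \<and> (\<forall>a\<in>B \<alpha>. Lo a \<sqsubset> Lo z))" by metis
 define \<zeta> where "\<zeta> \<alpha> A = (SOME z. dominates \<alpha> A z)" for \<alpha> A
 have \<zeta>: "dominates \<alpha> A (\<zeta> \<alpha> A)" if "big \<alpha>" "A \<subseteq> Field \<eta>" "|A| <o \<kappa>" for \<alpha> A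
  unfolding \<zeta>_def using big_dominates[OF that(1,2) less_le[OF that(3)]] by (rule someI_ex)
 define \<Psi> where "\<Psi> a = {y \<in> Field \<eta>. cless (\<rho> y) (\<rho> a)} \<union> (if big (Lo a) then {} else B (Lo a))" for a
 \<comment> \<open>\<open>closure_exists\<close> closes under an operation on one set, whereas the
   choice depends on a level \<open>w\<close> and a set \<open>A\<close>. Both are recovered from
   \<open>insert w A\<close>: the two terms cover the cases that \<open>w\<close> is or is not a
   member of \<open>A\<close>.\<close>
 define \<Phi> where "\<Phi> A = (\<Union>a\<in>A. \<Psi> a) \<union> (\<Union>a\<in>A. {\<zeta> (Lo a) A, \<zeta> (Lo a) (A - {a})}) \<union> {\<zeta> (Hi 0) A}" for A
 have \<Psi>_le: "|\<Psi> a| \<le>o \<kappa>" for a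
  unfolding \<Psi>_def using B[of "Lo a"] less_le[OF finite_less[of "{}"]] by (intro Un_le seg_le) auto
 have \<Phi>_le: "|\<Phi> A| \<le>o \<kappa>" if A: "|A| <o \<kappa>" for A
  unfolding \<Phi>_def
  by (intro Un_le UN_le less_le[OF A] \<Psi>_le less_le[OF finite_less]) simp_all
 have "\<exists>V. W0 \<subseteq> V \<and> |V| \<le>o \<kappa> \<and> (\<forall>A. A \<subseteq> V \<and> |A| <o \<kappa> --> \<Phi> A \<subseteq> V)"
  by (rule closure_exists[OF W0(2)]) (rule \<Phi>_le)
 then obtain V where V12: "W0 \<subseteq> V" "|V| \<le>o \<kappa>" and V3: "\<forall>A. A \<subseteq> V \<and> |A| <o \<kappa> --> \<Phi> A \<subseteq> V" by (elim exE conjE)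
 have "\<Phi> A \<subseteq> V" if "A \<subseteq> V" "|A| <o \<kappa>" for A using V3 that by (elim allE[of _ A]) (rule mp, assumption, rule conjI)
 note V = V12 this
 let ?W = "V \<inter> Field \<eta>"
 have \<Psi>W: "\<Psi> a \<subseteq> ?W" if "a \<in> ?W" for a
 proof -
  have "\<Psi> a \<subseteq> \<Phi> {a}" unfolding \<Phi>_def by blast
  moreover have "\<Phi> {a} \<subseteq> V" using that by (intro V(3) finite_less) auto
  moreover have "\<Psi> a \<subseteq> Field \<eta>" unfolding \<Psi>_def using B[of "Lo a"] by (auto split: if_splits intro: FieldI1)
  ultimately show ?thesis by blast
 qed
 have main: "\<zeta> (gap ?W \<alpha>) A \<in> ?W \<and> dominates \<alpha> A (\<zeta> (gap ?W \<alpha>) A)"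
  if fr: "free ?W \<alpha>" and A: "A \<subseteq> ?W" "|A| <o \<kappa>" for \<alpha> A
 proof -
  let ?\<gamma> = "gap ?W \<alpha>"
  have \<alpha>: "\<alpha> = Hi 0 \<or> (\<exists>x\<in>Field \<eta>. \<alpha> = Lo x)" using fr unfolding free_def by blast
  note g = gap[OF \<alpha>, where W = ?W]
  have below: "Lo w \<sqsubset> \<alpha>" if w: "w \<in> ?W" "Lo w \<sqsubset> ?\<gamma>" for w
  proof -
   have "\<not> \<alpha> \<sqsubset> Lo w" using g(3)[OF w] .
   moreover have "Lo w \<noteq> \<alpha>" using fr w(1) unfolding free_def by blast
   moreover have "Lo w \<in> levs \<eta>" "\<alpha> \<in> levs \<eta>" using w(1) \<alpha> unfolding levs_def by blast+
   ultimately show ?thesis using lev_less_total[OF wo_eta] by blast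
  qed
  have up: "Lo w \<sqsubset> ?\<gamma>" if w: "Lo w \<sqsubset> \<alpha>" for w using g(2) w lt_trans by metis
  have big: "big ?\<gamma>"
  proof (rule ccontr)
   assume nb: "\<not> big ?\<gamma>"
   then obtain w where w: "w \<in> ?W" "?\<gamma> = Lo w" using g(1) big_top by auto
   have BW: "B ?\<gamma> \<subseteq> ?W" using \<Psi>W[OF w(1)] nb unfolding \<Psi>_def w(2) by simp
   obtain x where x: "\<alpha> = Lo x" using g(2) \<alpha> w(2) by auto
   have "\<not> (\<forall>a\<in>B ?\<gamma>. Lo a \<sqsubset> Lo x)" using B[OF nb] g(2) x by auto
   then obtain a where a: "a \<in> B ?\<gamma>" "\<not> Lo a \<sqsubset> Lo x" by blast
   have "Lo a \<sqsubset> ?\<gamma>" using B[OF nb] a(1) by blast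
   then show False using below[of a] BW a x by blast
  qed
  have AF: "A \<subseteq> Field \<eta>" using A(1) by blast
  have dom: "dominates ?\<gamma> A (\<zeta> ?\<gamma> A)" using \<zeta>[OF big AF A(2)] .
  have "\<zeta> ?\<gamma> A \<in> V"
  proof (cases "?\<gamma> = Hi 0")
   case True
   have "\<zeta> (Hi 0) A \<in> \<Phi> A" unfolding \<Phi>_def by blast
   then show ?thesis using V(3)[of A] A True by auto
  next
   case False
   then obtain w where w: "w \<in> ?W" "?\<gamma> = Lo w" using g(1) by auto
   let ?A = "insert w A"
   have "?A \<subseteq> V" "|?A| <o \<kappa>" using w(1) A Un_less[OF finite_less[of "{w}"] A(2)] by auto
   then have "\<Phi> ?A \<subseteq> V" by (rule V(3))
   moreover have "\<zeta> (Lo w) A \<in> \<Phi> ?A"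
   proof (cases "w \<in> A")
    case True
    then have "?A = A" by blast
    then show ?thesis unfolding \<Phi>_def by auto
   next
    case False
    then have "?A - {w} = A" by blast
    then show ?thesis unfolding \<Phi>_def by auto
   qed
   ultimately show ?thesis using w(2) by auto
  qed
  moreover have "\<zeta> ?\<gamma> A \<in> Field \<eta>" using dom below_Field unfolding dominates_def by blast
  ultimately have zW: "\<zeta> ?\<gamma> A \<in> ?W" by blast
  have "dominates \<alpha> A (\<zeta> ?\<gamma> A)"
   using dom below[OF zW] up unfolding dominates_def by blast
  then show ?thesis using zW by blast
 qed
 show ?thesis
 proof (intro exI[of _ ?W] exI[of _ \<zeta>] conjI ballI allI impI)
  show "W0 \<subseteq> ?W" using V(1) W0(1) by blast
  show "?W \<subseteq> Field \<eta>" by blast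
  show "|?W| \<le>o \<kappa>" by (rule subset_le[OF _ V(2)]) blast
  show "y \<in> ?W" if "x \<in> ?W" "y \<in> Field \<eta>" "cless (\<rho> y) (\<rho> x)" for x y
   using \<Psi>W[OF that(1)] that(2,3) unfolding \<Psi>_def by blast
 qed (elim conjE, drule (2) main, elim conjE, assumption)+
qed

lemma Times_less: assumes X: "|X| <o \<kappa>" shows "|X \<times> X| <o \<kappa>"
proof -
 have "X \<times> X = (\<Union>x\<in>X. Pair x ` X)" by blast
 moreover have "|\<Union>x\<in>X. Pair x ` X| <o \<kappa>" by (rule UN_less[OF X]) (rule image_less[OF X])
 ultimately show ?thesis by simp
qed

lemma cnd_rel_less: "cnd p ==> |p| <o \<kappa>"
 by (rule subset_less[OF _ Times_less[OF cnd_small]]) (auto intro: FieldI1 FieldI2)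

text \<open>A condition with field \<open>X\<close> is a small subset of
  \<open>X \<times> X\<close>, so \<open>small_subsets\<close> counts it. This yields the hypothesis
  \<open>fib\<close> of \<open>delta_system\<close>.\<close>

lemma fibre_le: "|{p \<in> A. cnd p \<and> Field p = X}| \<le>o \<kappa>"
proof (cases "|X| <o \<kappa>")
 case True
 have "|{Y. Y \<subseteq> X \<times> X \<and> |Y| <o \<kappa>}| \<le>o \<kappa>" by (rule small_subsets[OF less_le[OF Times_less[OF True]]])
 then show ?thesis by (rule subset_le[rotated]) (use cnd_rel_less in \<open>auto intro: FieldI1 FieldI2\<close>)
next
 case False
 then have "{p \<in> A. cnd p \<and> Field p = X} = {}" using cnd_small by blast
 then show ?thesis using less_le[OF finite_less[OF finite.emptyI]] by (simp only:)
qed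

lemma cnd_lev: "cnd p ==> s \<in> Field p ==> lv s = Hi 0 \<or> (\<exists>x\<in>Field \<eta>. lv s = Lo x)"
 using cnd_T unfolding T_def by fastforce

text \<open>It labels the points of a condition by elements of \<kappa>, and it chooses the second
  coordinates of new points away from those of the two conditions.\<close>

lemma small_inj:
 assumes X: "|X| <o \<kappa>" and J: "|J| <o \<kappa>"
 obtains k where "inj_on k X" "k ` X \<subseteq> Field \<kappa> - J"
proof -
 have "\<not> |Field \<kappa> - J| <o \<kappa>"
 proof
  assume "|Field \<kappa> - J| <o \<kappa>"
  then have "|J \<union> (Field \<kappa> - J)| <o \<kappa>" by (rule Un_less[OF J])
  then have "|Field \<kappa>| <o \<kappa>" by (rule subset_less[rotated]) blast
  then show False using Field_k not_ordLess_ordIso by blast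
 qed
 then have "\<kappa> \<le>o |Field \<kappa> - J|" using not_ordLess_iff_ordLeq[OF wo_k card_of_Well_order] by blast
 then have "|X| \<le>o |Field \<kappa> - J|" using ordLeq_transitive[OF less_le[OF X]] by blast
 from iffD2[OF card_of_ordLeq this] show ?thesis using that by blast
qed

end

text \<open>Two conditions of the same type over a set \<open>W\<close> as produced above, with disjoint new parts.\<close>

locale twins = cs_poset +
 fixes p p' :: "'a pt rel" and D :: "'a pt set" and W :: "'a set" and \<zeta> :: "'a lev => 'a set => 'a"
  and g g' :: "'a pt => 'a"
 assumes p: "cnd p" and p': "cnd p'" and D: "D = Field p \<inter> Field p'"
  and W: "W \<subseteq> Field \<eta>" and W_init: "\<And>x y. x \<in> W ==> y \<in> Field \<eta> ==> cless (\<rho> y) (\<rho> x) ==> y \<in> W"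
  and \<zeta>: "\<And>\<alpha> A. free W \<alpha> ==> A \<subseteq> W ==> |A| <o \<kappa> ==> \<zeta> (gap W \<alpha>) A \<in> W \<and> dominates \<alpha> A (\<zeta> (gap W \<alpha>) A)"
  and new: "\<And>x i. Low x i \<in> Field p - D ==> x \<notin> W" "\<And>x i. Low x i \<in> Field p' - D ==> x \<notin> W"
  and root: "\<And>x i. Low x i \<in> D ==> x \<in> W"
  and root_top: "\<And>l m y. Top l \<in> D ==> Top m \<in> D ==> l \<noteq> m ==> y \<in> Field \<eta> ==> cless (\<rho> y) (F {l, m}) ==> y \<in> W"
  and g: "inj_on g (Field p)" "inj_on g' (Field p')"
  and rels: "map_prod g g ` p = map_prod g' g' ` p'"
  and infos: "(\<lambda>s. (g s, gap W (lv s), lv s = Hi 0, if s \<in> D then Some s else None)) ` Field p =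
   (\<lambda>s. (g' s, gap W (lv s), lv s = Hi 0, if s \<in> D then Some s else None)) ` Field p'"
begin

definition h :: "'a pt => 'a pt" where
 "h s = (SOME t. t \<in> Field p' \<and> g' t = g s)"

lemma h:
 assumes s: "s \<in> Field p"
 shows "h s \<in> Field p'" "g' (h s) = g s" "gap W (lv (h s)) = gap W (lv s)" "s \<in> D ==> h s = s" "h s \<in> D \<longleftrightarrow> s \<in> D"
  "lv (h s) = Hi 0 \<longleftrightarrow> lv s = Hi 0"
proof -
 have "(g s, gap W (lv s), lv s = Hi 0, if s \<in> D then Some s else None) \<in>
   (\<lambda>s. (g' s, gap W (lv s), lv s = Hi 0, if s \<in> D then Some s else None)) ` Field p'"
  unfolding infos[symmetric] using s by (rule imageI)
 then obtain t where t: "t \<in> Field p'" "g' t = g s" "gap W (lv t) = gap W (lv s)"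
   "lv t = Hi 0 \<longleftrightarrow> lv s = Hi 0" "(if s \<in> D then Some s else None) = (if t \<in> D then Some t else None)"
  by auto
 have "\<exists>t. t \<in> Field p' \<and> g' t = g s" using t by blast
 from someI_ex[OF this, folded h_def] have hs: "h s \<in> Field p'" "g' (h s) = g s" by blast+
 have "h s = t" using inj_onD[OF g(2)] hs t(1,2) by metis
 then show "h s \<in> Field p'" "g' (h s) = g s" "gap W (lv (h s)) = gap W (lv s)" "s \<in> D ==> h s = s" "h s \<in> D \<longleftrightarrow> s \<in> D"
  "lv (h s) = Hi 0 \<longleftrightarrow> lv s = Hi 0"
  using t by (auto split: if_splits)
qed

lemma h_bij: "bij_betw h (Field p) (Field p')"
 unfolding bij_betw_def
proof (intro conjI inj_onI subset_antisym subsetI)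
 fix s t assume st: "s \<in> Field p" "t \<in> Field p" "h s = h t"
 then have "g s = g t" using h(2)[OF st(1)] h(2)[OF st(2)] by simp
 then show "s = t" using inj_onD[OF g(1)] st by blast
next
 fix t assume "t \<in> h ` Field p" then show "t \<in> Field p'" using h(1) by blast
next
 fix t assume t: "t \<in> Field p'"
 then have "(g' t, gap W (lv t), lv t = Hi 0, if t \<in> D then Some t else None) \<in>
   (\<lambda>s. (g s, gap W (lv s), lv s = Hi 0, if s \<in> D then Some s else None)) ` Field p"
  unfolding infos by (rule imageI)
 then obtain s where s: "s \<in> Field p" "g' t = g s" by auto
 then have "h s = t" using inj_onD[OF g(2)] h(1,2)[OF s(1)] t by metis
 then show "t \<in> h ` Field p" using s(1) by blast
qed

lemma h_iff: assumes st: "s \<in> Field p" "t \<in> Field p" shows "(h s, h t) \<in> p' \<longleftrightarrow> (s, t) \<in> p"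
proof
 assume "(h s, h t) \<in> p'"
 then have "map_prod g' g' (h s, h t) \<in> map_prod g g ` p" unfolding rels by (rule imageI)
 then obtain a b where ab: "(a, b) \<in> p" "g a = g s" "g b = g t" using h(2)[OF st(1)] h(2)[OF st(2)] by auto
 then have "a = s" "b = t" using inj_onD[OF g(1)] st FieldI1[OF ab(1)] FieldI2[OF ab(1)] by blast+
 then show "(s, t) \<in> p" using ab by blast
next
 assume "(s, t) \<in> p"
 then have "map_prod g g (s, t) \<in> map_prod g' g' ` p'" unfolding rels[symmetric] by (rule imageI)
 then obtain a b where ab: "(a, b) \<in> p'" "g' a = g s" "g' b = g t" by auto
 then have "a = h s" "b = h t"
  using inj_onD[OF g(2)] h(1,2)[OF st(1)] h(1,2)[OF st(2)] FieldI1[OF ab(1)] FieldI2[OF ab(1)] by metis+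
 then show "(h s, h t) \<in> p'" using ab by blast
qed

definition pre :: "('a pt => 'a) => 'a pt => 'a set" where
 "pre f s = {x. \<exists>i. Low x i \<in> D \<and> (Low x i, s) \<in> p} \<union> f ` {t \<in> Field p - D. (t, s) \<in> p \<and> t \<noteq> s}"

text \<open>Recursion along \<open>p\<close>: the level chosen for \<open>s\<close> dominates the
  levels of the root points below \<open>s\<close> and the levels chosen before. The level of
  \<open>s\<close> enters only through its gap, hence the choice suits \<open>h s\<close> as
  well.\<close>

definition lo :: "'a pt => 'a" where
 "lo = wfrec {(t, s). (t, s) \<in> p \<and> t \<noteq> s} (\<lambda>f s. \<zeta> (gap W (lv s)) (pre f s))"

lemma wf_p: "wf {(t, s). (t, s) \<in> p \<and> t \<noteq> s}"
 by (rule wf_subset[OF wf_inv_image[OF wf_lev_less[OF wo_eta], of lv]]) (use cnd_lv[OF p] in \<open>auto simp: inv_image_def\<close>)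

lemma lo: "lo s = \<zeta> (gap W (lv s)) (pre lo s)"
proof -
 have "pre (cut lo {(t, s). (t, s) \<in> p \<and> t \<noteq> s} s) s = pre lo s"
  unfolding pre_def by (intro arg_cong2[where f = "(\<union>)"] refl image_cong) (auto simp: cut_def)
 moreover have "lo s = \<zeta> (gap W (lv s)) (pre (cut lo {(t, s). (t, s) \<in> p \<and> t \<noteq> s} s) s)"
  unfolding lo_def by (subst wfrec[OF wf_p]) (rule refl)
 ultimately show ?thesis by (simp only:)
qed

lemma free_new: "s \<in> Field p - D ==> free W (lv s)" "s \<in> Field p' - D ==> free W (lv s)"
proof -
 have "free W (lv s)" if "s \<in> T" "\<And>x i. s = Low x i ==> x \<notin> W" for s
 proof (cases s)
  case (Low x i)
  then have "x \<in> Field \<eta>" using that(1) unfolding T_def by auto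
  then show ?thesis using that(2)[OF Low] Low unfolding free_def by auto
 qed (simp add: free_def)
 note * = this
 show "free W (lv s)" if "s \<in> Field p - D"
 proof (rule *)
  show "s \<in> T" using cnd_T[OF p] that by blast
  show "x \<notin> W" if "s = Low x i" for x i using new(1)[of x i] \<open>s \<in> Field p - D\<close> that by simp
 qed
 show "free W (lv s)" if "s \<in> Field p' - D"
 proof (rule *)
  show "s \<in> T" using cnd_T[OF p'] that by blast
  show "x \<notin> W" if "s = Low x i" for x i using new(2)[of x i] \<open>s \<in> Field p' - D\<close> that by simp
 qed
qed

lemma pre_less: "|pre f s| <o \<kappa>"
proof (rule subset_less)
 show "pre f s \<subseteq> (\<lambda>t. case t of Low x i => x | Top l => l) ` Field p \<union> f ` Field p"
  unfolding pre_def using D by (auto intro: rev_image_eqI)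
 show "|(\<lambda>t. case t of Low x i => x | Top l => l) ` Field p \<union> f ` Field p| <o \<kappa>"
  by (intro Un_less image_less cnd_small p)
qed

lemma lo_W: "s \<in> Field p - D ==> lo s \<in> W \<and> pre lo s \<subseteq> W"
proof (induction s rule: wf_induct_rule[OF wf_p])
 case (1 s)
 have "pre lo s \<subseteq> W" using 1 root unfolding pre_def by blast
 then show ?case using \<zeta>[OF free_new(1)[OF 1(2)] _ pre_less] lo[of s] by metis
qed

lemma lo_dom:
 assumes s: "s \<in> Field p - D"
 shows "dominates (lv s) (pre lo s) (lo s)" "Lo (lo s) \<sqsubset> lv (h s)"
proof -
 have A: "pre lo s \<subseteq> W" using lo_W[OF s] by blast
 show "dominates (lv s) (pre lo s) (lo s)" using \<zeta>[OF free_new(1)[OF s] A pre_less] lo[of s] by metis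
 have "h s \<in> Field p' - D" and eq: "gap W (lv (h s)) = gap W (lv s)" using h s by blast+
 then have "dominates (lv (h s)) (pre lo s) (lo s)" using \<zeta>[OF free_new(2) A pre_less] lo[of s] by metis
 then show "Lo (lo s) \<sqsubset> lv (h s)" unfolding dominates_def by blast
qed

text \<open>Strong unboundedness speaks of sets of one fixed size, and the isomorphism
  \<open>h\<close> shows that corresponding conditions have equally many new top points.\<close>

lemma tops_iso: "|{l. Top l \<in> Field p - D}| =o |{l. Top l \<in> Field p' - D}|"
proof -
 have "Top ` {l. Top l \<in> Field q - D} = {s \<in> Field q - D. lv s = Hi 0}" for q :: "'a pt rel"
 proof (intro subset_antisym subsetI)
  fix s assume "s \<in> {s \<in> Field q - D. lv s = Hi 0}"
  then show "s \<in> Top ` {l. Top l \<in> Field q - D}" by (cases s) auto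
 qed auto
 then have 1: "|{l. Top l \<in> Field q - D}| =o |{s \<in> Field q - D. lv s = Hi 0}|" for q :: "'a pt rel"
  using card_of_ordIsoI[of Top "{l. Top l \<in> Field q - D}"] by (simp add: bij_betw_def inj_on_def)
 have "h ` {s \<in> Field p - D. lv s = Hi 0} = {s \<in> Field p' - D. lv s = Hi 0}"
 proof (intro subset_antisym subsetI)
  fix t assume t: "t \<in> {s \<in> Field p' - D. lv s = Hi 0}"
  then obtain s where "s \<in> Field p" "t = h s" using h_bij unfolding bij_betw_def by blast
  then show "t \<in> h ` {s \<in> Field p - D. lv s = Hi 0}" using t h(5,6)[of s] by simp
 next
  fix t assume "t \<in> h ` {s \<in> Field p - D. lv s = Hi 0}"
  then obtain s where "s \<in> Field p - D" "lv s = Hi 0" "t = h s" by blast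
  then show "t \<in> {s \<in> Field p' - D. lv s = Hi 0}" using h(1,5,6)[of s] by simp
 qed
 moreover have "inj_on h {s \<in> Field p - D. lv s = Hi 0}"
  by (rule inj_on_subset[OF bij_betw_imp_inj_on[OF h_bij]]) blast
 ultimately have "bij_betw h {s \<in> Field p - D. lv s = Hi 0} {s \<in> Field p' - D. lv s = Hi 0}"
  unfolding bij_betw_def by (rule conjI[rotated])
 from card_of_ordIsoI[OF this] show ?thesis
  by (rule ordIso_transitive[OF 1[of p] ordIso_transitive[OF _ ordIso_symmetric[OF 1[of p']]]])
qed

lemma compatible_twins:
 assumes new_top: "\<And>l m y. Top l \<in> Field p - D ==> Top m \<in> Field p' - D ==> y \<in> W ==> cless (\<rho> y) (F {l, m})"
 shows "\<exists>r. cnd r \<and> ext r p \<and> ext r p'"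
proof -
 define J where "J = {j. \<exists>y. Low y j \<in> Field p \<union> Field p'}"
 have "J \<subseteq> (\<lambda>t. case t of Low x i => i | Top l => l) ` (Field p \<union> Field p')"
  unfolding J_def by (auto intro: rev_image_eqI)
 then have "|J| <o \<kappa>" by (rule subset_less) (intro Un_less image_less cnd_small p p')
 then obtain k where k: "inj_on k (Field p)" "k ` Field p \<subseteq> Field \<kappa> - J"
  by (rule small_inj[OF cnd_small[OF p]])
 have l_pre: "Lo (lo s) \<sqsubset> lv s" if "s \<in> Field p - D" for s
  using lo_dom(1)[OF that] unfolding dominates_def by (rule conjunct1)
 have l_pre2: "(Lo a \<sqsubset> lv s --> Lo a \<sqsubset> Lo (lo s)) \<and> cless (\<rho> a) (\<rho> (lo s))"
  if "s \<in> Field p - D" "a \<in> pre lo s" for s a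
  using lo_dom(1)[OF that(1)] that(2) unfolding dominates_def by blast
 interpret amalgam \<kappa> \<Lambda> \<eta> F \<rho> p p' D h W lo k
 proof (unfold_locales)
  show "h s = s" if "s \<in> D" for s using h(4)[of s] D that by blast
  show "lo s \<in> W" if "s \<in> Field p - D" for s using lo_W[OF that] by (rule conjunct1)
  show "\<exists>x i. r = Low x i \<and> Lo x \<sqsubset> Lo (lo s) \<and> cless (\<rho> x) (\<rho> (lo s))"
   if s: "s \<in> Field p - D" and r: "r \<in> D" "(r, s) \<in> p" for r s
  proof -
   have lt: "lv r \<sqsubset> lv s" using cnd_lv[OF p r(2)] s r(1) by blast
   then obtain x i where x: "r = Low x i" by (cases r; cases s) auto
   then have "x \<in> pre lo s" using r unfolding pre_def by blast
   then show ?thesis using l_pre2[OF s, of x] lt x by auto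
  qed
  show "Lo (lo t) \<sqsubset> Lo (lo s) \<and> cless (\<rho> (lo t)) (\<rho> (lo s))"
   if s: "s \<in> Field p - D" and t: "t \<in> Field p - D" "(t, s) \<in> p" "t \<noteq> s" for t s
  proof -
   have "lo t \<in> pre lo s" using t unfolding pre_def by blast
   moreover have "Lo (lo t) \<sqsubset> lv s" using lt_trans[OF l_pre[OF t(1)] cnd_lv[OF p t(2,3)]] .
   ultimately show ?thesis using l_pre2[OF s, of "lo t"] by blast
  qed
  show "inj_on k (Field p - D)" by (rule inj_on_subset[OF k(1)]) blast
  show "k s \<in> Field \<kappa>" if "s \<in> Field p - D" for s using k(2) that by blast
  show "Low (lo s) (k s) \<notin> Field p \<union> Field p'" if "s \<in> Field p - D" for s
  proof
   assume "Low (lo s) (k s) \<in> Field p \<union> Field p'"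
   then have "k s \<in> J" unfolding J_def by blast
   then show False using k(2) that by blast
  qed
 qed (fact p p' D h_bij | erule (1) h_iff | rule W | erule (2) W_init | erule new | erule root | erule (4) root_top
   | erule (2) new_top | erule l_pre | erule lo_dom(2))+
 show ?thesis by (rule compatible)
qed

end

section \<open>Finding two conditions that can be amalgamated\<close>

context cs_poset
begin

text \<open>A family of size exactly \<open>\<kappa>\<^sup>+\<close> is cut out by an injection of
  the successor cardinal into \<open>A\<close>. The case of empty sets is separate: disjointness
  then no longer makes the sets distinct, but the bound is vacuous.\<close>

lemma tops_pair:
 fixes a :: "'b => 'a set" and a0 :: "'a set"
 assumes A: "\<And>p. p \<in> A ==> a p \<subseteq> Field \<Lambda> \<and> |a p| =o |a0|" and a0: "|a0| <o \<kappa>"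
  and dj: "\<And>p p'. p \<in> A ==> p' \<in> A ==> p \<noteq> p' ==> a p \<inter> a p' = {}"
  and big: "\<not> |A| \<le>o \<kappa>" and d: "d \<in> Field (cardSuc \<kappa>)"
 shows "\<exists>p\<in>A. \<exists>p'\<in>A. p \<noteq> p' \<and> (\<forall>l\<in>a p. \<forall>m\<in>a p'. cless d (F {l, m}))"
proof (cases "a0 = {}")
 case True
 have e: "a p = {}" if "p \<in> A" for p using A[OF that] True card_of_empty3 ordIso_iff_ordLeq by metis
 have "\<exists>p\<in>A. \<exists>p'\<in>A. p \<noteq> p'"
 proof (rule ccontr)
  assume n: "\<not> ?thesis"
  have "finite A"
  proof (cases "A = {}")
   case False
   then obtain p where "A = {p}" using n by blast
   then show ?thesis by simp
  qed simp
  then show False using less_le[OF finite_less] big by blast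
 qed
 then show ?thesis using e by blast
next
 case False
 have ne: "a p \<noteq> {}" if "p \<in> A" for p
  using A[OF that] False card_of_empty3 ordIso_symmetric ordIso_iff_ordLeq by metis
 have "\<kappa> <o |A|" using big not_ordLeq_iff_ordLess[OF wo_k card_of_Well_order] by blast
 then have "cardSuc \<kappa> \<le>o |A|" by (rule cardSuc_least[OF Card card_of_Card_order])
 then have "|Field (cardSuc \<kappa>)| \<le>o |A|"
  using ordIso_ordLeq_trans[OF card_of_Field_ordIso[OF cardSuc_Card_order[OF Card]]] by blast
 from iffD2[OF card_of_ordLeq this] obtain f where f: "inj_on f (Field (cardSuc \<kappa>))" "f ` Field (cardSuc \<kappa>) \<subseteq> A" by blast
 let ?B = "(\<lambda>x. a (f x)) ` Field (cardSuc \<kappa>)"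
 have "inj_on (\<lambda>x. a (f x)) (Field (cardSuc \<kappa>))"
 proof (rule inj_onI)
  fix x y assume xy: "x \<in> Field (cardSuc \<kappa>)" "y \<in> Field (cardSuc \<kappa>)" "a (f x) = a (f y)"
  have fA: "f x \<in> A" "f y \<in> A" using f(2) xy(1,2) by blast+
  have "f x = f y" by (rule ccontr) (use dj[OF fA] ne[OF fA(1)] xy(3) in simp)
  then show "x = y" using inj_onD[OF f(1)] xy by blast
 qed
 then have "|Field (cardSuc \<kappa>)| =o |?B|" by (intro card_of_ordIsoI[of "\<lambda>x. a (f x)"] bij_betw_imageI) auto
 then have B: "|?B| =o cardSuc \<kappa>"
  using ordIso_transitive[OF ordIso_symmetric card_of_Field_ordIso[OF cardSuc_Card_order[OF Card]]] by blast
 have 1: "\<forall>b\<in>?B. b \<subseteq> Field \<Lambda> \<and> |b| =o |a0|"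
 proof (intro ballI)
  fix b assume "b \<in> ?B"
  then obtain x where "f x \<in> A" "b = a (f x)" using f(2) by fast
  then show "b \<subseteq> Field \<Lambda> \<and> |b| =o |a0|" using A[of "f x"] by simp
 qed
 have 2: "pairwise disjnt ?B"
  unfolding pairwise_def disjnt_def
 proof (intro ballI impI)
  fix b c assume bc: "b \<in> ?B" "c \<in> ?B" "b \<noteq> c"
  obtain x where x: "b = a (f x)" "f x \<in> A" using bc(1) f(2) by fast
  obtain y where y: "c = a (f y)" "f y \<in> A" using bc(2) f(2) by fast
  have "f x \<noteq> f y" using bc(3) x(1) y(1) by auto
  with x y show "b \<inter> c = {}" using dj[of "f x" "f y"] by simp
 qed
 have "\<exists>b\<in>?B. \<exists>c\<in>?B. b \<noteq> c \<and> (\<forall>l\<in>b. \<forall>m\<in>c. (d, F {l, m}) \<in> cardSuc \<kappa> - Id)"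
  by (rule mp[OF spec[OF spec[OF bspec[OF conjunct2[OF F[unfolded strongly_unbounded_def]] d], of "|a0|"], of ?B]])
   (intro conjI card_of_Card_order a0 1 2 B)
 then obtain x y where xy: "x \<in> Field (cardSuc \<kappa>)" "y \<in> Field (cardSuc \<kappa>)" "a (f x) \<noteq> a (f y)"
  "\<forall>l\<in>a (f x). \<forall>m\<in>a (f y). (d, F {l, m}) \<in> cardSuc \<kappa> - Id" by blast
 have "f x \<in> A" "f y \<in> A" "f x \<noteq> f y" using f(2) xy(1-3) by auto
 then show ?thesis using xy(4) unfolding strict_def by blast
qed

lemma large_Un: "\<not> |A| \<le>o \<kappa> ==> |{p \<in> A. \<not> P p}| \<le>o \<kappa> ==> \<not> |{p \<in> A. P p}| \<le>o \<kappa>"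
proof
 assume *: "\<not> |A| \<le>o \<kappa>" "|{p \<in> A. \<not> P p}| \<le>o \<kappa>" "|{p \<in> A. P p}| \<le>o \<kappa>"
 have "|{p \<in> A. \<not> P p} \<union> {p \<in> A. P p}| \<le>o \<kappa>" by (rule Un_le[OF *(2,3)])
 moreover have "{p \<in> A. \<not> P p} \<union> {p \<in> A. P p} = A" by blast
 ultimately show False using *(1) by simp
qed

lemma Times_small_subsets:
 assumes "|Z| \<le>o \<kappa>" "|Y| \<le>o \<kappa>"
 shows "|{X. X \<subseteq> Z \<and> |X| <o \<kappa>} \<times> {X. X \<subseteq> Y \<and> |X| <o \<kappa>}| \<le>o \<kappa>"
 by (rule Times_le) (rule small_subsets, rule assms)+

theorem chain_condition:
 assumes A: "\<And>p. p \<in> A ==> cnd p"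
  and inc: "\<And>p p' r. p \<in> A ==> p' \<in> A ==> cnd r ==> ext r p ==> ext r p' ==> p = p'"
 shows "|A| \<le>o \<kappa>"
proof (rule ccontr)
 assume large: "\<not> |A| \<le>o \<kappa>"
 have fib: "|{p \<in> A. Field p = X}| \<le>o \<kappa>" for X
  by (rule subset_le[OF _ fibre_le[of A X]]) (use A in blast)
 have "\<exists>D A'. A' \<subseteq> A \<and> \<not> |A'| \<le>o \<kappa> \<and> (\<forall>p\<in>A'. D \<subseteq> Field p) \<and>
   (\<forall>p\<in>A'. \<forall>p'\<in>A'. p \<noteq> p' --> Field p \<inter> Field p' = D)"
  by (rule delta_system[OF _ large fib]) (rule cnd_small[OF A])
 then obtain D A1 where o: "A1 \<subseteq> A" "\<not> |A1| \<le>o \<kappa>" "\<forall>p\<in>A1. D \<subseteq> Field p"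
  "\<forall>p\<in>A1. \<forall>p'\<in>A1. p \<noteq> p' --> Field p \<inter> Field p' = D" by (elim exE conjE)
 note A1 = o(1,2) bspec[OF o(3)] mp[OF bspec[OF bspec[OF o(4)]]]
 have "A1 \<noteq> {}"
 proof
  assume "A1 = {}"
  then have "|A1| \<le>o \<kappa>" using less_le[OF finite_less[of "{}"]] by simp
  then show False using A1(2) by blast
 qed
 then obtain p1 where p1: "p1 \<in> A1" by blast
 have D_less: "|D| <o \<kappa>" by (rule subset_less[OF A1(3)[OF p1] cnd_small[OF A[OF subsetD[OF A1(1) p1]]]])
 have DT: "D \<subseteq> T" by (rule subset_trans[OF A1(3)[OF p1] cnd_T[OF A[OF subsetD[OF A1(1) p1]]]])
 \<comment> \<open>The levels that \<open>ok\<close> permits below two top points of the root. There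
   are at most \<kappa> of them for each pair, and \<open>root_top\<close> requires them in
   \<open>W\<close>.\<close>
 define wit where "wit s t = {y \<in> Field \<eta>. \<exists>l m. s = Top l \<and> t = Top m \<and> cless (\<rho> y) (F {l, m})}" for s t
 define W0 where "W0 = {x. \<exists>i. Low x i \<in> D} \<union> (\<Union>s\<in>D. \<Union>t\<in>D. wit s t)"
 have "{x. \<exists>i. Low x i \<in> D} \<subseteq> (\<lambda>t. case t of Low x i => x | Top l => l) ` D"
  by (auto intro: rev_image_eqI)
 then have 1: "|{x. \<exists>i. Low x i \<in> D}| \<le>o \<kappa>" by (rule subset_le[OF _ less_le[OF image_less[OF D_less]]])
 have wit: "|wit s t| \<le>o \<kappa>" for s t
 proof -
  have "\<exists>c. wit s t \<subseteq> {y \<in> Field \<eta>. cless (\<rho> y) c}" unfolding wit_def by (cases s; cases t) auto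
  then obtain c where "wit s t \<subseteq> {y \<in> Field \<eta>. cless (\<rho> y) c}" ..
  then show ?thesis by (rule subset_le[OF _ seg_le])
 qed
 have W0_le: "|W0| \<le>o \<kappa>" unfolding W0_def by (rule Un_le[OF 1]) (intro UN_le less_le[OF D_less] wit)
 have W0F: "W0 \<subseteq> Field \<eta>" unfolding W0_def wit_def using DT unfolding T_def by auto
 from closed_set[OF W0F W0_le] obtain W \<zeta> where o: "W0 \<subseteq> W" "W \<subseteq> Field \<eta>" "|W| \<le>o \<kappa>"
  "\<forall>x\<in>W. \<forall>y\<in>Field \<eta>. cless (\<rho> y) (\<rho> x) --> y \<in> W"
  "\<forall>\<alpha> A. free W \<alpha> \<and> A \<subseteq> W \<and> |A| <o \<kappa> --> \<zeta> (gap W \<alpha>) A \<in> W \<and> dominates \<alpha> A (\<zeta> (gap W \<alpha>) A)"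
  by (elim exE conjE)
 note W = o(1-3) mp[OF bspec[OF bspec[OF o(4)]]]
 have \<zeta>: "\<zeta> (gap W \<alpha>) A \<in> W \<and> dominates \<alpha> A (\<zeta> (gap W \<alpha>) A)" if "free W \<alpha>" "A \<subseteq> W" "|A| <o \<kappa>" for \<alpha> A
  by (rule mp[OF spec[OF spec[OF o(5)]]]) (intro conjI that)
 define good where "good p \<longleftrightarrow> (\<forall>x i. Low x i \<in> Field p - D --> x \<notin> W)" for p
 define A2 where "A2 = {p \<in> A1. good p}"
 have "\<forall>p. \<exists>s. \<not> good p --> s \<in> Field p - D \<and> (\<exists>x\<in>W. \<exists>i. s = Low x i)" unfolding good_def by blast
 then obtain f where f: "\<And>p. \<not> good p ==> f p \<in> Field p - D \<and> (\<exists>x\<in>W. \<exists>i. f p = Low x i)" by metis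
 \<comment> \<open>Each bad condition has a new point with level in \<open>W\<close>. The new parts
   are disjoint, and at most \<kappa> points below the top have a level in \<open>W\<close>.\<close>
 have "|{p \<in> A1. \<not> good p}| \<le>o \<kappa>"
 proof -
  have inj: "inj_on f {p \<in> A1. \<not> good p}"
  proof (rule inj_onI)
   fix p p' assume pp: "p \<in> {p \<in> A1. \<not> good p}" "p' \<in> {p \<in> A1. \<not> good p}" "f p = f p'"
   show "p = p'"
   proof (rule ccontr)
    assume "p \<noteq> p'"
    then have "Field p \<inter> Field p' = D" using A1(4)[of p p'] pp(1,2) by simp
    then show False using f[of p] f[of p'] pp by auto
   qed
  qed
  have "f ` {p \<in> A1. \<not> good p} \<subseteq> (\<lambda>(x, i). Low x i) ` (W \<times> Field \<kappa>)"
  proof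
   fix s assume "s \<in> f ` {p \<in> A1. \<not> good p}"
   then obtain p where p: "p \<in> A1" "\<not> good p" "s = f p" by blast
   obtain x i where x: "x \<in> W" "s = Low x i" using f[OF p(2)] p(3) by blast
   have "s \<in> T" using f[OF p(2)] p(3) cnd_T[OF A[OF subsetD[OF A1(1) p(1)]]] by blast
   then show "s \<in> (\<lambda>(x, i). Low x i) ` (W \<times> Field \<kappa>)" using x unfolding T_def by auto
  qed
  with inj have "|{p \<in> A1. \<not> good p}| \<le>o |(\<lambda>(x, i). Low x i) ` (W \<times> Field \<kappa>)|"
   by (intro iffD1[OF card_of_ordLeq] exI[of _ f] conjI)
  moreover have "|(\<lambda>(x, i). Low x i) ` (W \<times> Field \<kappa>)| \<le>o \<kappa>"
   by (rule image_le[OF Times_le[OF W(3) ordIso_imp_ordLeq[OF Field_k]]])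
  ultimately show ?thesis by (rule ordLeq_transitive)
 qed
 then have A2: "\<not> |A2| \<le>o \<kappa>" unfolding A2_def by (rule large_Un[OF A1(2)])
 have "\<forall>p. \<exists>g. p \<in> A --> inj_on g (Field p) \<and> g ` Field p \<subseteq> Field \<kappa>"
 proof (intro allI)
  fix p
  show "\<exists>g. p \<in> A --> inj_on g (Field p) \<and> g ` Field p \<subseteq> Field \<kappa>"
  proof (cases "p \<in> A")
   case True
   obtain k where "inj_on k (Field p)" "k ` Field p \<subseteq> Field \<kappa> - {}"
    by (rule small_inj[OF cnd_small[OF A[OF True]] finite_less[OF finite.emptyI]])
   then show ?thesis by blast
  qed blast
 qed
 then obtain g where g: "\<And>p. p \<in> A ==> inj_on (g p) (Field p) \<and> g p ` Field p \<subseteq> Field \<kappa>" by metis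
 \<comment> \<open>The type of a condition: its order transported to \<kappa> along the labelling
   \<open>g p\<close>, and for each label the gap of the level, whether the point is a top point,
   and its identity if it belongs to the root. There are at most \<kappa> types.\<close>
 define info where "info p s = (g p s, gap W (lv s), lv s = Hi 0, if s \<in> D then Some s else None)" for p s
 define ty where "ty p = (map_prod (g p) (g p) ` p, info p ` Field p)" for p
 let ?Y = "Field \<kappa> \<times> (insert (Hi 0) (Lo ` W) \<times> (UNIV :: bool set) \<times> insert None (Some ` D))"
 let ?Z = "{X. X \<subseteq> Field \<kappa> \<times> Field \<kappa> \<and> |X| <o \<kappa>} \<times> {X. X \<subseteq> ?Y \<and> |X| <o \<kappa>}"
 have fin1: "|insert a X| \<le>o \<kappa>" if "|X| \<le>o \<kappa>" for a and X :: "'z set"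
  using Un_le[OF less_le[OF finite_less[OF finite.insertI[OF finite.emptyI]]] that, of a] by simp
 have "|?Z| \<le>o \<kappa>"
  by (intro Times_small_subsets Times_le fin1 image_le W(3) less_le[OF finite_less[OF finite_UNIV]] less_le[OF D_less] ordIso_imp_ordLeq[OF Field_k])
 moreover have "ty ` A2 \<subseteq> ?Z"
 proof
  fix z assume "z \<in> ty ` A2"
  then obtain p where p: "p \<in> A2" "z = ty p" by blast
  have pA: "p \<in> A" using p(1) A1(1) unfolding A2_def by blast
  have gF: "g p s \<in> Field \<kappa>" if "s \<in> Field p" for s using g[OF pA] that by blast
  have 1: "map_prod (g p) (g p) ` p \<subseteq> Field \<kappa> \<times> Field \<kappa>"
   using gF by (auto intro: FieldI1 FieldI2)
  have 2: "info p ` Field p \<subseteq> ?Y"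
   unfolding info_def using gF gap(1)[OF cnd_lev[OF A[OF pA]]] by auto
  show "z \<in> ?Z" unfolding p(2) ty_def
   
   using 1 2 image_less[OF cnd_rel_less[OF A[OF pA]], of "map_prod (g p) (g p)"] image_less[OF cnd_small[OF A[OF pA]], of "info p"]
   by (intro SigmaI CollectI conjI)
 qed
 ultimately obtain z where "\<not> |{p \<in> A2. ty p = z}| \<le>o \<kappa>" using large_fibre[OF A2] by blast
 then obtain A3 where A3: "A3 = {p \<in> A2. ty p = z}" "\<not> |A3| \<le>o \<kappa>" by blast
 have A3A: "A3 \<subseteq> A1" "A3 \<subseteq> A" unfolding A3(1) A2_def using A1(1) by blast+
 have A3_ty: "ty p = ty p'" if "p \<in> A3" "p' \<in> A3" for p p' using that unfolding A3(1) by simp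
 have A3_new: "x \<notin> W" if "p \<in> A3" "Low x i \<in> Field p - D" for p x i
  using that unfolding A3(1) A2_def good_def by blast
 define a where "a p = {l. Top l \<in> Field p - D}" for p
 have dj: "a p \<inter> a p' = {}" if "p \<in> A3" "p' \<in> A3" "p \<noteq> p'" for p p'
 proof -
  have "Field p \<inter> Field p' = D" using A1(4)[OF subsetD[OF A3A(1) that(1)] subsetD[OF A3A(1) that(2)] that(3)] .
  then show ?thesis unfolding a_def by blast
 qed
 \<comment> \<open>A level outside \<open>W\<close> provides the ordinal for strong unboundedness:
   as \<open>W\<close> is closed downwards under \<rho>, the \<rho> of such a level exceeds that of
   every member of \<open>W\<close>.\<close>
 have "\<not> Field \<eta> \<subseteq> W"
 proof
  assume "Field \<eta> \<subseteq> W"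
  then have "|Field \<eta>| \<le>o \<kappa>" by (rule subset_le[OF _ W(3)])
  moreover have "|Field (cardSuc \<kappa>)| \<le>o |Field \<eta>|"
   by (rule ordIso_imp_ordLeq[OF ordIso_symmetric[OF card_of_ordIsoI[OF rho]]])
  ultimately have "|Field (cardSuc \<kappa>)| \<le>o \<kappa>" by (rule ordLeq_transitive[rotated])
  then have "cardSuc \<kappa> \<le>o \<kappa>" by (rule ordIso_ordLeq_trans[OF ordIso_symmetric[OF card_of_Field_ordIso[OF cardSuc_Card_order[OF Card]]]])
  then show False using cardSuc_greater[OF Card] not_ordLess_ordLeq by metis
 qed
 then obtain x0 where x0: "x0 \<in> Field \<eta>" "x0 \<notin> W" by blast
 have d: "cless (\<rho> y) (\<rho> x0)" if "y \<in> W" for y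
  using rho_total[of y x0] subsetD[OF W(2) that] W(4)[OF that x0(1)] x0 that by metis
 have dF: "\<rho> x0 \<in> Field (cardSuc \<kappa>)" using bij_betwE[OF rho] x0(1) by blast
 have twins: "twins \<kappa> \<Lambda> \<eta> F \<rho> p p' D W \<zeta> (g p) (g p')" if pp: "p \<in> A3" "p' \<in> A3" "p \<noteq> p'" for p p'
 proof unfold_locales
  show "cnd p" "cnd p'" using A[OF subsetD[OF A3A(2)]] pp(1,2) by simp_all
  show "D = Field p \<inter> Field p'" using A1(4)[OF subsetD[OF A3A(1) pp(1)] subsetD[OF A3A(1) pp(2)] pp(3)] by simp
  show "x \<notin> W" if "Low x i \<in> Field p - D" for x i using A3_new[OF pp(1) that] .
  show "x \<notin> W" if "Low x i \<in> Field p' - D" for x i using A3_new[OF pp(2) that] .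
  show "x \<in> W" if "Low x i \<in> D" for x i using W(1) that unfolding W0_def by blast
  show "y \<in> W" if "Top l \<in> D" "Top m \<in> D" "y \<in> Field \<eta>" "cless (\<rho> y) (F {l, m})" for l m y
   using W(1) that unfolding W0_def wit_def by blast
  show "inj_on (g p) (Field p)" "inj_on (g p') (Field p')" using g[OF subsetD[OF A3A(2)]] pp(1,2) by simp_all
  show "map_prod (g p) (g p) ` p = map_prod (g p') (g p') ` p'"
   "(\<lambda>s. (g p s, gap W (lv s), lv s = Hi 0, if s \<in> D then Some s else None)) ` Field p =
   (\<lambda>s. (g p' s, gap W (lv s), lv s = Hi 0, if s \<in> D then Some s else None)) ` Field p'"
   using A3_ty[OF pp(1,2)] unfolding ty_def info_def prod.inject by simp_all
 qed (rule W(2) | erule (2) W(4) | erule (2) \<zeta>)+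
 have "A3 \<noteq> {}"
 proof
  assume "A3 = {}"
  then have "|A3| \<le>o \<kappa>" using less_le[OF finite_less[of "{}"]] by simp
  then show False using A3(2) by blast
 qed
 then obtain p0 where p0: "p0 \<in> A3" by blast
 have a_iso: "a p \<subseteq> Field \<Lambda> \<and> |a p| =o |a p0|" if p: "p \<in> A3" for p
 proof
  have "Field p \<subseteq> T" by (rule cnd_T[OF A[OF subsetD[OF A3A(2) p]]])
  then show "a p \<subseteq> Field \<Lambda>" unfolding a_def T_def by blast
  show "|a p| =o |a p0|"
  proof (cases "p = p0")
   case False
   show ?thesis unfolding a_def by (rule twins.tops_iso[OF twins[OF p p0 False]])
  qed (simp add: card_of_refl)
 qed
 have "a p0 \<subseteq> (\<lambda>t. case t of Low x i => i | Top l => l) ` Field p0"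
  unfolding a_def by (auto intro: rev_image_eqI)
 then have a0: "|a p0| <o \<kappa>"
  by (rule subset_less[OF _ image_less[OF cnd_small[OF A[OF subsetD[OF A3A(2) p0]]]]])
 have "\<exists>p\<in>A3. \<exists>p'\<in>A3. p \<noteq> p' \<and> (\<forall>l\<in>a p. \<forall>m\<in>a p'. cless (\<rho> x0) (F {l, m}))"
  by (rule tops_pair[OF _ a0 _ A3(2) dF]) (rule a_iso dj; assumption)+
 then obtain p p' where pp: "p \<in> A3" "p' \<in> A3" "p \<noteq> p'" "\<And>l m. l \<in> a p ==> m \<in> a p' ==> cless (\<rho> x0) (F {l, m})"
  by blast
 have nt: "cless (\<rho> y) (F {l, m})" if "Top l \<in> Field p - D" "Top m \<in> Field p' - D" "y \<in> W" for l m y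
  using strict_trans[OF wo_C d[OF that(3)] pp(4)] that(1,2) unfolding a_def by blast
 have "\<exists>r. cnd r \<and> ext r p \<and> ext r p'"
  by (rule twins.compatible_twins[OF twins[OF pp(1-3)]]) (rule nt)
 then obtain r where "cnd r" "ext r p" "ext r p'" by blast
 then have "p = p'" by (rule inc[OF subsetD[OF A3A(2) pp(1)] subsetD[OF A3A(2) pp(2)]])
 then show False using pp(3) by contradiction
qed

end

section \<open>The generic Boolean algebra\<close>

locale cs_forcing = cs_poset +
 assumes Lambda: "\<kappa> \<le>o \<Lambda>"
begin

section \<open>Coding of conditions as sets, and the size of the set of points\<close>

abbreviation M :: "'a set rel" where "M \<equiv> |UNIV :: 'a set set|"

lemma inf_a: "infinite (UNIV :: 'a set)"
 using infinite_Field finite_subset[OF subset_UNIV] by blast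

lemma Cinfinite_a: "Cinfinite |UNIV :: 'a set|"
 using inf_a by (simp add: cinfinite_def Field_card_of card_of_card_order_on)

lemma a_le_M: "|UNIV :: 'a set| \<le>o M"
 by (rule iffD1[OF card_of_ordLeq]) (intro exI[of _ "\<lambda>x. {x}"] conjI inj_onI; simp)

lemma pt_le: "|X :: 'a pt set| \<le>o |UNIV :: 'a set|"
proof -
 have "X \<subseteq> (\<lambda>(x, i). Low x i) ` (UNIV \<times> UNIV) \<union> range Top"
 proof
  fix t show "t \<in> (\<lambda>(x, i). Low x i) ` (UNIV \<times> UNIV) \<union> range Top" by (cases t) auto
 qed
 moreover have "|(\<lambda>(x :: 'a, i). Low x i) ` (UNIV \<times> UNIV) \<union> range Top| \<le>o |UNIV :: 'a set|"
 proof (intro Un_Cinfinite_bound Cinfinite_a)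
  have "|(UNIV :: 'a set) \<times> (UNIV :: 'a set)| \<le>o |UNIV :: 'a set|"
   by (rule card_of_Times_ordLeq_infinite_Field) (simp_all add: Field_card_of inf_a card_of_card_order_on card_of_refl ordIso_imp_ordLeq)
  then show "|(\<lambda>(x :: 'a, i). Low x i) ` (UNIV \<times> UNIV)| \<le>o |UNIV :: 'a set|"
   by (rule ordLeq_transitive[OF card_of_image])
 qed (rule card_of_image)
 ultimately show ?thesis by (rule ordLeq_transitive[OF card_of_mono1])
qed

definition emb :: "'a pt \<times> 'a pt => 'a" where
 "emb = (SOME f. inj f)"

lemma inj_emb: "inj emb"
proof -
 have "|(UNIV :: 'a pt set) \<times> (UNIV :: 'a pt set)| \<le>o |UNIV :: 'a set|"
  by (rule card_of_Times_ordLeq_infinite_Field) (simp_all add: Field_card_of inf_a card_of_card_order_on pt_le)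
 from iffD2[OF card_of_ordLeq this] have "\<exists>f :: 'a pt \<times> 'a pt => 'a. inj f" by auto
 then show ?thesis unfolding emb_def by (rule someI_ex)
qed

text \<open>The conditions are coded as sets in order to match the type in the theorem.\<close>

definition enc :: "'a pt rel => 'a set" where
 "enc p = emb ` p"

lemma enc_eq: "enc p = enc q \<longleftrightarrow> p = q"
 unfolding enc_def by (rule inj_image_eq_iff[OF inj_emb])

definition R :: "'a set rel" where
 "R = {(enc q, enc p) | q p. cnd q \<and> cnd p \<and> ext q p}"

lemma R_iff: "(enc q, enc p) \<in> R \<longleftrightarrow> cnd q \<and> cnd p \<and> ext q p"
 unfolding R_def using enc_eq by auto

lemma R_E: assumes "(x, y) \<in> R" obtains q p where "x = enc q" "y = enc p" "cnd q" "cnd p" "ext q p"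
 using assms unfolding R_def by auto

lemma Field_R: "x \<in> Field R \<longleftrightarrow> (\<exists>p. cnd p \<and> x = enc p)"
proof
 assume "x \<in> Field R"
 then show "\<exists>p. cnd p \<and> x = enc p" unfolding R_def Field_def by blast
next
 assume "\<exists>p. cnd p \<and> x = enc p"
 then obtain p where p: "cnd p" "x = enc p" by blast
 have "(x, x) \<in> R" unfolding p(2) R_iff using p(1) ext_refl[OF p(1)] by blast
 then show "x \<in> Field R" by (rule FieldI1)
qed

lemma R_po: "Partial_order R"
proof (rule Partial_orderI)
 show "(a, a) \<in> R \<and> (b, b) \<in> R" if "(a, b) \<in> R" for a b
  using that by (elim R_E) (simp add: R_iff ext_refl)
 show "(a, c) \<in> R" if ab: "(a, b) \<in> R" "(b, c) \<in> R" for a b c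
 proof -
  obtain p q where 1: "a = enc p" "b = enc q" "cnd p" "cnd q" "ext p q" by (rule R_E[OF ab(1)])
  obtain q' r where 2: "b = enc q'" "c = enc r" "cnd q'" "cnd r" "ext q' r" by (rule R_E[OF ab(2)])
  have q': "q' = q" using 1(2) 2(1) enc_eq by simp
  have "ext p r" using ext_trans[OF 1(3,5) 2(5)[unfolded q']] .
  then show ?thesis using 1 2 R_iff by simp
 qed
 show "a = b" if ab: "(a, b) \<in> R" "(b, a) \<in> R" for a b
 proof -
  obtain p q where 1: "a = enc p" "b = enc q" "cnd p" "cnd q" "ext p q" by (rule R_E[OF ab(1)])
  have "ext q p" using ab(2) unfolding 1(1,2) R_iff by blast
  then show ?thesis using ext_antisym[OF 1(5)] 1(1,2) by simp
 qed
qed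

lemma cnd_empty: "cnd {}"
 unfolding cnd_def using finite_less[of "{}"] by (simp add: order_on_defs refl_on_def trans_def antisym_def)

lemma R_nonempty: "R \<noteq> {}"
 using R_iff[of "{}" "{}"] cnd_empty ext_refl by blast

sublocale forcing R
 by unfold_locales (rule R_po, use inf_a in \<open>simp add: Finite_Set.finite_set\<close>)

abbreviation (input) R_le (infix "\<lhd>" 50) where "q \<lhd> p \<equiv> (q, p) \<in> R"
abbreviation (input) R_frc (infix "||-" 45) where "p ||- \<phi> \<equiv> forces R \<phi> p"

section \<open>Closure, distributivity and preservation of cardinals\<close>

lemma lower_bound:
 assumes C: "C \<subseteq> Field R" "|C| <o \<kappa>" "C \<noteq> {}" "\<And>x y. x \<in> C ==> y \<in> C ==> x \<lhd> y \<or> y \<lhd> x"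
 shows "\<exists>q. \<forall>x\<in>C. q \<lhd> x"
proof -
 let ?C = "{p. cnd p \<and> enc p \<in> C}"
 have "enc ` ?C \<subseteq> C" by blast
 moreover have "inj_on enc ?C" using enc_eq by (simp add: inj_on_def)
 ultimately have "|?C| \<le>o |C|" by (intro iffD1[OF card_of_ordLeq] exI[of _ enc] conjI)
 then have small: "|?C| <o \<kappa>" using C(2) by (rule ordLeq_ordLess_trans)
 have "cnd (\<Union>?C) \<and> (\<forall>p\<in>?C. ext (\<Union>?C) p)"
 proof (rule cnd_Union[OF _ small])
  show "ext p q \<or> ext q p" if "p \<in> ?C" "q \<in> ?C" for p q
  proof -
   have "enc p \<lhd> enc q \<or> enc q \<lhd> enc p" by (rule C(4)) (use that in simp_all)
   then show ?thesis unfolding R_iff by blast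
  qed
 qed simp
 note U = conjunct1[OF this] bspec[OF conjunct2[OF this]]
 have "enc (\<Union>?C) \<lhd> x" if "x \<in> C" for x
 proof -
  obtain p where p: "cnd p" "x = enc p" using subsetD[OF C(1) \<open>x \<in> C\<close>] unfolding Field_R by blast
  have "p \<in> ?C" using p that by simp
  then show ?thesis unfolding p(2) R_iff using p(1) U(1) U(2)[of p] by blast
 qed
 then show ?thesis by blast
qed

text \<open>The properties are decided one after the other along a well-order of \<open>A\<close>;
  at each stage \<open>lower_bound\<close> supplies a condition below the chain built so far, which
  has fewer than \<kappa> members.\<close>

lemma distributive:
 fixes A :: "'j set"
 assumes A: "|A| <o \<kappa>" and p: "p \<in> Field R" and \<Phi>: "\<And>a q r. r \<lhd> q ==> \<Phi> q a ==> \<Phi> r a"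
  and dense: "\<And>a q. a \<in> A ==> q \<lhd> p ==> \<exists>r. r \<lhd> q \<and> \<Phi> r a"
 shows "\<exists>q. q \<lhd> p \<and> (\<forall>a\<in>A. \<Phi> q a)"
proof -
 let ?W = "|A|"
 have wo: "Well_order ?W" by (rule card_of_Well_order)
 then have wf: "wf (?W - Id)" by (simp add: well_order_on_def)
 define f where "f = wfrec (?W - Id) (\<lambda>f a. SOME x. x \<lhd> p \<and> (\<forall>b. (b, a) \<in> ?W - Id --> x \<lhd> f b) \<and> \<Phi> x a)"
 have f: "f a = (SOME x. x \<lhd> p \<and> (\<forall>b. (b, a) \<in> ?W - Id --> x \<lhd> f b) \<and> \<Phi> x a)" for a
  unfolding f_def by (subst wfrec[OF wf]) (simp add: cut_def)
 have WA: "(b, a) \<in> ?W - Id ==> b \<in> A" for a b using FieldI1[of b a ?W] by (simp add: Field_card_of)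
 let ?P = "\<lambda>a. f a \<lhd> p \<and> (\<forall>b. (b, a) \<in> ?W - Id --> f a \<lhd> f b) \<and> \<Phi> (f a) a"
 have lb: "\<exists>q. q \<lhd> p \<and> (\<forall>b\<in>S. q \<lhd> f b)" if S: "S \<subseteq> A" and P: "\<And>b. b \<in> S ==> ?P b" for S
 proof -
  let ?C = "insert p (f ` S)"
  have "\<exists>q. \<forall>x\<in>?C. q \<lhd> x"
  proof (rule lower_bound)
   show "?C \<subseteq> Field R"
   proof
    fix x assume "x \<in> ?C"
    then show "x \<in> Field R"
    proof
     assume "x \<in> f ` S"
     then obtain b where "b \<in> S" "x = f b" by (elim imageE)
     then show ?thesis using P[of b] le_Field(1)[of x p] by simp
    qed (simp add: p)
   qed
   have "|{p} \<union> f ` S| <o \<kappa>" by (rule Un_less[OF finite_less image_less[OF subset_less[OF S A]]]) simp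
   then show "|?C| <o \<kappa>" by simp
   have pp: "p \<lhd> p" using p le_refl by blast
   have ff: "f b \<lhd> f c \<or> f c \<lhd> f b" if bc: "b \<in> S" "c \<in> S" for b c
   proof -
    have F: "b \<in> Field ?W" "c \<in> Field ?W" using bc S by (auto simp: Field_card_of)
    consider "b = c" | "(b, c) \<in> ?W - Id" | "(c, b) \<in> ?W - Id"
     using strict_total[OF wo F] unfolding strict_def by auto
    then show ?thesis
    proof cases
     case 1
     then show ?thesis using le_refl[OF le_Field(1)[OF conjunct1[OF P[OF bc(1)]]]] by simp
    next
     case 2
     then show ?thesis using P[OF bc(2)] by simp
    next
     case 3
     then show ?thesis using P[OF bc(1)] by simp
    qed
   qed
   show "x \<lhd> y \<or> y \<lhd> x" if xy: "x \<in> ?C" "y \<in> ?C" for x y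
   proof -
    have "f b \<lhd> p" if "b \<in> S" for b using P[OF that] by (rule conjunct1)
    then show ?thesis using xy pp ff by (elim insertE imageE) simp_all
   qed
  qed simp
  then show ?thesis by blast
 qed
 have P: "a \<in> A --> ?P a" for a
 proof (induction a rule: wf_induct_rule[OF wf])
  case (1 a)
  show ?case
  proof
   assume a: "a \<in> A"
   let ?S = "{b. (b, a) \<in> ?W - Id}"
   have "?S \<subseteq> A" using WA by blast
   then have "\<exists>q. q \<lhd> p \<and> (\<forall>b\<in>?S. q \<lhd> f b)"
   proof (rule lb)
    show "?P b" if "b \<in> ?S" for b
    proof -
     have ba: "(b, a) \<in> ?W - Id" using that by simp
     show ?thesis by (rule mp[OF 1[OF ba] WA[OF ba]])
    qed
   qed
   then obtain q where q: "q \<lhd> p" "\<forall>b\<in>?S. q \<lhd> f b" by (elim exE conjE)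
   obtain r where r: "r \<lhd> q" "\<Phi> r a" using dense[OF a q(1)] by blast
   have "r \<lhd> p \<and> (\<forall>b. (b, a) \<in> ?W - Id --> r \<lhd> f b) \<and> \<Phi> r a"
   proof (intro conjI allI impI)
    show "r \<lhd> p" by (rule le_trans[OF r(1) q(1)])
    show "r \<lhd> f b" if "(b, a) \<in> ?W - Id" for b using le_trans[OF r(1)] q(2) that by simp
   qed (rule r(2))
   then show "?P a" unfolding f[of a] by (rule someI)
  qed
 qed
 have "\<exists>q. q \<lhd> p \<and> (\<forall>b\<in>A. q \<lhd> f b)" by (rule lb[OF subset_refl]) (rule mp[OF P])
 then obtain q where q: "q \<lhd> p" "\<forall>b\<in>A. q \<lhd> f b" by (elim exE conjE)
 have "\<Phi> q a" if a: "a \<in> A" for a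
  by (rule \<Phi>[OF bspec[OF q(2) a]]) (rule conjunct2[OF conjunct2[OF mp[OF P a]]])
 then show ?thesis using q(1) by blast
qed

lemma cardinals_preserved: "cardinal_preserving R"
proof (rule cardinal_preservingI[OF inf])
 show "\<exists>q. q \<lhd> p \<and> (\<forall>a\<in>A. \<Phi> q a)"
  if "|A| <o \<kappa>" "p \<in> Field R" "persistent \<Phi>" "\<And>a q. a \<in> A ==> q \<lhd> p ==> \<exists>r. r \<lhd> q \<and> \<Phi> r a"
  for A :: "'a set set" and \<Phi> p
  by (rule distributive[OF that(1,2)]) (rule persistentD[OF that(3)] that(4); assumption)+
next
 fix A assume A: "A \<subseteq> Field R" "\<And>x y r. x \<in> A ==> y \<in> A ==> r \<lhd> x ==> r \<lhd> y ==> x = y"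
 let ?A = "{p. cnd p \<and> enc p \<in> A}"
 have "|?A| \<le>o \<kappa>"
 proof (rule chain_condition)
  show "cnd p" if "p \<in> ?A" for p using that by blast
  show "p = p'" if "p \<in> ?A" "p' \<in> ?A" "cnd r" "ext r p" "ext r p'" for p p' r
  proof -
   have "enc p = enc p'" by (rule A(2)[of _ _ "enc r"]) (use that R_iff in simp_all)
   then show ?thesis using enc_eq by simp
  qed
 qed
 from image_le[OF this, of enc] have "|enc ` ?A| \<le>o \<kappa>" .
 moreover have "A \<subseteq> enc ` ?A"
 proof
  fix x assume x: "x \<in> A"
  then obtain p where "cnd p" "x = enc p" using A(1) Field_R by blast
  then show "x \<in> enc ` ?A" using x by simp
 qed
 ultimately show "|A| \<le>o \<kappa>" by (rule subset_le[rotated])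
qed

section \<open>Generators, codes and the ideal of null codes\<close>

text \<open>\<open>None\<close> is the unit, of rank \<eta> + 1. It makes the quotient at that level
  a two-element algebra and is the reason why the ideal with index \<eta> + 2 is the whole
  algebra.\<close>

definition G :: "'a pt option set" where
 "G = insert None (Some ` T)"

text \<open>A valuation \<open>v\<close> records which of the generating sets contain a given point.
  Codes are sets of valuations, so that they do not depend on the generic order.\<close>

definition U :: "'a pt option => 'a pt set set" where
 "U g = (case g of None => UNIV | Some s => {v. s \<in> v})"

definition rk :: "'a pt option => 'a lev" where
 "rk g = (case g of None => Hi 1 | Some s => lv s)"

lemma U_simps: "U None = UNIV" "v \<in> U (Some s) \<longleftrightarrow> s \<in> v"
 and rk_simps: "rk None = Hi 1" "rk (Some s) = lv s"
 by (simp_all add: U_def rk_def)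

inductive_set Cod :: "'a pt set set set" where
 gen: "g \<in> G ==> U g \<in> Cod"
| compl: "a \<in> Cod ==> - a \<in> Cod"
| inter: "a \<in> Cod ==> b \<in> Cod ==> a \<inter> b \<in> Cod"

definition supports :: "'a pt set => 'a pt set set => bool" where
 "supports S c \<longleftrightarrow> finite S \<and> S \<subseteq> T \<and> (\<forall>v w. v \<inter> S = w \<inter> S --> (v \<in> c \<longleftrightarrow> w \<in> c))"

lemma support: "c \<in> Cod ==> \<exists>S. supports S c"
proof (induction rule: Cod.induct)
 case (gen g)
 show ?case
 proof (cases g)
  case None
  then show ?thesis unfolding supports_def by (intro exI[of _ "{}"]) (simp add: U_simps)
 next
  case (Some s)
  then have "supports {s} (U g)" using gen unfolding supports_def G_def Some by (auto simp: U_simps)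
  then show ?thesis by blast
 qed
next
 case (compl a)
 then show ?case unfolding supports_def by auto
next
 case (inter a b)
 then obtain S S' where S: "supports S a" "supports S' b" by blast
 have "supports (S \<union> S') (a \<inter> b)"
  unfolding supports_def
 proof (intro conjI allI impI)
  fix v w assume eq: "v \<inter> (S \<union> S') = w \<inter> (S \<union> S')"
  have "v \<inter> S = w \<inter> S" "v \<inter> S' = w \<inter> S'" using eq by blast+
  then have "v \<in> a \<longleftrightarrow> w \<in> a" "v \<in> b \<longleftrightarrow> w \<in> b" using S unfolding supports_def by blast+
  then show "v \<in> a \<inter> b \<longleftrightarrow> w \<in> a \<inter> b" by blast
 qed (use S in \<open>auto simp: supports_def\<close>)
 then show ?case by blast
qed

lemma Cod_small: "|Cod| \<le>o M"
proof -
 have inf: "Cinfinite M" "infinite (Field M)"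
  using inf_a by (simp_all add: cinfinite_def Field_card_of card_of_card_order_on Finite_Set.finite_set)
 define step where "step C = C \<union> (uminus ` C \<union> (\<lambda>(a, b). a \<inter> b) ` (C \<times> C))" for C :: "'a pt set set set"
 define C where "C n = (step ^^ n) (U ` G)" for n
 have G_le: "|G| \<le>o M"
 proof -
  have "|Some ` T| \<le>o |UNIV :: 'a set|" by (rule ordLeq_transitive[OF card_of_image pt_le])
  moreover have "|{None :: 'a pt option}| \<le>o |UNIV :: 'a set|"
   using card_of_ordLeq_finite inf_a by (meson card_of_ordLeq_infinite finite.emptyI finite.insertI ordLeq_total card_of_Well_order)
  ultimately have "|{None} \<union> Some ` T| \<le>o |UNIV :: 'a set|" by (intro Un_Cinfinite_bound Cinfinite_a)
  then show ?thesis unfolding G_def using ordLeq_transitive[OF _ a_le_M] by simp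
 qed
 have step: "|step C| \<le>o M" if "|C| \<le>o M" for C
  unfolding step_def
  by (intro Un_Cinfinite_bound inf(1) that ordLeq_transitive[OF card_of_image]
    card_of_Times_ordLeq_infinite_Field[OF inf(2)] card_of_Card_order)
 have "|C n| \<le>o M" for n
 proof (induction n)
  case 0
  show ?case unfolding C_def using ordLeq_transitive[OF card_of_image G_le] by simp
 next
  case (Suc n)
  then show ?case using step unfolding C_def by simp
 qed
 moreover have "|UNIV :: nat set| \<le>o M"
  using infinite_iff_card_of_nat[of "UNIV :: 'a set set"] inf(2) by (simp add: Field_card_of)
 ultimately have UN: "|\<Union>n. C n| \<le>o M" by (intro UNION_Cinfinite_bound inf(1)) auto
 have mono: "C m \<subseteq> C n" if "m \<le> n" for m n
 proof (rule lift_Suc_mono_le[OF _ that])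
  show "C n \<subseteq> C (Suc n)" for n unfolding C_def step_def by auto
 qed
 have stepI: "- a \<in> C (Suc n)" "a \<inter> b \<in> C (Suc n)" if "a \<in> C n" "b \<in> C n" for a b n
  using that unfolding C_def step_def by auto
 have "c \<in> (\<Union>n. C n)" if "c \<in> Cod" for c
  using that
 proof induction
  case (gen g)
  then have "U g \<in> C 0" unfolding C_def by simp
  then show ?case by blast
 next
  case (compl a)
  then show ?case using stepI(1) by blast
 next
  case (inter a b)
  then obtain m n where "a \<in> C m" "b \<in> C n" by blast
  then have "a \<in> C (max m n)" "b \<in> C (max m n)" using mono[of m "max m n"] mono[of n "max m n"] by auto
  then show ?case using stepI(2) by blast
 qed
 then have "Cod \<subseteq> (\<Union>n. C n)" by blast
 from ordLeq_transitive[OF card_of_mono1[OF this] UN] show ?thesis .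
qed

lemma UNIV_Cod: "UNIV \<in> Cod"
 using Cod.gen[of None] unfolding G_def by (simp add: U_simps)

sublocale small_codes R Cod
 by unfold_locales (rule UNIV_Cod Cod.compl Cod.inter Cod_small; assumption?)+

text \<open>The conditions \<open>q\<close> and the points \<open>t\<close> of \<open>q\<close> provide the valuations which the codes
 in \<open>N\<close> have to avoid.\<close>

definition vl :: "'a pt rel => 'a pt => 'a pt set" where
 "vl q t = {s. (t, s) \<in> q}"

definition cyl :: "'a pt rel => 'a pt => 'a pt set set" where
 "cyl q t = {v. v \<inter> Field q = vl q t}"

text \<open>A condition \<open>q\<close> knows which points lie above \<open>t\<close> only on its
  own field. What it can put into \<open>c\<close> is therefore a whole cylinder, and
  \<open>null\<close> says that this happens at no extension of \<open>p\<close>.\<close>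

definition null :: "'a pt rel => 'a pt set set => bool" where
 "null p c \<longleftrightarrow> (\<forall>q t. cnd q \<and> ext q p \<and> t \<in> Field q --> \<not> cyl q t \<subseteq> c)"

definition N :: "'a set => 'a pt set set set" where
 "N x = {c \<in> Cod. \<forall>p. x = enc p --> null p c}"

lemma N_iff: "c \<in> N (enc p) \<longleftrightarrow> c \<in> Cod \<and> null p c"
 unfolding N_def enc_eq by auto

lemma vl_cyl: "vl q t \<in> cyl q t"
 unfolding cyl_def vl_def by (auto intro: FieldI2)

lemma cyl_mem: "v \<in> cyl q t ==> s \<in> Field q ==> s \<in> v \<longleftrightarrow> (t, s) \<in> q"
 unfolding cyl_def vl_def by blast

lemma cyl_mono:
 assumes rq: "ext r q" and t: "t \<in> Field q" shows "cyl r t \<subseteq> cyl q t"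
proof
 fix v assume v: "v \<in> cyl r t"
 have "s \<in> v \<longleftrightarrow> (t, s) \<in> q" if s: "s \<in> Field q" for s
  using cyl_mem[OF v] subsetD[OF ext_Field[OF rq] s] ext_restr[OF rq t s] ext_sub[OF rq] by blast
 then show "v \<in> cyl q t" unfolding cyl_def vl_def by (auto intro: FieldI2)
qed

lemma nullI:
 assumes "\<And>q t. cnd q ==> ext q p ==> t \<in> Field q ==> vl q t \<notin> c" shows "null p c"
 unfolding null_def using assms vl_cyl by blast

lemma add_points:
 assumes "finite S" "S \<subseteq> T" "cnd q" shows "\<exists>r. cnd r \<and> ext r q \<and> S \<subseteq> Field r"
 using assms(1,2)
proof (induction S)
 case empty
 then show ?case using assms(3) ext_refl by blast
next
 case (insert s S)
 then obtain r where r: "cnd r" "ext r q" "S \<subseteq> Field r" by blast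
 show ?case
 proof (cases "s \<in> Field r")
  case False
  have s: "s \<in> T" using insert by blast
  note a = add_point[OF r(1) s False, of "{}"]
  have "cnd (r \<union> {(s, s)} \<union> {s} \<times> {})" by (rule a(1)) auto
  moreover have e: "ext (r \<union> {(s, s)} \<union> {s} \<times> {}) r" by (rule a(2)) auto
  moreover have "Field (r \<union> {(s, s)} \<union> {s} \<times> {}) = insert s (Field r)" by (rule a(3)) auto
  ultimately show ?thesis using r(3) ext_trans[OF _ e r(2)] by blast
 qed (use r in blast)
qed

text \<open>Codes have finite supports. Once the support is contained in the field of the condition,
  every cylinder lies on one side of \<open>c\<close>.\<close>

lemma decide:
 assumes c: "c \<in> Cod" and q: "cnd q"
 shows "\<exists>r. cnd r \<and> ext r q \<and> (\<forall>t. cyl r t \<subseteq> c \<or> cyl r t \<inter> c = {})"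
proof -
 obtain S where S: "supports S c" using support[OF c] by blast
 then have "finite S" "S \<subseteq> T" unfolding supports_def by blast+
 from add_points[OF this q] obtain r where r: "cnd r" "ext r q" "S \<subseteq> Field r" by (elim exE conjE)
 have "cyl r t \<subseteq> c \<or> cyl r t \<inter> c = {}" for t
 proof -
  have "v \<in> c \<longleftrightarrow> w \<in> c" if vw: "v \<in> cyl r t" "w \<in> cyl r t" for v w
  proof -
   have "v \<inter> Field r = w \<inter> Field r" using vw unfolding cyl_def by simp
   then have "v \<inter> S = w \<inter> S" using r(3) by blast
   then show ?thesis using S unfolding supports_def by blast
  qed
  then show ?thesis by blast
 qed
 then show ?thesis using r by blast
qed

lemma N_videal: "videal x N"
 unfolding videal_def
proof (intro allI impI)
 fix y assume "y \<lhd> x"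
 then obtain p where p: "y = enc p" "cnd p" by (rule R_E)
 show "N y \<subseteq> Cod \<and> {} \<in> N y \<and> (\<forall>a\<in>N y. \<forall>b\<in>N y. a \<union> b \<in> N y) \<and>
  (\<forall>a\<in>N y. \<forall>b\<in>Cod. b \<subseteq> a --> b \<in> N y) \<and> (\<forall>r. r \<lhd> y --> N y \<subseteq> N r) \<and>
  (\<forall>a\<in>Cod. densely y (\<lambda>r. a \<in> N r) --> a \<in> N y)"
 proof (intro conjI ballI impI allI)
  show "N y \<subseteq> Cod" unfolding N_def by blast
  show "{} \<in> N y" unfolding p(1) N_iff using Cod_empty by (auto intro: nullI)
  show "b \<in> N y" if "a \<in> N y" "b \<in> Cod" "b \<subseteq> a" for a b
   using that unfolding p(1) N_iff null_def by blast
  show "a \<union> b \<in> N y" if ab: "a \<in> N y" "b \<in> N y" for a b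
  proof -
   have C: "a \<in> Cod" "b \<in> Cod" "null p a" "null p b" using ab unfolding p(1) N_iff by blast+
   have "null p (a \<union> b)"
    unfolding null_def
   proof (intro allI impI notI)
    fix q t assume q: "cnd q \<and> ext q p \<and> t \<in> Field q" and sub: "cyl q t \<subseteq> a \<union> b"
    \<comment> \<open>A cylinder contained in a union need not lie in either part before one of the
      two codes is decided.\<close>
    from decide[OF C(1) conjunct1[OF q]]
    obtain r where r: "cnd r" "ext r q" "\<forall>t. cyl r t \<subseteq> a \<or> cyl r t \<inter> a = {}" by (elim exE conjE)
    have rp: "ext r p" by (rule ext_trans[OF r(1,2) conjunct1[OF conjunct2[OF q]]])
    have t: "t \<in> Field r" using ext_Field[OF r(2)] q by blast
    have "cyl r t \<subseteq> a \<union> b" using cyl_mono[OF r(2), of t] q sub by blast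
    then have "cyl r t \<subseteq> a \<or> cyl r t \<subseteq> b" using spec[OF r(3), of t] by blast
    then show False using C(3,4) r(1) rp t unfolding null_def by blast
   qed
   then show ?thesis unfolding p(1) N_iff using Cod_Un C(1,2) by blast
  qed
  show "N y \<subseteq> N r" if r: "r \<lhd> y" for r
  proof
   fix a assume a: "a \<in> N y"
   obtain q p' where q: "r = enc q" "y = enc p'" "cnd q" "ext q p'" by (rule R_E[OF r])
   have "p' = p" using q(2) p(1) enc_eq by simp
   then have qp: "ext q p" using q(4) by simp
   have "null p a" using a unfolding p(1) N_iff by blast
   then have "null q a" unfolding null_def using ext_trans[OF _ _ qp] by metis
   then show "a \<in> N r" using a unfolding p(1) q(1) N_iff by blast
  qed
  show "a \<in> N y" if a: "a \<in> Cod" and d: "densely y (\<lambda>r. a \<in> N r)" for a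
  proof -
   have "null p a"
    unfolding null_def
   proof (intro allI impI notI)
    fix q t assume q: "cnd q \<and> ext q p \<and> t \<in> Field q" and sub: "cyl q t \<subseteq> a"
    have "enc q \<lhd> y" using q p R_iff by blast
    then obtain z where z: "z \<lhd> enc q" "a \<in> N z" using d unfolding densely_def by blast
    obtain r q' where r: "z = enc r" "enc q = enc q'" "cnd r" "ext r q'" by (rule R_E[OF z(1)])
    have rq: "ext r q" using r(2,4) enc_eq by simp
    have "cyl r t \<subseteq> a" using cyl_mono[OF rq, of t] q sub by blast
    moreover have "t \<in> Field r" using ext_Field[OF rq] q by blast
    ultimately show False using z(2) r(3) ext_refl[OF r(3)] unfolding r(1) N_iff null_def by blast
   qed
   then show ?thesis unfolding p(1) N_iff using a by blast
  qed
 qed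
qed

section \<open>The points of the conditions satisfy the hypotheses on generators\<close>

lemma lt_Hi1: "\<alpha> \<sqsubset> Hi 1 \<longleftrightarrow> \<alpha> = Hi 0 \<or> (\<exists>x\<in>Field \<eta>. \<alpha> = Lo x)"
 by (cases \<alpha>) auto

lemma lv_lt: "s \<in> T ==> lv s \<sqsubset> Hi 1"
 unfolding T_def by auto

text \<open>Each level has at least \<kappa> points, the top level because \<kappa> is at most
  \<open>\<Lambda>\<close>, while a condition has fewer.\<close>

lemma fresh_point:
 assumes p: "cnd p" and \<alpha>: "\<alpha> \<sqsubset> Hi 1"
 shows "\<exists>t\<in>T. t \<notin> Field p \<and> lv t = \<alpha>"
proof -
 consider "\<alpha> = Hi 0" | x where "x \<in> Field \<eta>" "\<alpha> = Lo x" using \<alpha> lt_Hi1 by blast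
 then show ?thesis
 proof cases
  case 1
  have "\<not> Top ` Field \<Lambda> \<subseteq> Field p"
  proof
   assume "Top ` Field \<Lambda> \<subseteq> Field p"
   then have "|Field \<Lambda>| \<le>o |Field p|" by (intro iffD1[OF card_of_ordLeq] exI[of _ Top]) (simp add: inj_on_def)
   moreover have "\<kappa> \<le>o |Field \<Lambda>|"
    using ordIso_ordLeq_trans[OF ordIso_symmetric[OF Field_k] card_of_mono2[OF Lambda]] .
   ultimately have "\<kappa> \<le>o |Field p|" by (rule ordLeq_transitive[rotated])
   then show False using cnd_small[OF p] not_ordLess_ordLeq by metis
  qed
  then obtain l where "l \<in> Field \<Lambda>" "Top l \<notin> Field p" by blast
  then show ?thesis unfolding T_def 1 by (intro bexI[of _ "Top l"]) auto
 next
  case 2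
  obtain i where i: "i \<in> Field \<kappa>" "i \<notin> (\<lambda>t. case t of Low x i => i | Top l => l) ` Field p"
   using not_surj[OF cnd_small[OF p]] by blast
  have "Low x i \<notin> Field p" using i(2) by (auto intro: rev_image_eqI)
  then show ?thesis using 2 i(1) unfolding T_def by (intro bexI[of _ "Low x i"]) auto
 qed
qed

lemma UN_U: "v \<in> \<Union> (U ` H) \<longleftrightarrow> None \<in> H \<or> (\<exists>s. Some s \<in> H \<and> s \<in> v)"
proof
 assume "v \<in> \<Union> (U ` H)"
 then obtain f where "f \<in> H" "v \<in> U f" by blast
 then show "None \<in> H \<or> (\<exists>s. Some s \<in> H \<and> s \<in> v)" by (cases f) (auto simp: U_simps)
next
 assume "None \<in> H \<or> (\<exists>s. Some s \<in> H \<and> s \<in> v)"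
 then show "v \<in> \<Union> (U ` H)"
 proof
  assume "None \<in> H"
  then show ?thesis by (rule UN_I) (simp add: U_simps)
 next
  assume "\<exists>s. Some s \<in> H \<and> s \<in> v"
  then obtain s where "Some s \<in> H" "s \<in> v" by blast
  then show ?thesis by (intro UN_I[of "Some s"]) (simp_all add: U_simps)
 qed
qed

lemma Some_G: "Some s \<in> G \<longleftrightarrow> s \<in> T"
 unfolding G_def by auto

lemma UN_Cod: "finite H ==> H \<subseteq> G ==> \<Union> (U ` H) \<in> Cod"
 by (induction H rule: finite_induct) (auto intro: Cod_empty Cod_Un Cod.gen)

text \<open>\<open>None\<close> cannot be in \<open>H\<close>, since it has the largest rank of all
  generators.\<close>

lemma collect_points:
 assumes H: "finite H" "H \<subseteq> G" and g: "g \<in> G" and lower: "\<And>f. f \<in> H ==> rk f \<sqsubset> rk g" and p: "cnd p"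
 shows "\<exists>q. cnd q \<and> ext q p \<and> (\<forall>s. Some s \<in> H \<or> g = Some s --> s \<in> Field q) \<and> None \<notin> H"
proof -
 let ?S = "{s. Some s \<in> insert g H}"
 have "finite ?S" by (rule finite_vimageI[OF _ inj_Some, of "insert g H", unfolded vimage_def]) (use H in simp)
 moreover have "?S \<subseteq> T" using H g Some_G by auto
 ultimately have "\<exists>q. cnd q \<and> ext q p \<and> ?S \<subseteq> Field q" by (rule add_points[OF _ _ p])
 then obtain q where q: "cnd q" "ext q p" "?S \<subseteq> Field q" by (elim exE conjE)
 have "rk g \<sqsubset> Hi 2"
  using g lt_trans[OF lv_lt, of _ "Hi 2"] unfolding G_def by (auto simp: rk_simps)
 then have "None \<notin> H" using lower[of None] by (cases "rk g") (auto simp: rk_simps)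
 then show ?thesis using q by (intro exI[of _ q]) auto
qed

text \<open>For incomparable points the finite set provided by the condition covers
  \<open>U g \<inter> U g'\<close>, and the last clause of \<open>ext\<close> keeps it a cover of
  all later common lower bounds. Comparable points give an inclusion, or the smaller point as the
  cover.\<close>

lemma N_split:
 assumes g: "g \<in> G" "g' \<in> G" and x: "x \<in> Field R"
 shows "\<exists>y H. y \<lhd> x \<and> finite H \<and> H \<subseteq> G \<and> (\<forall>f\<in>H. rk f \<sqsubset> rk g) \<and>
  (U g \<inter> U g' - \<Union> (U ` H) \<in> N y \<or> U g - U g' \<in> N y \<and> (g = g' \<or> rk g \<sqsubset> rk g'))"
proof -
 obtain p where p: "cnd p" "x = enc p" using x Field_R by blast
 have E: "{} \<in> N x" unfolding p(2) N_iff using Cod_empty by (auto intro: nullI)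
 have xx: "x \<lhd> x" using x le_refl by blast
 show ?thesis
 proof (cases g')
  case None
  have "U g - U g' \<in> N x" using E by (simp add: None U_simps)
  moreover have "g = g' \<or> rk g \<sqsubset> rk g'"
   using g(1) lv_lt unfolding G_def None by (auto simp: rk_simps)
  ultimately show ?thesis using xx by (intro exI[of _ x] exI[of _ "{}"]) blast
 next
  case g': (Some t)
  have t: "t \<in> T" using g(2) g' Some_G by simp
  show ?thesis
  proof (cases g)
   case None
   have "U g \<inter> U g' - \<Union> (U ` {g'}) = {}" by auto
   then have "U g \<inter> U g' - \<Union> (U ` {g'}) \<in> N x" using E by (simp only:)
   moreover have "rk g' \<sqsubset> rk g" using lv_lt[OF t] unfolding None g' by (simp add: rk_simps)
   ultimately show ?thesis using xx g(2) by (intro exI[of _ x] exI[of _ "{g'}"]) blast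
  next
   case gs: (Some s)
   have s: "s \<in> T" using g(1) gs Some_G by simp
   obtain q where q: "cnd q" "ext q p" "s \<in> Field q" "t \<in> Field q" using add_points[of "{s, t}", OF _ _ p(1)] s t by auto
   have qx: "enc q \<lhd> x" unfolding p(2) R_iff using p(1) q by blast
   have Eq: "{} \<in> N (enc q)" unfolding N_iff using Cod_empty by (auto intro: nullI)
   have C: "U g \<in> Cod" "U g' \<in> Cod" using Cod.gen g by blast+
   consider "(s, t) \<in> q" | "(t, s) \<in> q" "s \<noteq> t" | "(s, t) \<notin> q" "(t, s) \<notin> q" by blast
   then show ?thesis
   proof cases
    case 1
    have "null q (U g - U g')"
    proof (rule nullI)
     fix r u assume r: "cnd r" "ext r q"
     show "vl r u \<notin> U g - U g'"
      using cnd_trans[OF r(1), of u s t] ext_sub[OF r(2)] 1 unfolding gs g' vl_def by (auto simp: U_simps)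
    qed
    then have "U g - U g' \<in> N (enc q)" unfolding N_iff using Cod_Diff C by blast
    moreover have "g = g' \<or> rk g \<sqsubset> rk g'" using cnd_lv[OF q(1) 1] unfolding gs g' by (auto simp: rk_simps)
    ultimately show ?thesis using qx by (intro exI[of _ "enc q"] exI[of _ "{}"]) blast
   next
    case 2
    have "U g \<inter> U g' - \<Union> (U ` {g'}) = {}" by auto
    then have "U g \<inter> U g' - \<Union> (U ` {g'}) \<in> N (enc q)" using Eq by (simp only:)
    moreover have "rk g' \<sqsubset> rk g" using cnd_lv[OF q(1) 2(1)] 2(2) unfolding gs g' by (simp add: rk_simps)
    ultimately show ?thesis using qx g(2) by (intro exI[of _ "enc q"] exI[of _ "{g'}"]) blast
   next
    case 3
    obtain I where I: "finite I" "\<forall>v\<in>I. (v, s) \<in> q \<and> (v, t) \<in> q \<and> ok s t v"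
     "\<forall>u. (u, s) \<in> q --> (u, t) \<in> q --> (\<exists>v\<in>I. (u, v) \<in> q)"
     using cnd_cov[OF q(1,3,4) 3] unfolding covered_def by blast
    have IT: "I \<subseteq> T" using I(2) FieldI1 cnd_T[OF q(1)] by fastforce
    then have IG: "Some ` I \<subseteq> G" unfolding G_def by blast
    have "null q (U g \<inter> U g' - \<Union> (U ` Some ` I))"
    proof (rule nullI)
     fix r u assume r: "cnd r" "ext r q"
     show "vl r u \<notin> U g \<inter> U g' - \<Union> (U ` Some ` I)"
     proof
      assume v: "vl r u \<in> U g \<inter> U g' - \<Union> (U ` Some ` I)"
      then have us: "(u, s) \<in> r" "(u, t) \<in> r" unfolding gs g' vl_def by (simp_all add: U_simps)
      obtain w where w: "(w, s) \<in> q" "(w, t) \<in> q" "(u, w) \<in> r" using ext_cov[OF r(2) q(3,4) 3 us] by blast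
      obtain i where i: "i \<in> I" "(w, i) \<in> q" using I(3) w(1,2) by blast
      have "(u, i) \<in> r" using cnd_trans[OF r(1) w(3)] ext_sub[OF r(2)] i(2) by blast
      then have "vl r u \<in> \<Union> (U ` Some ` I)" unfolding UN_U vl_def using i(1) by blast
      then show False using v by blast
     qed
    qed
    then have "U g \<inter> U g' - \<Union> (U ` Some ` I) \<in> N (enc q)"
     unfolding N_iff using Cod_Diff[OF Cod_Int[OF C] UN_Cod[OF finite_imageI[OF I(1)] IG]] by blast
    moreover have "\<forall>f\<in>Some ` I. rk f \<sqsubset> rk g"
    proof
     fix f assume "f \<in> Some ` I"
     then obtain v where v: "f = Some v" "(v, s) \<in> q" "(v, t) \<in> q" using I(2) by blast
     have "v \<noteq> s" using v(3) 3(1) by blast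
     then show "rk f \<sqsubset> rk g" using cnd_lv[OF q(1) v(2)] unfolding v(1) gs by (simp add: rk_simps)
    qed
    ultimately show ?thesis using qx finite_imageI[OF I(1), of Some] IG
     by (intro exI[of _ "enc q"] exI[of _ "Some ` I"]) blast
   qed
  qed
 qed
qed

lemma not_below:
 assumes q: "cnd q" and s: "lv w \<sqsubset> lv s" shows "(s, w) \<notin> q"
proof
 assume "(s, w) \<in> q"
 then have "s = w \<or> lv s \<sqsubset> lv w" using cnd_lv[OF q] by blast
 then have "lv w \<sqsubset> lv w" using s lt_trans by metis
 then show False using lev_less_irrefl by blast
qed

text \<open>A fresh point \<open>t\<close> of level \<open>\<alpha>\<close> is put below
  \<open>s\<close> and the points above \<open>s\<close>, or below no old point if \<open>g\<close>
  is the unit. A point of \<open>H\<close> then has lower level than \<open>s\<close>, hence is not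
  above it; in either case it is incomparable to \<open>t\<close> without a common lower bound, and
  the last clause of \<open>ext\<close> forbids adding one.\<close>

lemma N_below:
 assumes g: "g \<in> G" and \<alpha>: "\<alpha> \<sqsubset> rk g" and H: "finite H" "H \<subseteq> G" "\<And>f. f \<in> H ==> rk f \<sqsubset> rk g" and x: "x \<in> Field R"
 shows "\<exists>y g'. y \<lhd> x \<and> g' \<in> G \<and> rk g' = \<alpha> \<and> U g' - U g \<in> N y \<and> (\<forall>f\<in>H. U g' \<inter> U f \<in> N y)"
proof -
 obtain p where p: "cnd p" "x = enc p" using x Field_R by blast
 have "\<exists>q. cnd q \<and> ext q p \<and> (\<forall>s. Some s \<in> H \<or> g = Some s --> s \<in> Field q) \<and> None \<notin> H"
  by (rule collect_points[OF H(1,2) g _ p(1)]) (rule H(3))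
 then obtain q0 where o: "cnd q0" "ext q0 p" "\<forall>s. Some s \<in> H \<or> g = Some s --> s \<in> Field q0" "None \<notin> H"
  by (elim exE conjE)
 note q0 = o(1,2) mp[OF spec[OF o(3)], OF disjI1] mp[OF spec[OF o(3)], OF disjI2] o(4)
 have \<alpha>1: "\<alpha> \<sqsubset> Hi 1"
 proof (cases g)
  case (Some s)
  then have "s \<in> T" using g Some_G by simp
  from lt_trans[OF _ lv_lt[OF this]] show ?thesis using \<alpha> unfolding Some by (simp add: rk_simps)
 qed (use \<alpha> in \<open>simp add: rk_simps\<close>)
 obtain t where t: "t \<in> T" "t \<notin> Field q0" "lv t = \<alpha>" using fresh_point[OF q0(1) \<alpha>1] by blast
 define B where "B = {w. \<exists>s. g = Some s \<and> (s, w) \<in> q0}"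
 define q where "q = q0 \<union> {(t, t)} \<union> {t} \<times> B"
 have B1: "B \<subseteq> Field q0" unfolding B_def by (auto intro: FieldI2)
 have B2: "\<And>u w. u \<in> B ==> (u, w) \<in> q0 ==> w \<in> B" unfolding B_def using cnd_trans[OF q0(1)] by blast
 have B3: "B = {} \<or> (\<exists>s\<in>B. \<forall>u\<in>B. (s, u) \<in> q0)"
 proof (cases g)
  case (Some s)
  have "(s, s) \<in> q0" using cnd_refl[OF q0(1) q0(4)[OF Some]] .
  then show ?thesis unfolding B_def Some by auto
 qed (simp add: B_def)
 have B4: "lv t \<sqsubset> lv u" if u: "u \<in> B" for u
 proof -
  obtain s where s: "g = Some s" "(s, u) \<in> q0" using u unfolding B_def by blast
  have 1: "lv t \<sqsubset> lv s" using \<alpha> unfolding t(3) s(1) by (simp add: rk_simps)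
  show ?thesis
  proof (cases "s = u")
   case False
   then show ?thesis using lt_trans[OF 1 cnd_lv[OF q0(1) s(2)]] by blast
  qed (use 1 in simp)
 qed
 note ap = add_point[OF q0(1) t(1,2) B1 _ B3, folded q_def]
 have q: "cnd q" "ext q q0" "Field q = insert t (Field q0)" "\<And>u. (t, u) \<in> q \<longleftrightarrow> u = t \<or> u \<in> B"
  by (rule ap(1-3) ap(5); (erule (1) B2 | erule B4))+
 have low: "u = t" if "(u, t) \<in> q" for u
  by (rule ap(4)[OF _ _ that]) (erule (1) B2 | erule B4)+
 have qx: "enc q \<lhd> x" unfolding p(2) R_iff using q(1) p(1) ext_trans[OF q(1,2) q0(2)] by blast
 have tq: "t \<in> Field q" using q(3) by blast
 have tG: "Some t \<in> G" using t(1) Some_G by simp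
 have "null q (U (Some t) - U g)"
 proof (rule nullI)
  fix r u assume r: "cnd r" "ext r q"
  show "vl r u \<notin> U (Some t) - U g"
  proof (cases g)
   case (Some s)
   have "s \<in> B" unfolding B_def Some using cnd_refl[OF q0(1) q0(4)[OF Some]] by blast
   then have "(t, s) \<in> q" using q(4) by blast
   then show ?thesis using cnd_trans[OF r(1), of u t s] ext_sub[OF r(2)] unfolding Some vl_def by (auto simp: U_simps)
  qed (simp add: U_simps)
 qed
 then have 1: "U (Some t) - U g \<in> N (enc q)" unfolding N_iff using Cod_Diff Cod.gen[OF tG] Cod.gen[OF g] by blast
 have 2: "U (Some t) \<inter> U f \<in> N (enc q)" if f: "f \<in> H" for f
 proof -
  obtain w where w: "f = Some w" using f q0(5) by (cases f) auto
  have wF: "w \<in> Field q0" using q0(3) f w by blast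
  then have wt: "w \<noteq> t" using t(2) by blast
  have "w \<notin> B"
  proof
   assume "w \<in> B"
   then obtain s where s: "g = Some s" "(s, w) \<in> q0" unfolding B_def by blast
   have "lv w \<sqsubset> lv s" using H(3)[OF f] unfolding w s(1) by (simp add: rk_simps)
   then show False using not_below[OF q0(1)] s(2) by blast
  qed
  then have n: "(t, w) \<notin> q" "(w, t) \<notin> q" using low q(4) wt by blast+
  have "null q (U (Some t) \<inter> U f)"
  proof (rule nullI)
   fix r u assume r: "cnd r" "ext r q"
   show "vl r u \<notin> U (Some t) \<inter> U f"
   proof
    assume "vl r u \<in> U (Some t) \<inter> U f"
    then have ut: "(u, t) \<in> r" "(u, w) \<in> r" unfolding w vl_def by (simp_all add: U_simps)
    have "w \<in> Field q" using wF q(3) by blast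
    then obtain v where "(v, t) \<in> q" "(v, w) \<in> q" using ext_cov[OF r(2) tq _ n ut] by blast
    then show False using low n(1) by blast
   qed
  qed
  then show ?thesis unfolding N_iff using Cod_Int Cod.gen[OF tG] Cod.gen[of f] f H(2) by blast
 qed
 show ?thesis using qx tG t(3) 1 2 by (intro exI[of _ "enc q"] exI[of _ "Some t"]) (simp add: rk_simps)
qed

text \<open>The point \<open>s\<close> of \<open>g\<close> is its own witness, because no point of
  lower level is above it. For the unit a fresh point with no other point above it is taken.\<close>

lemma N_nz:
 assumes g: "g \<in> G" and H: "finite H" "H \<subseteq> G" "\<And>f. f \<in> H ==> rk f \<sqsubset> rk g" and x: "x \<in> Field R"
 shows "U g - \<Union> (U ` H) \<notin> N x"
proof -
 obtain p where p: "cnd p" "x = enc p" using x Field_R by blast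
 have "\<exists>q. cnd q \<and> ext q p \<and> (\<forall>s. Some s \<in> H \<or> g = Some s --> s \<in> Field q) \<and> None \<notin> H"
  by (rule collect_points[OF H(1,2) g _ p(1)]) (rule H(3))
 then obtain q where o: "cnd q" "ext q p" "\<forall>s. Some s \<in> H \<or> g = Some s --> s \<in> Field q" "None \<notin> H"
  by (elim exE conjE)
 note q = o(1,2) mp[OF spec[OF o(3)], OF disjI1] mp[OF spec[OF o(3)], OF disjI2] o(4)
 have "\<exists>r t. cnd r \<and> ext r p \<and> t \<in> Field r \<and> cyl r t \<subseteq> U g - \<Union> (U ` H)"
 proof (cases g)
  case (Some s)
  have s: "s \<in> Field q" using q(4) Some by blast
  have "cyl q s \<subseteq> U g - \<Union> (U ` H)"
  proof
   fix v assume v: "v \<in> cyl q s"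
   have "s \<in> v" using cyl_mem[OF v s] cnd_refl[OF q(1) s] by blast
   moreover have "w \<notin> v" if w: "Some w \<in> H" for w
   proof -
    have "lv w \<sqsubset> lv s" using H(3)[OF w] unfolding Some by (simp add: rk_simps)
    then show ?thesis using cyl_mem[OF v q(3)[OF w]] not_below[OF q(1)] by blast
   qed
   ultimately show "v \<in> U g - \<Union> (U ` H)" unfolding Diff_iff UN_U Some using q(5) by (auto simp: U_simps)
  qed
  then show ?thesis using q(1,2) s by blast
 next
  case None
  obtain t where t: "t \<in> T" "t \<notin> Field q" using fresh_point[OF q(1), of "Hi 0"] by auto
  define r where "r = q \<union> {(t, t)} \<union> {t} \<times> {}"
  have r: "cnd r" "ext r q" "Field r = insert t (Field q)" "\<And>u. (t, u) \<in> r \<longleftrightarrow> u = t \<or> u \<in> {}"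
   unfolding r_def by (rule add_point[OF q(1) t]; simp)+
  have "cyl r t \<subseteq> U g - \<Union> (U ` H)"
  proof
   fix v assume v: "v \<in> cyl r t"
   have "w \<notin> v" if w: "Some w \<in> H" for w
   proof -
    have "w \<in> Field r" "w \<noteq> t" using q(3)[OF w] r(3) t(2) by auto
    then show ?thesis using cyl_mem[OF v] r(4) by blast
   qed
   then show "v \<in> U g - \<Union> (U ` H)" unfolding Diff_iff UN_U None using q(5) by (auto simp: U_simps)
  qed
  then show ?thesis using r(1,3) ext_trans[OF r(1,2) q(2)] by blast
 qed
 then show ?thesis unfolding p(2) N_iff null_def by blast
qed

abbreviation "seg r \<equiv> (\<lambda>x. segment_name R (dir_image r (\<lambda>x. {x})) {x})"

lemma inf_M: "infinite (UNIV :: 'a set set)"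
 by (rule inf_p)

lemma generators: "generators R Cod \<eta> (seg \<eta>) (check_ordinal R \<eta>) G U rk N"
proof -
 have ln: "level_names R \<eta> (seg \<eta>) (check_ordinal R \<eta>)" by (rule level_names_check[OF R_po inf_M wo_eta])
 show ?thesis
 proof (intro generators.intro generators_axioms.intro small_codes_axioms ln)
  show "gideal N" unfolding gideal_def using N_videal by blast
  show "U g \<in> Cod" if "g \<in> G" for g by (rule Cod.gen[OF that])
  show "rk g \<sqsubset> Hi 2" if "g \<in> G" for g
   using that lt_trans[OF lv_lt, of _ "Hi 2"] unfolding G_def by (auto simp: rk_simps)
  show "P e" if "\<And>g. g \<in> G ==> P (U g)" "\<And>a. a \<in> Cod ==> P a ==> P (- a)"
   "\<And>a b. a \<in> Cod ==> b \<in> Cod ==> P a ==> P b ==> P (a \<inter> b)" "e \<in> Cod" for P e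
   using that(4) by (induction rule: Cod.induct) (rule that(1-3); assumption)+
  show "\<exists>t\<in>G. U t = UNIV \<and> rk t = Hi 1" unfolding G_def by (intro bexI[of _ None]) (simp_all add: U_simps rk_simps)
  show "|Field \<eta>| \<le>o M" by (rule ordLeq_transitive[OF card_of_mono1[OF subset_UNIV] a_le_M])
  show "|G| \<le>o M"
  proof -
   have "inj_on (\<lambda>g. case g of None => {} | Some s => {emb (s, s)}) G"
    using inj_emb by (auto simp: inj_on_def inj_def split: option.splits)
   then show ?thesis by (intro iffD1[OF card_of_ordLeq] exI conjI) auto
  qed
 qed (erule (2) N_split | rule N_below; assumption | rule N_nz; assumption)+
qed

lemma check_cardinal:
 assumes r: "Card_order r" and p: "p \<in> Field R" shows "p ||- (is_cardinal (check_ordinal R r))"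
proof -
 have "Well_order r" using r by (simp add: card_order_on_def)
 then have "r =o dir_image r (\<lambda>x. {x})" by (rule dir_image_ordIso) (simp add: inj_on_def)
 then have "Card_order (dir_image r (\<lambda>x :: 'a. {x}))" by (rule Card_order_ordIso2[OF r])
 then show ?thesis using cardinals_preserved p unfolding cardinal_preserving_def forced_def check_ordinal_def by blast
qed

theorem algebra_forced:
 assumes \<Lambda>: "Card_order \<Lambda>"
 shows "forced R (\<^bold>\<exists>B. \<^bold>\<exists>L. is_kel_boolean_algebra (check_ordinal R \<kappa>) (check_ordinal R \<eta>) (check_ordinal R \<Lambda>) B L)"
proof -
 interpret A: generators R Cod \<eta> "seg \<eta>" "check_ordinal R \<eta>" G U rk N by (rule generators)
 have names: "(\<forall>q \<sigma>. q ||- (\<sigma> \<^bold>\<in> check_ordinal R r) \<longleftrightarrow> densely q (\<lambda>s. \<exists>x\<in>Field r. s ||- (\<sigma> \<^bold>= seg r x))) \<and>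
   (\<forall>q x y. q \<in> Field R --> x \<in> Field r --> y \<in> Field r --> q ||- (seg r x \<^bold>= seg r y) --> x = y)"
  if r: "Card_order r" for r :: "'a rel"
 proof -
  have "Well_order r" using r by (simp add: card_order_on_def)
  then interpret E: level_names R r "seg r" "check_ordinal R r" by (rule level_names_check[OF R_po inf_M])
  have "x = y" if "q \<in> Field R" "x \<in> Field r" "y \<in> Field r" "q ||- (seg r x \<^bold>= seg r y)" for q x y
   using E.ln_eq_iff[of q "Lo x" "Lo y"] that unfolding E.ln_simps levs_def by auto
  then show ?thesis using E.mem_on by blast
 qed
 note names = conjunct1[OF names, rule_format] conjunct2[OF names, rule_format]
 have on: "A.ln (Hi 0) = check_ordinal R \<eta>" by (simp add: A.ln_simps)
 have W: "p ||- (has_width A.B A.L (A.ln \<alpha>) (if \<alpha> = Hi 0 then check_ordinal R \<Lambda> else check_ordinal R \<kappa>))"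
  if p: "p \<in> Field R" and \<alpha>: "lev_less \<eta> \<alpha> (Hi 1)" for p \<alpha>
 proof -
  have \<alpha>2: "lev_less \<eta> \<alpha> (Hi 2)" by (rule lt_trans[OF \<alpha>]) simp
  consider "\<alpha> = Hi 0" | x where "x \<in> Field \<eta>" "\<alpha> = Lo x" using \<alpha> lt_Hi1 by blast
  then show ?thesis
  proof cases
   case 1
   let ?\<phi> = "\<lambda>g :: 'a pt option. case g of Some (Top l) => l | _ => undefined"
   have S: "{g \<in> G. rk g = \<alpha>} = (\<lambda>l. Some (Top l)) ` Field \<Lambda>"
    unfolding 1 G_def T_def by (auto simp: rk_simps)
   have bij: "bij_betw ?\<phi> {g \<in> G. rk g = \<alpha>} (Field \<Lambda>)"
    unfolding S bij_betw_def by (auto simp: inj_on_def image_iff)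
   have "p ||- (has_width A.B A.L (A.ln \<alpha>) (check_ordinal R \<Lambda>))"
    by (rule A.width[OF p \<alpha>2 check_cardinal[OF \<Lambda> p] names(1)[OF \<Lambda>] _ bij]) (rule names(2)[OF \<Lambda>])
   then show ?thesis using 1 by simp
  next
   case 2
   let ?\<phi> = "\<lambda>g :: 'a pt option. case g of Some (Low x i) => i | _ => undefined"
   have S: "{g \<in> G. rk g = \<alpha>} = (\<lambda>i. Some (Low x i)) ` Field \<kappa>"
    unfolding 2 G_def T_def using 2(1) by (auto simp: rk_simps)
   have bij: "bij_betw ?\<phi> {g \<in> G. rk g = \<alpha>} (Field \<kappa>)"
    unfolding S bij_betw_def by (auto simp: inj_on_def image_iff)
   have "p ||- (has_width A.B A.L (A.ln \<alpha>) (check_ordinal R \<kappa>))"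
    by (rule A.width[OF p \<alpha>2 check_cardinal[OF Card p] names(1)[OF Card] _ bij]) (rule names(2)[OF Card])
   then show ?thesis using 2 by simp
  qed
 qed
 show ?thesis
  unfolding forced_def
 proof
  fix p assume p: "p \<in> Field R"
  have "p ||- (is_kel_boolean_algebra (check_ordinal R \<kappa>) (A.ln (Hi 0)) (check_ordinal R \<Lambda>) A.B A.L)"
   by (rule A.kel_boolean_algebra[OF p]) (rule W)
  then show "p ||- (\<^bold>\<exists>B. \<^bold>\<exists>L. is_kel_boolean_algebra (check_ordinal R \<kappa>) (check_ordinal R \<eta>) (check_ordinal R \<Lambda>) B L)"
   unfolding on by (rule forces_ExisI[OF forces_ExisI])
 qed
qed

end

text \<open>As \<open>A\<close> is not cofinal, some \<open>x\<close> is strictly below no member of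
  \<open>A\<close>. Members of \<open>A\<close> may equal \<open>x\<close>, so the strict bound is
  taken above \<open>x\<close> from a cofinal set.\<close>

lemma cofinality_bound:
 assumes \<eta>: "Well_order \<eta>" and cof: "has_cofinality \<eta> (cardSuc \<kappa>)" and \<kappa>: "Card_order \<kappa>"
  and A: "A \<subseteq> Field \<eta>" "|A| \<le>o \<kappa>"
 shows "\<exists>z\<in>Field \<eta>. \<forall>a\<in>A. strict \<eta> a z"
proof -
 obtain A0 where A0: "A0 \<subseteq> Field \<eta>" "cofinal A0 \<eta>" using cof unfolding has_cofinality_def by blast
 have "\<not> cofinal A \<eta>"
 proof
  assume "cofinal A \<eta>"
  then have "cardSuc \<kappa> \<le>o |A|" using cof A(1) unfolding has_cofinality_def by simp
  then have "cardSuc \<kappa> \<le>o \<kappa>" using A(2) by (rule ordLeq_transitive)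
  then show False using cardSuc_greater[OF \<kappa>] not_ordLess_ordLeq by metis
 qed
 then obtain x where x: "x \<in> Field \<eta>" "\<And>a. a \<in> A ==> \<not> strict \<eta> x a" unfolding cofinal_def strict_def by blast
 obtain z where z: "z \<in> A0" "strict \<eta> x z" using A0(2) x(1) unfolding cofinal_def strict_def by blast
 have "strict \<eta> a z" if a: "a \<in> A" for a
  using strict_total[OF \<eta> _ x(1), of a] A(1) a x(2)[OF a] strict_trans[OF \<eta> _ z(2)] z(2) by blast
 then show ?thesis using z(1) A0(1) by blast
qed

theorem theorem3:
  fixes \<kappa> \<Lambda> \<eta> :: "'a rel"
  assumes "Cinfinite \<kappa>" and "Cinfinite \<Lambda>"
    and "cardSuc (cardSuc (cardSuc \<kappa>)) \<le>o \<Lambda>"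
    and "less_power \<kappa> =o \<kappa>"
    and "Well_order \<eta>" and "cardSuc \<kappa> \<le>o \<eta>" and "\<eta> <o cardSuc (cardSuc \<kappa>)"
    and "has_cofinality \<eta> (cardSuc \<kappa>)"
    and "\<exists>F. strongly_unbounded \<kappa> \<Lambda> F"
  shows "\<exists>R :: 'a set rel. Partial_order R \<and> R \<noteq> {} \<and> cardinal_preserving R \<and>
    forced R (\<^bold>\<exists>B. \<^bold>\<exists>L. is_kel_boolean_algebra
      (check_ordinal R \<kappa>) (check_ordinal R \<eta>) (check_ordinal R \<Lambda>) B L)"
proof -
 have \<kappa>: "Card_order \<kappa>" and \<Lambda>: "Card_order \<Lambda>" using assms(1,2) by simp_all
 note S = cardSuc_Card_order[OF \<kappa>]
 have "|Field \<eta>| <o cardSuc (cardSuc \<kappa>)" using ordLeq_ordLess_trans[OF card_of_least[OF assms(5)] assms(7)] .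
 then have "|Field \<eta>| \<le>o cardSuc \<kappa>" using cardSuc_ordLeq_ordLess[OF S card_of_Card_order] by blast
 then have 1: "|Field \<eta>| \<le>o |Field (cardSuc \<kappa>)|"
  using ordLeq_ordIso_trans[OF _ ordIso_symmetric[OF card_of_Field_ordIso[OF S]]] by blast
 \<comment> \<open>As \<eta> lies between \<open>\<kappa>\<^sup>+\<close> and the next cardinal, its
   field has size \<open>\<kappa>\<^sup>+\<close>; this is where the bijection \<rho> comes
   from.\<close>
 have "|Field \<eta>| =o |Field (cardSuc \<kappa>)|" using 1 card_of_mono2[OF assms(6)] ordIso_iff_ordLeq by blast
 then obtain \<rho> where \<rho>: "bij_betw \<rho> (Field \<eta>) (Field (cardSuc \<kappa>))" using card_of_ordIso by blast
 obtain F where F: "strongly_unbounded \<kappa> \<Lambda> F" using assms(9) by blast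
 have "\<kappa> \<le>o cardSuc \<kappa>" "cardSuc \<kappa> \<le>o cardSuc (cardSuc \<kappa>)" "cardSuc (cardSuc \<kappa>) \<le>o cardSuc (cardSuc (cardSuc \<kappa>))"
  by (intro cardSuc_ordLeq \<kappa> cardSuc_Card_order)+
 then have le: "\<kappa> \<le>o \<Lambda>" using assms(3) ordLeq_transitive by metis
 interpret cs_forcing \<kappa> \<Lambda> \<eta> F \<rho>
  by unfold_locales (rule assms(1,4,5) \<rho> F le cofinality_bound[OF assms(5,8) \<kappa>]; assumption?)+
 show ?thesis using R_po R_nonempty cardinals_preserved algebra_forced[OF \<Lambda>] by blast
qed

end
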